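(* Let $a,q\in(0,1)$ and $\kappa>0$, and let $\mathcal F_\kappa:\mathbb R\to\mathbb R$ and $\gamma_\kappa$ be as defined in the context. The function $\mathcal F_\kappa$ is non-decreasing, non-negative, convex, and continuously differentiable, with derivative being $(\log q^{-1})$-Lipschitz. We have $\mathcal F_\kappa(\gamma_\kappa)=0$, and there exists $x_0=x_0(a,q,\kappa)>0$ such that for all $x\ge x_0$, $$\mathcal F_\kappa(x)=(\log q^{-1})\frac{(x-1)^2}{2}+\kappa\log\frac{1-aq}{1-a}.$$
   Context: $\gamma_\kappa=1-\kappa$ for $\kappa\in(0,a]$, $\gamma_\kappa=\frac{(1-\sqrt{a\kappa})^2}{1-a}$ for $\kappa\in[a,a^{-1}]$, $\gamma_\kappa=0$ for $\kappa\ge a^{-1}$. Equilibrium energy: let $\mathcal A_\infty$ be the set of $\phi\in L^1([0,\infty))$ with $0\le\phi\le1$ a.e. and $\int_0^\infty\phi(x)\,dx=1$; $\mu_\phi$ is the probability measure with density $\phi$. For continuous $V:[0,\infty)\to\mathbb R$ with $V(x)\ge2\log(1+x^2)$ for all large $x$, put $I_V(\mu)=\iint_{x\ne y}\big(-\log|x-y|+\tfrac12V(x)+\tfrac12V(y)\big)d\mu(x)d\mu(y)$ and $F_V:=\inf_{\phi\in\mathcal A_\infty}I_V(\mu_\phi)\in\mathbb R$ (the infimum is attained at a unique $\phi_V$, which has compact support). For $\kappa\ge1$ and $y\in(-\infty,\infty]$ let (with the convention $0\log 0=0$; in particular the terms containing $\kappa-1$ are $0$ if $\kappa=1$) $$V_{\kappa,y}(x)=(\log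 a^{-1})x+(\log q^{-1})\min(x,y)-(\kappa-1)[\log(x+\kappa-1)-1]+x\log\frac{x}{x+\kappa-1},$$ $F_\kappa(y):=F_{V_{\kappa,y}}$, and $C_\kappa:=-\tfrac12\big[(\kappa-1)^2\log(\kappa-1)-\kappa^2\log\kappa+3\kappa\big]$. Write $t_+=\max(t,0)$. For $\kappa\ge1$, $y\in\mathbb R$: $$\mathcal F_\kappa(y):=(\log q^{-1})\frac{(y_+)^2-2y}{2}-\kappa\log(1-a)+\frac{\log a}{2}+C_\kappa+F_\kappa(y).$$ For $\kappa\in(0,1)$, $y\in\mathbb R$: $$\mathcal F_\kappa(y):=(\log q^{-1})\frac{(y_+)^2-2y\kappa+2\kappa-2\kappa^2}{2}-(\log q^{-1})\int_\kappa^1(y+x-1)_+dx-\kappa\log(1-a)+\kappa^2\frac{\log a}{2}+\kappa^2C_{\kappa^{-1}}+\kappa^2F_{\kappa^{-1}}(y\kappa^{-1}-\kappa^{-1}+1).$$ *)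

theory Defs
  imports "HOL-Analysis.Analysis"
begin

definition gam :: "real \<Rightarrow> real \<Rightarrow> real" where
  "gam a \<kappa> =
     (if \<kappa> \<le> a then 1 - \<kappa>
      else if \<kappa> \<le> 1 / a then (1 - sqrt (a * \<kappa>))\<^sup>2 / (1 - a)
      else 0)"

(* An element of L^1([0,\<infinity>)) is given by a representative \<phi> on the whole line whose values on
   (-\<infinity>,0) are irrelevant; every a.e. class has a representative that is Borel on [0,\<infinity>). *)
definition admissible_densities :: "(real \<Rightarrow> real) set" where
  "admissible_densities =
     {\<phi>. set_integrable lborel {0..} \<phi> \<and>
         (AE x in lborel. x \<ge> 0 \<longrightarrow> 0 \<le> \<phi> x \<and> \<phi> x \<le> 1) \<and>
         (LINT x:{0..}|lborel. \<phi> x) = 1}"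

definition density_measure :: "(real \<Rightarrow> real) \<Rightarrow> real measure" where
  "density_measure \<phi> = density lborel (\<lambda>x. ennreal (indicator {0..} x * \<phi> x))"

definition energy_kernel :: "(real \<Rightarrow> real) \<Rightarrow> real \<times> real \<Rightarrow> real" where
  "energy_kernel V = (\<lambda>(x, y). - ln \<bar>x - y\<bar> + V x / 2 + V y / 2)"

(* The integral of the kernel off the diagonal lies in (-\<infinity>,\<infinity>] for V of the required growth, so
   it is taken as (integral of the positive part) - (integral of the negative part) in ereal:
   the Bochner integral would assign the value 0 to a configuration of infinite energy.
   Note that ennreal truncates negative reals to 0. *)
definition energy :: "(real \<Rightarrow> real) \<Rightarrow> real measure \<Rightarrow> ereal" where
  "energy V \<mu> =
     enn2ereal (\<integral>\<^sup>+ z\<in>{z. fst z \<noteq> snd z}. ennreal (energy_kernel V z) \<partial>(\<mu> \<Otimes>\<^sub>M \<mu>)) -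
     enn2ereal (\<integral>\<^sup>+ z\<in>{z. fst z \<noteq> snd z}. ennreal (- energy_kernel V z) \<partial>(\<mu> \<Otimes>\<^sub>M \<mu>))"

(* For continuous V on [0,\<infinity>) with V(x) \<ge> 2 log(1+x^2) for large x the infimum is finite, so that
   real_of_ereal loses nothing. Only the values of V on [0,\<infinity>) matter. *)
definition equilibrium_energy :: "(real \<Rightarrow> real) \<Rightarrow> real" where
  "equilibrium_energy V =
     real_of_ereal (INF \<phi>\<in>admissible_densities. energy V (density_measure \<phi>))"

(* Meant for \<kappa> \<ge> 1 and x \<ge> 0. The convention 0 log 0 = 0 holds automatically for products in HOL,
   including all the terms with \<kappa> - 1 when \<kappa> = 1. *)
definition potential :: "real \<Rightarrow> real \<Rightarrow> real \<Rightarrow> real \<Rightarrow> real \<Rightarrow> real" where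
  "potential a q \<kappa> y x =
     ln (1 / a) * x + ln (1 / q) * min x y
     - (\<kappa> - 1) * (ln (x + \<kappa> - 1) - 1) + x * ln (x / (x + \<kappa> - 1))"

definition F_eq :: "real \<Rightarrow> real \<Rightarrow> real \<Rightarrow> real \<Rightarrow> real" where
  "F_eq a q \<kappa> y = equilibrium_energy (potential a q \<kappa> y)"

definition C_const :: "real \<Rightarrow> real" where
  "C_const \<kappa> = - ((\<kappa> - 1)\<^sup>2 * ln (\<kappa> - 1) - \<kappa>\<^sup>2 * ln \<kappa> + 3 * \<kappa>) / 2"

definition rate_fun :: "real \<Rightarrow> real \<Rightarrow> real \<Rightarrow> real \<Rightarrow> real" where
  "rate_fun a q \<kappa> y =
     (if \<kappa> \<ge> 1 then
        ln (1 / q) * (((max y 0)\<^sup>2 - 2 * y) / 2) - \<kappa> * ln (1 - a) + ln a / 2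
        + C_const \<kappa> + F_eq a q \<kappa> y
      else
        ln (1 / q) * (((max y 0)\<^sup>2 - 2 * y * \<kappa> + 2 * \<kappa> - 2 * \<kappa>\<^sup>2) / 2)
        - ln (1 / q) * integral {\<kappa>..1} (\<lambda>x. max (y + x - 1) 0)
        - \<kappa> * ln (1 - a) + \<kappa>\<^sup>2 * (ln a / 2)
        + \<kappa>\<^sup>2 * C_const (1 / \<kappa>) + \<kappa>\<^sup>2 * F_eq a q (1 / \<kappa>) (y / \<kappa> - 1 / \<kappa> + 1))"

end

theory Submission
  imports Defs "HOL-Real_Asymp.Real_Asymp"
begin

text \<open>For \<open>\<kappa> < 1\<close> the rate function is \<open>\<kappa>\<^sup>2\<close> times the one for \<open>1 / \<kappa>\<close> after an affine change of
  variable, so let \<open>\<kappa> \<ge> 1\<close>. With \<open>L = ln (1 / q)\<close> it is then, up to a constant, the infimum over the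
  densities \<open>\<phi>\<close> of \<open>E(\<phi>) + L * (integral of x - \<Phi>(x) over [0, max y 0])\<close>, where \<open>E\<close> is the energy for
  the Meixner potential and \<open>\<Phi>\<close> the distribution function of \<open>\<phi>\<close>. This is monotone in \<open>y\<close>, and
  subtracting \<open>L * y\<^sup>2 / 2\<close> makes it concave. It is also convex: the logarithmic kernel is, up to terms that
  only depend on the mass, the integral over \<open>r\<close> of \<open>1 / r\<^sup>2\<close> times the product of the masses of sliding
  windows of length \<open>r\<close>, so the energy is submodular under the minimum and maximum of distribution
  functions. Given near-minimisers at \<open>y\<^sub>0 < y\<^sub>1\<close>, translating the holes (not the particles) of the first by
  half of \<open>y\<^sub>1 - y\<^sub>0\<close> before taking minimum and maximum yields two competitors at the midpoint. Convexity and
  semiconcavity give the differentiability, with no information on the minimisers for general \<open>y\<close>.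

  The normalisation and the behaviour for large \<open>y\<close> need the energy for the Meixner potential itself. Its
  minimiser is the average over \<open>s \<in> [0,1]\<close> of the arcsine laws on \<open>[\<alpha>(s), \<beta>(s)]\<close>; since
  \<open>(x - \<alpha>(s)) (\<beta>(s) - x)\<close> is symmetric in \<open>s\<close> and \<open>x\<close>, both the constraint \<open>\<phi> \<le> 1\<close> and the
  Euler-Lagrange conditions can be read off. Its mean is the derivative of the minimal energy in
  \<open>ln (1 / a)\<close>, and the constant of integration is found by letting \<open>a\<close> tend to 0, where the minimiser tends
  to the uniform density on \<open>[0,1]\<close>.\<close>

text \<open>Why the holes are the right thing to translate: their counting function is
  \<open>x - \<Phi>(x)\<close>, so translating them by \<delta> carries the hole integral over
  [0, y0] unchanged to the one over [\<delta>, y0 + \<delta>]. Moving only the particles would also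
  have the wrong sign. Undoing the shift after taking minimum and maximum leaves an error of the
  form: integral of h times (\<phi>3 - \<phi>0), where \<phi>3 is stochastically smaller than
  \<phi>0. It is harmless if h is nondecreasing. For a plain translation of the particles h would be
  \<open>V(x) - V(x + \<delta>)\<close>, which is nonincreasing because the Meixner potential V is
  convex. Translating the holes means that the gap [0, \<delta>) is filled with further particles,
  and their interaction with the old ones adds twice the logarithmic potential of the gap to h. This
  outweighs the convexity of V, whose only convex term that is not affine is
  \<open>x * ln x\<close>.\<close>

section \<open>One-dimensional convex functions\<close>

lemma midpoint_convex_continuous_imp_convex:
  fixes f :: "real \<Rightarrow> real"
  assumes cont: "continuous_on UNIV f"
    and mid: "\<And>x y. f ((x + y) / 2) \<le> (f x + f y) / 2"
  shows "convex_on UNIV f"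
proof (rule convex_onI)
  fix t x y :: real
  assume t: "0 < t" "t < 1"
  define h where "h s = f ((1 - s) * x + s * y) - ((1 - s) * f x + s * f y)" for s
  have hmid: "h ((s + s') / 2) \<le> (h s + h s') / 2" for s s'
  proof -
    define A where "A = (1 - (s + s') / 2) * x + (s + s') / 2 * y"
    have Aeq: "A
        = (((1 - s) * x + s * y) + ((1 - s') * x + s' * y)) / 2"
      by (simp add: A_def field_simps)
    then have "f A
        \<le> (f ((1 - s) * x + s * y) + f ((1 - s') * x + s' * y)) / 2"
      using mid[of "(1 - s) * x + s * y" "(1 - s') * x + s' * y"] by (simp only: Aeq)
    then show ?thesis unfolding h_def A_def[symmetric] by (simp add: field_simps)
  qed
  have hc: "continuous_on UNIV h"
    unfolding h_def by (intro continuous_intros continuous_on_compose2[OF cont]) auto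
  have h01: "h 0 = 0" "h 1 = 0" by (auto simp: h_def)
  have "h t \<le> 0"
  proof (rule ccontr)
    assume "\<not> h t \<le> 0"
    obtain m where m: "m \<in> {0..1}" "\<forall>s\<in>{0..1}. h s \<le> h m"
      using continuous_attains_sup[of "{0..1::real}" h] continuous_on_subset[OF hc] by auto
    have hm: "h m > 0" using bspec[OF m(2), of t] t \<open>\<not> h t \<le> 0\<close> by simp
    \<comment> \<open>The leftmost maximum point \<open>c\<close>: of the pair c - e, c + e, with e
      reaching to the nearer end, the left value is strictly smaller and the right one no larger,
      against midpoint convexity.\<close>
    define A where "A = {0..1} \<inter> h -` {h m}"
    have "closed A" unfolding A_def
      by (intro continuous_closed_preimage continuous_on_subset[OF hc]) auto
    moreover have "A \<noteq> {}" "bdd_below A" using m by (auto simp: A_def)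
    ultimately have "Inf A \<in> A" by (intro closed_contains_Inf) auto
    then have c: "0 \<le> Inf A" "Inf A \<le> 1" "h (Inf A) = h m" by (auto simp: A_def)
    define c where "c = Inf A"
    have c01: "0 < c" "c < 1" using c hm h01 unfolding c_def by (metis less_le not_less_iff_gr_or_eq)+
    define e where "e = min c (1 - c)"
    have e: "e > 0" "c - e \<ge> 0" "c + e \<le> 1" using c01 by (auto simp: e_def)
    have "c - e \<notin> A" using cInf_lower[OF _ \<open>bdd_below A\<close>, of "c - e"] e unfolding c_def by auto
    then have "h (c - e) < h m"
      using bspec[OF m(2), of "c - e"] e c01 unfolding A_def by (auto simp: less_le)
    moreover have "h (c + e) \<le> h m" using bspec[OF m(2), of "c + e"] e c01 by auto
    moreover have "h c \<le> (h (c - e) + h (c + e)) / 2" using hmid[of "c - e" "c + e"] by simp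
    ultimately show False using c unfolding c_def by simp
  qed
  then show "f ((1 - t) *\<^sub>R x + t *\<^sub>R y) \<le> (1 - t) * f x + t * f y"
    by (simp add: h_def)
qed simp

lemma convex_on_UNIV_subgradient:
  fixes f :: "real \<Rightarrow> real"
  assumes "convex_on UNIV f"
  obtains p where "\<And>z. f z \<ge> f y + p * (z - y)"
  using convex_le_Inf_differential[OF assms, of y] by auto

text \<open>A subgradient of \<open>f\<close> and one of \<open>L y\<^sup>2 / 2 - f\<close> squeeze \<open>f\<close> between two parabolas that touch.\<close>
lemma convex_semiconcave_C11:
  fixes f :: "real \<Rightarrow> real"
  assumes cf: "convex_on UNIV f" and cg: "convex_on UNIV (\<lambda>y. L * y\<^sup>2 / 2 - f y)"
  obtains d where "\<And>y. (f has_real_derivative d y) (at y)" "mono d" "L-lipschitz_on UNIV d"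
proof -
  have "\<exists>p. \<forall>z. f y + p * (z - y) \<le> f z \<and> f z \<le> f y + p * (z - y) + L / 2 * (z - y)\<^sup>2" for y
  proof -
    obtain p where p: "\<And>z. f z \<ge> f y + p * (z - y)"
      using convex_on_UNIV_subgradient[OF cf] by metis
    obtain p' where p': "\<And>z. L * z\<^sup>2 / 2 - f z \<ge> L * y\<^sup>2 / 2 - f y + p' * (z - y)"
      using convex_on_UNIV_subgradient[OF cg, of y] by metis
    have up: "f z \<le> f y + (L * y - p') * (z - y) + L / 2 * (z - y)\<^sup>2" for z
      using p'[of z] by (simp add: power2_eq_square field_simps)
    have le: "(p - (L * y - p')) * h \<le> L / 2 * h\<^sup>2" for h
      using p[of "y + h"] up[of "y + h"] by (simp add: field_simps)
    have "p - (L * y - p') = 0"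
    proof (rule ccontr)
      define c where "c = p - (L * y - p')"
      assume "p - (L * y - p') \<noteq> 0"
      then have c: "c \<noteq> 0" by (simp add: c_def)
      have le': "c * h \<le> L / 2 * h\<^sup>2" for h using le by (simp add: c_def)
      \<comment> \<open>This makes the linear side \<open>c\<^sup>2 / (\<bar>L\<bar> + 1)\<close>
        and the quadratic side less than half of it, whatever the sign of \<open>L\<close>.\<close>
      define h where "h = c / (\<bar>L\<bar> + 1)"
      have "c * h = c\<^sup>2 / (\<bar>L\<bar> + 1)" by (simp add: h_def power2_eq_square)
      moreover have "L / 2 * h\<^sup>2 = L / (2 * (\<bar>L\<bar> + 1)) * (c\<^sup>2 / (\<bar>L\<bar> + 1))"
        by (simp add: h_def power2_eq_square)
      moreover have "L / (2 * (\<bar>L\<bar> + 1)) < 1" by (simp add: field_simps)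
      moreover have "c\<^sup>2 / (\<bar>L\<bar> + 1) > 0" using c by (simp add: add_nonneg_pos)
      ultimately show False using le'[of h]
        mult_less_cancel_right_pos[of "c\<^sup>2 / (\<bar>L\<bar> + 1)" "L / (2 * (\<bar>L\<bar> + 1))" 1] by linarith
    qed
    then show ?thesis using p up by (metis eq_iff_diff_eq_0)
  qed
  then obtain d where d1: "\<And>y z. f y + d y * (z - y) \<le> f z"
    and d2: "\<And>y z. f z \<le> f y + d y * (z - y) + L / 2 * (z - y)\<^sup>2" by metis
  have L0: "L \<ge> 0" using d1[of 0 1] d2[of 1 0] by simp
  have der: "(f has_real_derivative d y) (at y)" for y
  proof -
    have "((\<lambda>z. (f z - f y) / (z - y) - d y) \<longlongrightarrow> 0) (at y)"
    proof (rule Lim_null_comparison)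
      show "\<forall>\<^sub>F z in at y. norm ((f z - f y) / (z - y) - d y) \<le> L / 2 * \<bar>z - y\<bar>"
      proof (rule eventually_at_filter[THEN iffD2], rule always_eventually, intro allI impI)
        fix z assume zy: "z \<noteq> y"
        have "\<bar>f z - f y - d y * (z - y)\<bar> \<le> L / 2 * (z - y)\<^sup>2"
          using d1[of y z] d2[of z y] by auto
        then have "\<bar>f z - f y - d y * (z - y)\<bar> / \<bar>z - y\<bar> \<le> L / 2 * (z - y)\<^sup>2 / \<bar>z - y\<bar>"
          by (rule divide_right_mono) simp
        moreover have "\<bar>f z - f y - d y * (z - y)\<bar> / \<bar>z - y\<bar> = \<bar>(f z - f y) / (z - y) - d y\<bar>"
          using zy by (simp add: diff_divide_distrib flip: abs_divide)
        moreover have "L / 2 * (z - y)\<^sup>2 / \<bar>z - y\<bar> = L / 2 * \<bar>z - y\<bar>"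
        proof -
          have "(z - y)\<^sup>2 = \<bar>z - y\<bar> * \<bar>z - y\<bar>" by (simp add: power2_eq_square)
          then show ?thesis using zy by (simp only: mult.assoc[symmetric]) simp
        qed
        ultimately show "norm ((f z - f y) / (z - y) - d y) \<le> L / 2 * \<bar>z - y\<bar>" by simp
      qed
      show "((\<lambda>z. L / 2 * \<bar>z - y\<bar>) \<longlongrightarrow> 0) (at y)" by (auto intro!: tendsto_eq_intros)
    qed
    then show ?thesis unfolding DERIV_def LIM_zero_iff
      by (metis has_field_derivative_iff DERIV_def LIM_zero_iff)
  qed
  have dm: "d y \<le> d z" if "y \<le> z" for y z
  proof (cases "y = z")
    case False
    then have "z - y > 0" using that by simp
    moreover have "(d y - d z) * (z - y) \<le> 0" using d1[of y z] d1[of z y] by (simp add: algebra_simps)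
    ultimately show ?thesis by (simp add: mult_le_0_iff)
  qed simp
  have dL: "d z - d y \<le> L * (z - y)" if "y < z" for y z
  proof -
    \<comment> \<open>The slope of the convex function \<open>g\<close> at \<open>y\<close> is
      \<open>L * y - d y\<close>; its monotonicity is the upper bound on the growth of
      \<open>d\<close>.\<close>
    define g where "g y = L * y\<^sup>2 / 2 - f y" for y
    have gd: "g z \<ge> g y + (L * y - d y) * (z - y)" for y z
      using d2[of z y] by (simp add: g_def power2_eq_square field_simps)
    have "(d z - d y - L * (z - y)) * (z - y) \<le> 0"
      using gd[of y z] gd[of z y] by (simp add: algebra_simps)
    then show ?thesis using that by (simp add: mult_le_0_iff)
  qed
  have "L-lipschitz_on UNIV d"
  proof (rule lipschitz_onI[OF _ L0])
    fix y z :: real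
    show "dist (d y) (d z) \<le> L * dist y z"
      using dm[of y z] dm[of z y] dL[of y z] dL[of z y]
      by (cases y z rule: linorder_cases) (auto simp: dist_real_def abs_if)
  qed
  then show ?thesis using that der dm by (auto simp: mono_def)
qed

section \<open>Logarithmic energy of bounded densities\<close>

text \<open>The singular part of the logarithm. Since \<open>ln 0 = 0\<close> it vanishes at 0, and
  beyond distance 1 the logarithm is at most \<open>\<bar>d\<bar>\<close>, so integrals split into a
  locally integrable part and a first moment.\<close>

definition lnear :: "real \<Rightarrow> real" where
  "lnear d = (if \<bar>d\<bar> < 1 then - ln \<bar>d\<bar> else 0)"

lemma lnear_nonneg: "0 \<le> lnear d"
  by (cases "d = 0") (auto simp: lnear_def)

lemma borel_measurable_lnear [measurable]: "lnear \<in> borel_measurable borel"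
  unfolding lnear_def by measurable

lemma abs_ln_abs_le: "\<bar>ln \<bar>d\<bar>\<bar> \<le> lnear d + \<bar>d :: real\<bar>"
proof (cases "\<bar>d\<bar> < 1")
  case True
  then show ?thesis by (cases "d = 0") (auto simp: lnear_def)
next
  case False
  then show ?thesis using ln_bound[of "\<bar>d\<bar>"] by (auto simp: lnear_def)
qed

lemma continuous_on_xlnx: "continuous_on {0..} (\<lambda>x::real. x * ln x)"
  unfolding continuous_on_eq_continuous_within
proof
  fix x :: real assume "x \<in> {0..}"
  show "continuous (at x within {0..}) (\<lambda>x. x * ln x)"
  proof (cases "x = 0")
    case True
    have "((\<lambda>x::real. x * ln x) \<longlongrightarrow> 0) (at_right 0)" by real_asymp
    then show ?thesis using True
      by (simp add: continuous_within at_within_Ici_at_right)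
  next
    case False
    then have "x > 0" using \<open>x \<in> {0..}\<close> by simp
    then show ?thesis by (intro continuous_intros) auto
  qed
qed

lemma has_integral_ln: 
  assumes "0 \<le> (a::real)" "a \<le> b"
  shows "(ln has_integral (b * ln b - b - (a * ln a - a))) {a..b}"
proof (rule fundamental_theorem_of_calculus_interior)
  show "continuous_on {a..b} (\<lambda>x. x * ln x - x)"
    by (rule continuous_on_diff[OF continuous_on_subset[OF continuous_on_xlnx] continuous_on_id]) (use assms in auto)
  show "((\<lambda>x. x * ln x - x) has_vector_derivative ln x) (at x)" if "x \<in> {a<..<b}" for x
    using that assms
    by (auto intro!: derivative_eq_intros simp flip: has_real_derivative_iff_has_vector_derivative)
qed (use assms in auto)

lemma nn_integral_translate_reflect:
  assumes [measurable]: "f \<in> borel_measurable borel"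
  shows "(\<integral>\<^sup>+y. f (x - y) \<partial>lborel) = (\<integral>\<^sup>+y. f (y::real) \<partial>lborel)"
  using nn_integral_real_affine[of f "-1" x] by (simp add: assms)

lemma nn_integral_lnear: "(\<integral>\<^sup>+d. ennreal (lnear d) \<partial>lborel) \<le> 2"
proof -
  define f where "f d = max 0 (- ln d)" for d :: real
  have [measurable]: "f \<in> borel_measurable borel" unfolding f_def by measurable
  have "(f has_integral 1) {0..1}"
  proof (rule has_integral_eq)
    show "((\<lambda>x. - ln x) has_integral 1) {0..1::real}"
      using has_integral_neg[OF has_integral_ln[of 0 1]] by simp
    show "- ln x = f x" if "x \<in> {0..1}" for x
      using that by (cases "x = 0") (auto simp: f_def)
  qed
  then have f1: "(\<integral>\<^sup>+x. ennreal (indicator {0..1} x * f x) \<partial>lborel) = 1"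
    by (subst nn_integral_has_integral_lebesgue[where I = 1]) (auto simp: f_def)
  have "(\<integral>\<^sup>+d. ennreal (lnear d) \<partial>lborel)
      \<le> (\<integral>\<^sup>+d. ennreal (indicator {0..1} d * f d) + ennreal (indicator {0..1} (0 - d) * f (0 - d)) \<partial>lborel)"
    by (rule nn_integral_mono)
      (auto simp: lnear_def f_def indicator_def abs_if simp flip: ennreal_plus intro!: ennreal_leI)
  also have "\<dots> = 1 + 1"
    by (subst nn_integral_add) (use f1 nn_integral_translate_reflect[of "\<lambda>d. ennreal (indicator {0..1} d * f d)" 0] in auto)
  finally show ?thesis by simp
qed

lemma nn_integral_lnear_shift: "(\<integral>\<^sup>+y. ennreal (lnear (x - y)) \<partial>lborel) \<le> 2"
  using nn_integral_lnear nn_integral_translate_reflect[of "\<lambda>d. ennreal (lnear d)" x] by simp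

text \<open>The class on which the logarithmic form is finite and bilinear: boundedness controls the
  singularity on the diagonal, the first moment controls the growth at infinity. Functions may be
  signed because differences of densities occur.\<close>

definition bdd_moment :: "(real \<Rightarrow> real) \<Rightarrow> bool" where
  "bdd_moment f \<longleftrightarrow> f \<in> borel_measurable borel \<and> integrable lborel f \<and>
     integrable lborel (\<lambda>x. x * f x) \<and> (\<exists>B. \<forall>x. \<bar>f x\<bar> \<le> B)"

lemma bdd_momentD:
  assumes "bdd_moment f"
  shows "f \<in> borel_measurable borel" "integrable lborel f" "integrable lborel (\<lambda>x. x * f x)"
  using assms by (auto simp: bdd_moment_def)

lemma bdd_moment_add:
  assumes "bdd_moment f" "bdd_moment g"
  shows "bdd_moment (\<lambda>x. f x + g x)"
proof -
  obtain A B where "\<And>x. \<bar>f x\<bar> \<le> A" "\<And>x. \<bar>g x\<bar> \<le> B" using assms by (auto simp: bdd_moment_def)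
  then have "\<bar>f x + g x\<bar> \<le> A + B" for x by (meson abs_triangle_ineq add_mono order_trans)
  then show ?thesis using assms by (auto simp: bdd_moment_def distrib_left)
qed

lemma bdd_moment_cmult:
  assumes "bdd_moment f"
  shows "bdd_moment (\<lambda>x. c * f x)"
proof -
  obtain A where "\<And>x. \<bar>f x\<bar> \<le> A" using assms by (auto simp: bdd_moment_def)
  then have "\<bar>c * f x\<bar> \<le> \<bar>c\<bar> * A" for x by (simp add: abs_mult mult_left_mono)
  moreover have "integrable lborel (\<lambda>x. x * (c * f x))"
    using assms integrable_mult_right[of c lborel "\<lambda>x. x * f x"]
    by (simp add: bdd_moment_def mult.left_commute)
  ultimately show ?thesis using assms by (auto simp: bdd_moment_def)
qed

lemma bdd_moment_diff:
  assumes "bdd_moment f" "bdd_moment g"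
  shows "bdd_moment (\<lambda>x. f x - g x)"
  using bdd_moment_add[OF assms(1) bdd_moment_cmult[OF assms(2), of "-1"]] by simp

lemma bdd_moment_abs:
  assumes "bdd_moment f"
  shows "bdd_moment (\<lambda>x. \<bar>f x\<bar>)"
proof -
  have [measurable]: "f \<in> borel_measurable borel" using assms by (simp add: bdd_moment_def)
  have "integrable lborel (\<lambda>x. x * \<bar>f x\<bar>)"
    by (rule Bochner_Integration.integrable_bound[OF bdd_momentD(3)[OF assms]]) (auto simp: abs_mult)
  then show ?thesis using assms by (auto simp: bdd_moment_def)
qed

text \<open>One growth bound covers the logarithm, its truncation, \<open>abs\<close> and the
  constants, so that integrability and bilinearity of \<open>kform\<close> are shown once for all
  four.\<close>

definition log_kernel :: "(real \<Rightarrow> real) \<Rightarrow> bool" where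
  "log_kernel h \<longleftrightarrow> h \<in> borel_measurable borel \<and> (\<exists>C. \<forall>d. \<bar>h d\<bar> \<le> C * (1 + \<bar>d\<bar> + lnear d))"

abbreviation "lborel2 \<equiv> lborel \<Otimes>\<^sub>M lborel"

definition kform :: "(real \<Rightarrow> real) \<Rightarrow> (real \<Rightarrow> real) \<Rightarrow> (real \<Rightarrow> real) \<Rightarrow> real" where
  "kform h f g = (LINT z|lborel2. h (fst z - snd z) * f (fst z) * g (snd z))"

lemma log_kernelI:
  assumes "h \<in> borel_measurable borel" "\<And>d. \<bar>h d\<bar> \<le> C * (1 + \<bar>d\<bar> + lnear d)"
  shows "log_kernel h"
  using assms by (auto simp: log_kernel_def)

lemma log_kernel_const: "log_kernel (\<lambda>d. c)"
proof (rule log_kernelI)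
  show "\<bar>c\<bar> \<le> \<bar>c\<bar> * (1 + \<bar>d\<bar> + lnear d)" for d
    using lnear_nonneg[of d] by (simp add: mult_le_cancel_left1)
qed simp

lemma log_kernel_abs: "log_kernel abs"
  by (rule log_kernelI[where C = 1]) (use lnear_nonneg in \<open>auto simp: add_nonneg_nonneg\<close>)

lemma log_kernel_ln: "log_kernel (\<lambda>d. - ln \<bar>d\<bar>)"
proof (rule log_kernelI[where C = 1])
  show "\<bar>- ln \<bar>d\<bar>\<bar> \<le> 1 * (1 + \<bar>d\<bar> + lnear d)" for d using abs_ln_abs_le[of d] by simp
qed measurable

lemma integrable_pair_mult:
  fixes u v :: "real \<Rightarrow> real"
  assumes u: "integrable lborel u" and v: "integrable lborel v"
  shows "integrable lborel2 (\<lambda>z. u (fst z) * v (snd z))"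
    and "(LINT z|lborel2. u (fst z) * v (snd z)) = integral\<^sup>L lborel u * integral\<^sup>L lborel v"
proof -
  have [measurable]: "u \<in> borel_measurable borel" "v \<in> borel_measurable borel"
    using borel_measurable_integrable[OF u] borel_measurable_integrable[OF v] by auto
  show i: "integrable lborel2 (\<lambda>z. u (fst z) * v (snd z))"
  proof (rule lborel_pair.Fubini_integrable)
    show "integrable lborel (\<lambda>x. LINT y|lborel. norm (u (fst (x, y)) * v (snd (x, y))))"
      using integrable_mult_left[OF integrable_abs[OF u], of "LINT y|lborel. \<bar>v y\<bar>"]
      by (simp add: abs_mult)
    show "AE x in lborel. integrable lborel (\<lambda>y. u (fst (x, y)) * v (snd (x, y)))"
      using v by simp
  qed simp
  show "(LINT z|lborel2. u (fst z) * v (snd z)) = integral\<^sup>L lborel u * integral\<^sup>L lborel v"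
    using lborel_pair.integral_fst'[OF i] by simp
qed

text \<open>The linear part splits into products of one-variable integrals. For the singular part,
  the bound on \<open>g\<close> allows \<open>y\<close> to be integrated out first, at the cost of
  twice that bound, uniformly in \<open>x\<close>.\<close>

lemma integrable_log_kernel_aux:
  assumes f: "bdd_moment f" and g: "bdd_moment g"
    and f0: "\<And>x. 0 \<le> f x" and g0: "\<And>x. 0 \<le> g x"
  shows "integrable lborel2
    (\<lambda>z. (1 + \<bar>fst z - snd z\<bar> + lnear (fst z - snd z)) * f (fst z) * g (snd z))"
proof -
  have [measurable]: "f \<in> borel_measurable borel" "g \<in> borel_measurable borel"
    using f g by (auto simp: bdd_moment_def)
  note fi = bdd_momentD(2)[OF f] bdd_momentD(3)[OF bdd_moment_abs[OF f]]
  note gi = bdd_momentD(2)[OF g] bdd_momentD(3)[OF bdd_moment_abs[OF g]]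
  obtain B where B: "\<And>x. g x \<le> B" using g by (auto simp: bdd_moment_def abs_le_iff)
  have af: "integrable lborel (\<lambda>x. \<bar>x\<bar> * f x)" 
    using integrable_abs[OF bdd_momentD(3)[OF f]] f0 by (simp add: abs_mult)
  have ag: "integrable lborel (\<lambda>x. \<bar>x\<bar> * g x)" 
    using integrable_abs[OF bdd_momentD(3)[OF g]] g0 by (simp add: abs_mult)
  note prod = integrable_pair_mult(1)
  have i1: "integrable lborel2 (\<lambda>z. (1 + \<bar>fst z\<bar> + \<bar>snd z\<bar>) * (f (fst z) * g (snd z)))"
    using Bochner_Integration.integrable_add[OF Bochner_Integration.integrable_add[OF prod[OF fi(1) gi(1)] prod[OF af gi(1)]] prod[OF fi(1) ag]]
    by (simp add: algebra_simps)
  have i2: "integrable lborel2 (\<lambda>z. lnear (fst z - snd z) * (f (fst z) * g (snd z)))"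
  proof (rule integrableI_bounded)
    have "(\<integral>\<^sup>+z. ennreal (norm (lnear (fst z - snd z) * (f (fst z) * g (snd z)))) \<partial>lborel2)
      = (\<integral>\<^sup>+x. \<integral>\<^sup>+y. ennreal (norm (lnear (x - y) * (f x * g y))) \<partial>lborel \<partial>lborel)"
      by (subst lborel.nn_integral_fst[symmetric]) simp_all
    also have "\<dots> \<le> (\<integral>\<^sup>+x. \<integral>\<^sup>+y. ennreal (f x * B) * ennreal (lnear (x - y)) \<partial>lborel \<partial>lborel)"
    proof (intro nn_integral_mono)
      fix x y
      have "norm (lnear (x - y) * (f x * g y)) \<le> (f x * B) * lnear (x - y)"
        using mult_right_mono[OF mult_left_mono[OF B[of y] f0[of x]] lnear_nonneg[of "x - y"]]
          lnear_nonneg[of "x - y"] f0[of x] g0[of y]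
        by (simp add: abs_mult mult_ac)
      then show "ennreal (norm (lnear (x - y) * (f x * g y))) \<le> ennreal (f x * B) * ennreal (lnear (x - y))"
        using lnear_nonneg by (simp add: ennreal_leI flip: ennreal_mult'')
    qed
    also have "\<dots> = (\<integral>\<^sup>+x. ennreal (f x * B) * (\<integral>\<^sup>+y. ennreal (lnear (x - y)) \<partial>lborel) \<partial>lborel)"
      by (intro nn_integral_cong nn_integral_cmult) simp
    also have "\<dots> \<le> (\<integral>\<^sup>+x. ennreal (f x * B) * 2 \<partial>lborel)"
      by (intro nn_integral_mono mult_left_mono nn_integral_lnear_shift) simp
    also have "\<dots> = (\<integral>\<^sup>+x. ennreal (f x * B) \<partial>lborel) * 2" by (rule nn_integral_multc) simp
    also have "\<dots> < \<infinity>"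
    proof -
      have "B \<ge> 0" using B[of 0] g0[of 0] by simp
      then have "(\<integral>\<^sup>+x. ennreal (f x * B) \<partial>lborel) < \<infinity>"
        using integrableD(2)[OF integrable_mult_left[OF fi(1), of B]] f0
        by (simp add: abs_mult top.not_eq_extremum)
      then show ?thesis by (simp add: ennreal_mult_less_top)
    qed
    finally show "(\<integral>\<^sup>+z. ennreal (norm (lnear (fst z - snd z) * (f (fst z) * g (snd z)))) \<partial>lborel2) < \<infinity>" .
  qed simp
  show ?thesis
  proof (rule Bochner_Integration.integrable_bound[OF Bochner_Integration.integrable_add[OF i1 i2]])
    show "AE z in lborel2. norm ((1 + \<bar>fst z - snd z\<bar> + lnear (fst z - snd z)) * f (fst z) * g (snd z))
      \<le> norm ((1 + \<bar>fst z\<bar> + \<bar>snd z\<bar>) * (f (fst z) * g (snd z)) + lnear (fst z - snd z) * (f (fst z) * g (snd z)))"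
    proof (rule AE_I2)
      fix z :: "real \<times> real"
      obtain x y where z: "z = (x, y)" by fastforce
      have "(1 + \<bar>x - y\<bar> + lnear (x - y)) * (f x * g y) \<le> ((1 + \<bar>x\<bar> + \<bar>y\<bar>) + lnear (x - y)) * (f x * g y)"
        using f0 g0 by (intro mult_right_mono) auto
      moreover have "0 \<le> (1 + \<bar>x - y\<bar> + lnear (x - y)) * (f x * g y)"
        using f0 g0 lnear_nonneg[of "x - y"] by simp
      ultimately show "norm ((1 + \<bar>fst z - snd z\<bar> + lnear (fst z - snd z)) * f (fst z) * g (snd z))
      \<le> norm ((1 + \<bar>fst z\<bar> + \<bar>snd z\<bar>) * (f (fst z) * g (snd z)) + lnear (fst z - snd z) * (f (fst z) * g (snd z)))"
        by (simp add: z distrib_right mult.assoc)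
    qed
  qed simp
qed

lemma integrable_kform:
  assumes h: "log_kernel h" and f: "bdd_moment f" and g: "bdd_moment g"
  shows "integrable lborel2 (\<lambda>z. h (fst z - snd z) * f (fst z) * g (snd z))"
proof -
  have [measurable]: "f \<in> borel_measurable borel" "g \<in> borel_measurable borel" "h \<in> borel_measurable borel"
    using f g h by (auto simp: bdd_moment_def log_kernel_def)
  obtain C where C: "\<And>d. \<bar>h d\<bar> \<le> C * (1 + \<bar>d\<bar> + lnear d)" using h by (auto simp: log_kernel_def)
  show ?thesis
  proof (rule Bochner_Integration.integrable_bound)
    show "integrable lborel2 (\<lambda>z. C * ((1 + \<bar>fst z - snd z\<bar> + lnear (fst z - snd z)) * \<bar>f (fst z)\<bar> * \<bar>g (snd z)\<bar>))"
      by (intro integrable_mult_right integrable_log_kernel_aux bdd_moment_abs f g) auto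
    show "AE z in lborel2. norm (h (fst z - snd z) * f (fst z) * g (snd z))
      \<le> norm (C * ((1 + \<bar>fst z - snd z\<bar> + lnear (fst z - snd z)) * \<bar>f (fst z)\<bar> * \<bar>g (snd z)\<bar>))"
    proof (rule AE_I2)
      fix z :: "real \<times> real"
      have "\<bar>h (fst z - snd z)\<bar> * (\<bar>f (fst z)\<bar> * \<bar>g (snd z)\<bar>)
        \<le> (C * (1 + \<bar>fst z - snd z\<bar> + lnear (fst z - snd z))) * (\<bar>f (fst z)\<bar> * \<bar>g (snd z)\<bar>)"
        by (intro mult_right_mono C) auto
      also have "\<dots> \<le> \<bar>C * (1 + \<bar>fst z - snd z\<bar> + lnear (fst z - snd z))\<bar> * (\<bar>f (fst z)\<bar> * \<bar>g (snd z)\<bar>)"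
        by (intro mult_right_mono) auto
      finally show "norm (h (fst z - snd z) * f (fst z) * g (snd z))
      \<le> norm (C * ((1 + \<bar>fst z - snd z\<bar> + lnear (fst z - snd z)) * \<bar>f (fst z)\<bar> * \<bar>g (snd z)\<bar>))"
        by (simp add: abs_mult mult.assoc)
    qed
  qed simp
qed

lemma kform_add_left:
  assumes "log_kernel h" "bdd_moment f" "bdd_moment f'" "bdd_moment g"
  shows "kform h (\<lambda>x. f x + f' x) g = kform h f g + kform h f' g"
  unfolding kform_def
  using Bochner_Integration.integral_add[OF integrable_kform[OF assms(1,2,4)] integrable_kform[OF assms(1,3,4)]]
  by (simp add: algebra_simps)

lemma kform_add_right:
  assumes "log_kernel h" "bdd_moment f" "bdd_moment g" "bdd_moment g'"
  shows "kform h f (\<lambda>x. g x + g' x) = kform h f g + kform h f g'"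
  unfolding kform_def
  using Bochner_Integration.integral_add[OF integrable_kform[OF assms(1-3)] integrable_kform[OF assms(1,2,4)]]
  by (simp add: algebra_simps)

lemma kform_diff_left:
  assumes "log_kernel h" "bdd_moment f" "bdd_moment f'" "bdd_moment g"
  shows "kform h (\<lambda>x. f x - f' x) g = kform h f g - kform h f' g"
  unfolding kform_def
  using Bochner_Integration.integral_diff[OF integrable_kform[OF assms(1,2,4)] integrable_kform[OF assms(1,3,4)]]
  by (simp add: algebra_simps)

lemma kform_diff_right:
  assumes "log_kernel h" "bdd_moment f" "bdd_moment g" "bdd_moment g'"
  shows "kform h f (\<lambda>x. g x - g' x) = kform h f g - kform h f g'"
  unfolding kform_def
  using Bochner_Integration.integral_diff[OF integrable_kform[OF assms(1-3)] integrable_kform[OF assms(1,2,4)]]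
  by (simp add: algebra_simps)

lemma kform_swap:
  assumes "log_kernel h" "bdd_moment f" "bdd_moment g" "\<And>d. h (- d) = h d"
  shows "kform h f g = kform h g f"
proof -
  have "h (x - y) = h (y - x)" for x y using assms(4)[of "y - x"] by simp
  then have "(\<lambda>(x, y). h (fst (y, x) - snd (y, x)) * f (fst (y, x)) * g (snd (y, x)))
      = (\<lambda>z. h (fst z - snd z) * g (fst z) * f (snd z))"
    by (auto simp: fun_eq_iff)
  moreover have "(\<lambda>z. h (fst z - snd z) * f (fst z) * g (snd z)) \<in> borel_measurable lborel2"
    using integrable_kform[OF assms(1-3)] by auto
  ultimately show ?thesis unfolding kform_def
    by (subst lborel_pair.integral_product_swap[symmetric]) (simp_all add: case_prod_beta')
qed

lemma kform_Fubini:
  assumes "log_kernel h" "bdd_moment f" "bdd_moment g"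
  shows "kform h f g = (LINT x|lborel. (LINT y|lborel. h (x - y) * g y) * f x)"
    and "integrable lborel (\<lambda>x. (LINT y|lborel. h (x - y) * g y) * f x)"
proof -
  have eq: "(\<lambda>x. LINT y|lborel. h (x - y) * f x * g y) = (\<lambda>x. (LINT y|lborel. h (x - y) * g y) * f x)"
    by (subst integral_mult_left_zero[symmetric]) (simp add: mult_ac)
  have "integrable lborel2 (\<lambda>(x, y). h (x - y) * f x * g y)"
    using integrable_kform[OF assms] by (simp add: case_prod_beta')
  from lborel_pair.integral_fst'[OF this] lborel_pair.integrable_fst'[OF this]
  show "kform h f g = (LINT x|lborel. (LINT y|lborel. h (x - y) * g y) * f x)"
    and "integrable lborel (\<lambda>x. (LINT y|lborel. h (x - y) * g y) * f x)"
    by (simp_all add: kform_def eq case_prod_beta')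
qed

lemma kform_const: "kform (\<lambda>d. c) f g = c * integral\<^sup>L lborel f * integral\<^sup>L lborel g"
  if "bdd_moment f" "bdd_moment g"
  using kform_Fubini(1)[OF log_kernel_const that, of c] by (simp add: mult_ac)

text \<open>Fubini would give this for almost every \<open>x\<close> only; here it holds at every
  point, so that logarithmic potentials can be evaluated pointwise.\<close>

lemma integrable_log_kernel_inner:
  assumes h: "log_kernel h" and g: "bdd_moment g"
  shows "integrable lborel (\<lambda>y. h (x - y) * g y)"
proof -
  have [measurable]: "g \<in> borel_measurable borel" "h \<in> borel_measurable borel"
    using g h by (auto simp: bdd_moment_def log_kernel_def)
  obtain C where C: "\<And>d. \<bar>h d\<bar> \<le> C * (1 + \<bar>d\<bar> + lnear d)" using h by (auto simp: log_kernel_def)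
  obtain B where B: "\<And>x. \<bar>g x\<bar> \<le> B" using g by (auto simp: bdd_moment_def)
  have il: "integrable lborel (\<lambda>y. lnear (x - y))"
    using nn_integral_lnear_shift[of x] lnear_nonneg
    by (intro integrableI_nonneg) (auto simp: top_unique ennreal_numeral_less_top intro: le_less_trans)
  have "integrable lborel (\<lambda>y. \<bar>C\<bar> * ((1 + \<bar>x\<bar>) * \<bar>g y\<bar> + \<bar>y * g y\<bar> + B * lnear (x - y)))"
    using bdd_momentD[OF g] il by auto
  then show ?thesis
  proof (rule Bochner_Integration.integrable_bound)
    show "AE y in lborel. norm (h (x - y) * g y)
        \<le> norm (\<bar>C\<bar> * ((1 + \<bar>x\<bar>) * \<bar>g y\<bar> + \<bar>y * g y\<bar> + B * lnear (x - y)))"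
    proof (rule AE_I2)
      fix y
      have "\<bar>h (x - y)\<bar> \<le> \<bar>C\<bar> * (1 + \<bar>x - y\<bar> + lnear (x - y))"
        using C[of "x - y"] lnear_nonneg[of "x - y"]
          mult_right_mono[OF abs_ge_self[of C], of "1 + \<bar>x - y\<bar> + lnear (x - y)"] by linarith
      also have "\<dots> \<le> \<bar>C\<bar> * (1 + \<bar>x\<bar> + \<bar>y\<bar> + lnear (x - y))" by (intro mult_left_mono) auto
      finally have "\<bar>h (x - y)\<bar> * \<bar>g y\<bar> \<le> \<bar>C\<bar> * (1 + \<bar>x\<bar> + \<bar>y\<bar> + lnear (x - y)) * \<bar>g y\<bar>"
        by (rule mult_right_mono) simp
      also have "\<dots> = \<bar>C\<bar> * ((1 + \<bar>x\<bar>) * \<bar>g y\<bar> + \<bar>y * g y\<bar> + \<bar>g y\<bar> * lnear (x - y))"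
        by (simp add: algebra_simps abs_mult)
      also have "\<dots> \<le> \<bar>C\<bar> * ((1 + \<bar>x\<bar>) * \<bar>g y\<bar> + \<bar>y * g y\<bar> + B * lnear (x - y))"
        by (intro mult_left_mono add_left_mono mult_right_mono B lnear_nonneg) simp
      finally show "norm (h (x - y) * g y)
        \<le> norm (\<bar>C\<bar> * ((1 + \<bar>x\<bar>) * \<bar>g y\<bar> + \<bar>y * g y\<bar> + B * lnear (x - y)))"
        unfolding real_norm_def abs_mult[symmetric] using abs_ge_self order_trans by blast
    qed
  qed simp
qed

text \<open>The integral of \<open>(r - \<bar>d\<bar>)\<^sub>+ / r\<^sup>2\<close> over
  \<open>0 < r < R\<close>. It is nonnegative, and up to an error \<open>\<bar>d\<bar> / R\<close>
  it is \<open>- ln \<bar>d\<bar> + ln R - 1\<close>. At \<open>d = 0\<close>, where that integral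
  diverges, the value 0 is a convention on a null set.\<close>

definition trunc_log :: "real \<Rightarrow> real \<Rightarrow> real" where
  "trunc_log R d = (if d \<noteq> 0 \<and> \<bar>d\<bar> < R then ln (R / \<bar>d\<bar>) - 1 + \<bar>d\<bar> / R else 0)"

lemma borel_measurable_trunc_log [measurable]: "trunc_log R \<in> borel_measurable borel"
  unfolding trunc_log_def by measurable

lemma trunc_log_nonneg: "0 \<le> trunc_log R d"
proof (cases "d \<noteq> 0 \<and> \<bar>d\<bar> < R")
  case True
  then have "R > 0" by linarith
  then have "ln (\<bar>d\<bar> / R) \<le> \<bar>d\<bar> / R - 1" using True by (intro ln_le_minus_one) auto
  then show ?thesis using True \<open>R > 0\<close> by (simp add: trunc_log_def ln_div)
qed (auto simp: trunc_log_def)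

lemma trunc_log_approx:
  assumes "R > 0" "d \<noteq> 0"
  shows "\<bar>- ln \<bar>d\<bar> - trunc_log R d + (ln R - 1)\<bar> \<le> \<bar>d\<bar> / R"
proof (cases "\<bar>d\<bar> < R")
  case True
  then show ?thesis using assms by (simp add: trunc_log_def ln_div)
next
  case False
  have "ln (\<bar>d\<bar> / R) \<le> \<bar>d\<bar> / R - 1" using assms by (intro ln_le_minus_one) auto
  moreover have "ln R \<le> ln \<bar>d\<bar>" using False assms by simp
  moreover have "ln (\<bar>d\<bar> / R) = ln \<bar>d\<bar> - ln R" using assms by (simp add: ln_div)
  moreover have "trunc_log R d = 0" using False by (simp add: trunc_log_def)
  ultimately show ?thesis by linarith
qed

lemma log_kernel_trunc_log: assumes "R > 0" shows "log_kernel (trunc_log R)"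
proof (rule log_kernelI[where C = "\<bar>ln R\<bar> + 2 + 1 / R"])
  fix d
  define C where "C = \<bar>ln R\<bar> + 2 + 1 / R"
  have C: "C \<ge> 2 + 1 / R" "C \<ge> 2 + \<bar>ln R\<bar>" "C \<ge> 0" using assms by (auto simp: C_def)
  have "\<bar>trunc_log R d\<bar> \<le> (1 + \<bar>ln R\<bar>) + (1 + 1 / R) * \<bar>d\<bar> + lnear d"
  proof (cases "d = 0")
    case True
    then show ?thesis using lnear_nonneg[of d] by (simp add: trunc_log_def)
  next
    case False
    show ?thesis
      using trunc_log_approx[OF assms False] abs_ln_abs_le[of d] by (simp add: distrib_right) linarith
  qed
  also have "\<dots> \<le> C * 1 + C * \<bar>d\<bar> + C * lnear d"
  proof (intro add_mono)
    show "1 + \<bar>ln R\<bar> \<le> C * 1" using C by simp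
    show "(1 + 1 / R) * \<bar>d\<bar> \<le> C * \<bar>d\<bar>" using C by (intro mult_right_mono) auto
    have "C \<ge> 1" using C by linarith
    then show "lnear d \<le> C * lnear d" using lnear_nonneg[of d] by (simp add: mult_le_cancel_right1)
  qed
  finally show "\<bar>trunc_log R d\<bar> \<le> (\<bar>ln R\<bar> + 2 + 1 / R) * (1 + \<bar>d\<bar> + lnear d)"
    by (simp add: C_def distrib_left)
qed simp

lemma nn_integral_trunc_log:
  assumes "d \<noteq> 0"
  shows "(\<integral>\<^sup>+r. ennreal (indicator {0<..<R} r / r\<^sup>2) * ennreal (max 0 (r - \<bar>d\<bar>)) \<partial>lborel) = ennreal (trunc_log R d)"
proof (cases "\<bar>d\<bar> < R")
  case False
  have "(\<integral>\<^sup>+r. ennreal (indicator {0<..<R} r / r\<^sup>2) * ennreal (max 0 (r - \<bar>d\<bar>)) \<partial>lborel) = (\<integral>\<^sup>+(r::real). 0 \<partial>lborel)"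
    using False by (intro nn_integral_cong) (auto simp: indicator_def max_def)
  then show ?thesis using False by (simp add: trunc_log_def)
next
  case True
  have d: "\<bar>d\<bar> > 0" using assms by simp
  have "((\<lambda>r. (r - \<bar>d\<bar>) / r\<^sup>2) has_integral (ln R + \<bar>d\<bar> / R) - (ln \<bar>d\<bar> + \<bar>d\<bar> / \<bar>d\<bar>)) {\<bar>d\<bar>..R}"
  proof (rule fundamental_theorem_of_calculus)
    fix r assume "r \<in> {\<bar>d\<bar>..R}"
    then have "r > 0" using d by (auto intro: less_le_trans)
    then have "((\<lambda>r. ln r + \<bar>d\<bar> / r) has_real_derivative (r - \<bar>d\<bar>) / r\<^sup>2) (at r)"
      by (auto intro!: derivative_eq_intros simp: field_simps power2_eq_square)
    then show "((\<lambda>r. ln r + \<bar>d\<bar> / r) has_vector_derivative (r - \<bar>d\<bar>) / r\<^sup>2) (at r within {\<bar>d\<bar>..R})"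
      by (simp add: has_real_derivative_iff_has_vector_derivative has_vector_derivative_at_within)
  qed (use True in simp)
  then have "((\<lambda>r. (r - \<bar>d\<bar>) / r\<^sup>2) has_integral trunc_log R d) {\<bar>d\<bar>..R}"
    using True d less_trans[OF d True] by (simp add: trunc_log_def ln_div algebra_simps)
  then have "(\<integral>\<^sup>+r. ennreal (indicator {\<bar>d\<bar>..R} r * ((r - \<bar>d\<bar>) / r\<^sup>2)) \<partial>lborel) = ennreal (trunc_log R d)"
    by (rule nn_integral_has_integral_lebesgue[rotated]) (use d in auto)
  moreover have "(\<integral>\<^sup>+r. ennreal (indicator {0<..<R} r / r\<^sup>2) * ennreal (max 0 (r - \<bar>d\<bar>)) \<partial>lborel)
    = (\<integral>\<^sup>+r. ennreal (indicator {\<bar>d\<bar>..R} r * ((r - \<bar>d\<bar>) / r\<^sup>2)) \<partial>lborel)"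
  proof (rule nn_integral_cong_AE)
    have "AE r in lborel. r \<noteq> R" by (rule AE_lborel_singleton)
    then show "AE r in lborel. ennreal (indicator {0<..<R} r / r\<^sup>2) * ennreal (max 0 (r - \<bar>d\<bar>))
        = ennreal (indicator {\<bar>d\<bar>..R} r * ((r - \<bar>d\<bar>) / r\<^sup>2))"
      by eventually_elim (use d in \<open>auto simp: indicator_def max_def simp flip: ennreal_mult''\<close>)
  qed
  ultimately show ?thesis by simp
qed

section \<open>Slicing of the truncated kernel by sliding windows\<close>

lemma AE_off_diagonal: "AE z in lborel2. fst z \<noteq> (snd z :: real)"
proof (rule lborel_pair.AE_pair_measure)
  show "{z \<in> space lborel2. fst z \<noteq> (snd z :: real)} \<in> sets lborel2"
    by measurable
  have "AE y in lborel. fst (x, y) \<noteq> snd (x, y)" for x :: real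
    using AE_lborel_singleton[of x] by eventually_elim auto
  then show "AE x in lborel. AE y in lborel. fst (x, y) \<noteq> (snd (x, y) :: real)" by simp
qed

text \<open>The pair \<open>p = (r, u)\<close> encodes the window (u, u + r], half open so that its
  mass is an increment of a distribution function. The positions \<open>u\<close> whose window
  contains both \<open>x\<close> and \<open>y\<close> have total length
  \<open>max 0 (r - \<bar>x - y\<bar>)\<close>.\<close>

definition window :: "real \<times> real \<Rightarrow> real \<Rightarrow> real" where
  "window p x = (if snd p < x \<and> x \<le> snd p + fst p then 1 else 0)"

lemma borel_measurable_window [measurable (raw)]:
  assumes [measurable]: "f \<in> measurable M (borel :: (real \<times> real) measure)" "g \<in> borel_measurable M"
  shows "(\<lambda>x. window (f x) (g x)) \<in> borel_measurable M"
proof -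
  have [measurable]: "(\<lambda>x. fst (f x)) \<in> borel_measurable M" "(\<lambda>x. snd (f x)) \<in> borel_measurable M"
    by (rule borel_measurable_continuous_on[OF _ assms(1)]; intro continuous_intros)+
  show ?thesis unfolding window_def by measurable
qed

lemma nn_integral_window:
  "(\<integral>\<^sup>+u. ennreal (window (r, u) x) * ennreal (window (r, u) y) \<partial>lborel) = ennreal (max 0 (r - \<bar>x - y\<bar>))"
proof -
  have "(\<integral>\<^sup>+u. ennreal (window (r, u) x) * ennreal (window (r, u) y) \<partial>lborel)
      = (\<integral>\<^sup>+u. indicator {max x y - r..<min x y} u \<partial>lborel)"
    by (intro nn_integral_cong) (auto simp: window_def indicator_def)
  also have "\<dots> = ennreal (max 0 (r - \<bar>x - y\<bar>))"
    by (auto simp: max_def min_def abs_if ennreal_neg)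
  finally show ?thesis .
qed

text \<open>Integrating out the position \<open>u\<close> turns the product of two windows into
  their overlap length \<open>max 0 (r - \<bar>x - y\<bar>)\<close>, and the weight
  \<open>1 / r\<^sup>2\<close> then rebuilds the truncated logarithm, pointwise off the
  diagonal.\<close>

lemma nn_integral_trunc_log_Tonelli:
  fixes f g :: "real \<Rightarrow> ennreal"
  assumes [measurable]: "f \<in> borel_measurable borel" "g \<in> borel_measurable borel"
  shows "(\<integral>\<^sup>+z. ennreal (trunc_log R (fst z - snd z)) * f (fst z) * g (snd z) \<partial>lborel)
    = (\<integral>\<^sup>+p. ennreal (indicator {0<..<R} (fst p) / (fst p)\<^sup>2) *
        ((\<integral>\<^sup>+x. ennreal (window p x) * f x \<partial>lborel) * (\<integral>\<^sup>+y. ennreal (window p y) * g y \<partial>lborel)) \<partial>lborel)"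
proof -
  define w where "w r = ennreal (indicator {0<..<R} r / r\<^sup>2)" for r :: real
  have [measurable]: "w \<in> borel_measurable borel" unfolding w_def by measurable
  have [measurable]: "fst \<in> borel_measurable (borel :: (real \<times> real) measure)"
     "snd \<in> borel_measurable (borel :: (real \<times> real) measure)"
    by (intro borel_measurable_continuous_onI continuous_intros)+
  have "(\<integral>\<^sup>+p. w (fst p) * ((\<integral>\<^sup>+x. ennreal (window p x) * f x \<partial>lborel) * (\<integral>\<^sup>+y. ennreal (window p y) * g y \<partial>lborel)) \<partial>lborel)
    = (\<integral>\<^sup>+p. (\<integral>\<^sup>+z. w (fst p) * (ennreal (window p (fst z)) * f (fst z) * (ennreal (window p (snd z)) * g (snd z))) \<partial>lborel) \<partial>lborel)"
  proof (rule nn_integral_cong)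
    fix p
    have "(\<integral>\<^sup>+z. w (fst p) * (ennreal (window p (fst z)) * f (fst z) * (ennreal (window p (snd z)) * g (snd z))) \<partial>lborel)
      = w (fst p) * (\<integral>\<^sup>+z. (ennreal (window p (fst z)) * f (fst z)) * (ennreal (window p (snd z)) * g (snd z)) \<partial>lborel2)"
      unfolding lborel_prod by (rule nn_integral_cmult) measurable
    also have "(\<integral>\<^sup>+z. (ennreal (window p (fst z)) * f (fst z)) * (ennreal (window p (snd z)) * g (snd z)) \<partial>lborel2)
      = (\<integral>\<^sup>+x. \<integral>\<^sup>+y. (ennreal (window p x) * f x) * (ennreal (window p y) * g y) \<partial>lborel \<partial>lborel)"
      by (subst lborel.nn_integral_fst[symmetric]) (simp_all add: lborel_prod)
    also have "\<dots> = (\<integral>\<^sup>+x. ennreal (window p x) * f x \<partial>lborel) * (\<integral>\<^sup>+y. ennreal (window p y) * g y \<partial>lborel)"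
      by (simp add: nn_integral_cmult nn_integral_multc)
    finally show "w (fst p) * ((\<integral>\<^sup>+x. ennreal (window p x) * f x \<partial>lborel) * (\<integral>\<^sup>+y. ennreal (window p y) * g y \<partial>lborel))
      = (\<integral>\<^sup>+z. w (fst p) * (ennreal (window p (fst z)) * f (fst z) * (ennreal (window p (snd z)) * g (snd z))) \<partial>lborel)"
      by simp
  qed
  also have "\<dots> = (\<integral>\<^sup>+z. (\<integral>\<^sup>+p. w (fst p) * (ennreal (window p (fst z)) * f (fst z) * (ennreal (window p (snd z)) * g (snd z))) \<partial>lborel) \<partial>lborel)"
    by (rule lborel_pair.Fubini'[symmetric]) measurable
  also have "\<dots> = (\<integral>\<^sup>+z. ennreal (trunc_log R (fst z - snd z)) * f (fst z) * g (snd z) \<partial>lborel)"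
  proof (rule nn_integral_cong_AE)
    note AE_off_diagonal
    then have "AE z in lborel. fst z \<noteq> (snd z :: real)" by (simp only: lborel_prod)
    then show "AE z in lborel. (\<integral>\<^sup>+p. w (fst p) * (ennreal (window p (fst z)) * f (fst z) * (ennreal (window p (snd z)) * g (snd z))) \<partial>lborel)
       = ennreal (trunc_log R (fst z - snd z)) * f (fst z) * g (snd z)"
    proof eventually_elim
      fix z :: "real \<times> real" assume ne: "fst z \<noteq> snd z"
      have "(\<integral>\<^sup>+p. w (fst p) * (ennreal (window p (fst z)) * f (fst z) * (ennreal (window p (snd z)) * g (snd z))) \<partial>lborel)
        = (\<integral>\<^sup>+p. (f (fst z) * g (snd z)) * (w (fst p) * (ennreal (window p (fst z)) * ennreal (window p (snd z)))) \<partial>lborel)"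
        by (intro nn_integral_cong) (simp add: mult_ac)
      also have "\<dots> = (f (fst z) * g (snd z)) * (\<integral>\<^sup>+p. (w (fst p) * (ennreal (window p (fst z)) * ennreal (window p (snd z)))) \<partial>lborel2)"
        unfolding lborel_prod by (rule nn_integral_cmult) measurable
      also have "(\<integral>\<^sup>+p. (w (fst p) * (ennreal (window p (fst z)) * ennreal (window p (snd z)))) \<partial>lborel2)
        = (\<integral>\<^sup>+r. \<integral>\<^sup>+u. (w r * (ennreal (window (r, u) (fst z)) * ennreal (window (r, u) (snd z)))) \<partial>lborel \<partial>lborel)"
        by (subst lborel.nn_integral_fst[symmetric]) (simp_all add: lborel_prod)
      also have "\<dots> = (\<integral>\<^sup>+r. w r * ennreal (max 0 (r - \<bar>fst z - snd z\<bar>)) \<partial>lborel)"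
        by (simp add: nn_integral_cmult nn_integral_window)
      also have "\<dots> = ennreal (trunc_log R (fst z - snd z))"
        unfolding w_def using ne by (intro nn_integral_trunc_log) simp
      finally show "(\<integral>\<^sup>+p. w (fst p) * (ennreal (window p (fst z)) * f (fst z) * (ennreal (window p (snd z)) * g (snd z))) \<partial>lborel)
       = ennreal (trunc_log R (fst z - snd z)) * f (fst z) * g (snd z)" by (simp add: mult_ac)
    qed
  qed
  finally show ?thesis unfolding w_def by simp
qed

definition imass :: "(real \<Rightarrow> real) \<Rightarrow> real \<Rightarrow> real \<Rightarrow> real" where
  "imass f u r = (LINT x:{u<..u + r}|lborel. f x)"

lemma nn_integral_window_imass:
  assumes "integrable lborel f" "\<And>x. 0 \<le> f x"
  shows "(\<integral>\<^sup>+x. ennreal (window p x) * ennreal (f x) \<partial>lborel) = ennreal (imass f (snd p) (fst p))"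
proof -
  have "(\<integral>\<^sup>+x. ennreal (window p x) * ennreal (f x) \<partial>lborel)
      = (\<integral>\<^sup>+x. ennreal (indicator {snd p<..snd p + fst p} x *\<^sub>R f x) \<partial>lborel)"
    by (intro nn_integral_cong) (auto simp: window_def indicator_def)
  also have "\<dots> = ennreal (imass f (snd p) (fst p))"
    unfolding imass_def set_lebesgue_integral_def
    using assms by (intro nn_integral_eq_integral integrable_mult_indicator) auto
  finally show ?thesis .
qed

lemma imass_nonneg: "(\<And>x. 0 \<le> f x) \<Longrightarrow> 0 \<le> imass f u r"
  unfolding imass_def set_lebesgue_integral_def by (intro integral_nonneg_AE) auto

lemma kform_trunc_log_eq:
  assumes "R > 0" "bdd_moment f" "bdd_moment g" "\<And>x. 0 \<le> f x" "\<And>x. 0 \<le> g x"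
  shows "ennreal (kform (trunc_log R) f g) = (\<integral>\<^sup>+p. ennreal (indicator {0<..<R} (fst p) / (fst p)\<^sup>2) *
        ennreal (imass f (snd p) (fst p) * imass g (snd p) (fst p)) \<partial>lborel)"
proof -
  have [measurable]: "f \<in> borel_measurable borel" "g \<in> borel_measurable borel"
    using assms by (auto simp: bdd_moment_def)
  have "ennreal (kform (trunc_log R) f g) = (\<integral>\<^sup>+z. ennreal (trunc_log R (fst z - snd z) * f (fst z) * g (snd z)) \<partial>lborel2)"
    unfolding kform_def using integrable_kform[OF log_kernel_trunc_log[OF assms(1)] assms(2,3)] trunc_log_nonneg assms(4,5)
    by (intro nn_integral_eq_integral[symmetric]) auto
  also have "\<dots> = (\<integral>\<^sup>+z. ennreal (trunc_log R (fst z - snd z)) * ennreal (f (fst z)) * ennreal (g (snd z)) \<partial>lborel)"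
    using assms(4,5) trunc_log_nonneg by (simp add: lborel_prod ennreal_mult'')
  also have "\<dots> = (\<integral>\<^sup>+p. ennreal (indicator {0<..<R} (fst p) / (fst p)\<^sup>2) *
        ennreal (imass f (snd p) (fst p) * imass g (snd p) (fst p)) \<partial>lborel)"
    using assms by (subst nn_integral_trunc_log_Tonelli)
      (simp_all add: nn_integral_window_imass bdd_momentD ennreal_mult'' imass_nonneg)
  finally show ?thesis .
qed

text \<open>The constant \<open>ln R - 1\<close> sees only the two total masses, and the error is
  governed by first moments divided by \<open>R\<close>, hence vanishes as \<open>R\<close>
  grows.\<close>

lemma kform_ln_approx:
  assumes R: "R > 0" and f: "bdd_moment f" and g: "bdd_moment g"
  shows "\<bar>kform (\<lambda>d. - ln \<bar>d\<bar>) f g - kform (trunc_log R) f g + (ln R - 1) * integral\<^sup>L lborel f * integral\<^sup>L lborel g\<bar>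
    \<le> kform abs (\<lambda>x. \<bar>f x\<bar>) (\<lambda>x. \<bar>g x\<bar>) / R"
proof -
  have [measurable]: "f \<in> borel_measurable borel" "g \<in> borel_measurable borel"
    using f g by (auto simp: bdd_moment_def)
  define e where "e d = - ln \<bar>d\<bar> - trunc_log R d + (ln R - 1)" for d
  have i1: "integrable lborel2 (\<lambda>z. (- ln \<bar>fst z - snd z\<bar>) * f (fst z) * g (snd z))"
    by (rule integrable_kform[OF log_kernel_ln f g])
  have i2: "integrable lborel2 (\<lambda>z. trunc_log R (fst z - snd z) * f (fst z) * g (snd z))"
    by (rule integrable_kform[OF log_kernel_trunc_log[OF R] f g])
  have i3: "integrable lborel2 (\<lambda>z. (ln R - 1) * f (fst z) * g (snd z))"
    by (rule integrable_kform[OF log_kernel_const f g])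
  have i4: "integrable lborel2 (\<lambda>z. \<bar>fst z - snd z\<bar> * \<bar>f (fst z)\<bar> * \<bar>g (snd z)\<bar>)"
    by (rule integrable_kform[OF log_kernel_abs bdd_moment_abs[OF f] bdd_moment_abs[OF g]])
  have eq: "kform (\<lambda>d. - ln \<bar>d\<bar>) f g - kform (trunc_log R) f g + (ln R - 1) * integral\<^sup>L lborel f * integral\<^sup>L lborel g
    = (LINT z|lborel2. e (fst z - snd z) * f (fst z) * g (snd z))"
    using Bochner_Integration.integral_add[OF Bochner_Integration.integrable_diff[OF i1 i2] i3]
      Bochner_Integration.integral_diff[OF i1 i2] kform_const[OF f g, of "ln R - 1"]
    by (simp add: kform_def e_def left_diff_distrib distrib_right)
  have "\<bar>\<dots>\<bar> \<le> (LINT z|lborel2. \<bar>fst z - snd z\<bar> * \<bar>f (fst z)\<bar> * \<bar>g (snd z)\<bar> / R)"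
  proof (rule order_trans[OF integral_abs_bound], rule integral_mono_AE')
    show "integrable lborel2 (\<lambda>z. \<bar>fst z - snd z\<bar> * \<bar>f (fst z)\<bar> * \<bar>g (snd z)\<bar> / R)"
      using i4 by simp
    note AE_off_diagonal
    then show "AE z in lborel2. \<bar>e (fst z - snd z) * f (fst z) * g (snd z)\<bar>
        \<le> \<bar>fst z - snd z\<bar> * \<bar>f (fst z)\<bar> * \<bar>g (snd z)\<bar> / R"
    proof eventually_elim
      case (elim z)
      then have "\<bar>e (fst z - snd z)\<bar> \<le> \<bar>fst z - snd z\<bar> / R"
        unfolding e_def by (intro trunc_log_approx R) simp
      from mult_right_mono[OF this, of "\<bar>f (fst z)\<bar> * \<bar>g (snd z)\<bar>"]
      show ?case by (simp add: abs_mult mult.assoc)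
    qed
  qed (use R in auto)
  then show ?thesis unfolding eq by (simp add: kform_def)
qed

text \<open>The slicing \<open>kform_trunc_log_eq\<close> of the truncated kernel reduces inequalities between
  logarithmic energies to inequalities between products of interval masses.\<close>
lemma kform_ln_compare:
  assumes m: "bdd_moment f0" "bdd_moment g0" "bdd_moment f1" "bdd_moment g1"
      "bdd_moment f2" "bdd_moment g2" "bdd_moment f3" "bdd_moment g3"
    and nn: "\<And>x. 0 \<le> f0 x" "\<And>x. 0 \<le> g0 x" "\<And>x. 0 \<le> f1 x" "\<And>x. 0 \<le> g1 x"
      "\<And>x. 0 \<le> f2 x" "\<And>x. 0 \<le> g2 x" "\<And>x. 0 \<le> f3 x" "\<And>x. 0 \<le> g3 x"
    and le: "\<And>u r. 0 < r \<Longrightarrow> imass f0 u r * imass g0 u r + imass f1 u r * imass g1 u r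
      \<le> imass f2 u r * imass g2 u r + imass f3 u r * imass g3 u r"
    and mass: "integral\<^sup>L lborel f0 * integral\<^sup>L lborel g0 + integral\<^sup>L lborel f1 * integral\<^sup>L lborel g1
      = integral\<^sup>L lborel f2 * integral\<^sup>L lborel g2 + integral\<^sup>L lborel f3 * integral\<^sup>L lborel g3"
  shows "kform (\<lambda>d. - ln \<bar>d\<bar>) f0 g0 + kform (\<lambda>d. - ln \<bar>d\<bar>) f1 g1
    \<le> kform (\<lambda>d. - ln \<bar>d\<bar>) f2 g2 + kform (\<lambda>d. - ln \<bar>d\<bar>) f3 g3"
proof -
  define K where "K = kform (\<lambda>d. - ln \<bar>d\<bar>)"
  define A where "A f g = kform abs (\<lambda>x. \<bar>f x\<bar>) (\<lambda>x. \<bar>g x\<bar>)" for f g :: "real \<Rightarrow> real"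
  define M where "M = A f0 g0 + A f1 g1 + A f2 g2 + A f3 g3"
  define I where "I f = integral\<^sup>L lborel f" for f :: "real \<Rightarrow> real"
  have slice: "kform (trunc_log R) f0 g0 + kform (trunc_log R) f1 g1 \<le> kform (trunc_log R) f2 g2 + kform (trunc_log R) f3 g3" if R: "R > 0" for R
  proof -
    have nonneg: "0 \<le> kform (trunc_log R) f g" if "\<And>x. 0 \<le> f x" "\<And>x. 0 \<le> g x" for f g
      unfolding kform_def using that trunc_log_nonneg by (intro integral_nonneg_AE) auto
    define T where "T f g p = ennreal (indicator {0<..<R} (fst p) / (fst p)\<^sup>2) * ennreal (imass f (snd p) (fst p) * imass g (snd p) (fst p))"
      for f g :: "real \<Rightarrow> real" and p :: "real \<times> real"
    have meas: "T f g \<in> borel_measurable lborel"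
      if "bdd_moment f" "bdd_moment g" "\<And>x. 0 \<le> f x" "\<And>x. 0 \<le> g x" for f g
    proof -
      have [measurable]: "f \<in> borel_measurable borel" "g \<in> borel_measurable borel"
        using that by (auto simp: bdd_moment_def)
      have [measurable]: "fst \<in> borel_measurable (borel :: (real \<times> real) measure)"
        by (intro borel_measurable_continuous_onI continuous_intros)
      \<comment> \<open>Joint measurability in the window is read off the window integrals, to which
        the products of \<open>imass\<close> are equal.\<close>
      have "(\<lambda>p. ennreal (indicator {0<..<R} (fst p) / (fst p)\<^sup>2) *
        ((\<integral>\<^sup>+x. ennreal (window p x) * ennreal (f x) \<partial>lborel) * (\<integral>\<^sup>+y. ennreal (window p y) * ennreal (g y) \<partial>lborel))) \<in> borel_measurable lborel"
        by measurable
      then show ?thesis unfolding T_def using that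
        by (simp add: nn_integral_window_imass bdd_momentD ennreal_mult'' imass_nonneg)
    qed
    have kT: "ennreal (kform (trunc_log R) f g + kform (trunc_log R) f' g') = (\<integral>\<^sup>+p. T f g p + T f' g' p \<partial>lborel)"
      if "bdd_moment f" "bdd_moment g" "\<And>x. 0 \<le> f x" "\<And>x. 0 \<le> g x"
        "bdd_moment f'" "bdd_moment g'" "\<And>x. 0 \<le> f' x" "\<And>x. 0 \<le> g' x" for f g f' g'
    proof -
      have "ennreal (kform (trunc_log R) f g + kform (trunc_log R) f' g') = integral\<^sup>N lborel (T f g) + integral\<^sup>N lborel (T f' g')"
        unfolding T_def by (simp add: nonneg that ennreal_plus kform_trunc_log_eq[OF R])
      also have "\<dots> = (\<integral>\<^sup>+p. T f g p + T f' g' p \<partial>lborel)"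
        by (rule nn_integral_add[symmetric]; rule meas; fact that)
      finally show ?thesis .
    qed
    have "T f0 g0 p + T f1 g1 p \<le> T f2 g2 p + T f3 g3 p" for p
    proof (cases "0 < fst p")
      case True
      show ?thesis unfolding T_def distrib_left[symmetric]
        using le[OF True, of "snd p"] nn
        by (intro mult_left_mono) (auto simp: imass_nonneg ennreal_leI simp flip: ennreal_plus)
    qed (simp add: T_def)
    then have "ennreal (kform (trunc_log R) f0 g0 + kform (trunc_log R) f1 g1) \<le> ennreal (kform (trunc_log R) f2 g2 + kform (trunc_log R) f3 g3)"
      by (subst (1 2) kT) (auto simp: m nn intro!: nn_integral_mono)
    then show ?thesis by (rule ennreal_le_iff[THEN iffD1, rotated]) (auto simp: nn nonneg)
  qed
  have approx: "\<bar>K f g - kform (trunc_log R) f g + (ln R - 1) * (I f * I g)\<bar> \<le> A f g / R"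
    if "R > 0" "bdd_moment f" "bdd_moment g" for R f g
    using kform_ln_approx[OF that] by (simp add: K_def A_def I_def mult.assoc)
  define D where "D = K f0 g0 + K f1 g1 - (K f2 g2 + K f3 g3)"
  \<comment> \<open>By the mass hypothesis the contributions of \<open>ln R - 1\<close>, which would
    blow up, cancel exactly; only errors of order \<open>1 / R\<close> remain.\<close>
  have "D \<le> M / R" if R: "R > 0" for R
  proof -
    have "(ln R - 1) * (I f0 * I g0) + (ln R - 1) * (I f1 * I g1) = (ln R - 1) * (I f2 * I g2) + (ln R - 1) * (I f3 * I g3)"
      using mass by (simp add: I_def flip: distrib_left)
    then show ?thesis
      using slice[OF R] approx[OF R m(1,2)] approx[OF R m(3,4)] approx[OF R m(5,6)] approx[OF R m(7,8)]
      unfolding D_def M_def add_divide_distrib by linarith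
  qed
  then have "\<forall>\<^sub>F R in at_top. D \<le> M / R" 
    by (intro eventually_mono[OF eventually_gt_at_top[of 0]])
  moreover have "((\<lambda>R. M / R) \<longlongrightarrow> 0) at_top" by real_asymp
  ultimately have "D \<le> 0" by (intro tendsto_lowerbound) auto
  then show ?thesis by (simp add: D_def K_def)
qed

text \<open>Conditional positive definiteness of the logarithm: each window contributes the square
  of the difference of the two masses. Equality of the total masses is what removes the divergent
  constant.\<close>

lemma kform_ln_nonneg:
  assumes f: "bdd_moment f" "\<And>x. 0 \<le> f x" and g: "bdd_moment g" "\<And>x. 0 \<le> g x"
    and "integral\<^sup>L lborel f = integral\<^sup>L lborel g"
  shows "0 \<le> kform (\<lambda>d. - ln \<bar>d\<bar>) (\<lambda>x. f x - g x) (\<lambda>x. f x - g x)"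
proof -
  define K where "K = kform (\<lambda>d. - ln \<bar>d\<bar>)"
  have "K f g + K g f \<le> K f f + K g g" unfolding K_def
  proof (rule kform_ln_compare)
    fix u r
    have "0 \<le> (imass f u r - imass g u r)\<^sup>2" by simp
    then show "imass f u r * imass g u r + imass g u r * imass f u r \<le> imass f u r * imass f u r + imass g u r * imass g u r"
      by (simp add: power2_eq_square algebra_simps)
  qed (use assms in auto)
  moreover have "K (\<lambda>x. f x - g x) (\<lambda>x. f x - g x) = K f f - K f g - K g f + K g g"
    unfolding K_def using f g
    by (simp add: kform_diff_left kform_diff_right bdd_moment_diff log_kernel_ln)
  ultimately show ?thesis by (simp add: K_def)
qed

section \<open>The variational problem\<close>

text \<open>The representatives, normalised to vanish on the negative half-line, with finite first moment;
  all other admissible densities have infinite energy.\<close>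
definition dens :: "(real \<Rightarrow> real) set" where
  "dens = {\<phi>. \<phi> \<in> borel_measurable borel \<and> (\<forall>x. 0 \<le> \<phi> x \<and> \<phi> x \<le> 1) \<and> (\<forall>x<0. \<phi> x = 0) \<and>
     integrable lborel \<phi> \<and> integral\<^sup>L lborel \<phi> = 1 \<and> integrable lborel (\<lambda>x. x * \<phi> x)}"

lemma densD:
  assumes "\<phi> \<in> dens"
  shows "\<phi> \<in> borel_measurable borel" "0 \<le> \<phi> x" "\<phi> x \<le> 1" "x < 0 \<Longrightarrow> \<phi> x = 0"
    "integrable lborel \<phi>" "integral\<^sup>L lborel \<phi> = 1" "integrable lborel (\<lambda>x. x * \<phi> x)" "bdd_moment \<phi>"
  using assms by (auto simp: dens_def bdd_moment_def abs_le_iff intro!: exI[of _ 1] order_trans[of "- _" 0])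

text \<open>The term \<open>2 * ln (1 + x)\<close> absorbs the logarithm because
  \<open>\<bar>x - y\<bar> \<le> (1 + x) * (1 + y)\<close>; the surplus
  \<open>\<epsilon> * x\<close> turns finite energy into a finite first moment. The linear upper
  bound keeps the potential integrable against \<open>dens\<close>.\<close>

definition tame :: "(real \<Rightarrow> real) \<Rightarrow> bool" where
  "tame V \<longleftrightarrow> V \<in> borel_measurable borel \<and>
     (\<exists>\<epsilon>>0. \<exists>C. \<forall>x\<ge>0. 2 * ln (1 + x) + \<epsilon> * x - C \<le> V x) \<and> (\<exists>C. \<forall>x\<ge>0. V x \<le> C * (1 + x))"

lemma tame_measurable: "tame V \<Longrightarrow> V \<in> borel_measurable borel"
  by (simp add: tame_def)

lemma tame_abs_bound:
  assumes "tame V"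
  obtains C where "\<And>x. x \<ge> 0 \<Longrightarrow> \<bar>V x\<bar> \<le> C * (1 + x)"
proof -
  obtain e C where e: "e > 0" and C: "\<And>x. x \<ge> 0 \<Longrightarrow> 2 * ln (1 + x) + e * x - C \<le> V x"
    using assms by (auto simp: tame_def)
  obtain D where D: "\<And>x. x \<ge> 0 \<Longrightarrow> V x \<le> D * (1 + x)" using assms by (auto simp: tame_def)
  have "\<bar>V x\<bar> \<le> (\<bar>C\<bar> + \<bar>D\<bar>) * (1 + x)" if x: "x \<ge> 0" for x
  proof -
    have "0 \<le> ln (1 + x)" "0 \<le> e * x" using x e by auto
    then have "- V x \<le> \<bar>C\<bar> * 1" using C[OF x] by linarith
    also have "\<dots> \<le> (\<bar>C\<bar> + \<bar>D\<bar>) * (1 + x)" using x by (intro mult_mono) auto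
    finally have "- V x \<le> (\<bar>C\<bar> + \<bar>D\<bar>) * (1 + x)" .
    moreover have "D * (1 + x) \<le> (\<bar>C\<bar> + \<bar>D\<bar>) * (1 + x)" using x by (intro mult_right_mono) auto
    ultimately show ?thesis using D[OF x] by linarith
  qed
  then show ?thesis using that by blast
qed

lemma integrable_tame:
  assumes V: "tame V" and f: "bdd_moment f" and f0: "\<And>x. x < 0 \<Longrightarrow> f x = 0"
  shows "integrable lborel (\<lambda>x. V x * f x)"
proof -
  obtain C where C: "\<And>x. x \<ge> 0 \<Longrightarrow> \<bar>V x\<bar> \<le> C * (1 + x)" using tame_abs_bound[OF V] by blast
  have [measurable]: "V \<in> borel_measurable borel" "f \<in> borel_measurable borel"
    using tame_measurable[OF V] bdd_momentD[OF f] by auto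
  show ?thesis
  proof (rule Bochner_Integration.integrable_bound)
    show "integrable lborel (\<lambda>x. C * (\<bar>f x\<bar> + \<bar>x * f x\<bar>))" using bdd_momentD[OF f] by auto
    show "AE x in lborel. norm (V x * f x) \<le> norm (C * (\<bar>f x\<bar> + \<bar>x * f x\<bar>))"
    proof (rule AE_I2)
      fix x
      show "norm (V x * f x) \<le> norm (C * (\<bar>f x\<bar> + \<bar>x * f x\<bar>))"
      proof (cases "x < 0")
        case False
        then have "\<bar>V x\<bar> * \<bar>f x\<bar> \<le> C * (1 + x) * \<bar>f x\<bar>" by (intro mult_right_mono C) auto
        also have "\<dots> = C * (\<bar>f x\<bar> + \<bar>x * f x\<bar>)" using False by (simp add: abs_mult algebra_simps)
        finally show ?thesis unfolding real_norm_def abs_mult[of "V x"] by linarith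
      qed (simp add: f0)
    qed
  qed simp
qed

definition log_energy :: "(real \<Rightarrow> real) \<Rightarrow> (real \<Rightarrow> real) \<Rightarrow> real" where
  "log_energy = kform (\<lambda>d. - ln \<bar>d\<bar>)"

definition weighted_energy :: "(real \<Rightarrow> real) \<Rightarrow> (real \<Rightarrow> real) \<Rightarrow> real" where
  "weighted_energy V \<phi> = log_energy \<phi> \<phi> + (LINT x|lborel. V x * \<phi> x)"

section \<open>From extended-real energies of measures to real energies of densities\<close>

lemma integral_energy_kernel:
  assumes V: "tame V" and \<phi>: "\<phi> \<in> dens"
  shows "integrable lborel2 (\<lambda>z. energy_kernel V z * (\<phi> (fst z) * \<phi> (snd z)))" (is ?I)
    and "(LINT z|lborel2. energy_kernel V z * (\<phi> (fst z) * \<phi> (snd z))) = weighted_energy V \<phi>" (is ?E)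
proof -
  note d = densD[OF \<phi>]
  have i: "integrable lborel (\<lambda>x. V x / 2 * \<phi> x)"
    using integrable_tame[OF V d(8) d(4)] integrable_mult_right[of "1/2" lborel "\<lambda>x. V x * \<phi> x"] by simp
  note i1 = integrable_kform[OF log_kernel_ln d(8) d(8)]
  note i2 = integrable_pair_mult[OF i d(5)] and i3 = integrable_pair_mult[OF d(5) i]
  have eq: "(\<lambda>z. energy_kernel V z * (\<phi> (fst z) * \<phi> (snd z))) = (\<lambda>z. - ln \<bar>fst z - snd z\<bar> * \<phi> (fst z) * \<phi> (snd z)
      + V (fst z) / 2 * \<phi> (fst z) * \<phi> (snd z) + \<phi> (fst z) * (V (snd z) / 2 * \<phi> (snd z)))"
    by (auto simp: energy_kernel_def algebra_simps)
  show ?I unfolding eq by (intro Bochner_Integration.integrable_add i1 i2(1) i3(1))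
  have h: "(LINT x|lborel. V x / 2 * \<phi> x) = (LINT x|lborel. V x * \<phi> x) / 2"
    using integral_mult_right_zero[of lborel "1/2" "\<lambda>x. V x * \<phi> x"] by simp
  show ?E
    unfolding eq Bochner_Integration.integral_add[OF Bochner_Integration.integrable_add[OF i1 i2(1)] i3(1)]
      Bochner_Integration.integral_add[OF i1 i2(1)] i2(2) i3(2) d(6) h weighted_energy_def log_energy_def kform_def
    by simp
qed

lemma energy_kernel_lower_bound:
  assumes "tame V"
  obtains \<epsilon> C where "\<epsilon> > 0" "\<And>x y. x \<ge> 0 \<Longrightarrow> y \<ge> 0 \<Longrightarrow> x \<noteq> y \<Longrightarrow> energy_kernel V (x, y) \<ge> \<epsilon> * x + \<epsilon> * y - C"
proof -
  obtain e C where e: "e > 0" and C: "\<And>x. x \<ge> 0 \<Longrightarrow> 2 * ln (1 + x) + e * x - C \<le> V x"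
    using assms by (auto simp: tame_def)
  have "energy_kernel V (x, y) \<ge> e / 2 * x + e / 2 * y - C" if xy: "x \<ge> 0" "y \<ge> 0" "x \<noteq> y" for x y
  proof -
    have "\<bar>x - y\<bar> \<le> (1 + x) * (1 + y)" using xy by (auto simp: abs_if algebra_simps add_nonneg_nonneg intro: add_increasing)
    then have "ln \<bar>x - y\<bar> \<le> ln ((1 + x) * (1 + y))" using xy by (intro ln_mono) auto
    also have "\<dots> = ln (1 + x) + ln (1 + y)" using xy by (simp add: ln_mult)
    finally show ?thesis using C[OF xy(1)] C[OF xy(2)] by (simp add: energy_kernel_def)
  qed
  then show ?thesis using that[of "e / 2" C] e by auto
qed

lemma borel_measurable_energy_kernel:
  assumes [measurable]: "V \<in> borel_measurable borel"
  shows "energy_kernel V \<in> borel_measurable lborel2"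
  unfolding energy_kernel_def by measurable

lemma nn_integral_density_measure_pair:
  assumes [measurable]: "\<phi> \<in> borel_measurable borel" and \<phi>0: "\<And>x. 0 \<le> \<phi> x" "\<And>x. x < 0 \<Longrightarrow> \<phi> x = 0"
    and int: "integrable lborel \<phi>"
    and [measurable]: "k \<in> borel_measurable lborel2"
  shows "(\<integral>\<^sup>+z\<in>{z. fst z \<noteq> snd z}. k z \<partial>(density_measure \<phi> \<Otimes>\<^sub>M density_measure \<phi>))
    = (\<integral>\<^sup>+z. ennreal (\<phi> (fst z) * \<phi> (snd z)) * k z \<partial>lborel2)"
proof -
  have eq: "(\<lambda>x. ennreal (indicator {0..} x * \<phi> x)) = (\<lambda>x. ennreal (\<phi> x))"
    using \<phi>0(2) by (auto simp: indicator_def fun_eq_iff)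
  have fin: "(\<integral>\<^sup>+x. ennreal (\<phi> x) \<partial>lborel) < \<infinity>"
    using integrableD(2)[OF int] \<phi>0 by (simp add: top.not_eq_extremum)
  then have "finite_measure (density lborel (\<lambda>x. ennreal (\<phi> x)))"
    by (intro finite_measureI) (simp add: emeasure_density)
  then have "sigma_finite_measure (density lborel (\<lambda>x. ennreal (\<phi> x)))"
    by (rule finite_measure.axioms(1))
  then have dm: "density_measure \<phi> \<Otimes>\<^sub>M density_measure \<phi>
      = density lborel2 (\<lambda>(x, y). ennreal (\<phi> x) * ennreal (\<phi> y))"
    unfolding density_measure_def eq
    by (intro pair_measure_density lborel.sigma_finite_measure_axioms) simp_all
  show ?thesis unfolding dm
  proof (subst nn_integral_density)
    show "(\<integral>\<^sup>+z. (case z of (x, y) \<Rightarrow> ennreal (\<phi> x) * ennreal (\<phi> y)) * (k z * indicator {z. fst z \<noteq> snd z} z) \<partial>lborel2)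
      = (\<integral>\<^sup>+z. ennreal (\<phi> (fst z) * \<phi> (snd z)) * k z \<partial>lborel2)"
    proof (rule nn_integral_cong_AE)
      show "AE z in lborel2. (case z of (x, y) \<Rightarrow> ennreal (\<phi> x) * ennreal (\<phi> y)) * (k z * indicator {z. fst z \<noteq> snd z} z)
          = ennreal (\<phi> (fst z) * \<phi> (snd z)) * k z"
        using AE_off_diagonal by eventually_elim (auto simp: case_prod_beta' ennreal_mult'' \<phi>0)
    qed
    have "(\<lambda>z. k z * indicator {z \<in> space lborel2. fst z \<noteq> (snd z :: real)} z) \<in> borel_measurable lborel2"
      by measurable
    then show "(\<lambda>z. k z * indicator {z. fst z \<noteq> snd z} z) \<in> borel_measurable lborel2"
      by (simp add: space_pair_measure)
  qed simp_all
qed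

lemma energy_dens:
  assumes V: "tame V" and \<phi>: "\<phi> \<in> dens"
  shows "energy V (density_measure \<phi>) = ereal (weighted_energy V \<phi>)"
proof -
  note d = densD[OF \<phi>]
  have [measurable]: "energy_kernel V \<in> borel_measurable lborel2"
    by (intro borel_measurable_energy_kernel tame_measurable V)
  define f where "f z = energy_kernel V z * (\<phi> (fst z) * \<phi> (snd z))" for z
  have f: "integrable lborel2 f" "integral\<^sup>L lborel2 f = weighted_energy V \<phi>"
    unfolding f_def[abs_def] by (rule integral_energy_kernel[OF V \<phi>])+
  have p: "(\<integral>\<^sup>+z\<in>{z. fst z \<noteq> snd z}. ennreal (energy_kernel V z) \<partial>(density_measure \<phi> \<Otimes>\<^sub>M density_measure \<phi>))
      = (\<integral>\<^sup>+z. ennreal (f z) \<partial>lborel2)"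
    using d by (subst nn_integral_density_measure_pair) (auto simp: f_def ennreal_mult'' mult_ac)
  have "ennreal (\<phi> (fst z) * \<phi> (snd z)) * ennreal (- energy_kernel V z) = ennreal (- f z)" for z
    using d(2) by (subst ennreal_mult'[symmetric]) (auto simp: f_def algebra_simps)
  then have n: "(\<integral>\<^sup>+z\<in>{z. fst z \<noteq> snd z}. ennreal (- energy_kernel V z) \<partial>(density_measure \<phi> \<Otimes>\<^sub>M density_measure \<phi>))
      = (\<integral>\<^sup>+z. ennreal (- f z) \<partial>lborel2)"
    using d by (subst nn_integral_density_measure_pair) auto
  have fin: "(\<integral>\<^sup>+z. ennreal (f z) \<partial>lborel2) \<noteq> \<infinity>" "(\<integral>\<^sup>+z. ennreal (- f z) \<partial>lborel2) \<noteq> \<infinity>"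
    using f(1) by (auto simp: real_integrable_def)
  have e: "enn2ereal x = ereal (enn2real x)" if "x \<noteq> \<infinity>" for x
    using that by (cases x rule: ennreal_cases) auto
  show ?thesis unfolding energy_def p n e[OF fin(1)] e[OF fin(2)]
    using f(2) unfolding real_lebesgue_integral_def[OF f(1)] by simp
qed

lemma dens_subset_admissible: "dens \<subseteq> admissible_densities"
proof
  fix \<phi> assume "\<phi> \<in> dens"
  note d = densD[OF this]
  have "(\<lambda>x. indicator {0..} x *\<^sub>R \<phi> x) = \<phi>"
    using d(4) by (auto simp: indicator_def fun_eq_iff)
  then show "\<phi> \<in> admissible_densities"
    using d by (simp add: admissible_densities_def set_integrable_def set_lebesgue_integral_def)
qed

text \<open>The kernel is at least \<open>\<epsilon> * x + \<epsilon> * y - C\<close> on the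
  half-line, so its negative part has a finite integral, while a finite integral of the positive
  part would bound the first moment. The element of \<open>dens\<close> comes from clipping the
  representative to [0, 1] and setting it to 0 on the negative half-line.\<close>

lemma admissible_energy_cases:
  assumes V: "tame V" and \<phi>: "\<phi> \<in> admissible_densities"
  shows "energy V (density_measure \<phi>) = \<infinity> \<or> (\<exists>\<psi>\<in>dens. density_measure \<psi> = density_measure \<phi>)"
proof -
  have i\<phi>: "integrable lborel (\<lambda>x. indicator {0..} x * \<phi> x)" and ae: "AE x in lborel. x \<ge> 0 \<longrightarrow> 0 \<le> \<phi> x \<and> \<phi> x \<le> 1"
    and one: "(LINT x|lborel. indicator {0..} x * \<phi> x) = 1"
    using \<phi> by (auto simp: admissible_densities_def set_integrable_def set_lebesgue_integral_def)
  have [measurable]: "(\<lambda>x. indicator {0..} x * \<phi> x) \<in> borel_measurable borel"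
    using borel_measurable_integrable[OF i\<phi>] by simp
  define \<psi> where "\<psi> x = min 1 (max 0 (indicator {0..} x * \<phi> x))" for x
  have [measurable]: "\<psi> \<in> borel_measurable borel" unfolding \<psi>_def by measurable
  have ae2: "AE x in lborel. \<psi> x = indicator {0..} x * \<phi> x"
    using ae by eventually_elim (auto simp: \<psi>_def indicator_def)
  have \<psi>: "0 \<le> \<psi> x" "\<psi> x \<le> 1" "x < 0 \<Longrightarrow> \<psi> x = 0" for x
    by (auto simp: \<psi>_def)
  have ii: "integrable lborel \<psi>" "integral\<^sup>L lborel \<psi> = 1"
    using i\<phi> one integrable_cong_AE[OF _ _ ae2] integral_cong_AE[OF _ _ ae2] by auto
  have ind: "indicator {0..} x * \<psi> x = \<psi> x" for x using \<psi>(3)[of x] by (auto simp: indicator_def)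
  have dm: "density_measure \<psi> = density_measure \<phi>"
    unfolding density_measure_def ind by (rule density_cong) (use ae2 in auto)
  show ?thesis
  proof (cases "integrable lborel (\<lambda>x. x * \<psi> x)")
    case True
    then have "\<psi> \<in> dens" using \<psi> ii by (simp add: dens_def)
    then show ?thesis using dm by blast
  next
    case False
    obtain e C where e: "e > 0"
      and C: "\<And>x y. x \<ge> 0 \<Longrightarrow> y \<ge> 0 \<Longrightarrow> x \<noteq> y \<Longrightarrow> energy_kernel V (x, y) \<ge> e * x + e * y - C"
      using energy_kernel_lower_bound[OF V] by metis
    have [measurable]: "energy_kernel V \<in> borel_measurable lborel2"
      by (intro borel_measurable_energy_kernel tame_measurable V)
    define P N where "P = (\<integral>\<^sup>+z. ennreal (\<psi> (fst z) * \<psi> (snd z)) * ennreal (energy_kernel V z) \<partial>lborel2)"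
      and "N = (\<integral>\<^sup>+z. ennreal (\<psi> (fst z) * \<psi> (snd z)) * ennreal (- energy_kernel V z) \<partial>lborel2)"
    have en: "energy V (density_measure \<phi>) = enn2ereal P - enn2ereal N"
      unfolding energy_def dm[symmetric] P_def N_def using \<psi> ii
      by (simp add: nn_integral_density_measure_pair)
    have one': "(\<integral>\<^sup>+x. ennreal (\<psi> x) \<partial>lborel) = 1"
      using ii \<psi> by (simp add: nn_integral_eq_integral)
    have oneone: "(\<integral>\<^sup>+z. ennreal (\<psi> (fst z) * \<psi> (snd z)) \<partial>lborel2) = 1"
      by (subst lborel.nn_integral_fst[symmetric]) (simp_all add: \<psi> ennreal_mult'' nn_integral_cmult one')
    have N: "N \<le> ennreal \<bar>C\<bar>"
    proof -
      have "N \<le> (\<integral>\<^sup>+z. ennreal \<bar>C\<bar> * ennreal (\<psi> (fst z) * \<psi> (snd z)) \<partial>lborel2)"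
        unfolding N_def
      proof (rule nn_integral_mono_AE)
        show "AE z in lborel2. ennreal (\<psi> (fst z) * \<psi> (snd z)) * ennreal (- energy_kernel V z)
            \<le> ennreal \<bar>C\<bar> * ennreal (\<psi> (fst z) * \<psi> (snd z))"
          using AE_off_diagonal
        proof eventually_elim
          case (elim z)
          show ?case
          proof (cases "fst z \<ge> 0 \<and> snd z \<ge> 0")
            case True
            then have "e * fst z + e * snd z - C \<le> energy_kernel V z" using C[of "fst z" "snd z"] elim by simp
            moreover have "0 \<le> e * fst z" "0 \<le> e * snd z" using True e by auto
            ultimately have "- energy_kernel V z \<le> \<bar>C\<bar>" by linarith
            then show ?thesis by (subst mult.commute) (intro mult_right_mono ennreal_leI, auto)
          next
            case False
            then have "\<psi> (fst z) * \<psi> (snd z) = 0" using \<psi>(3) by (auto simp: not_le)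
            then show ?thesis by auto
          qed
        qed
      qed
      also have "\<dots> = ennreal \<bar>C\<bar>" by (subst nn_integral_cmult) (simp_all add: oneone)
      finally show ?thesis .
    qed
    have P: "P = \<infinity>"
    proof (rule ccontr)
      assume "P \<noteq> \<infinity>"
      have "(\<integral>\<^sup>+x. ennreal (e * x * \<psi> x) \<partial>lborel) = (\<integral>\<^sup>+z. ennreal (e * fst z * \<psi> (fst z)) * ennreal (\<psi> (snd z)) \<partial>lborel2)"
        by (subst lborel.nn_integral_fst[symmetric]) (simp_all add: nn_integral_cmult one')
      also have "\<dots> \<le> (\<integral>\<^sup>+z. ennreal (\<psi> (fst z) * \<psi> (snd z)) * ennreal (energy_kernel V z)
          + ennreal \<bar>C\<bar> * ennreal (\<psi> (fst z) * \<psi> (snd z)) \<partial>lborel2)"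
      proof (rule nn_integral_mono_AE)
        show "AE z in lborel2. ennreal (e * fst z * \<psi> (fst z)) * ennreal (\<psi> (snd z))
            \<le> ennreal (\<psi> (fst z) * \<psi> (snd z)) * ennreal (energy_kernel V z) + ennreal \<bar>C\<bar> * ennreal (\<psi> (fst z) * \<psi> (snd z))"
          using AE_off_diagonal
        proof eventually_elim
          case (elim z)
          show ?case
          proof (cases "fst z \<ge> 0 \<and> snd z \<ge> 0")
            case True
            then have "e * fst z + e * snd z - C \<le> energy_kernel V z" using C[of "fst z" "snd z"] elim by simp
            moreover have "0 \<le> e * snd z" "0 \<le> e * fst z" using True e by auto
            ultimately have "e * fst z \<le> max 0 (energy_kernel V z) + \<bar>C\<bar>" by linarith
            then have "ennreal (e * fst z) \<le> ennreal (max 0 (energy_kernel V z) + \<bar>C\<bar>)"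
              by (rule ennreal_leI)
            then have "ennreal (e * fst z) \<le> ennreal (max 0 (energy_kernel V z)) + ennreal \<bar>C\<bar>"
              by (simp only: ennreal_plus max.cobounded1 abs_ge_zero)
            then have "ennreal (\<psi> (fst z) * \<psi> (snd z)) * ennreal (e * fst z)
                \<le> ennreal (\<psi> (fst z) * \<psi> (snd z)) * (ennreal (energy_kernel V z) + ennreal \<bar>C\<bar>)"
              by (intro mult_left_mono) (auto simp: max_def ennreal_neg split: if_splits)
            then show ?thesis
              using \<psi> ennreal_mult''[of "\<psi> (fst z)" "e * fst z"]
              by (simp add: distrib_left ennreal_mult'' mult_ac)
          next
            case False
            then have "\<psi> (fst z) * \<psi> (snd z) = 0" using \<psi>(3) by (auto simp: not_le)
            then have "e * fst z * \<psi> (fst z) = 0 \<or> \<psi> (snd z) = 0" by auto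
            then show ?thesis by auto
          qed
        qed
      qed
      also have "\<dots> = P + ennreal \<bar>C\<bar>"
        unfolding P_def by (subst nn_integral_add) (simp_all add: nn_integral_cmult oneone)
      also have "\<dots> < \<infinity>" using \<open>P \<noteq> \<infinity>\<close> by (simp add: top.not_eq_extremum)
      finally have fin: "(\<integral>\<^sup>+x. ennreal (e * x * \<psi> x) \<partial>lborel) < \<infinity>" .
      have "0 \<le> e * x * \<psi> x" for x using e \<psi>[of x] by (cases "x < 0") auto
      then have "integrable lborel (\<lambda>x. e * x * \<psi> x)" using fin by (intro integrableI_nonneg) auto
      from integrable_mult_right[OF this, of "1 / e"] show False using False e by simp
    qed
    have "enn2ereal N \<noteq> \<infinity>" using N by (cases N rule: ennreal_cases) (auto simp: top_unique)
    then have "energy V (density_measure \<phi>) = \<infinity>"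
      unfolding en P by (cases N rule: ennreal_cases) auto
    then show ?thesis ..
  qed
qed

lemma weighted_energy_bdd_below:
  assumes V: "tame V"
  shows "bdd_below (weighted_energy V ` dens)"
proof -
  obtain e C where e: "e > 0"
    and C: "\<And>x y. x \<ge> 0 \<Longrightarrow> y \<ge> 0 \<Longrightarrow> x \<noteq> y \<Longrightarrow> energy_kernel V (x, y) \<ge> e * x + e * y - C"
    using energy_kernel_lower_bound[OF V] by metis
  have "- C \<le> weighted_energy V \<phi>" if \<phi>: "\<phi> \<in> dens" for \<phi>
  proof -
    note d = densD[OF \<phi>]
    have "- C = (LINT z|lborel2. - C * (\<phi> (fst z) * \<phi> (snd z)))"
      using integrable_pair_mult(2)[OF d(5) d(5)] d(6) by simp
    also have "\<dots> \<le> (LINT z|lborel2. energy_kernel V z * (\<phi> (fst z) * \<phi> (snd z)))"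
    proof (rule integral_mono_AE)
      show "AE z in lborel2. - C * (\<phi> (fst z) * \<phi> (snd z)) \<le> energy_kernel V z * (\<phi> (fst z) * \<phi> (snd z))"
        using AE_off_diagonal
      proof eventually_elim
        case (elim z)
        show ?case
        proof (cases "fst z \<ge> 0 \<and> snd z \<ge> 0")
          case True
          then have "e * fst z + e * snd z - C \<le> energy_kernel V z" using C[of "fst z" "snd z"] elim by simp
          moreover have "0 \<le> e * snd z" "0 \<le> e * fst z" using True e by auto
          ultimately have "- C \<le> energy_kernel V z" by linarith
          then show ?thesis using d(2) by (intro mult_right_mono) auto
        next
          case False
          then have "\<phi> (fst z) * \<phi> (snd z) = 0" using d(4) by (auto simp: not_le)
          then show ?thesis by auto
        qed
      qed
    qed (use integral_energy_kernel[OF V \<phi>] integrable_pair_mult(1)[OF d(5) d(5)] in auto)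
    finally show ?thesis using integral_energy_kernel(2)[OF V \<phi>] by simp
  qed
  then show ?thesis by (intro bdd_belowI2)
qed

lemma dens_uniform: "indicator {0..<1} \<in> dens"
proof -
  have "integrable lborel (\<lambda>x::real. x * indicator {0..<1} x)"
    by (rule Bochner_Integration.integrable_bound[of _ "indicator {0..<1} :: real \<Rightarrow> real"]) (auto simp: indicator_def)
  then show ?thesis by (auto simp: dens_def indicator_def)
qed

lemma equilibrium_energy_eq:
  assumes V: "tame V"
  shows "equilibrium_energy V = (INF \<phi>\<in>dens. weighted_energy V \<phi>)"
proof -
  have "(INF \<phi>\<in>admissible_densities. energy V (density_measure \<phi>)) = (INF \<phi>\<in>dens. ereal (weighted_energy V \<phi>))"
  proof (rule antisym)
    show "(INF \<phi>\<in>admissible_densities. energy V (density_measure \<phi>)) \<le> (INF \<phi>\<in>dens. ereal (weighted_energy V \<phi>))"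
      by (rule INF_mono) (metis V dens_subset_admissible energy_dens order_refl subsetD)
    show "(INF \<phi>\<in>dens. ereal (weighted_energy V \<phi>)) \<le> (INF \<phi>\<in>admissible_densities. energy V (density_measure \<phi>))"
    proof (rule INF_greatest)
      fix \<phi> assume "\<phi> \<in> admissible_densities"
      from admissible_energy_cases[OF V this]
      show "(INF \<phi>\<in>dens. ereal (weighted_energy V \<phi>)) \<le> energy V (density_measure \<phi>)"
        by (metis INF_lower V energy_dens ereal_less_eq(1))
    qed
  qed
  also have "\<dots> = ereal (INF \<phi>\<in>dens. weighted_energy V \<phi>)"
  proof (rule antisym)
    have ne: "dens \<noteq> {}" using dens_uniform by auto
    show "ereal (INF \<phi>\<in>dens. weighted_energy V \<phi>) \<le> (INF \<phi>\<in>dens. ereal (weighted_energy V \<phi>))"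
      by (rule INF_greatest) (auto intro: cINF_lower weighted_energy_bdd_below[OF V])
    show "(INF \<phi>\<in>dens. ereal (weighted_energy V \<phi>)) \<le> ereal (INF \<phi>\<in>dens. weighted_energy V \<phi>)"
    proof (rule ereal_le_epsilon2)
      fix e :: real assume "e > 0"
      then obtain \<phi> where \<phi>: "\<phi> \<in> dens" "weighted_energy V \<phi> < (INF \<phi>\<in>dens. weighted_energy V \<phi>) + e"
        using cINF_less_iff[OF ne weighted_energy_bdd_below[OF V], of "(INF \<phi>\<in>dens. weighted_energy V \<phi>) + e"] by auto
      show "(INF \<phi>\<in>dens. ereal (weighted_energy V \<phi>)) \<le> ereal (INF \<phi>\<in>dens. weighted_energy V \<phi>) + ereal e"
        using INF_lower[OF \<phi>(1), of "\<lambda>\<phi>. ereal (weighted_energy V \<phi>)"] \<phi>(2)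
        by (auto elim: order_trans)
    qed
  qed
  finally show ?thesis by (simp add: equilibrium_energy_def)
qed

section \<open>Logarithmic potentials and sufficiency of the Euler-Lagrange conditions\<close>

definition log_potential :: "(real \<Rightarrow> real) \<Rightarrow> real \<Rightarrow> real" where
  "log_potential \<psi> x = (LINT t|lborel. ln \<bar>x - t\<bar> * \<psi> t)"

lemma log_energy_potential:
  assumes "bdd_moment f" "bdd_moment g"
  shows "log_energy f g = - (LINT x|lborel. log_potential g x * f x)"
    and "integrable lborel (\<lambda>x. log_potential g x * f x)"
  using kform_Fubini[OF log_kernel_ln assms] 
  by (simp_all add: log_energy_def log_potential_def)

lemma log_energy_add_left:
  "bdd_moment f \<Longrightarrow> bdd_moment g \<Longrightarrow> bdd_moment h \<Longrightarrow> log_energy (\<lambda>x. f x + g x) h = log_energy f h + log_energy g h"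
  unfolding log_energy_def by (rule kform_add_left[OF log_kernel_ln])

lemma log_energy_add_right:
  "bdd_moment f \<Longrightarrow> bdd_moment g \<Longrightarrow> bdd_moment h \<Longrightarrow> log_energy f (\<lambda>x. g x + h x) = log_energy f g + log_energy f h"
  unfolding log_energy_def by (rule kform_add_right[OF log_kernel_ln])

lemma log_energy_diff_left:
  "bdd_moment f \<Longrightarrow> bdd_moment g \<Longrightarrow> bdd_moment h \<Longrightarrow> log_energy (\<lambda>x. f x - g x) h = log_energy f h - log_energy g h"
  unfolding log_energy_def by (rule kform_diff_left[OF log_kernel_ln])

lemma log_energy_diff_right:
  "bdd_moment f \<Longrightarrow> bdd_moment g \<Longrightarrow> bdd_moment h \<Longrightarrow> log_energy f (\<lambda>x. g x - h x) = log_energy f g - log_energy f h"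
  unfolding log_energy_def by (rule kform_diff_right[OF log_kernel_ln])

lemma log_energy_commute: "bdd_moment f \<Longrightarrow> bdd_moment g \<Longrightarrow> log_energy f g = log_energy g f"
  unfolding log_energy_def by (rule kform_swap[OF log_kernel_ln]) auto

text \<open>For \<open>r = \<phi> - \<psi>\<close> the energy difference is
  \<open>log_energy r r\<close> plus the integral of
  \<open>(V - 2 * log_potential \<psi> + l) * r\<close>. The first term is nonnegative because
  \<open>r\<close> has mass 0, which is also why any constant \<open>l\<close> may be added. The
  second is nonnegative pointwise: \<open>r \<ge> 0\<close> where \<psi> vanishes and
  \<open>r \<le> 0\<close> where \<psi> is saturated.\<close>

lemma Euler_Lagrange_minimizer:
  assumes V: "tame V" and \<psi>: "\<psi> \<in> dens" and \<phi>: "\<phi> \<in> dens"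
    and EL0: "\<And>x. x > 0 \<Longrightarrow> V x - 2 * log_potential \<psi> x + l > 0 \<Longrightarrow> \<psi> x = 0"
    and EL1: "\<And>x. x > 0 \<Longrightarrow> V x - 2 * log_potential \<psi> x + l < 0 \<Longrightarrow> \<psi> x = 1"
  shows "weighted_energy V \<psi> \<le> weighted_energy V \<phi>"
proof -
  note d = densD[OF \<psi>] and d' = densD[OF \<phi>]
  define r where "r x = \<phi> x - \<psi> x" for x
  have r: "bdd_moment r" unfolding r_def using d(8) d'(8) by (intro bdd_moment_diff)
  have r0: "r x = 0" if "x < 0" for x using d(4) d'(4) that by (simp add: r_def)
  have ir: "integral\<^sup>L lborel r = 0" unfolding r_def using d d' by simp
  have pos: "0 \<le> log_energy r r"
    unfolding r_def log_energy_def using d d' by (intro kform_ln_nonneg) auto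
  have rr: "log_energy r r = log_energy \<phi> \<phi> - log_energy \<psi> \<psi> - 2 * log_energy r \<psi>"
    unfolding r_def using d(8) d'(8) log_energy_commute[OF d(8) d'(8)]
    by (simp add: log_energy_diff_left log_energy_diff_right bdd_moment_diff)
  have iV: "integrable lborel (\<lambda>x. V x * r x)" by (rule integrable_tame[OF V r r0])
  have V1: "(LINT x|lborel. V x * r x) = (LINT x|lborel. V x * \<phi> x) - (LINT x|lborel. V x * \<psi> x)"
    unfolding r_def using integrable_tame[OF V d(8) d(4)] integrable_tame[OF V d'(8) d'(4)]
    by (simp add: right_diff_distrib)
  note g = log_energy_potential[OF r d(8)]
  have "0 \<le> (LINT x|lborel. (V x - 2 * log_potential \<psi> x + l) * r x)"
  proof (rule integral_nonneg_AE)
    have "AE x in lborel. x \<noteq> (0::real)" by (rule AE_lborel_singleton)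
    then show "AE x in lborel. 0 \<le> (V x - 2 * log_potential \<psi> x + l) * r x"
    proof eventually_elim
      case (elim x)
      show ?case
      proof (cases "x > 0")
        case True
        then show ?thesis using EL0[OF True] EL1[OF True] d(2,3)[of x] d'(2,3)[of x]
          by (cases "V x - 2 * log_potential \<psi> x + l" "0::real" rule: linorder_cases)
            (auto simp: r_def mult_nonneg_nonneg mult_nonpos_nonpos)
      next
        case False
        then show ?thesis using elim r0 by simp
      qed
    qed
  qed
  also have "\<dots> = (LINT x|lborel. V x * r x - 2 * (log_potential \<psi> x * r x) + l * r x)"
    by (simp add: algebra_simps)
  also have "\<dots> = (LINT x|lborel. V x * r x) + 2 * log_energy r \<psi>"
    using iV g bdd_momentD(2)[OF r] ir by simp
  finally show ?thesis using pos rr V1 unfolding weighted_energy_def by linarith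
qed

section \<open>Logarithmic potential of the arcsine law\<close>

lemma sin_ge_half:
  assumes "0 \<le> x" "x \<le> pi / 2"
  shows "x / 2 \<le> sin x"
proof -
  have *: "v * cos v \<le> sin v" if "0 \<le> v" "v \<le> pi" for v :: real
  proof -
    have "sin 0 - 0 * cos 0 \<le> sin v - v * cos v"
    proof (rule DERIV_nonneg_imp_nondecreasing[OF that(1)])
      fix t assume "0 \<le> t" "t \<le> v"
      then show "\<exists>y. ((\<lambda>x. sin x - x * cos x) has_real_derivative y) (at t) \<and> 0 \<le> y"
        using that by (intro exI[of _ "t * sin t"]) (auto intro!: derivative_eq_intros mult_nonneg_nonneg sin_ge_zero)
    qed
    then show ?thesis by simp
  qed
  have c: "0 \<le> cos (x / 2)" using assms by (intro cos_ge_zero) auto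
  have "x / 2 * cos (x / 2) * cos (x / 2) \<le> sin (x / 2) * cos (x / 2)"
    using *[of "x / 2"] assms c by (intro mult_right_mono) auto
  moreover have "sin x = 2 * sin (x / 2) * cos (x / 2)" using sin_double[of "x / 2"] by simp
  moreover have "cos x = 2 * (cos (x / 2))\<^sup>2 - 1" using cos_double_cos[of "x / 2"] by simp
  moreover have "0 \<le> cos x" using assms by (intro cos_ge_zero) auto
  ultimately have "x / 2 * (1 + cos x) \<le> sin x" by (simp add: power2_eq_square)
  moreover have "x / 2 * 1 \<le> x / 2 * (1 + cos x)" using assms \<open>0 \<le> cos x\<close> by (intro mult_left_mono) auto
  ultimately show ?thesis by linarith
qed

text \<open>Both factors in the product formula for \<open>cos \<tau> - cos \<theta>\<close> are
  bounded below by the one with the difference of the angles, since the squares of the two sines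
  differ by \<open>sin \<tau> * sin \<theta> \<ge> 0\<close>. A quadratic lower bound suffices, as
  its logarithm is still integrable.\<close>

lemma abs_cos_diff_ge:
  assumes "\<tau> \<in> {0..pi}" "\<theta> \<in> {0..pi}"
  shows "(\<tau> - \<theta>)\<^sup>2 / 4 \<le> \<bar>2 * cos \<tau> - 2 * cos \<theta>\<bar>"
proof -
  define A B where "A = \<bar>sin ((\<tau> + \<theta>) / 2)\<bar>" and "B = \<bar>sin ((\<theta> - \<tau>) / 2)\<bar>"
  have "\<bar>2 * cos \<tau> - 2 * cos \<theta>\<bar> = 2 * \<bar>cos \<tau> - cos \<theta>\<bar>"
    unfolding right_diff_distrib[symmetric] abs_mult by simp
  also have "\<dots> = 4 * (A * B)" unfolding cos_diff_cos A_def B_def by (simp add: abs_mult)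
  finally have 1: "\<bar>2 * cos \<tau> - 2 * cos \<theta>\<bar> = 4 * (A * B)" .
  have "A\<^sup>2 - B\<^sup>2 = sin \<tau> * sin \<theta>"
  proof -
    have e: "2 * ((\<tau> + \<theta>) / 2) = \<tau> + \<theta>" "2 * ((\<theta> - \<tau>) / 2) = \<theta> - \<tau>" by simp_all
    have "cos (\<tau> + \<theta>) = 1 - 2 * A\<^sup>2" "cos (\<theta> - \<tau>) = 1 - 2 * B\<^sup>2"
      using cos_double_sin[of "(\<tau> + \<theta>) / 2", unfolded e] cos_double_sin[of "(\<theta> - \<tau>) / 2", unfolded e]
      unfolding A_def B_def power2_abs by simp_all
    then show ?thesis by (simp add: cos_add cos_diff algebra_simps)
  qed
  also have "\<dots> \<ge> 0" using assms by (intro mult_nonneg_nonneg sin_ge_zero) auto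
  finally have "B\<^sup>2 \<le> A\<^sup>2" by simp
  then have "B \<le> A" by (rule power2_le_imp_le) (simp add: A_def)
  have "\<bar>\<theta> - \<tau>\<bar> / 2 / 2 \<le> sin (\<bar>\<theta> - \<tau>\<bar> / 2)" using assms by (intro sin_ge_half) auto
  also have "\<dots> \<le> B"
  proof -
    have "sin \<bar>u\<bar> \<le> \<bar>sin u\<bar>" for u :: real by (cases "u \<ge> 0") auto
    from this[of "(\<theta> - \<tau>) / 2"] show ?thesis unfolding B_def by simp
  qed
  finally have "\<bar>\<theta> - \<tau>\<bar> / 4 \<le> B" by simp
  then have "(\<bar>\<theta> - \<tau>\<bar> / 4) * (\<bar>\<theta> - \<tau>\<bar> / 4) \<le> A * B"
    using \<open>B \<le> A\<close> by (intro mult_mono) auto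
  then show ?thesis unfolding 1 by (simp add: power2_eq_square abs_mult_self_eq algebra_simps)
qed

text \<open>The function arcosh of \<open>\<bar>z\<bar>\<close>, extended by 0 to [-1, 1]: the Green
  function of the complement of [-1, 1] with pole at infinity, restricted to the real line.\<close>

definition arcosh' :: "real \<Rightarrow> real" where
  "arcosh' z = (if \<bar>z\<bar> \<le> 1 then 0 else ln (\<bar>z\<bar> + sqrt (z\<^sup>2 - 1)))"

lemma borel_measurable_arcosh' [measurable]: "arcosh' \<in> borel_measurable borel"
  unfolding arcosh'_def by measurable

lemma arcosh'_nonneg: "0 \<le> arcosh' z"
proof (cases "\<bar>z\<bar> \<le> 1")
  case False
  then have "1 \<le> z\<^sup>2" using one_le_power[of "\<bar>z\<bar>" 2] by simp
  then have "0 \<le> sqrt (z\<^sup>2 - 1)" by simp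
  then have "1 \<le> \<bar>z\<bar> + sqrt (z\<^sup>2 - 1)" using False by linarith
  then show ?thesis using False by (simp add: arcosh'_def)
qed (simp add: arcosh'_def)

lemma arcosh'_exp_bounds:
  assumes "\<bar>z\<bar> > 1"
  shows "ln \<bar>z\<bar> \<le> arcosh' z" "arcosh' z \<le> ln (2 * \<bar>z\<bar>)"
proof -
  have z2: "z\<^sup>2 \<ge> 1" using assms by (metis abs_le_square_iff abs_one less_imp_le one_power2)
  have "sqrt (z\<^sup>2 - 1) \<le> sqrt (z\<^sup>2)" by (rule real_sqrt_le_mono) simp
  also have "\<dots> = \<bar>z\<bar>" by simp
  finally have "sqrt (z\<^sup>2 - 1) \<le> \<bar>z\<bar>" .
  moreover have s0: "0 \<le> sqrt (z\<^sup>2 - 1)" using z2 by simp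
  moreover have pos_add: "0 < \<bar>z\<bar> + sqrt (z\<^sup>2 - 1)" using s0 assms by linarith
  ultimately show "ln \<bar>z\<bar> \<le> arcosh' z" "arcosh' z \<le> ln (2 * \<bar>z\<bar>)"
    using assms pos_add by (auto simp: arcosh'_def intro!: ln_mono)
qed

lemma arcosh'_double: "arcosh' (2 * z\<^sup>2 - 1) = 2 * arcosh' z"
proof (cases "\<bar>z\<bar> \<le> 1")
  case True
  then have "z\<^sup>2 \<le> 1" by (simp add: abs_square_le_1)
  then show ?thesis using True by (simp add: arcosh'_def abs_le_iff)
next
  case False
  then have z2: "z\<^sup>2 > 1" by (metis abs_square_le_1 not_le)
  define w where "w = \<bar>z\<bar> + sqrt (z\<^sup>2 - 1)"
  have w: "w > 0" using False z2 by (simp add: w_def add_pos_nonneg)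
  have "(2 * z\<^sup>2 - 1)\<^sup>2 - 1 = (2 * \<bar>z\<bar>)\<^sup>2 * (z\<^sup>2 - 1)" by (simp add: power2_eq_square algebra_simps)
  then have "sqrt ((2 * z\<^sup>2 - 1)\<^sup>2 - 1) = 2 * \<bar>z\<bar> * sqrt (z\<^sup>2 - 1)" by (simp add: real_sqrt_mult)
  moreover have "w\<^sup>2 = 2 * z\<^sup>2 - 1 + 2 * \<bar>z\<bar> * sqrt (z\<^sup>2 - 1)"
    using z2 by (simp add: w_def power2_sum)
  ultimately have "arcosh' (2 * z\<^sup>2 - 1) = ln (w\<^sup>2)" using z2 by (simp add: arcosh'_def)
  also have "\<dots> = 2 * ln w" using w by (simp add: ln_realpow)
  finally show ?thesis using False by (simp add: arcosh'_def w_def)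
qed

text \<open>The point is a bound uniform in \<open>z\<close>, including large \<open>z\<close>. Here
  \<tau> is the angle of the point of [-1, 1] nearest to \<open>z\<close>, the only place where the
  logarithm can be singular, and 6 bounds twice \<open>ln 4\<close>.\<close>

lemma ln_cos_diff_bound:
  obtains \<tau> where "\<And>\<theta>. \<theta> \<in> {0..pi} \<Longrightarrow> \<theta> \<noteq> \<tau> \<Longrightarrow> \<bar>ln \<bar>2 * z - 2 * cos \<theta>\<bar> - arcosh' z\<bar> \<le> 6 + 2 * lnear (\<tau> - \<theta>)"
proof -
  define z' where "z' = max (- 1) (min 1 z)"
  define \<tau> where "\<tau> = arccos z'"
  have z': "- 1 \<le> z'" "z' \<le> 1" by (auto simp: z'_def)
  then have \<tau>: "\<tau> \<in> {0..pi}" "cos \<tau> = z'" unfolding \<tau>_def by (auto simp: arccos_lbound arccos_ubound)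
  have ln4: "ln (4::real) \<le> 3" using ln_le_minus_one[of 4] by simp
  have "\<bar>ln \<bar>2 * z - 2 * cos \<theta>\<bar> - arcosh' z\<bar> \<le> 6 + 2 * lnear (\<tau> - \<theta>)"
    if \<theta>: "\<theta> \<in> {0..pi}" "\<theta> \<noteq> \<tau>" for \<theta>
  proof -
    have c: "- 1 \<le> cos \<theta>" "cos \<theta> \<le> 1" by auto
    have "\<bar>2 * z' - 2 * cos \<theta>\<bar> \<le> \<bar>2 * z - 2 * cos \<theta>\<bar>" using c by (auto simp: z'_def max_def min_def)
    then have ge: "(\<tau> - \<theta>)\<^sup>2 / 4 \<le> \<bar>2 * z - 2 * cos \<theta>\<bar>" using abs_cos_diff_ge[OF \<tau>(1) \<theta>(1)] \<tau>(2) by simp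
    have pos: "0 < (\<tau> - \<theta>)\<^sup>2 / 4" using \<theta> by simp
    have "ln ((\<tau> - \<theta>)\<^sup>2 / 4) = 2 * ln \<bar>\<tau> - \<theta>\<bar> - ln 4"
      using \<theta> ln_realpow[of "\<bar>\<tau> - \<theta>\<bar>" 2] by (simp add: ln_div)
    moreover have "- lnear (\<tau> - \<theta>) \<le> ln \<bar>\<tau> - \<theta>\<bar>"
      using \<theta> by (auto simp: lnear_def)
    ultimately have low: "- 2 * lnear (\<tau> - \<theta>) - ln 4 \<le> ln \<bar>2 * z - 2 * cos \<theta>\<bar>"
      using ln_mono[OF ge pos] by linarith
    have up: "ln \<bar>2 * z - 2 * cos \<theta>\<bar> - arcosh' z \<le> ln 4"
    proof (cases "\<bar>z\<bar> \<le> 1")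
      case True
      have "\<bar>2 * z - 2 * cos \<theta>\<bar> \<le> 4" using True c by linarith
      then show ?thesis using True ge pos by (auto simp: arcosh'_def intro!: ln_mono)
    next
      case False
      have "\<bar>2 * z - 2 * cos \<theta>\<bar> \<le> 4 * \<bar>z\<bar>" using False c by linarith
      then have "ln \<bar>2 * z - 2 * cos \<theta>\<bar> \<le> ln (4 * \<bar>z\<bar>)" using ge pos by (intro ln_mono) auto
      also have "\<dots> = ln 4 + ln \<bar>z\<bar>" using False by (intro ln_mult_pos) auto
      finally show ?thesis using arcosh'_exp_bounds(1)[of z] False by simp
    qed
    have "- 2 * lnear (\<tau> - \<theta>) - 6 \<le> ln \<bar>2 * z - 2 * cos \<theta>\<bar> - arcosh' z"
    proof (cases "\<bar>z\<bar> \<le> 2")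
      case True
      have "arcosh' z \<le> ln 4"
      proof (cases "\<bar>z\<bar> \<le> 1")
        case False
        have "ln (2 * \<bar>z\<bar>) \<le> ln 4" using False True by (intro ln_mono) auto
        then show ?thesis using arcosh'_exp_bounds(2)[of z] False by linarith
      qed (simp add: arcosh'_def)
      then show ?thesis using low ln4 by linarith
    next
      case False
      have "\<bar>z\<bar> \<le> \<bar>2 * z - 2 * cos \<theta>\<bar>" using False c by linarith
      then have "ln \<bar>z\<bar> \<le> ln \<bar>2 * z - 2 * cos \<theta>\<bar>" using False by (intro ln_mono) auto
      moreover have "arcosh' z \<le> ln 2 + ln \<bar>z\<bar>" using arcosh'_exp_bounds(2)[of z] False ln_mult_pos[of 2 "\<bar>z\<bar>"] by linarith
      moreover have "ln (2::real) \<le> 1" using ln_le_minus_one[of 2] by simp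
      ultimately show ?thesis using lnear_nonneg[of "\<tau> - \<theta>"] by linarith
    qed
    then show ?thesis using up ln4 lnear_nonneg[of "\<tau> - \<theta>"] by (simp add: abs_le_iff)
  qed
  then show ?thesis using that by blast
qed

lemma integrable_lnear: "integrable lborel (\<lambda>y. lnear (x - y))" "(LINT y|lborel. lnear (x - y)) \<le> 2"
proof -
  show i: "integrable lborel (\<lambda>y. lnear (x - y))"
    using nn_integral_lnear_shift[of x] lnear_nonneg
    by (intro integrableI_nonneg) (auto simp: top_unique ennreal_numeral_less_top intro: le_less_trans)
  have "ennreal (LINT y|lborel. lnear (x - y)) \<le> ennreal 2"
    using nn_integral_lnear_shift[of x] nn_integral_eq_integral[OF i] lnear_nonneg by simp
  then show "(LINT y|lborel. lnear (x - y)) \<le> 2" by (simp del: ennreal_numeral)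
qed

text \<open>This is \<open>pi\<close> times the mean of \<open>h\<close> under the arcsine law on
  [-1, 1]; the angle as variable removes the endpoint singularities of its density.\<close>

definition cint :: "(real \<Rightarrow> real) \<Rightarrow> real" where
  "cint h = (LINT \<theta>|lborel. indicator {0..pi} \<theta> * h (cos \<theta>))"

definition cintegrable :: "(real \<Rightarrow> real) \<Rightarrow> bool" where
  "cintegrable h \<longleftrightarrow> integrable lborel (\<lambda>\<theta>. indicator {0..pi} \<theta> * h (cos \<theta>))"

lemma cint_reflect: "cint (\<lambda>x. h (- x)) = cint h" "cintegrable (\<lambda>x. h (- x)) \<longleftrightarrow> cintegrable h"
proof -
  have eq: "(\<lambda>\<theta>. indicator {0..pi} (pi + - 1 * \<theta>) * h (cos (pi + - 1 * \<theta>))) = (\<lambda>\<theta>. indicator {0..pi} \<theta> * h (- cos \<theta>))"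
    by (auto simp: indicator_def fun_eq_iff)
  show "cint (\<lambda>x. h (- x)) = cint h"
    unfolding cint_def using lborel_integral_real_affine[of "- 1" "\<lambda>\<theta>. indicator {0..pi} \<theta> * h (cos \<theta>)" pi] eq by simp
  show "cintegrable (\<lambda>x. h (- x)) \<longleftrightarrow> cintegrable h"
    unfolding cintegrable_def
    using lborel_integrable_real_affine_iff[of "- 1" "\<lambda>\<theta>. indicator {0..pi} \<theta> * h (cos \<theta>)" pi] eq by simp
qed

text \<open>Angle doubling preserves the law of the cosine: \<open>2 * \<theta>\<close> sweeps
  [0, 2 pi], which folds into two copies of [0, pi], and the factor 1/2 of the substitution
  compensates.\<close>

lemma cint_double:
  assumes [measurable]: "h \<in> borel_measurable borel" and i: "cintegrable h"
  shows "(LINT \<theta>|lborel. indicator {0..pi} \<theta> * h (cos (2 * \<theta>))) = cint h"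
proof -
  define f where "f \<theta> = indicator {0..pi} \<theta> * h (cos \<theta>)" for \<theta>
  have f: "integrable lborel f" "integral\<^sup>L lborel f = cint h"
    using i by (simp_all add: f_def[abs_def] cintegrable_def cint_def)
  have [measurable]: "f \<in> borel_measurable borel" using f(1) by auto
  have f': "integrable lborel (\<lambda>\<theta>. f (2 * pi + - 1 * \<theta>))" "(LINT \<theta>|lborel. f (2 * pi + - 1 * \<theta>)) = cint h"
    using f lborel_integrable_real_affine_iff[of "- 1" f "2 * pi"] lborel_integral_real_affine[of "- 1" f "2 * pi"] by simp_all
  have "(LINT \<theta>|lborel. indicator {0..2*pi} \<theta> * h (cos \<theta>)) = (LINT \<theta>|lborel. f \<theta> + f (2 * pi + - 1 * \<theta>))"
  proof (rule integral_cong_AE)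
    have "AE \<theta> in lborel. \<theta> \<noteq> pi" by (rule AE_lborel_singleton)
    then show "AE \<theta> in lborel. indicator {0..2*pi} \<theta> * h (cos \<theta>) = f \<theta> + f (2 * pi + - 1 * \<theta>)"
      by eventually_elim (auto simp: f_def indicator_def cos_diff)
  qed simp_all
  also have "\<dots> = 2 * cint h" using f f' by simp
  finally have "(LINT \<theta>|lborel. indicator {0..2*pi} \<theta> * h (cos \<theta>)) = 2 * cint h" .
  moreover have "(LINT \<theta>|lborel. indicator {0..2*pi} \<theta> * h (cos \<theta>)) = 2 * (LINT \<theta>|lborel. indicator {0..2*pi} (2 * \<theta>) * h (cos (2 * \<theta>)))"
    using lborel_integral_real_affine[of 2 "\<lambda>\<theta>. indicator {0..2*pi} \<theta> * h (cos \<theta>)" 0] by simp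
  moreover have "(\<lambda>\<theta>. indicator {0..2*pi} (2 * \<theta>) * h (cos (2 * \<theta>))) = (\<lambda>\<theta>. indicator {0..pi} \<theta> * h (cos (2 * \<theta>)))"
    by (auto simp: indicator_def fun_eq_iff)
  ultimately show ?thesis by simp
qed

lemma cint_ln_bounded:
  shows "cintegrable (\<lambda>x. ln \<bar>2 * z - 2 * x\<bar>)" "\<bar>cint (\<lambda>x. ln \<bar>2 * z - 2 * x\<bar>) - pi * arcosh' z\<bar> \<le> 6 * pi + 4"
proof -
  obtain \<tau> where \<tau>: "\<And>\<theta>. \<theta> \<in> {0..pi} \<Longrightarrow> \<theta> \<noteq> \<tau> \<Longrightarrow> \<bar>ln \<bar>2 * z - 2 * cos \<theta>\<bar> - arcosh' z\<bar> \<le> 6 + 2 * lnear (\<tau> - \<theta>)"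
    using ln_cos_diff_bound[of z] by blast
  define f where "f \<theta> = indicator {0..pi} \<theta> * (ln \<bar>2 * z - 2 * cos \<theta>\<bar> - arcosh' z)" for \<theta>
  define g where "g \<theta> = 6 * indicator {0..pi} \<theta> + 2 * lnear (\<tau> - \<theta>)" for \<theta>
  have [measurable]: "f \<in> borel_measurable borel" unfolding f_def by measurable
  have ind: "integrable lborel (indicator {0..pi} :: real \<Rightarrow> real)" by simp
  have g: "integrable lborel g" "integral\<^sup>L lborel g \<le> 6 * pi + 4"
    unfolding g_def using ind integrable_lnear[of \<tau>] by simp_all
  have fg: "AE \<theta> in lborel. norm (f \<theta>) \<le> g \<theta>"
    using AE_lborel_singleton[of \<tau>]
    by eventually_elim (use \<tau> lnear_nonneg in \<open>auto simp: f_def g_def indicator_def\<close>)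
  have f: "integrable lborel f"
    by (rule Bochner_Integration.integrable_bound[OF g(1)])
      (use fg in \<open>auto elim!: eventually_mono intro: order_trans\<close>)
  have "\<bar>integral\<^sup>L lborel f\<bar> \<le> integral\<^sup>L lborel g"
    using order_trans[OF integral_abs_bound integral_mono_AE[OF integrable_abs[OF f] g(1)]] fg by simp
  have eq: "(\<lambda>\<theta>. indicator {0..pi} \<theta> * ln \<bar>2 * z - 2 * cos \<theta>\<bar>) = (\<lambda>\<theta>. f \<theta> + arcosh' z * indicator {0..pi} \<theta>)"
    by (auto simp: f_def indicator_def fun_eq_iff)
  show "cintegrable (\<lambda>x. ln \<bar>2 * z - 2 * x\<bar>)"
    unfolding cintegrable_def eq using f ind by simp
  have "cint (\<lambda>x. ln \<bar>2 * z - 2 * x\<bar>) = integral\<^sup>L lborel f + arcosh' z * pi"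
    unfolding cint_def eq using f ind by simp
  then show "\<bar>cint (\<lambda>x. ln \<bar>2 * z - 2 * x\<bar>) - pi * arcosh' z\<bar> \<le> 6 * pi + 4"
    using \<open>\<bar>integral\<^sup>L lborel f\<bar> \<le> integral\<^sup>L lborel g\<close> g(2) by (simp add: mult.commute)
qed

text \<open>For the Chebyshev polynomial \<open>2 * z\<^sup>2 - 1\<close>, the difference with
  \<open>cos (2 * \<theta>)\<close> factors into the differences with \<open>cos \<theta>\<close>
  for \<open>z\<close> and for \<open>- z\<close>, and reflection preserves the arcsine law. The
  scaling by 2 gives an interval of capacity 1, so no additive constant appears.\<close>

lemma cint_ln_double:
  "cint (\<lambda>x. ln \<bar>2 * (2 * z\<^sup>2 - 1) - 2 * x\<bar>) = 2 * cint (\<lambda>x. ln \<bar>2 * z - 2 * x\<bar>)"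
proof -
  define f where "f z \<theta> = indicator {0..pi} \<theta> * ln \<bar>2 * z - 2 * cos \<theta>\<bar>" for z \<theta> :: real
  have f: "integrable lborel (f z)" "integral\<^sup>L lborel (f z) = cint (\<lambda>x. ln \<bar>2 * z - 2 * x\<bar>)" for z
    using cint_ln_bounded(1)[of z] by (simp_all add: f_def[abs_def] cint_def cintegrable_def)
  have refl: "cint (\<lambda>x. ln \<bar>2 * (- z) - 2 * x\<bar>) = cint (\<lambda>x. ln \<bar>2 * z - 2 * x\<bar>)"
  proof -
    have "\<bar>2 * (- z) - 2 * x\<bar> = \<bar>2 * z - 2 * (- x)\<bar>" for x by (auto simp: abs_if)
    then show ?thesis using cint_reflect(1)[of "\<lambda>x. ln \<bar>2 * z - 2 * x\<bar>"] by (simp only:)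
  qed
  have "cint (\<lambda>x. ln \<bar>2 * (2 * z\<^sup>2 - 1) - 2 * x\<bar>)
      = (LINT \<theta>|lborel. indicator {0..pi} \<theta> * ln \<bar>2 * (2 * z\<^sup>2 - 1) - 2 * cos (2 * \<theta>)\<bar>)"
    using cint_double[of "\<lambda>x. ln \<bar>2 * (2 * z\<^sup>2 - 1) - 2 * x\<bar>"] cint_ln_bounded(1)[of "2 * z\<^sup>2 - 1"]
    by (simp only:) simp
  also have "\<dots> = (LINT \<theta>|lborel. f z \<theta> + f (- z) \<theta>)"
  proof (rule integral_cong_AE)
    have "AE \<theta> in lborel. \<theta> \<noteq> arccos z" "AE \<theta> in lborel. \<theta> \<noteq> arccos (- z)" by (rule AE_lborel_singleton)+
    then show "AE \<theta> in lborel. indicator {0..pi} \<theta> * ln \<bar>2 * (2 * z\<^sup>2 - 1) - 2 * cos (2 * \<theta>)\<bar> = f z \<theta> + f (- z) \<theta>"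
    proof eventually_elim
      case (elim \<theta>)
      show ?case
      proof (cases "\<theta> \<in> {0..pi}")
        case True
        then have "cos \<theta> \<noteq> z" "cos \<theta> \<noteq> - z" using elim arccos_cos by force+
        then have "2 * z - 2 * cos \<theta> \<noteq> 0" "2 * (- z) - 2 * cos \<theta> \<noteq> 0" by auto
        moreover have "\<bar>2 * (2 * z\<^sup>2 - 1) - 2 * cos (2 * \<theta>)\<bar> = \<bar>2 * z - 2 * cos \<theta>\<bar> * \<bar>2 * (- z) - 2 * cos \<theta>\<bar>"
          unfolding abs_mult[symmetric] cos_double_cos
          by (subst abs_minus_cancel[symmetric]) (simp add: power2_eq_square algebra_simps)
        ultimately show ?thesis using True by (simp add: f_def ln_mult)
      qed (simp add: f_def)
    qed
  qed (simp_all add: f_def)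
  also have "\<dots> = 2 * cint (\<lambda>x. ln \<bar>2 * z - 2 * x\<bar>)" using f refl by simp
  finally show ?thesis .
qed

text \<open>Both sides double under \<open>z \<mapsto> 2 z\<^sup>2 - 1\<close> and their difference is bounded.\<close>
lemma cint_ln: "cint (\<lambda>x. ln \<bar>2 * z - 2 * x\<bar>) = pi * arcosh' z"
proof -
  define D where "D z = cint (\<lambda>x. ln \<bar>2 * z - 2 * x\<bar>) - pi * arcosh' z" for z
  have D2: "D (2 * z\<^sup>2 - 1) = 2 * D z" for z
    unfolding D_def cint_ln_double arcosh'_double by (simp add: algebra_simps)
  have Dn: "D (((\<lambda>z. 2 * z\<^sup>2 - 1) ^^ n) z) = 2 ^ n * D z" for n
    by (induction n) (simp_all add: D2)
  have le: "2 ^ n * \<bar>D z\<bar> \<le> 6 * pi + 4" for n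
    using cint_ln_bounded(2)[of "((\<lambda>z. 2 * z\<^sup>2 - 1) ^^ n) z"] Dn[of n]
    by (simp add: D_def[of "((\<lambda>z. 2 * z\<^sup>2 - 1) ^^ n) z", symmetric] abs_mult)
  have "D z = 0"
  proof (rule ccontr)
    assume "D z \<noteq> 0"
    then obtain n where "(6 * pi + 4) / \<bar>D z\<bar> < 2 ^ n" using real_arch_pow[of 2 "(6 * pi + 4) / \<bar>D z\<bar>"] by auto
    then have "6 * pi + 4 < 2 ^ n * \<bar>D z\<bar>" using \<open>D z \<noteq> 0\<close> by (simp add: pos_divide_less_eq)
    then show False using le[of n] by simp
  qed
  then show ?thesis by (simp add: D_def)
qed

text \<open>The argument is the quadratic \<open>(x - \<alpha>) * (\<beta> - x)\<close> itself and
  not the interval, so that a symmetry of the quadratic passes to the density. Off the interval the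
  quadratic is negative and the density 0.\<close>

definition arcsine :: "real \<Rightarrow> real" where
  "arcsine p = (if 0 < p then 1 / (pi * sqrt p) else 0)"

lemma arcsine_nonneg: "0 \<le> arcsine p"
  by (simp add: arcsine_def)

lemma borel_measurable_arcsine [measurable]: "arcsine \<in> borel_measurable borel"
  unfolding arcsine_def by measurable

lemma nn_integral_arcsine:
  assumes \<rho>: "\<rho> > 0" and [measurable]: "h \<in> borel_measurable borel" and h0: "\<And>x. 0 \<le> h x"
  shows "(\<integral>\<^sup>+x. ennreal (arcsine (\<rho>\<^sup>2 - (x - c)\<^sup>2) * h x) \<partial>lborel)
    = (\<integral>\<^sup>+\<theta>. ennreal (indicator {0..pi} \<theta> / pi * h (c - \<rho> * cos \<theta>)) \<partial>lborel)"
proof -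
  \<comment> \<open>The minus sign makes the substitution increasing on [0, pi]; its derivative
    \<open>\<rho> * sin \<theta>\<close> cancels the square root.\<close>
  define g where "g \<theta> = c - \<rho> * cos \<theta>" for \<theta>
  have g: "g 0 = c - \<rho>" "g pi = c + \<rho>" by (auto simp: g_def)
  have pos: "arcsine (\<rho>\<^sup>2 - (x - c)\<^sup>2) = 0" if "x \<notin> {c - \<rho>..c + \<rho>}" for x
  proof -
    have "\<bar>\<rho>\<bar> < \<bar>x - c\<bar>" using that \<rho> by auto
    then have "\<rho>\<^sup>2 < (x - c)\<^sup>2" by (metis abs_le_square_iff not_le)
    then show ?thesis by (simp add: arcsine_def)
  qed
  have "(\<integral>\<^sup>+x. ennreal (arcsine (\<rho>\<^sup>2 - (x - c)\<^sup>2) * h x) \<partial>lborel)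
    = (\<integral>\<^sup>+x. ennreal (arcsine (\<rho>\<^sup>2 - (x - c)\<^sup>2) * h x * indicator {g 0..g pi} x) \<partial>lborel)"
    using pos unfolding g by (intro nn_integral_cong) (auto simp: indicator_def)
  also have "\<dots> = (\<integral>\<^sup>+\<theta>. ennreal (arcsine (\<rho>\<^sup>2 - (g \<theta> - c)\<^sup>2) * h (g \<theta>)) * ennreal (\<rho> * sin \<theta>) * indicator {0..pi} \<theta> \<partial>lborel)"
  proof -
    have "(\<integral>\<^sup>+x. ennreal (arcsine (\<rho>\<^sup>2 - (x - c)\<^sup>2) * h x * indicator {g 0..g pi} x) \<partial>lborel)
      = (\<integral>\<^sup>+\<theta>. ennreal (arcsine (\<rho>\<^sup>2 - (g \<theta> - c)\<^sup>2) * h (g \<theta>) * (\<rho> * sin \<theta>) * indicator {0..pi} \<theta>) \<partial>lborel)"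
    proof (rule nn_integral_substitution)
      show "set_borel_measurable borel {g 0..g pi} (\<lambda>x. arcsine (\<rho>\<^sup>2 - (x - c)\<^sup>2) * h x)"
        unfolding set_borel_measurable_def by measurable
      show "(g has_real_derivative \<rho> * sin x) (at x)" for x
        unfolding g_def by (auto intro!: derivative_eq_intros)
      show "continuous_on {0..pi} (\<lambda>\<theta>. \<rho> * sin \<theta>)" by (intro continuous_intros)
      show "0 \<le> \<rho> * sin x" if "x \<in> {0..pi}" for x using that \<rho> by (simp add: sin_ge_zero)
    qed simp
    also have "\<dots> = (\<integral>\<^sup>+\<theta>. ennreal (arcsine (\<rho>\<^sup>2 - (g \<theta> - c)\<^sup>2) * h (g \<theta>)) * ennreal (\<rho> * sin \<theta>) * indicator {0..pi} \<theta> \<partial>lborel)"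
      using \<rho> by (intro nn_integral_cong) (auto simp: indicator_def h0 arcsine_nonneg sin_ge_zero simp flip: ennreal_mult)
    finally show ?thesis .
  qed
  also have "\<dots> = (\<integral>\<^sup>+\<theta>. ennreal (indicator {0..pi} \<theta> / pi * h (c - \<rho> * cos \<theta>)) \<partial>lborel)"
  proof (rule nn_integral_cong_AE)
    have "AE \<theta> in lborel. \<theta> \<noteq> 0" "AE \<theta> in lborel. \<theta> \<noteq> pi" by (rule AE_lborel_singleton)+
    then show "AE \<theta> in lborel. ennreal (arcsine (\<rho>\<^sup>2 - (g \<theta> - c)\<^sup>2) * h (g \<theta>)) * ennreal (\<rho> * sin \<theta>) * indicator {0..pi} \<theta>
       = ennreal (indicator {0..pi} \<theta> / pi * h (c - \<rho> * cos \<theta>))"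
    proof eventually_elim
      case (elim \<theta>)
      show ?case
      proof (cases "\<theta> \<in> {0..pi}")
        case True
        then have s: "sin \<theta> > 0" using elim by (intro sin_gt_zero) auto
        have "\<rho>\<^sup>2 - (g \<theta> - c)\<^sup>2 = (\<rho> * sin \<theta>)\<^sup>2"
          by (simp add: g_def power_mult_distrib sin_squared_eq algebra_simps)
        then have "arcsine (\<rho>\<^sup>2 - (g \<theta> - c)\<^sup>2) * h (g \<theta>) * (\<rho> * sin \<theta>) = 1 / pi * h (g \<theta>)"
          using s \<rho> by (simp add: arcsine_def)
        then show ?thesis using True s \<rho> h0 arcsine_nonneg
          by (simp add: g_def flip: ennreal_mult)
      qed simp
    qed
  qed
  finally show ?thesis .
qed

text \<open>As an identity of measures it transfers integrability and integrals of signed functions,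
  which the formula for nonnegative integrands does not give directly.\<close>

lemma arcsine_distr:
  assumes \<rho>: "\<rho> > 0"
  shows "density lborel (\<lambda>x. ennreal (arcsine (\<rho>\<^sup>2 - (x - c)\<^sup>2)))
    = distr (density lborel (\<lambda>\<theta>. ennreal (indicator {0..pi} \<theta> / pi))) borel (\<lambda>\<theta>. c - \<rho> * cos \<theta>)"
proof (rule measure_eqI)
  fix A assume "A \<in> sets (density lborel (\<lambda>x. ennreal (arcsine (\<rho>\<^sup>2 - (x - c)\<^sup>2))))"
  then have [measurable]: "A \<in> sets borel" by simp
  have [measurable]: "(\<lambda>\<theta>. c - \<rho> * cos \<theta>) \<in> borel_measurable borel" by measurable
  have "(\<lambda>\<theta>. c - \<rho> * cos \<theta>) -` A \<in> sets borel"
    using measurable_sets[of "\<lambda>\<theta>. c - \<rho> * cos \<theta>" borel borel A] by simp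
  note [measurable] = this
  have "emeasure (density lborel (\<lambda>x. ennreal (arcsine (\<rho>\<^sup>2 - (x - c)\<^sup>2)))) A
    = (\<integral>\<^sup>+x. ennreal (arcsine (\<rho>\<^sup>2 - (x - c)\<^sup>2) * indicator A x) \<partial>lborel)"
    by (subst emeasure_density) (auto intro!: nn_integral_cong simp: indicator_def)
  also have "\<dots> = (\<integral>\<^sup>+\<theta>. ennreal (indicator {0..pi} \<theta> / pi * indicator A (c - \<rho> * cos \<theta>)) \<partial>lborel)"
    by (rule nn_integral_arcsine[OF \<rho>]) auto
  also have "\<dots> = emeasure (distr (density lborel (\<lambda>\<theta>. ennreal (indicator {0..pi} \<theta> / pi))) borel (\<lambda>\<theta>. c - \<rho> * cos \<theta>)) A"
    by (subst emeasure_distr, simp, simp, subst emeasure_density) (auto intro!: nn_integral_cong simp: indicator_def)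
  finally show "emeasure (density lborel (\<lambda>x. ennreal (arcsine (\<rho>\<^sup>2 - (x - c)\<^sup>2)))) A
    = emeasure (distr (density lborel (\<lambda>\<theta>. ennreal (indicator {0..pi} \<theta> / pi))) borel (\<lambda>\<theta>. c - \<rho> * cos \<theta>)) A" .
qed simp

lemma arcsine_integral:
  assumes \<rho>: "\<rho> > 0" and [measurable]: "h \<in> borel_measurable borel"
  shows "(LINT x|lborel. arcsine (\<rho>\<^sup>2 - (x - c)\<^sup>2) * h x) = cint (\<lambda>u. h (c - \<rho> * u)) / pi"
    and "integrable lborel (\<lambda>x. arcsine (\<rho>\<^sup>2 - (x - c)\<^sup>2) * h x) \<longleftrightarrow> cintegrable (\<lambda>u. h (c - \<rho> * u))"
proof -
  define M where "M = density lborel (\<lambda>x. ennreal (arcsine (\<rho>\<^sup>2 - (x - c)\<^sup>2)))"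
  have am: "(\<lambda>x. arcsine (\<rho>\<^sup>2 - (x - c)\<^sup>2)) \<in> borel_measurable lborel" by measurable
  have an: "AE x in lborel. 0 \<le> arcsine (\<rho>\<^sup>2 - (x - c)\<^sup>2)" by (simp add: arcsine_nonneg)
  have hm0: "h \<in> borel_measurable lborel" by simp
  have 1: "integral\<^sup>L M h = (LINT x|lborel. arcsine (\<rho>\<^sup>2 - (x - c)\<^sup>2) * h x)"
    "integrable M h \<longleftrightarrow> integrable lborel (\<lambda>x. arcsine (\<rho>\<^sup>2 - (x - c)\<^sup>2) * h x)"
    using integral_density[OF hm0 am an] integrable_density[OF hm0 am an]
    unfolding M_def real_scaleR_def .
  define N where "N = density lborel (\<lambda>\<theta>. ennreal (indicator {0..pi} \<theta> / pi))"
  have MN: "M = distr N borel (\<lambda>\<theta>. c - \<rho> * cos \<theta>)"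
    unfolding M_def N_def by (rule arcsine_distr[OF \<rho>])
  have gm: "(\<lambda>\<theta>. c - \<rho> * cos \<theta>) \<in> measurable N borel" unfolding N_def by measurable
  have hm: "(\<lambda>\<theta>. h (c - \<rho> * cos \<theta>)) \<in> borel_measurable lborel" by measurable
  have ind: "AE \<theta> in lborel. 0 \<le> indicator {0..pi} \<theta> / pi" by (intro AE_I2) simp
  have eq: "(\<lambda>\<theta>. (indicator {0..pi} \<theta> / pi) *\<^sub>R h (c - \<rho> * cos \<theta>)) = (\<lambda>\<theta>. (1 / pi) * (indicator {0..pi} \<theta> * h (c - \<rho> * cos \<theta>)))"
    by auto
  have 2: "integral\<^sup>L M h = cint (\<lambda>u. h (c - \<rho> * u)) / pi"
    unfolding MN integral_distr[OF gm assms(2)] unfolding N_def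
    by (subst integral_density[OF hm _ ind]) (simp_all add: eq cint_def)
  have 3: "integrable M h \<longleftrightarrow> cintegrable (\<lambda>u. h (c - \<rho> * u))"
    unfolding MN integrable_distr_eq[OF gm assms(2)] unfolding N_def
    by (subst integrable_density[OF hm _ ind], simp, unfold eq integrable_mult_left_iff) (simp add: cintegrable_def)
  show "(LINT x|lborel. arcsine (\<rho>\<^sup>2 - (x - c)\<^sup>2) * h x) = cint (\<lambda>u. h (c - \<rho> * u)) / pi"
    and "integrable lborel (\<lambda>x. arcsine (\<rho>\<^sup>2 - (x - c)\<^sup>2) * h x) \<longleftrightarrow> cintegrable (\<lambda>u. h (c - \<rho> * u))"
    using 1 2 3 by auto
qed

lemma cint_const: "cint (\<lambda>u. k) = k * pi" "cintegrable (\<lambda>u. k)"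
proof -
  have "integrable lborel (indicator {0..pi} :: real \<Rightarrow> real)" by simp
  then show "cint (\<lambda>u. k) = k * pi" "cintegrable (\<lambda>u. k)" by (simp_all add: cint_def cintegrable_def)
qed

lemma cint_add:
  assumes "cintegrable f" "cintegrable g"
  shows "cint (\<lambda>x. f x + g x) = cint f + cint g" "cintegrable (\<lambda>x. f x + g x)"
  using assms by (simp_all add: cint_def cintegrable_def distrib_left)

lemma nn_integral_arcsine_eq_1: "\<rho> > 0 \<Longrightarrow> (\<integral>\<^sup>+x. ennreal (arcsine (\<rho>\<^sup>2 - (x - c)\<^sup>2)) \<partial>lborel) = 1"
proof -
  assume \<rho>: "\<rho> > 0"
  have "(\<integral>\<^sup>+\<theta>. ennreal (indicator {0..pi} \<theta> / pi) \<partial>lborel) = ennreal (integral\<^sup>L lborel (\<lambda>\<theta>. indicator {0..pi} \<theta> / pi))"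
    by (intro nn_integral_eq_integral) auto
  then show ?thesis using nn_integral_arcsine[OF \<rho>, of "\<lambda>_. 1" c] by simp
qed

lemma arcsine_mean:
  assumes "\<rho> > 0"
  shows "(LINT x|lborel. arcsine (\<rho>\<^sup>2 - (x - c)\<^sup>2) * x) = c"
    and "integrable lborel (\<lambda>x. arcsine (\<rho>\<^sup>2 - (x - c)\<^sup>2) * x)"
proof -
  have i: "cintegrable (\<lambda>u. u)"
    unfolding cintegrable_def
    by (rule Bochner_Integration.integrable_bound[of _ "indicator {0..pi} :: real \<Rightarrow> real"])
      (auto simp: indicator_def abs_cos_le_one)
  have "cint (\<lambda>u. - u) = - cint (\<lambda>u. u)" by (simp add: cint_def)
  then have 0: "cint (\<lambda>u. u) = 0" using cint_reflect(1)[of "\<lambda>u. u"] by simp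
  have i': "cintegrable (\<lambda>u. (- \<rho>) * u)" and z0: "cint (\<lambda>u. (- \<rho>) * u) = 0"
    using i 0 integrable_mult_right[of "- \<rho>" lborel "\<lambda>\<theta>. indicator {0..pi} \<theta> * cos \<theta>"]
      integral_mult_right_zero[of lborel "- \<rho>" "\<lambda>\<theta>. indicator {0..pi} \<theta> * cos \<theta>"]
    unfolding cintegrable_def cint_def by (simp_all add: mult.left_commute)
  show "(LINT x|lborel. arcsine (\<rho>\<^sup>2 - (x - c)\<^sup>2) * x) = c" "integrable lborel (\<lambda>x. arcsine (\<rho>\<^sup>2 - (x - c)\<^sup>2) * x)"
    using cint_add[OF cint_const(2)[of c] i'] z0 cint_const(1)[of c]
    by (simp_all add: arcsine_integral[OF assms])
qed

text \<open>The logarithmic potential of the equilibrium measure of an interval: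
  \<open>\<rho> / 2\<close> is the capacity of an interval of half-length \<rho>, and
  \<open>arcosh'\<close> is the Green function, which is 0 on the interval.\<close>

lemma arcsine_log_potential:
  assumes \<rho>: "\<rho> > 0"
  shows "(LINT x|lborel. arcsine (\<rho>\<^sup>2 - (x - c)\<^sup>2) * ln \<bar>X - x\<bar>) = ln (\<rho> / 2) + arcosh' ((X - c) / \<rho>)"
    and "integrable lborel (\<lambda>x. arcsine (\<rho>\<^sup>2 - (x - c)\<^sup>2) * ln \<bar>X - x\<bar>)"
proof -
  define z where "z = (X - c) / \<rho>"
  have i: "cintegrable (\<lambda>u. ln \<bar>2 * z + 2 * u\<bar>)" and j: "cint (\<lambda>u. ln \<bar>2 * z + 2 * u\<bar>) = pi * arcosh' z"
    using cint_ln_bounded(1)[of z] cint_ln[of z] cint_reflect[of "\<lambda>u. ln \<bar>2 * z - 2 * u\<bar>"] by simp_all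
  define f where "f u = ln (\<rho> / 2) + ln \<bar>2 * z + 2 * u\<bar>" for u
  have f: "cintegrable f" "cint f = pi * (ln (\<rho> / 2) + arcosh' z)"
    using cint_add[OF cint_const(2)[of "ln (\<rho> / 2)"] i] j cint_const(1)[of "ln (\<rho> / 2)"]
    unfolding f_def[abs_def] by (simp_all add: algebra_simps)
  have ae: "AE \<theta> in lborel. indicator {0..pi} \<theta> * ln \<bar>X - (c - \<rho> * cos \<theta>)\<bar> = indicator {0..pi} \<theta> * f (cos \<theta>)"
    using AE_lborel_singleton[of "arccos (- z)"]
  proof eventually_elim
    case (elim \<theta>)
    show ?case
    proof (cases "\<theta> \<in> {0..pi}")
      case True
      then have "cos \<theta> \<noteq> - z" using elim arccos_cos by force
      then have ne: "\<bar>2 * z + 2 * cos \<theta>\<bar> > 0" by auto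
      have "X - (c - \<rho> * cos \<theta>) = \<rho> / 2 * (2 * z + 2 * cos \<theta>)" using \<rho> by (simp add: z_def field_simps)
      then have eq: "\<bar>X - (c - \<rho> * cos \<theta>)\<bar> = \<rho> / 2 * \<bar>2 * z + 2 * cos \<theta>\<bar>"
        using \<rho> abs_mult[of "\<rho> / 2" "2 * z + 2 * cos \<theta>"] by (simp only: abs_of_pos half_gt_zero)
      have "ln \<bar>X - (c - \<rho> * cos \<theta>)\<bar> = ln (\<rho> / 2) + ln \<bar>2 * z + 2 * cos \<theta>\<bar>"
        unfolding eq using \<rho> ne by (subst ln_mult_pos) simp_all
      then show ?thesis by (simp add: f_def)
    qed simp
  qed
  have m: "(\<lambda>\<theta>. indicator {0..pi} \<theta> * ln \<bar>X - (c - \<rho> * cos \<theta>)\<bar>) \<in> borel_measurable lborel"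
     "(\<lambda>\<theta>. indicator {0..pi} \<theta> * f (cos \<theta>)) \<in> borel_measurable lborel"
    unfolding f_def by measurable
  have "cint (\<lambda>u. ln \<bar>X - (c - \<rho> * u)\<bar>) = cint f" "cintegrable (\<lambda>u. ln \<bar>X - (c - \<rho> * u)\<bar>) \<longleftrightarrow> cintegrable f"
    unfolding cint_def cintegrable_def using m ae by (intro integral_cong_AE integrable_cong_AE; simp)+
  then show "(LINT x|lborel. arcsine (\<rho>\<^sup>2 - (x - c)\<^sup>2) * ln \<bar>X - x\<bar>) = ln (\<rho> / 2) + arcosh' ((X - c) / \<rho>)"
    and "integrable lborel (\<lambda>x. arcsine (\<rho>\<^sup>2 - (x - c)\<^sup>2) * ln \<bar>X - x\<bar>)"
    using f by (simp_all add: arcsine_integral[OF \<rho>] z_def)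
qed

section \<open>The Meixner equilibrium measure\<close>

lemma nn_integral_inverse_sqrt:
  assumes \<rho>: "\<rho> > 0" and x: "c + \<rho> \<le> x"
  shows "(\<integral>\<^sup>+t. ennreal (indicator {c + \<rho><..<x} t / sqrt ((t - c)\<^sup>2 - \<rho>\<^sup>2)) \<partial>lborel) = ennreal (arcosh' ((x - c) / \<rho>))"
proof -
  \<comment> \<open>With \<open>u\<close> and \<open>v\<close> the two square roots,
    \<open>(u + v)\<^sup>2 = 2 * \<rho> * (z + sqrt (z\<^sup>2 - 1))\<close>, so \<open>F\<close> is
    \<open>arcosh'\<close> up to a constant. In this form it is continuous up to
    \<open>c + \<rho>\<close>, where the integrand is singular.\<close>
  define F where "F t = 2 * ln (sqrt (t - (c - \<rho>)) + sqrt (t - (c + \<rho>)))" for t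
  have f: "(t - c)\<^sup>2 - \<rho>\<^sup>2 = (t - (c - \<rho>)) * (t - (c + \<rho>))" for t by (simp add: power2_eq_square algebra_simps)
  have "((\<lambda>t. 1 / sqrt ((t - c)\<^sup>2 - \<rho>\<^sup>2)) has_integral (F x - F (c + \<rho>))) {c + \<rho>..x}"
  proof (rule fundamental_theorem_of_calculus_interior[OF x])
    have "sqrt (t - (c - \<rho>)) + sqrt (t - (c + \<rho>)) \<noteq> 0" if "c + \<rho> \<le> t" for t
    proof -
      have "sqrt (t - (c - \<rho>)) > 0" "sqrt (t - (c + \<rho>)) \<ge> 0" using that \<rho> by auto
      then show ?thesis by linarith
    qed
    then show "continuous_on {c + \<rho>..x} F" unfolding F_def
      by (intro continuous_intros) auto
    fix t assume t: "t \<in> {c + \<rho><..<x}"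
    define u v where "u = sqrt (t - (c - \<rho>))" and "v = sqrt (t - (c + \<rho>))"
    have uv: "u > 0" "v > 0" using t \<rho> by (auto simp: u_def v_def)
    have "(F has_real_derivative 2 * ((inverse u / 2 + inverse v / 2) / (u + v))) (at t)"
      unfolding F_def u_def v_def using t \<rho> add_pos_pos[OF uv]
      by (auto intro!: derivative_eq_intros simp: u_def v_def)
    also have "2 * ((inverse u / 2 + inverse v / 2) / (u + v)) = 1 / (u * v)"
      using uv by (simp add: divide_simps)
    also have "u * v = sqrt ((t - c)\<^sup>2 - \<rho>\<^sup>2)" unfolding f u_def v_def real_sqrt_mult ..
    finally show "(F has_vector_derivative 1 / sqrt ((t - c)\<^sup>2 - \<rho>\<^sup>2)) (at t)"
      by (simp add: has_real_derivative_iff_has_vector_derivative)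
  qed
  moreover have "F x - F (c + \<rho>) = arcosh' ((x - c) / \<rho>)"
  proof -
    define u v where "u = sqrt (x - (c - \<rho>))" and "v = sqrt (x - (c + \<rho>))"
    have uv: "u > 0" "v \<ge> 0" "u\<^sup>2 = x - c + \<rho>" "v\<^sup>2 = x - c - \<rho>" using x \<rho> by (auto simp: u_def v_def)
    have uv': "u * v = sqrt ((x - c)\<^sup>2 - \<rho>\<^sup>2)" unfolding f u_def v_def real_sqrt_mult ..
    define z where "z = (x - c) / \<rho>"
    have z: "z \<ge> 1" using x \<rho> by (simp add: z_def)
    have "sqrt (z\<^sup>2 - 1) = sqrt (((x - c)\<^sup>2 - \<rho>\<^sup>2) / \<rho>\<^sup>2)" unfolding z_def power_divide using \<rho> by (simp add: diff_divide_distrib)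
    also have "\<dots> = u * v / \<rho>" using \<rho> uv' by (simp add: real_sqrt_divide)
    finally have r: "sqrt (z\<^sup>2 - 1) = u * v / \<rho>" .
    have sq: "(u + v)\<^sup>2 = 2 * ((x - c) + u * v)" using uv by (simp add: power2_sum)
    have zr: "z + sqrt (z\<^sup>2 - 1) = (u + v)\<^sup>2 / (2 * \<rho>)"
      unfolding r sq using \<rho> by (simp add: z_def field_simps)
    have "F x = ln ((u + v)\<^sup>2)" using uv by (simp add: F_def u_def v_def ln_realpow add_pos_nonneg)
    moreover have "F (c + \<rho>) = ln (2 * \<rho>)" using \<rho> by (simp add: F_def ln_sqrt)
    moreover have "ln ((u + v)\<^sup>2 / (2 * \<rho>)) = ln ((u + v)\<^sup>2) - ln (2 * \<rho>)"
      using uv \<rho> by (subst ln_div) (auto simp: add_pos_nonneg)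
    moreover have "arcosh' z = ln (z + sqrt (z\<^sup>2 - 1))" using z by (auto simp: arcosh'_def)
    ultimately show ?thesis using zr by (simp add: z_def)
  qed
  ultimately have "((\<lambda>t. 1 / sqrt ((t - c)\<^sup>2 - \<rho>\<^sup>2)) has_integral arcosh' ((x - c) / \<rho>)) {c + \<rho>..x}" by simp
  then have "(\<integral>\<^sup>+t. ennreal (indicator {c + \<rho>..x} t * (1 / sqrt ((t - c)\<^sup>2 - \<rho>\<^sup>2))) \<partial>lborel) = ennreal (arcosh' ((x - c) / \<rho>))"
  proof (rule nn_integral_has_integral_lebesgue[rotated])
    fix t assume "t \<in> {c + \<rho>..x}"
    then have "0 \<le> (t - c)\<^sup>2 - \<rho>\<^sup>2" using \<rho> by (simp add: f)
    then show "0 \<le> 1 / sqrt ((t - c)\<^sup>2 - \<rho>\<^sup>2)" by simp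
  qed
  moreover have "(\<integral>\<^sup>+t. ennreal (indicator {c + \<rho><..<x} t / sqrt ((t - c)\<^sup>2 - \<rho>\<^sup>2)) \<partial>lborel)
    = (\<integral>\<^sup>+t. ennreal (indicator {c + \<rho>..x} t * (1 / sqrt ((t - c)\<^sup>2 - \<rho>\<^sup>2))) \<partial>lborel)"
  proof (rule nn_integral_cong_AE)
    have "AE t in lborel. t \<noteq> c + \<rho>" "AE t in lborel. t \<noteq> x" by (rule AE_lborel_singleton)+
    then show "AE t in lborel. ennreal (indicator {c + \<rho><..<x} t / sqrt ((t - c)\<^sup>2 - \<rho>\<^sup>2))
      = ennreal (indicator {c + \<rho>..x} t * (1 / sqrt ((t - c)\<^sup>2 - \<rho>\<^sup>2)))"
      by eventually_elim (auto simp: indicator_def)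
  qed
  ultimately show ?thesis by simp
qed

lemma arcosh'_minus: "arcosh' (- z) = arcosh' z"
  by (simp add: arcosh'_def)

lemma nn_integral_inverse_sqrt':
  assumes \<rho>: "\<rho> > 0" and x: "x \<le> c - \<rho>"
  shows "(\<integral>\<^sup>+t. ennreal (indicator {x<..<c - \<rho>} t / sqrt ((t - c)\<^sup>2 - \<rho>\<^sup>2)) \<partial>lborel) = ennreal (arcosh' ((x - c) / \<rho>))"
proof -
  have "(\<integral>\<^sup>+t. ennreal (indicator {x<..<c - \<rho>} t / sqrt ((t - c)\<^sup>2 - \<rho>\<^sup>2)) \<partial>lborel)
    = (\<integral>\<^sup>+t. ennreal (indicator {x<..<c - \<rho>} (2 * c - t) / sqrt ((2 * c - t - c)\<^sup>2 - \<rho>\<^sup>2)) \<partial>lborel)"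
    by (rule nn_integral_translate_reflect[symmetric]) measurable
  also have "\<dots> = (\<integral>\<^sup>+t. ennreal (indicator {c + \<rho><..<2 * c - x} t / sqrt ((t - c)\<^sup>2 - \<rho>\<^sup>2)) \<partial>lborel)"
    by (intro nn_integral_cong) (auto simp: indicator_def power2_commute[of c])
  also have "\<dots> = ennreal (arcosh' ((2 * c - x - c) / \<rho>))" using x by (intro nn_integral_inverse_sqrt \<rho>) auto
  also have "(2 * c - x - c) / \<rho> = - ((x - c) / \<rho>)" by (simp add: minus_divide_left)
  finally show ?thesis by (simp only: arcosh'_minus)
qed

text \<open>The parameter \<open>b\<close> stands for \<open>\<kappa> - 1\<close>. For large N,
  \<open>cen s\<close> and \<open>rad s / 2\<close> are the limits of the recurrence coefficients,
  divided by N, of the orthonormal Meixner polynomials of degree s N with parameters b N and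
  \<open>a\<close>.\<close>

locale meixner =
  fixes a b :: real
  assumes a: "0 < a" "a < 1" and b: "0 \<le> b"
begin

definition cen :: "real \<Rightarrow> real" where "cen s = (s + a * (s + b)) / (1 - a)"
definition rad :: "real \<Rightarrow> real" where "rad s = 2 * sqrt (a * s * (s + b)) / (1 - a)"
definition lo :: "real \<Rightarrow> real" where "lo s = cen s - rad s"
definition hi :: "real \<Rightarrow> real" where "hi s = cen s + rad s"
text \<open>The square of \<open>rad s\<close> is written out as a polynomial, which keeps the
  symmetry in \<open>s\<close> and \<open>x\<close> valid for all reals, also where the radicand in
  \<open>rad\<close> is negative.\<close>

definition quad :: "real \<Rightarrow> real \<Rightarrow> real" where
  "quad s x = 4 * a * s * (s + b) / (1 - a)\<^sup>2 - (x - cen s)\<^sup>2"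
text \<open>The fixed point of \<open>t = a * (t + b)\<close>: there \<open>lo\<close> vanishes and
  the potential \<open>mpot\<close> is minimal.\<close>

definition xc :: real where "xc = a * b / (1 - a)"

lemma xc_nonneg: "0 \<le> xc" using a b by (simp add: xc_def)

text \<open>After multiplication by \<open>(1 - a)\<^sup>2\<close> the quadratic coefficients agree
  because \<open>4 * a - (1 + a)\<^sup>2 = - (1 - a)\<^sup>2\<close>, and the linear ones because
  \<open>4 * a * b - 2 * (1 + a) * a * b = 2 * (1 - a) * a * b\<close>. The whole analysis of the
  equilibrium measure rests on this.\<close>

lemma quad_sym: "quad s x = quad x s"
proof -
  have "1 - a \<noteq> 0" using a by simp
  then show ?thesis unfolding quad_def cen_def
    by (simp add: power2_eq_square divide_simps) (simp add: algebra_simps)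
qed

lemma rad_pos: "s > 0 \<Longrightarrow> rad s > 0"
  using a b by (simp add: rad_def add_pos_nonneg)

lemma rad_sq: "s \<ge> 0 \<Longrightarrow> (rad s)\<^sup>2 = 4 * a * s * (s + b) / (1 - a)\<^sup>2"
  using a b by (simp add: rad_def power_divide power_mult_distrib)

lemma quad_rad: "s \<ge> 0 \<Longrightarrow> quad s x = (rad s)\<^sup>2 - (x - cen s)\<^sup>2"
  by (simp add: quad_def rad_sq)

lemma quad_factor: "s \<ge> 0 \<Longrightarrow> quad s x = (x - lo s) * (hi s - x)"
  by (simp add: quad_rad lo_def hi_def power2_eq_square algebra_simps)

lemma rad_eq: "s \<ge> 0 \<Longrightarrow> rad s = 2 * (sqrt s * sqrt (a * (s + b))) / (1 - a)"
  unfolding rad_def by (simp add: mult_ac flip: real_sqrt_mult)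

lemma cen_eq: "s \<ge> 0 \<Longrightarrow> cen s = ((sqrt s)\<^sup>2 + (sqrt (a * (s + b)))\<^sup>2) / (1 - a)"
  using a b by (simp add: cen_def)

lemma lo_eq: "s \<ge> 0 \<Longrightarrow> lo s = (sqrt s - sqrt (a * (s + b)))\<^sup>2 / (1 - a)"
  unfolding lo_def cen_eq rad_eq by (simp only: power2_diff mult.assoc flip: diff_divide_distrib)

lemma hi_eq: "s \<ge> 0 \<Longrightarrow> hi s = (sqrt s + sqrt (a * (s + b)))\<^sup>2 / (1 - a)"
  unfolding hi_def cen_eq rad_eq by (simp only: power2_sum mult.assoc flip: add_divide_distrib)

lemma lo_nonneg: "s \<ge> 0 \<Longrightarrow> 0 \<le> lo s"
  using a by (simp add: lo_eq)

lemma lo_less_hi: "s > 0 \<Longrightarrow> lo s < hi s"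
  using rad_pos[of s] by (simp add: lo_def hi_def)

lemma hi_ge: "s \<ge> 0 \<Longrightarrow> cen s \<le> hi s"
  using a b by (simp add: hi_def rad_def)

lemma cen_ge: "s \<ge> 0 \<Longrightarrow> s / (1 - a) \<le> cen s"
  using a b by (simp add: cen_def divide_right_mono)

lemma hi_ge_self: "s \<ge> 0 \<Longrightarrow> s \<le> hi s"
proof -
  assume s: "s \<ge> 0"
  have "s \<le> s / (1 - a)" using a s by (simp add: field_simps mult_nonneg_nonneg)
  then show ?thesis using cen_ge[OF s] hi_ge[OF s] by linarith
qed

lemma hi_gt_xc: "s > 0 \<Longrightarrow> xc < hi s"
proof -
  assume s: "s > 0"
  have "xc < cen s" unfolding xc_def cen_def using a s
    by (intro divide_strict_right_mono) (auto simp: distrib_left add_pos_pos)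
  then show ?thesis using hi_ge[of s] s by simp
qed

lemma xc_iff: "t < xc \<longleftrightarrow> t < a * (t + b)" "xc < t \<longleftrightarrow> a * (t + b) < t" "t = xc \<longleftrightarrow> t = a * (t + b)"
  using a by (auto simp: xc_def field_simps)

lemma lo_le_self: assumes "t \<ge> xc" shows "lo t \<le> t"
proof -
  have t: "t \<ge> 0" "a * (t + b) \<le> t" using assms xc_nonneg xc_iff[of t] by auto
  define u v where "u = sqrt t" and "v = sqrt (a * (t + b))"
  have uv: "0 \<le> v" "v \<le> u" "u\<^sup>2 = t" "v\<^sup>2 = a * (t + b)" using t a b by (auto simp: u_def v_def)
  have at: "a * t \<le> v\<^sup>2" unfolding uv using a b by (intro mult_left_mono) auto
  have "v\<^sup>2 \<le> u * v" unfolding power2_eq_square by (rule mult_right_mono[OF uv(2,1)])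
  then have "(u - v)\<^sup>2 \<le> t * (1 - a)"
    using at uv by (simp add: power2_diff algebra_simps)
  then show ?thesis using a t by (simp add: lo_eq u_def v_def divide_le_eq)
qed

lemma lo_le_xc: assumes "0 \<le> t" "t \<le> xc" shows "lo t \<le> xc"
proof -
  have t: "t \<ge> 0" "t \<le> a * (t + b)" using assms xc_iff[of t] by auto
  define u v where "u = sqrt t" and "v = sqrt (a * (t + b))"
  have uv: "0 \<le> u" "u \<le> v" "u\<^sup>2 = t" "v\<^sup>2 = a * (t + b)" using t a b by (auto simp: u_def v_def)
  have "u\<^sup>2 \<le> u * v" unfolding power2_eq_square by (rule mult_left_mono[OF uv(2,1)])
  then have "(u - v)\<^sup>2 \<le> a * (t + b) - t"
    using uv by (simp add: power2_diff algebra_simps)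
  also have "\<dots> \<le> a * b" using a t mult_right_mono[of a 1 t] by (simp add: algebra_simps)
  finally show ?thesis unfolding xc_def lo_eq[OF t(1)] u_def v_def using a by (intro divide_right_mono) auto
qed

lemma quad_neg_iff: "s > 0 \<Longrightarrow> quad s x < 0 \<longleftrightarrow> x < lo s \<or> hi s < x"
  using lo_less_hi[of s] by (auto simp: quad_factor mult_less_0_iff)

text \<open>By symmetry the set where \<open>quad\<close> is negative can be described from
  \<open>s\<close> or from \<open>t\<close>, each time by two branches of one curve; the bounds
  \<open>t \<le> hi t\<close> and, right of \<open>xc\<close>, \<open>lo t \<le> t\<close> select
  the branch. So right of \<open>xc\<close> the function \<open>lo\<close> is the inverse of
  \<open>hi\<close>.\<close>

lemma hi_less_iff:
  assumes s: "s > 0" and t: "t > 0"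
  shows "hi s < t \<longleftrightarrow> xc < t \<and> s < lo t"
proof
  assume h: "hi s < t"
  then have "quad t s < 0" using quad_neg_iff[OF s, of t] by (simp add: quad_sym)
  then have "s < lo t \<or> hi t < s" using quad_neg_iff[OF t] by simp
  then show "xc < t \<and> s < lo t" using hi_ge_self[of t] hi_ge_self[of s] s t h hi_gt_xc[OF s] by auto
next
  assume h: "xc < t \<and> s < lo t"
  then have "quad s t < 0" using quad_neg_iff[OF t, of s] by (simp add: quad_sym)
  then have "t < lo s \<or> hi s < t" using quad_neg_iff[OF s] by simp
  moreover have "\<not> t < lo s"
  proof
    assume "t < lo s"
    then show False using lo_le_self[of t] lo_le_self[of s] lo_le_xc[of s] h s by (cases "s \<ge> xc") auto
  qed
  ultimately show "hi s < t" by simp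
qed

text \<open>Left of \<open>xc\<close> the curve \<open>t = lo s\<close> falls from (0, xc) to (xc,
  0) and is its own mirror image in the diagonal.\<close>

lemma less_lo_iff:
  assumes s: "s > 0" and t: "t > 0"
  shows "t < lo s \<and> s < xc \<longleftrightarrow> t < xc \<and> s < lo t"
proof -
  have *: "t < lo s \<and> s < xc" if "t < xc" "s < lo t" "s > 0" "t > 0" for s t
  proof -
    have "s < xc" using lo_le_xc[of t] that by auto
    have "quad s t < 0" using quad_neg_iff[OF \<open>t > 0\<close>, of s] that by (simp add: quad_sym)
    then have "t < lo s \<or> hi s < t" using quad_neg_iff[OF \<open>s > 0\<close>] by simp
    then show ?thesis using hi_less_iff[of s t] that \<open>s < xc\<close> by auto
  qed
  show ?thesis using *[of t s] *[of s t] s t by auto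
qed

section \<open>The Meixner potential as an integral of Green functions\<close>

definition mpot :: "real \<Rightarrow> real" where
  "mpot x = ln (1 / a) * x - (x + b) * ln (x + b) + x * ln x + b"

lemma mpot_deriv:
  assumes "x > 0"
  shows "(mpot has_real_derivative ln (x / (a * (x + b)))) (at x)"
proof -
  have "ln (x / (a * (x + b))) = ln (1 / a) + ln x - ln (x + b)"
    using assms a b by (simp add: ln_div ln_mult)
  moreover have "(mpot has_real_derivative (ln (1 / a) - (ln (x + b) + (x + b) * (1 / (x + b))) + (ln x + x * (1 / x)))) (at x)"
    unfolding mpot_def using assms b by (auto intro!: derivative_eq_intros)
  moreover have "(x + b) * (1 / (x + b)) = 1" "x * (1 / x) = 1" using assms b by auto
  ultimately show ?thesis by (simp only:) (simp add: algebra_simps)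
qed

lemma mpot_continuous: "continuous_on {0..} mpot"
proof -
  have "continuous_on {0..} (\<lambda>x. (x + b) * ln (x + b))"
    by (rule continuous_on_compose2[OF continuous_on_xlnx]) (use b in \<open>auto intro!: continuous_intros\<close>)
  moreover have "continuous_on {0..} (\<lambda>x. ln (1 / a) * x)" by (intro continuous_intros)
  ultimately show ?thesis unfolding mpot_def
    by (intro continuous_on_add[OF continuous_on_add[OF continuous_on_diff continuous_on_xlnx] continuous_on_const])
qed

lemma mpot_min:
  assumes x: "x > 0"
  shows "mpot xc \<le> mpot x"
proof (cases "xc < x")
  case True
  show ?thesis
  proof (rule DERIV_nonneg_imp_increasing_open[OF less_imp_le[OF True]])
    show "\<exists>y. (mpot has_real_derivative y) (at t) \<and> 0 \<le> y" if t: "xc < t" "t < x" for t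
    proof -
      have "t > 0" "a * (t + b) > 0" "a * (t + b) \<le> t" using t xc_nonneg a b xc_iff(2)[of t] by (auto simp: add_pos_nonneg)
      then show ?thesis using mpot_deriv[of t] by (intro exI conjI) auto
    qed
    show "continuous_on {xc..x} mpot" using xc_nonneg by (intro continuous_on_subset[OF mpot_continuous]) auto
  qed
next
  case False
  then have "x \<le> xc" by simp
  then show ?thesis
  proof (rule DERIV_nonpos_imp_decreasing_open)
    show "\<exists>y. (mpot has_real_derivative y) (at t) \<and> y \<le> 0" if t: "x < t" "t < xc" for t
    proof -
      have "t > 0" "a * (t + b) > 0" "t \<le> a * (t + b)" using t x a b xc_iff(1)[of t] by (auto simp: add_pos_nonneg)
      then show ?thesis using mpot_deriv[of t] by (intro exI conjI) (auto simp: ln_le_zero_iff)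
    qed
    show "continuous_on {x..xc} mpot" using x by (intro continuous_on_subset[OF mpot_continuous]) auto
  qed
qed

text \<open>In the variable \<open>s\<close> the kernel belongs to the interval from
  \<open>lo t\<close> to \<open>hi t\<close>, so the integral is the Green function of that interval
  at the point 0. There the normalised coordinate is \<open>- (w + 1 / w) / 2\<close> with
  \<open>w\<^sup>2 = t / (a * (t + b))\<close>, hence the value \<open>\<bar>ln w\<bar>\<close>:
  half the absolute derivative of \<open>mpot\<close>.\<close>

lemma nn_integral_dual:
  assumes t: "t > 0"
  shows "(\<integral>\<^sup>+s. ennreal (indicator {0<..<lo t} s / sqrt (- quad s t)) \<partial>lborel) = ennreal (\<bar>ln (t / (a * (t + b)))\<bar> / 2)"
proof -
  have r: "rad t > 0" by (rule rad_pos[OF t])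
  have "- quad s t = (s - cen t)\<^sup>2 - (rad t)\<^sup>2" for s using quad_rad[of t s] t quad_sym[of s t] by simp
  then have "(\<integral>\<^sup>+s. ennreal (indicator {0<..<lo t} s / sqrt (- quad s t)) \<partial>lborel)
    = (\<integral>\<^sup>+s. ennreal (indicator {0<..<cen t - rad t} s / sqrt ((s - cen t)\<^sup>2 - (rad t)\<^sup>2)) \<partial>lborel)"
    by (simp add: lo_def)
  also have "\<dots> = ennreal (arcosh' ((0 - cen t) / rad t))"
    using lo_nonneg[of t] t by (intro nn_integral_inverse_sqrt' r) (simp add: lo_def)
  also have "arcosh' ((0 - cen t) / rad t) = \<bar>ln (t / (a * (t + b)))\<bar> / 2"
  proof -
    define p where "p = t / (a * (t + b))"
    have tb: "a * (t + b) > 0" using t a b by (simp add: add_pos_nonneg)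
    have p: "p > 0" using t tb by (simp add: p_def)
    define w where "w = sqrt p"
    have w: "w > 0" using p by (simp add: w_def)
    have wc: "cen t / rad t = (w + 1 / w) / 2"
    proof -
      have "sqrt (a * t * (t + b)) = w * (a * (t + b))"
      proof -
        have "a * t * (t + b) = p * (a * (t + b))\<^sup>2" using tb by (simp add: p_def power2_eq_square field_simps)
        then show ?thesis using tb by (simp add: real_sqrt_mult w_def)
      qed
      moreover have "t = w\<^sup>2 * (a * (t + b))"
      proof -
        have "a * (t + b) \<noteq> 0" using tb by linarith
        from iffD1[OF nonzero_eq_divide_eq[OF this] p_def] have "p * (a * (t + b)) = t" .
        then show ?thesis using p by (simp add: w_def)
      qed
      ultimately have "cen t / rad t = (w\<^sup>2 * (a * (t + b)) + a * (t + b)) / (2 * (w * (a * (t + b))))"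
        using a by (simp add: cen_def rad_def)
      also have "\<dots> = (w + 1 / w) / 2"
      proof -
        have "(w\<^sup>2 * K + K) / (2 * (w * K)) = (w + 1 / w) / 2" if "K > 0" for K
          using w that by (simp add: power2_eq_square field_simps)
        then show ?thesis using tb by blast
      qed
      finally show ?thesis .
    qed
    have "arcosh' ((w + 1 / w) / 2) = \<bar>ln w\<bar>"
    proof -
      define z where "z = (w + 1 / w) / 2"
      have zz: "z\<^sup>2 - 1 = ((w - 1 / w) / 2)\<^sup>2" using w by (simp add: z_def power2_eq_square divide_simps) (simp add: algebra_simps)?
      have z1: "z \<ge> 1"
      proof -
        have "0 \<le> (w - 1)\<^sup>2 / (2 * w)" using w by simp
        also have "\<dots> = z - 1" using w by (simp add: z_def power2_eq_square divide_simps) (simp add: algebra_simps)?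
        finally show ?thesis by simp
      qed
      then have "arcosh' z = ln (z + sqrt (z\<^sup>2 - 1))" by (auto simp: arcosh'_def)
      also have "\<dots> = ln (z + \<bar>w - 1 / w\<bar> / 2)" unfolding zz by simp
      also have "\<dots> = \<bar>ln w\<bar>"
      proof (cases "w \<ge> 1")
        case True
        then have "1 / w \<le> w" by (meson divide_le_eq_1_pos le_less_trans less_le order_trans w zero_less_one)
        then show ?thesis using True by (simp add: z_def field_simps)
      next
        case False
        then have "w \<le> 1 / w" using w by (simp add: field_simps mult_le_one)
        then have "z + \<bar>w - 1 / w\<bar> / 2 = 1 / w" by (simp add: z_def field_simps)
        then show ?thesis using False w by (simp add: ln_div)
      qed
      finally show ?thesis by (simp add: z_def)
    qed
    moreover have "(0 - cen t) / rad t = - (cen t / rad t)" by simp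
    moreover have "ln w = ln p / 2" using p by (simp add: w_def ln_sqrt)
    ultimately show ?thesis unfolding p_def[symmetric] wc[symmetric] by (simp add: arcosh'_minus)
  qed
  finally show ?thesis .
qed

text \<open>The Green function of the complement of [lo s, hi s] with pole at infinity, on the real
  line.\<close>

definition green :: "real \<Rightarrow> real \<Rightarrow> real" where
  "green s x = arcosh' ((x - cen s) / rad s)"

lemma green_nonneg: "0 \<le> green s x"
  by (simp add: green_def arcosh'_nonneg)

lemma borel_measurable_cen [measurable]: "cen \<in> borel_measurable borel" unfolding cen_def by measurable
lemma borel_measurable_rad [measurable]: "rad \<in> borel_measurable borel" unfolding rad_def by measurable
lemma borel_measurable_lo [measurable]: "lo \<in> borel_measurable borel" unfolding lo_def by measurable
lemma borel_measurable_hi [measurable]: "hi \<in> borel_measurable borel" unfolding hi_def by measurable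
lemma borel_measurable_quad [measurable (raw)]:
  assumes [measurable]: "f \<in> borel_measurable M" "g \<in> borel_measurable M"
  shows "(\<lambda>x. quad (f x) (g x)) \<in> borel_measurable M"
  unfolding quad_def by measurable
lemma borel_measurable_green [measurable (raw)]:
  assumes [measurable]: "f \<in> borel_measurable M" "g \<in> borel_measurable M"
  shows "(\<lambda>x. green (f x) (g x)) \<in> borel_measurable M"
  unfolding green_def by measurable

lemma green_eq_hi:
  assumes "s > 0" "hi s \<le> x"
  shows "ennreal (green s x) = (\<integral>\<^sup>+t. ennreal (indicator {hi s<..<x} t / sqrt (- quad s t)) \<partial>lborel)"
  using nn_integral_inverse_sqrt[OF rad_pos[OF assms(1)], of "cen s" x] assms
  by (simp add: green_def hi_def quad_rad)

lemma green_eq_lo: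
  assumes "s > 0" "x \<le> lo s"
  shows "ennreal (green s x) = (\<integral>\<^sup>+t. ennreal (indicator {x<..<lo s} t / sqrt (- quad s t)) \<partial>lborel)"
  using nn_integral_inverse_sqrt'[OF rad_pos[OF assms(1)], of x "cen s"] assms
  by (simp add: green_def lo_def quad_rad)

text \<open>Fubini for the kernel \<open>1 / sqrt (- quad s t)\<close>, whose symmetry exchanges the two variables.\<close>
lemma nn_integral_green:
  assumes x: "x > 0"
  shows "2 * (\<integral>\<^sup>+s. ennreal (indicator {0<..<lo x} s * green s x) \<partial>lborel) = ennreal (mpot x - mpot xc)"
proof -
  define k where "k s t = ennreal (1 / sqrt (- quad s t))" for s t
  have [measurable]: "(\<lambda>(s, t). k s t) \<in> borel_measurable lborel2"
    unfolding k_def by measurable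
  \<comment> \<open>\<open>J s\<close> is the range of \<open>t\<close> before the exchange of
    integrals and \<open>I\<close> the range after it; the two positions of \<open>x\<close>
    relative to \<open>xc\<close> differ only in this pair.\<close>
  have key: "2 * (\<integral>\<^sup>+s. ennreal (indicator {0<..<lo x} s * green s x) \<partial>lborel) = (\<integral>\<^sup>+t. ennreal (indicator I t * \<bar>ln (t / (a * (t + b)))\<bar>) \<partial>lborel)"
    if I: "I \<subseteq> {0<..}" and [measurable]: "I \<in> sets borel" "\<And>s. J s \<in> sets borel"
      "Measurable.pred lborel2 (\<lambda>(s, t). t \<in> J s)"
      and g: "\<And>s. s > 0 \<Longrightarrow> s < lo x \<Longrightarrow> ennreal (green s x) = (\<integral>\<^sup>+t. ennreal (indicator (J s) t / sqrt (- quad s t)) \<partial>lborel)"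
      and IJ: "\<And>s t. s > 0 \<Longrightarrow> t > 0 \<Longrightarrow> (s < lo x \<and> t \<in> J s) \<longleftrightarrow> (t \<in> I \<and> s < lo t)"
      and J: "\<And>s. s > 0 \<Longrightarrow> s < lo x \<Longrightarrow> J s \<subseteq> {0<..}"
    for I :: "real set" and J :: "real \<Rightarrow> real set"
  proof -
    have "(\<integral>\<^sup>+s. ennreal (indicator {0<..<lo x} s * green s x) \<partial>lborel)
      = (\<integral>\<^sup>+s. (\<integral>\<^sup>+t. indicator {0<..<lo x} s * (indicator (J s) t * k s t) \<partial>lborel) \<partial>lborel)"
      by (intro nn_integral_cong) (auto simp: indicator_def k_def g intro!: nn_integral_cong)
    also have "\<dots> = (\<integral>\<^sup>+s. (\<integral>\<^sup>+t. indicator I t * ennreal (indicator {0<..<lo t} s / sqrt (- quad s t)) \<partial>lborel) \<partial>lborel)"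
    proof (intro nn_integral_cong)
      fix s t :: real
      have "(s \<in> {0<..<lo x} \<and> t \<in> J s) \<longleftrightarrow> (t \<in> I \<and> s \<in> {0<..<lo t})"
        using IJ[of s t] I J[of s] by (cases "s > 0"; cases "t > 0") auto
      then show "indicator {0<..<lo x} s * (indicator (J s) t * k s t)
         = indicator I t * ennreal (indicator {0<..<lo t} s / sqrt (- quad s t))"
        unfolding k_def by (auto simp: indicator_def)
    qed
    also have "\<dots> = (\<integral>\<^sup>+t. (\<integral>\<^sup>+s. indicator I t * ennreal (indicator {0<..<lo t} s / sqrt (- quad s t)) \<partial>lborel) \<partial>lborel)"
    proof (rule lborel_pair.Fubini'[symmetric])
      have "(\<lambda>(s, t). indicator I t * ennreal (indicator {0<..<lo t} s / sqrt (- quad s t)))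
        = (\<lambda>(s, t). indicator I t * ennreal (if 0 < s \<and> s < lo t then 1 / sqrt (- quad s t) else 0))"
        by (auto simp: fun_eq_iff indicator_def)
      then show "(\<lambda>(s, t). indicator I t * ennreal (indicator {0<..<lo t} s / sqrt (- quad s t))) \<in> borel_measurable lborel2"
        by simp
    qed
    also have "\<dots> = (\<integral>\<^sup>+t. indicator I t * ennreal (\<bar>ln (t / (a * (t + b)))\<bar> / 2) \<partial>lborel)"
    proof (intro nn_integral_cong)
      fix t :: real
      show "(\<integral>\<^sup>+s. indicator I t * ennreal (indicator {0<..<lo t} s / sqrt (- quad s t)) \<partial>lborel)
        = indicator I t * ennreal (\<bar>ln (t / (a * (t + b)))\<bar> / 2)"
        using I nn_integral_dual[of t] by (subst nn_integral_cmult) (auto simp: indicator_def)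
    qed
    also have "2 * \<dots> = (\<integral>\<^sup>+t. 2 * (indicator I t * ennreal (\<bar>ln (t / (a * (t + b)))\<bar> / 2)) \<partial>lborel)"
      by (rule nn_integral_cmult[symmetric]) measurable
    also have "\<dots> = (\<integral>\<^sup>+t. ennreal (indicator I t * \<bar>ln (t / (a * (t + b)))\<bar>) \<partial>lborel)"
    proof (intro nn_integral_cong)
      fix t :: real
      have "2 * ennreal (r / 2) = ennreal r" if "r \<ge> 0" for r using that ennreal_mult'[of 2 "r / 2"] by simp
      then show "2 * (indicator I t * ennreal (\<bar>ln (t / (a * (t + b)))\<bar> / 2)) = ennreal (indicator I t * \<bar>ln (t / (a * (t + b)))\<bar>)"
        by (cases "t \<in> I") auto
    qed
    finally show ?thesis .
  qed
  have ftc: "(\<integral>\<^sup>+t. ennreal (indicator {u<..<v} t * \<bar>ln (t / (a * (t + b)))\<bar>) \<partial>lborel) = ennreal (\<bar>mpot v - mpot u\<bar>)"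
    if uv: "0 \<le> u" "u \<le> v" and sg: "v \<le> xc \<or> xc \<le> u" for u v
  proof -
    define \<sigma> where "\<sigma> = (if xc \<le> u then 1 else - 1 :: real)"
    have s: "\<bar>ln (t / (a * (t + b)))\<bar> = \<sigma> * ln (t / (a * (t + b)))" if t: "u < t" "t < v" for t
    proof -
      have tp: "t > 0" "a * (t + b) > 0" using t uv a b by (auto simp: add_pos_nonneg)
      show ?thesis
      proof (cases "xc \<le> u")
        case True
        then have "1 \<le> t / (a * (t + b))" using xc_iff(2)[of t] t tp by simp
        then show ?thesis using True by (simp add: \<sigma>_def)
      next
        case False
        then have "t / (a * (t + b)) \<le> 1" using xc_iff(1)[of t] t tp sg by simp
        then have "ln (t / (a * (t + b))) \<le> 0" using tp by simp
        then show ?thesis using False by (simp add: \<sigma>_def)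
      qed
    qed
    have "((\<lambda>t. \<sigma> * ln (t / (a * (t + b)))) has_integral (\<sigma> * mpot v - \<sigma> * mpot u)) {u..v}"
    proof (rule fundamental_theorem_of_calculus_interior[OF uv(2)])
      show "continuous_on {u..v} (\<lambda>x. \<sigma> * mpot x)"
        using uv by (intro continuous_intros continuous_on_subset[OF mpot_continuous]) auto
      show "((\<lambda>x. \<sigma> * mpot x) has_vector_derivative \<sigma> * ln (t / (a * (t + b)))) (at t)" if "t \<in> {u<..<v}" for t
        using that uv mpot_deriv[of t]
        by (auto simp: has_real_derivative_iff_has_vector_derivative[symmetric] intro!: DERIV_cmult)
    qed
    then have hi: "((\<lambda>t. \<sigma> * ln (t / (a * (t + b)))) has_integral (\<sigma> * mpot v - \<sigma> * mpot u)) {u<..<v}"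
      by (rule has_integral_Icc_iff_Ioo[THEN iffD1])
    have I: "(\<integral>\<^sup>+t. ennreal (indicator {u<..<v} t * (\<sigma> * ln (t / (a * (t + b))))) \<partial>lborel) = ennreal (\<sigma> * mpot v - \<sigma> * mpot u)"
      by (rule nn_integral_has_integral_lebesgue[OF _ hi]) (metis abs_ge_zero greaterThanLessThan_iff s)
    have "0 \<le> \<sigma> * mpot v - \<sigma> * mpot u"
      by (rule has_integral_nonneg[OF hi]) (metis abs_ge_zero greaterThanLessThan_iff s)
    then have "\<sigma> * mpot v - \<sigma> * mpot u = \<bar>mpot v - mpot u\<bar>" by (auto simp: \<sigma>_def split: if_splits)
    moreover have "(\<integral>\<^sup>+t. ennreal (indicator {u<..<v} t * \<bar>ln (t / (a * (t + b)))\<bar>) \<partial>lborel)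
      = (\<integral>\<^sup>+t. ennreal (indicator {u<..<v} t * (\<sigma> * ln (t / (a * (t + b))))) \<partial>lborel)"
      using s by (intro nn_integral_cong) (auto simp: indicator_def)
    ultimately show ?thesis using I by simp
  qed
  have mono: "mpot xc \<le> mpot x" by (rule mpot_min[OF x])
  show ?thesis
  proof (cases "xc < x")
    case True
    have "2 * (\<integral>\<^sup>+s. ennreal (indicator {0<..<lo x} s * green s x) \<partial>lborel) = (\<integral>\<^sup>+t. ennreal (indicator {xc<..<x} t * \<bar>ln (t / (a * (t + b)))\<bar>) \<partial>lborel)"
    proof (rule key[where J = "\<lambda>s. {hi s<..<x}"])
      show "Measurable.pred lborel2 (\<lambda>(s, t). t \<in> {hi s<..<x})"
        unfolding greaterThanLessThan_iff by measurable
      show "ennreal (green s x) = (\<integral>\<^sup>+t. ennreal (indicator {hi s<..<x} t / sqrt (- quad s t)) \<partial>lborel)"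
        if "s > 0" "s < lo x" for s
        using hi_less_iff[of s x] that True x by (intro green_eq_hi) auto
      show "(s < lo x \<and> t \<in> {hi s<..<x}) \<longleftrightarrow> (t \<in> {xc<..<x} \<and> s < lo t)" if "s > 0" "t > 0" for s t
        using hi_less_iff[of s t] hi_less_iff[of s x] that x by auto
      show "{hi s<..<x} \<subseteq> {0<..}" if "s > 0" for s using hi_ge_self[of s] that by auto
    qed (use xc_nonneg in auto)
    then show ?thesis using ftc[of xc x] True xc_nonneg mono by simp
  next
    case False
    have "2 * (\<integral>\<^sup>+s. ennreal (indicator {0<..<lo x} s * green s x) \<partial>lborel) = (\<integral>\<^sup>+t. ennreal (indicator {x<..<xc} t * \<bar>ln (t / (a * (t + b)))\<bar>) \<partial>lborel)"
    proof (rule key[where J = "\<lambda>s. if s < xc then {x<..<lo s} else {}"])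
      have eq: "(\<lambda>(s, t). t \<in> (if s < xc then {x<..<lo s} else {})) = (\<lambda>(s, t). s < xc \<and> x < t \<and> t < lo s)"
        by (auto simp: fun_eq_iff)
      show "Measurable.pred lborel2 (\<lambda>(s, t). t \<in> (if s < xc then {x<..<lo s} else {}))"
        unfolding eq by measurable
      show "ennreal (green s x) = (\<integral>\<^sup>+t. ennreal (indicator (if s < xc then {x<..<lo s} else {}) t / sqrt (- quad s t)) \<partial>lborel)"
        if s: "s > 0" "s < lo x" for s
      proof -
        \<comment> \<open>At \<open>x = xc\<close> the edge \<open>lo x\<close> is 0, so no
          \<open>s\<close> remains.\<close>
        have "x < xc"
        proof (rule ccontr)
          assume "\<not> x < xc"
          then have "x = xc" using False by simp
          then have "lo x = 0" using xc_iff(3)[of x] x by (simp add: lo_eq)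
          then show False using s by simp
        qed
        then have "x < lo s" "s < xc" using less_lo_iff[of s x] s x by auto
        then show ?thesis using green_eq_lo[of s x] s by simp
      qed
      show "(s < lo x \<and> t \<in> (if s < xc then {x<..<lo s} else {})) \<longleftrightarrow> (t \<in> {x<..<xc} \<and> s < lo t)" if "s > 0" "t > 0" for s t
        using less_lo_iff[of s t] less_lo_iff[of s x] that x by auto
      show "(if s < xc then {x<..<lo s} else {}) \<subseteq> {0<..}" if "s > 0" for s using x by auto
    qed (use x in auto)
    then show ?thesis using ftc[of x xc] False x mono by simp
  qed
qed

end

context meixner
begin

section \<open>The equilibrium density and its Euler-Lagrange conditions\<close>

lemma nn_integral_arcsine_quad: "s > 0 \<Longrightarrow> (\<integral>\<^sup>+x. ennreal (arcsine (quad s x)) \<partial>lborel) = 1"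
  using nn_integral_arcsine_eq_1[OF rad_pos, of s "cen s"] by (simp add: quad_rad)

text \<open>Symmetry of \<open>quad\<close> makes the arcsine density in \<open>x\<close> also one
  in \<open>s\<close>, on the interval from \<open>lo x\<close> to \<open>hi x\<close>. Its total
  mass 1 is what bounds \<open>mdens\<close>.\<close>

lemma arcsine_quad_integrable:
  assumes "x > 0"
  shows "integrable lborel (\<lambda>s. arcsine (quad s x))" "(LINT s|lborel. arcsine (quad s x)) = 1"
proof -
  have 1: "(\<integral>\<^sup>+s. ennreal (arcsine (quad s x)) \<partial>lborel) = 1"
    using nn_integral_arcsine_quad[OF assms] by (simp add: quad_sym[of x])
  show i: "integrable lborel (\<lambda>s. arcsine (quad s x))"
    by (rule integrableI_nonneg) (simp_all add: 1 arcsine_nonneg)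
  show "(LINT s|lborel. arcsine (quad s x)) = 1"
    using nn_integral_eq_integral[OF i] 1 arcsine_nonneg by simp
qed

text \<open>The limiting zero distribution of the Meixner polynomials: the average over \<open>s\<close> of the arcsine
  laws on the intervals \<open>[lo s, hi s]\<close> given by the recurrence coefficients.\<close>
definition mdens :: "real \<Rightarrow> real" where
  "mdens x = (if 0 < x then LINT s|lborel. indicator {0<..<1} s * arcsine (quad s x) else 0)"

lemma borel_measurable_mdens [measurable]: "mdens \<in> borel_measurable borel"
proof -
  have "(\<lambda>x. LINT s|lborel. indicator {0<..<1} s * arcsine (quad s x)) \<in> borel_measurable lborel"
    by (rule lborel.borel_measurable_lebesgue_integral) measurable
  then show ?thesis unfolding mdens_def by simp
qed

lemma integrable_arcsine_unit: "x > 0 \<Longrightarrow> integrable lborel (\<lambda>s. indicator {0<..<1} s * arcsine (quad s x))"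
  using integrable_mult_indicator[OF _ arcsine_quad_integrable(1)[of x], of "{0<..<1}"] by simp

lemma mdens_nonneg: "0 \<le> mdens x"
  unfolding mdens_def by (auto intro!: integral_nonneg_AE simp: arcsine_nonneg)

lemma mdens_le_1: "mdens x \<le> 1"
proof (cases "x > 0")
  case True
  have "(LINT s|lborel. indicator {0<..<1} s * arcsine (quad s x)) \<le> (LINT s|lborel. arcsine (quad s x))"
    by (rule integral_mono[OF integrable_arcsine_unit[OF True] arcsine_quad_integrable(1)[OF True]])
      (auto simp: indicator_def arcsine_nonneg)
  then show ?thesis using True arcsine_quad_integrable(2)[OF True] by (simp add: mdens_def)
qed (simp add: mdens_def)

lemma ennreal_mdens: "x > 0 \<Longrightarrow> ennreal (mdens x) = (\<integral>\<^sup>+s. ennreal (indicator {0<..<1} s * arcsine (quad s x)) \<partial>lborel)"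
  using nn_integral_eq_integral[OF integrable_arcsine_unit[of x]] by (simp add: mdens_def arcsine_nonneg)

lemma arcsine_quad_eq_0:
  assumes "s > 0" "x < lo s \<or> hi s < x"
  shows "arcsine (quad s x) = 0"
  using quad_neg_iff[OF assms(1), of x] assms by (simp add: arcsine_def)

text \<open>\<open>mdens x\<close> is the mass that the arcsine law in \<open>s\<close> on
  [lo x, hi x] gives to the unit interval. Here that law lies beyond 1 (void region); in
  \<open>mdens_eq_1\<close> it lies inside the unit interval (saturated region).\<close>

lemma mdens_eq_0_lo: assumes "x > 0" "1 \<le> lo x" shows "mdens x = 0"
proof -
  have "indicator {0<..<1} s * arcsine (quad s x) = 0" for s
    using arcsine_quad_eq_0[of x s] assms by (auto simp: indicator_def quad_sym[of s])
  then show ?thesis unfolding mdens_def by (simp only:) simp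
qed

lemma hi_mono: "0 \<le> s \<Longrightarrow> s \<le> t \<Longrightarrow> hi s \<le> hi t"
  using a b by (auto simp: hi_eq intro!: divide_right_mono power_mono add_mono)

lemma mdens_eq_0_hi: assumes "hi 1 < x" shows "mdens x = 0"
proof -
  have "indicator {0<..<1} s * arcsine (quad s x) = 0" for s
    using arcsine_quad_eq_0[of s x] hi_mono[of s 1] assms by (auto simp: indicator_def)
  then show ?thesis unfolding mdens_def by (simp only:) simp
qed

lemma mdens_eq_1: assumes x: "x > 0" "hi x \<le> 1" shows "mdens x = 1"
proof -
  have "(LINT s|lborel. indicator {0<..<1} s * arcsine (quad s x)) = (LINT s|lborel. arcsine (quad s x))"
  proof (rule integral_cong_AE)
    have "AE s in lborel. s \<noteq> (0::real)" "AE s in lborel. s \<noteq> (1::real)" by (rule AE_lborel_singleton)+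
    then show "AE s in lborel. indicator {0<..<1} s * arcsine (quad s x) = arcsine (quad s x)"
    proof eventually_elim
      case (elim s)
      then show ?case using arcsine_quad_eq_0[OF x(1), of s] lo_nonneg[of x] x
        by (cases "s < 0 \<or> 1 < s") (auto simp: quad_sym[of s] indicator_def)
    qed
  qed measurable
  then show ?thesis using x arcsine_quad_integrable(2)[of x] by (simp add: mdens_def)
qed

lemma mdens_nn_Fubini:
  assumes [measurable]: "h \<in> borel_measurable borel" and h0: "\<And>x. 0 \<le> h x"
  shows "(\<integral>\<^sup>+x. ennreal (mdens x * h x) \<partial>lborel)
    = (\<integral>\<^sup>+s. indicator {0<..<1} s * (\<integral>\<^sup>+x. ennreal (arcsine (quad s x) * h x) \<partial>lborel) \<partial>lborel)"
proof -
  have "(\<integral>\<^sup>+x. ennreal (mdens x * h x) \<partial>lborel) = (\<integral>\<^sup>+x. (\<integral>\<^sup>+s. indicator {0<..<1} s * ennreal (arcsine (quad s x) * h x) \<partial>lborel) \<partial>lborel)"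
  proof (rule nn_integral_cong_AE)
    show "AE x in lborel. ennreal (mdens x * h x) = (\<integral>\<^sup>+s. indicator {0<..<1} s * ennreal (arcsine (quad s x) * h x) \<partial>lborel)"
      using AE_lborel_singleton[of 0]
    proof eventually_elim
      case (elim x)
      show ?case
      proof (cases "x > 0")
        case True
        have "ennreal (mdens x * h x) = (\<integral>\<^sup>+s. ennreal (indicator {0<..<1} s * arcsine (quad s x)) \<partial>lborel) * ennreal (h x)"
          using ennreal_mdens[OF True] h0 by (simp add: ennreal_mult'')
        also have "\<dots> = (\<integral>\<^sup>+s. ennreal (indicator {0<..<1} s * arcsine (quad s x)) * ennreal (h x) \<partial>lborel)"
          by (rule nn_integral_multc[symmetric]) measurable
        also have "\<dots> = (\<integral>\<^sup>+s. indicator {0<..<1} s * ennreal (arcsine (quad s x) * h x) \<partial>lborel)"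
          by (intro nn_integral_cong) (auto simp: indicator_def ennreal_mult'' h0)
        finally show ?thesis .
      next
        case False
        then have "x < 0" using elim by simp
        have "indicator {0<..<1} s * ennreal (arcsine (quad s x) * h x) = 0" for s
          using arcsine_quad_eq_0[of s x] lo_nonneg[of s] \<open>x < 0\<close> by (auto simp: indicator_def)
        then show ?thesis using \<open>x < 0\<close> unfolding mdens_def by (simp only:) simp
      qed
    qed
  qed
  also have "\<dots> = (\<integral>\<^sup>+s. (\<integral>\<^sup>+x. indicator {0<..<1} s * ennreal (arcsine (quad s x) * h x) \<partial>lborel) \<partial>lborel)"
    by (rule lborel_pair.Fubini'[symmetric]) measurable
  also have "\<dots> = (\<integral>\<^sup>+s. indicator {0<..<1} s * (\<integral>\<^sup>+x. ennreal (arcsine (quad s x) * h x) \<partial>lborel) \<partial>lborel)"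
    by (intro nn_integral_cong nn_integral_cmult) measurable
  finally show ?thesis .
qed

lemma mdens_Fubini:
  assumes [measurable]: "h \<in> borel_measurable borel" and i: "integrable lborel (\<lambda>x. mdens x * h x)"
  shows "(LINT x|lborel. mdens x * h x) = (LINT s|lborel. indicator {0<..<1} s * (LINT x|lborel. arcsine (quad s x) * h x))"
    and "integrable lborel (\<lambda>s. indicator {0<..<1} s * (LINT x|lborel. arcsine (quad s x) * h x))"
proof -
  define f where "f s x = indicator {0<..<1} s * (arcsine (quad s x) * h x)" for s x
  have [measurable]: "(\<lambda>z. f (fst z) (snd z)) \<in> borel_measurable lborel2"
    unfolding f_def by measurable
  have "(\<integral>\<^sup>+z. ennreal (norm (f (fst z) (snd z))) \<partial>lborel2) = (\<integral>\<^sup>+s. \<integral>\<^sup>+x. ennreal (norm (f s x)) \<partial>lborel \<partial>lborel)"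
    by (subst lborel.nn_integral_fst[symmetric]) simp_all
  also have "\<dots> = (\<integral>\<^sup>+s. \<integral>\<^sup>+x. indicator {0<..<1} s * ennreal (arcsine (quad s x) * \<bar>h x\<bar>) \<partial>lborel \<partial>lborel)"
    by (intro nn_integral_cong) (auto simp: f_def indicator_def abs_mult arcsine_nonneg)
  also have "\<dots> = (\<integral>\<^sup>+s. indicator {0<..<1} s * (\<integral>\<^sup>+x. ennreal (arcsine (quad s x) * \<bar>h x\<bar>) \<partial>lborel) \<partial>lborel)"
    by (intro nn_integral_cong nn_integral_cmult) measurable
  also have "\<dots> = (\<integral>\<^sup>+x. ennreal (mdens x * \<bar>h x\<bar>) \<partial>lborel)"
    by (rule mdens_nn_Fubini[symmetric]) auto
  also have "\<dots> = (\<integral>\<^sup>+x. ennreal (norm (mdens x * h x)) \<partial>lborel)"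
    by (intro nn_integral_cong) (simp add: abs_mult mdens_nonneg)
  also have "\<dots> < \<infinity>" using i by (simp add: integrable_iff_bounded)
  finally have "integrable lborel2 (\<lambda>z. f (fst z) (snd z))" by (intro integrableI_bounded) simp_all
  then have int: "integrable lborel2 (\<lambda>(s, x). f s x)" by (simp add: case_prod_beta')
  have s: "(LINT x|lborel. f s x) = indicator {0<..<1} s * (LINT x|lborel. arcsine (quad s x) * h x)" for s
    unfolding f_def by simp
  have x: "AE x in lborel. (LINT s|lborel. f s x) = mdens x * h x"
    using AE_lborel_singleton[of 0]
  proof eventually_elim
    case (elim x)
    show ?case
    proof (cases "x > 0")
      case True
      then show ?thesis by (simp add: f_def mdens_def flip: mult.assoc)
    next
      case False
      then have "x < 0" using elim by simp
      have "f s x = 0" for s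
        using arcsine_quad_eq_0[of s x] lo_nonneg[of s] \<open>x < 0\<close> by (auto simp: f_def indicator_def)
      then show ?thesis using \<open>x < 0\<close> by (simp add: mdens_def)
    qed
  qed
  have xm: "(\<lambda>x. LINT s|lborel. f s x) \<in> borel_measurable lborel"
    by (rule lborel.borel_measurable_lebesgue_integral) (simp add: f_def case_prod_beta')
  have "(LINT x|lborel. mdens x * h x) = (LINT x|lborel. (LINT s|lborel. f s x))"
    by (rule integral_cong_AE) (use x xm in \<open>auto elim: eventually_mono\<close>)
  also have "\<dots> = (LINT s|lborel. (LINT x|lborel. f s x))"
    using lborel_pair.Fubini_integral[OF int] .
  finally show "(LINT x|lborel. mdens x * h x) = (LINT s|lborel. indicator {0<..<1} s * (LINT x|lborel. arcsine (quad s x) * h x))"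
    unfolding s .
  show "integrable lborel (\<lambda>s. indicator {0<..<1} s * (LINT x|lborel. arcsine (quad s x) * h x))"
    using lborel_pair.integrable_fst[OF int] unfolding s .
qed

lemma mdens_integral_1: "integrable lborel mdens" "integral\<^sup>L lborel mdens = 1"
proof -
  have "(\<integral>\<^sup>+x. ennreal (mdens x) \<partial>lborel) = (\<integral>\<^sup>+s. indicator {0<..<1} s * (\<integral>\<^sup>+x. ennreal (arcsine (quad s x)) \<partial>lborel) \<partial>lborel)"
    using mdens_nn_Fubini[of "\<lambda>_. 1"] by simp
  also have "\<dots> = (\<integral>\<^sup>+s. indicator {0<..<(1::real)} s \<partial>lborel)"
    by (intro nn_integral_cong) (auto simp: indicator_def nn_integral_arcsine_quad)
  finally have 1: "(\<integral>\<^sup>+x. ennreal (mdens x) \<partial>lborel) = 1" by simp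
  show i: "integrable lborel mdens" by (rule integrableI_nonneg) (simp_all add: 1 mdens_nonneg)
  show "integral\<^sup>L lborel mdens = 1" using nn_integral_eq_integral[OF i] 1 mdens_nonneg by simp
qed

lemma mdens_dens: "mdens \<in> dens"
proof -
  have "integrable lborel (\<lambda>x. x * mdens x)"
  proof (rule Bochner_Integration.integrable_bound)
    show "integrable lborel (\<lambda>x. hi 1 * mdens x)" using mdens_integral_1 by simp
    show "AE x in lborel. norm (x * mdens x) \<le> norm (hi 1 * mdens x)"
    proof (rule AE_I2)
      fix x
      show "norm (x * mdens x) \<le> norm (hi 1 * mdens x)"
      proof (cases "0 < x \<and> x \<le> hi 1")
        case True
        then show ?thesis by (simp add: abs_mult mult_right_mono)
      next
        case False
        then have "mdens x = 0" using mdens_eq_0_hi[of x] by (auto simp: mdens_def)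
        then show ?thesis by simp
      qed
    qed
  qed simp
  then show ?thesis using mdens_nonneg mdens_le_1 mdens_integral_1 by (auto simp: dens_def) (simp add: mdens_def)
qed

lemma mdens_mean: "(LINT x|lborel. x * mdens x) = 1 / 2 + a * (b + 1) / (1 - a)"
proof -
  have "(LINT x|lborel. mdens x * x) = (LINT s|lborel. indicator {0<..<1} s * (LINT x|lborel. arcsine (quad s x) * x))"
    by (rule mdens_Fubini) (use densD(7)[OF mdens_dens] in \<open>simp_all add: mult.commute\<close>)
  also have "\<dots> = (LINT s|lborel. cen s * indicator {0..1} s)"
  proof (rule integral_cong_AE)
    have "AE s in lborel. s \<noteq> (0::real)" "AE s in lborel. s \<noteq> (1::real)" by (rule AE_lborel_singleton)+
    then show "AE s in lborel. indicator {0<..<1} s * (LINT x|lborel. arcsine (quad s x) * x) = cen s * indicator {0..1} s"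
    proof eventually_elim
      case (elim s)
      then show ?case using arcsine_mean(1)[OF rad_pos, of s "cen s"]
        by (auto simp: indicator_def quad_rad)
    qed
    have "(\<lambda>s. LINT x|lborel. arcsine (quad s x) * x) \<in> borel_measurable lborel"
      by (rule lborel.borel_measurable_lebesgue_integral) measurable
    then show "(\<lambda>s. indicator {0<..<1} s * (LINT x|lborel. arcsine (quad s x) * x)) \<in> borel_measurable lborel"
      by simp
  qed measurable
  also have "\<dots> = ((1\<^sup>2 / 2 + a * (1\<^sup>2 / 2 + b * 1)) / (1 - a)) - ((0\<^sup>2 / 2 + a * (0\<^sup>2 / 2 + b * 0)) / (1 - a))"
  proof (rule integral_FTC_Icc_real)
    show "((\<lambda>s. (s\<^sup>2 / 2 + a * (s\<^sup>2 / 2 + b * s)) / (1 - a)) has_real_derivative cen s) (at s)" for s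
      unfolding cen_def by (rule DERIV_cdivide) (auto intro!: derivative_eq_intros simp: algebra_simps)
    show "isCont cen s" for s unfolding cen_def using a by (intro continuous_intros) auto
  qed simp
  also have "\<dots> = 1 / 2 + a * (b + 1) / (1 - a)" using a by (simp add: field_simps)
  finally show ?thesis by (simp add: mult.commute)
qed

lemma integrable_ln_rad: "integrable lborel (\<lambda>s. indicator {0<..<1} s * ln (rad s / 2))"
proof -
  have l: "integrable lborel (\<lambda>s. indicator {0<..<1} s * ln (s + c))" if c: "c \<ge> 0" for c :: real
  proof (rule Bochner_Integration.integrable_bound)
    have "integrable lborel (\<lambda>s. lnear (0 - (s + c)))"
      using lborel_integrable_real_affine[OF integrable_lnear(1)[of 0], of 1 c] by (simp add: add.commute)
    then show "integrable lborel (\<lambda>s. lnear (0 - (s + c)) + (1 + c) * indicator {0<..<1} s)" by simp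
    show "AE s in lborel. norm (indicator {0<..<1} s * ln (s + c)) \<le> norm (lnear (0 - (s + c)) + (1 + c) * indicator {0<..<1} s)"
    proof (rule AE_I2)
      fix s
      have "lnear (0 - (s + c)) = lnear (s + c)" by (simp only: lnear_def diff_0 abs_minus_cancel)
      then show "norm (indicator {0<..<1} s * ln (s + c)) \<le> norm (lnear (0 - (s + c)) + (1 + c) * indicator {0<..<1} s)"
        using abs_ln_abs_le[of "s + c"] c lnear_nonneg[of "s + c"] by (auto simp: indicator_def)
    qed
  qed measurable
  have "integrable lborel (\<lambda>s. 1/2 * (indicator {0<..<1} s * ln (s + 0) + indicator {0<..<1} s * ln (s + b)) + (ln a / 2 - ln (1 - a)) * indicator {0<..<1} s)"
    using l[of 0] l[OF b] by simp
  moreover have "(\<lambda>s. 1/2 * (indicator {0<..<1} s * ln (s + 0) + indicator {0<..<1} s * ln (s + b)) + (ln a / 2 - ln (1 - a)) * indicator {0<..<1} s)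
    = (\<lambda>s. indicator {0<..<1} s * ln (rad s / 2))"
  proof
    fix s
    show "1/2 * (indicator {0<..<1} s * ln (s + 0) + indicator {0<..<1} s * ln (s + b)) + (ln a / 2 - ln (1 - a)) * indicator {0<..<1} s
      = indicator {0<..<1} s * ln (rad s / 2)"
    proof (cases "s \<in> {0<..<1}")
      case True
      have r: "rad s / 2 = sqrt (a * s * (s + b)) / (1 - a)" using a by (simp add: rad_def divide_simps)
      have "a * s * (s + b) > 0" using True a b by (simp add: add_pos_nonneg)
      then have "ln (rad s / 2) = ln (sqrt (a * s * (s + b))) - ln (1 - a)"
        unfolding r using a by (subst ln_div) auto
      also have "ln (sqrt (a * s * (s + b))) = (ln a + ln s + ln (s + b)) / 2"
        using True a b by (simp add: ln_sqrt ln_mult add_pos_nonneg)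
      finally show ?thesis using True by (simp add: field_simps)
    qed simp
  qed
  ultimately show ?thesis by simp
qed

text \<open>Each arcsine law contributes the logarithm of its capacity, constant in
  \<open>X\<close>, and its Green function.\<close>

lemma log_potential_mdens:
  shows "log_potential mdens X = (LINT s|lborel. indicator {0<..<1} s * ln (rad s / 2)) + (LINT s|lborel. indicator {0<..<1} s * green s X)"
    and "integrable lborel (\<lambda>s. indicator {0<..<1} s * green s X)"
proof -
  have i: "integrable lborel (\<lambda>x. mdens x * ln \<bar>X - x\<bar>)"
    using integrable_log_kernel_inner[OF log_kernel_ln densD(8)[OF mdens_dens], of X] by (simp add: mult.commute)
  have eq: "indicator {0<..<1} s * (LINT x|lborel. arcsine (quad s x) * ln \<bar>X - x\<bar>)
      = indicator {0<..<1} s * ln (rad s / 2) + indicator {0<..<1} s * green s X" for s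
    using arcsine_log_potential(1)[OF rad_pos, of s "cen s" X]
    by (auto simp: indicator_def quad_rad green_def)
  note F = mdens_Fubini[OF _ i, unfolded eq]
  have "integrable lborel (\<lambda>s. (indicator {0<..<1} s * ln (rad s / 2) + indicator {0<..<1} s * green s X) - indicator {0<..<1} s * ln (rad s / 2))"
    by (rule Bochner_Integration.integrable_diff[OF F(2) integrable_ln_rad]) measurable
  then show i2: "integrable lborel (\<lambda>s. indicator {0<..<1} s * green s X)" by simp
  have "log_potential mdens X = (LINT x|lborel. mdens x * ln \<bar>X - x\<bar>)"
    unfolding log_potential_def by (simp add: mult.commute)
  also have "\<dots> = (LINT s|lborel. indicator {0<..<1} s * ln (rad s / 2) + indicator {0<..<1} s * green s X)"
    by (rule F(1)) measurable
  finally show "log_potential mdens X = (LINT s|lborel. indicator {0<..<1} s * ln (rad s / 2)) + (LINT s|lborel. indicator {0<..<1} s * green s X)"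
    using integrable_ln_rad i2 by simp
qed

lemma green_eq_0: assumes "s > 0" "x > 0" "lo x \<le> s" "s \<le> hi x" shows "green s x = 0"
proof -
  have "0 \<le> quad x s" using quad_neg_iff[OF assms(2), of s] assms by auto
  then have "(x - cen s)\<^sup>2 \<le> (rad s)\<^sup>2" using quad_rad[of s x] assms by (simp add: quad_sym)
  then have "\<bar>x - cen s\<bar> \<le> rad s" using rad_pos[OF assms(1)] by (metis abs_le_square_iff abs_of_pos)
  then show ?thesis using rad_pos[OF assms(1)] by (simp add: green_def arcosh'_def abs_divide)
qed

definition ell :: real where
  "ell = 2 * (LINT s|lborel. indicator {0<..<1} s * ln (rad s / 2)) - mpot xc"

text \<open>Up to constants, \<open>mpot x\<close> and twice the logarithmic potential are twice the
  integrals of \<open>green s x\<close> over \<open>s < lo x\<close> and over \<open>s < 1\<close>.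
  As \<open>green s x\<close> vanishes for \<open>s\<close> between \<open>lo x\<close> and
  \<open>hi x\<close>, their difference is positive only if \<open>1 \<le> lo x\<close> and negative
  only if \<open>hi x \<le> 1\<close>, which are the void and the saturated case.\<close>

lemma mdens_Euler_Lagrange:
  assumes x: "x > 0"
  shows "mpot x - 2 * log_potential mdens x + ell > 0 \<Longrightarrow> mdens x = 0"
    and "mpot x - 2 * log_potential mdens x + ell < 0 \<Longrightarrow> mdens x = 1"
proof -
  define A where "A u = (LINT s|lborel. indicator {0<..<u} s * green s x)" for u
  have i1: "integrable lborel (\<lambda>s. indicator {0<..<1} s * green s x)" by (rule log_potential_mdens(2))
  have nn: "2 * (\<integral>\<^sup>+s. ennreal (indicator {0<..<lo x} s * green s x) \<partial>lborel) = ennreal (mpot x - mpot xc)"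
    by (rule nn_integral_green[OF x])
  have i2: "integrable lborel (\<lambda>s. indicator {0<..<lo x} s * green s x)"
  proof (rule integrableI_nonneg)
    show "(\<integral>\<^sup>+s. ennreal (indicator {0<..<lo x} s * green s x) \<partial>lborel) < \<infinity>"
    proof (rule ccontr)
      assume "\<not> ?thesis"
      then have "(\<integral>\<^sup>+s. ennreal (indicator {0<..<lo x} s * green s x) \<partial>lborel) = \<infinity>" by (simp add: less_top[symmetric])
      with nn show False by (simp add: ennreal_mult_top)
    qed
  qed (simp_all add: green_nonneg)
  have A0: "0 \<le> A u" for u unfolding A_def by (intro integral_nonneg_AE) (simp add: green_nonneg)
  have "ennreal (2 * A (lo x)) = ennreal (mpot x - mpot xc)"
    using nn nn_integral_eq_integral[OF i2] green_nonneg A0[of "lo x"] by (simp add: A_def ennreal_mult'')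
  have mono: "mpot xc \<le> mpot x \<or> A (lo x) = 0"
    using \<open>ennreal (2 * A (lo x)) = _\<close> A0[of "lo x"] by (cases "mpot xc \<le> mpot x") (auto simp: ennreal_neg ennreal_eq_0_iff)
  have W0: "mpot x - 2 * log_potential mdens x + ell = mpot x - mpot xc - 2 * A 1"
    using log_potential_mdens(1)[of x] by (simp add: ell_def A_def)
  have V: "mpot x - mpot xc = 2 * A (lo x)"
    using \<open>ennreal (2 * A (lo x)) = _\<close> A0[of "lo x"] mpot_min[OF x] by (simp add: ennreal_inj)
  have W: "mpot x - 2 * log_potential mdens x + ell = 2 * (A (lo x) - A 1)" using W0 V by simp
  show "mdens x = 0" if "mpot x - 2 * log_potential mdens x + ell > 0"
  proof (cases "1 \<le> lo x")
    case False
    have "A (lo x) \<le> A 1" unfolding A_def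
      by (rule integral_mono[OF i2 i1]) (use False green_nonneg in \<open>auto simp: indicator_def\<close>)
    then show ?thesis using that W by simp
  qed (simp add: mdens_eq_0_lo x)
  show "mdens x = 1" if "mpot x - 2 * log_potential mdens x + ell < 0"
  proof (cases "hi x \<le> 1")
    case False
    have "A 1 \<le> A (lo x)" unfolding A_def
      by (rule integral_mono[OF i1 i2]) (use False green_nonneg green_eq_0[OF _ x] in \<open>auto simp: indicator_def\<close>)
    then show ?thesis using that W by simp
  qed (simp add: mdens_eq_1 x)
qed

text \<open>The second alternative admits potentials that are changed to the right of the support,
  in particular by a kink, as long as the effective potential stays nonnegative there.\<close>

lemma mdens_minimizes:
  assumes V: "tame V" and \<phi>: "\<phi> \<in> dens"
    and eq: "\<And>x. x > 0 \<Longrightarrow> V x = mpot x + c \<or> hi 1 < x \<and> 2 * log_potential mdens x - ell + c \<le> V x"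
  shows "weighted_energy V mdens \<le> weighted_energy V \<phi>"
proof (rule Euler_Lagrange_minimizer[OF V mdens_dens \<phi>, where l = "ell - c"])
  fix x :: real assume x: "x > 0"
  show "mdens x = 0" if "V x - 2 * log_potential mdens x + (ell - c) > 0"
    using eq[OF x] mdens_Euler_Lagrange(1)[OF x] mdens_eq_0_hi[of x] that by auto
  show "mdens x = 1" if "V x - 2 * log_potential mdens x + (ell - c) < 0"
    using eq[OF x] mdens_Euler_Lagrange(2)[OF x] that by auto
qed

lemma mdens_saturated:
  assumes "0 < x" "x < lo 1" "a * (b + 1) < 1"
  shows "mdens x = 1"
proof -
  have "xc < 1" using assms a by (simp add: xc_def field_simps)
  then have "hi x < 1" using hi_less_iff[of x 1] assms by simp
  then show ?thesis using mdens_eq_1[of x] assms by simp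
qed

text \<open>The interval [lo 1, hi 1] has length \<open>2 * rad 1\<close>, which tends to 0 with
  \<open>a\<close>; this is how the uniform density arises as the limit. At \<open>x = 0\<close> the
  two functions differ by convention.\<close>

lemma mdens_diff_uniform:
  assumes "a * (b + 1) < 1"
  shows "\<bar>mdens x - indicator {0..<1} x\<bar> \<le> indicator {lo 1..hi 1} x \<or> x = 0"
proof -
  have xc: "xc < 1" using assms a by (simp add: xc_def field_simps)
  have "lo 1 \<le> 1" "1 \<le> hi 1" using lo_le_self[of 1] hi_ge_self[of 1] xc by auto
  moreover have "\<bar>mdens x - indicator {0..<1} x\<bar> \<le> 1" using mdens_nonneg[of x] mdens_le_1[of x] by (auto simp: indicator_def)
  ultimately show ?thesis
    using mdens_saturated[of x] mdens_eq_0_hi[of x] assms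
    by (cases "x \<le> 0"; cases "x < lo 1"; cases "hi 1 < x") (auto simp: indicator_def mdens_def)
qed

end

section \<open>Value of the Meixner free energy\<close>

lemma tame_cong:
  assumes "tame V" "\<And>x. x \<ge> 0 \<Longrightarrow> V x = W x" "W \<in> borel_measurable borel"
  shows "tame W"
  using assms by (auto simp: tame_def)

lemma potential_measurable: "potential a q \<kappa> y \<in> borel_measurable borel"
  unfolding potential_def by measurable

lemma potential_tame:
  assumes a: "0 < a" "a < 1" and q: "0 < q" "q < 1" and k: "\<kappa> \<ge> 1"
  shows "tame (potential a q \<kappa> y)"
proof -
  define b where "b = \<kappa> - 1"
  define l where "l = ln (1 / a)"
  define L where "L = ln (1 / q)"
  have b: "b \<ge> 0" using k by (simp add: b_def)
  have l: "l > 0" using a by (simp add: l_def)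
  have L: "L > 0" using q by (simp add: L_def)
  have V: "potential a q \<kappa> y x = l * x + L * min x y - b * (ln (x + b) - 1) + x * ln (x / (x + b))" for x
    by (simp add: potential_def l_def L_def b_def algebra_simps)
  have xl0: "- b \<le> x * ln (x / (x + b)) \<and> x * ln (x / (x + b)) \<le> 0" if x: "x \<ge> 0" for x
  proof (cases "x = 0")
    case False
    then have x: "x > 0" using x by simp
    have "ln ((x + b) / x) \<le> (x + b) / x - 1" using x b by (intro ln_le_minus_one) auto
    then have "x * ln ((x + b) / x) \<le> x * ((x + b) / x - 1)" using x by (intro mult_left_mono) auto
    also have "\<dots> = b" using x by (simp add: field_simps)
    finally have "x * ln ((x + b) / x) \<le> b" .
    moreover have "ln ((x + b) / x) = - ln (x / (x + b))" using x b by (simp add: ln_div)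
    ultimately have "- b \<le> x * ln (x / (x + b))" by simp
    moreover
    have "ln (x / (x + b)) \<le> 0" using x b by (intro ln_le_zero_iff[THEN iffD2]) auto
    then have "x * ln (x / (x + b)) \<le> 0" using x by (intro mult_nonneg_nonpos) auto
    ultimately show ?thesis ..
  qed (use b in auto)
  note xl = xl0[THEN conjunct1] xl0[THEN conjunct2]
  have bl: "b * ln (x + b) \<le> b * ln (1 + b) + b * ln (1 + x)" "- (b * ln (x + b)) \<le> b * \<bar>ln b\<bar>" if x: "x \<ge> 0" for x
  proof -
    show "b * ln (x + b) \<le> b * ln (1 + b) + b * ln (1 + x)"
    proof (cases "b = 0")
      case False
      then have "b > 0" using b by simp
      have "x + b \<le> (1 + b) * (1 + x)" using x b by (simp add: algebra_simps)
      then have "ln (x + b) \<le> ln ((1 + b) * (1 + x))" using x \<open>b > 0\<close> by (intro ln_mono) auto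
      also have "\<dots> = ln (1 + b) + ln (1 + x)" using x b by (intro ln_mult_pos) auto
      finally have "b * ln (x + b) \<le> b * (ln (1 + b) + ln (1 + x))" using b by (rule mult_left_mono)
      then show ?thesis by (simp add: distrib_left)
    qed simp
    show "- (b * ln (x + b)) \<le> b * \<bar>ln b\<bar>"
    proof (cases "b = 0")
      case False
      then have "b > 0" using b by simp
      then have "ln b \<le> ln (x + b)" using x by (intro ln_mono) auto
      then have "b * (- ln (x + b)) \<le> b * \<bar>ln b\<bar>" using b by (intro mult_left_mono) auto
      then show ?thesis by simp
    qed simp
  qed
  \<comment> \<open>With this scale, \<open>ln (d * (1 + x)) \<le> d * (1 + x) - 1\<close> bounds
    \<open>(b + 2) * ln (1 + x)\<close> by \<open>l / 2 * x\<close> plus a constant: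
    \<open>b\<close> logarithms are lost in the potential, 2 are demanded by \<open>tame\<close>,
    and half of the linear term survives.\<close>
  define d where "d = l / (2 * (b + 2))"
  have d: "d > 0" using l b by (simp add: d_def)
  define C where "C = L * \<bar>y\<bar> + b * ln (1 + b) + b + (b + 2) * (d - 1 - ln d)"
  define D where "D = l + L + (b + b * \<bar>ln b\<bar>)"
  have lower: "2 * ln (1 + x) + l / 2 * x - C \<le> potential a q \<kappa> y x" if x: "0 \<le> x" for x
  proof -
    have "- \<bar>y\<bar> \<le> min x y" using x by auto
    then have "L * (- \<bar>y\<bar>) \<le> L * min x y" using L by (intro mult_left_mono) auto
    then have 1: "- (L * \<bar>y\<bar>) \<le> L * min x y" by simp
    have "ln (d * (1 + x)) \<le> d * (1 + x) - 1" using d x by (intro ln_le_minus_one) auto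
    moreover have "ln (d * (1 + x)) = ln d + ln (1 + x)" using d x by (intro ln_mult_pos) auto
    ultimately have "ln (1 + x) \<le> d * (1 + x) - 1 - ln d" by linarith
    then have "(b + 2) * ln (1 + x) \<le> (b + 2) * (d * (1 + x) - 1 - ln d)" using b by (intro mult_left_mono) auto
    also have "\<dots> = (b + 2) * d * x + (b + 2) * (d - 1 - ln d)" by (simp add: algebra_simps)
    also have "(b + 2) * d = l / 2" using b by (simp add: d_def field_simps)
    finally have 2: "(b + 2) * ln (1 + x) \<le> l / 2 * x + (b + 2) * (d - 1 - ln d)" .
    have "(b + 2) * ln (1 + x) = b * ln (1 + x) + 2 * ln (1 + x)" by (simp add: algebra_simps)
    moreover have "l * x = l / 2 * x + l / 2 * x" by simp
    moreover have "b * (ln (x + b) - 1) = b * ln (x + b) - b" by (simp add: algebra_simps)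
    ultimately show ?thesis
      unfolding V C_def using 1 2 xl(1)[OF x] bl(1)[OF x] b by linarith
  qed
  have upper: "potential a q \<kappa> y x \<le> D * (1 + x)" if x: "0 \<le> x" for x
  proof -
    have "L * min x y \<le> L * x" using L by (intro mult_left_mono) auto
    moreover have "b * (ln (x + b) - 1) = b * ln (x + b) - b" by (simp add: algebra_simps)
    ultimately have "potential a q \<kappa> y x \<le> (l + L) * x + (b + b * \<bar>ln b\<bar>) * 1"
      unfolding V using xl(2)[OF x] bl(2)[OF x] by (simp add: algebra_simps)
    also have "\<dots> \<le> (l + L + (b + b * \<bar>ln b\<bar>)) * (1 + x)"
      using x l L b by (simp add: algebra_simps add_nonneg_nonneg mult_nonneg_nonneg)
    finally show ?thesis by (simp add: D_def)
  qed
  have "l / 2 > 0" using l by simp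
  then show ?thesis unfolding tame_def using lower upper potential_measurable by blast
qed

section \<open>Energy of the uniform density\<close>

lemma has_integral_xlnx:
  assumes "0 \<le> (u::real)" "u \<le> v"
  shows "((\<lambda>x. x * ln x) has_integral ((v\<^sup>2 * ln v / 2 - v\<^sup>2 / 4) - (u\<^sup>2 * ln u / 2 - u\<^sup>2 / 4))) {u..v}"
proof (rule fundamental_theorem_of_calculus_interior[OF assms(2)])
  have "continuous_on {u..v} (\<lambda>x. x * (x * ln x) / 2 - x\<^sup>2 / 4)"
    by (intro continuous_on_diff continuous_on_divide continuous_on_mult[OF continuous_on_id continuous_on_subset[OF continuous_on_xlnx]] continuous_intros)
      (use assms in auto)
  then show "continuous_on {u..v} (\<lambda>x. x\<^sup>2 * ln x / 2 - x\<^sup>2 / 4)"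
    by (simp add: power2_eq_square mult.assoc)
  show "((\<lambda>x. x\<^sup>2 * ln x / 2 - x\<^sup>2 / 4) has_vector_derivative x * ln x) (at x)" if "x \<in> {u<..<v}" for x
    using that assms
    by (auto intro!: derivative_eq_intros simp: power2_eq_square field_simps simp flip: has_real_derivative_iff_has_vector_derivative)
qed

lemma lborel_integral_unit:
  fixes f :: "real \<Rightarrow> real"
  assumes "(f has_integral I) {0..1::real}" "continuous_on {0..1} f"
  shows "(LINT x|lborel. f x * indicator {0..<1} x) = I"
proof -
  have "set_integrable lborel {0..1} f" by (rule borel_integrable_atLeastAtMost') (rule assms(2))
  then have "(LINT x:{0..1}|lborel. f x) = integral {0..1} f" by (rule set_borel_integral_eq_integral(2))
  then have "(LINT x|lborel. indicator {0..1} x * f x) = I"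
    using assms(1) by (simp add: set_lebesgue_integral_def integral_unique)
  moreover have "(LINT x|lborel. f x * indicator {0..<1} x) = (LINT x|lborel. indicator {0..1} x * f x)"
  proof (rule integral_cong_AE)
    have m: "(\<lambda>x. indicator {0..1} x * f x) \<in> borel_measurable borel"
      using borel_measurable_integrable[OF \<open>set_integrable lborel {0..1} f\<close>[unfolded set_integrable_def]] by simp
    then show "(\<lambda>x. indicator {0..1} x * f x) \<in> borel_measurable lborel" by simp
    have "(\<lambda>x. f x * indicator {0..<1} x) = (\<lambda>x. (indicator {0..1} x * f x) * indicator {0..<1} x)"
      by (auto simp: indicator_def fun_eq_iff)
    then show "(\<lambda>x. f x * indicator {0..<1} x) \<in> borel_measurable lborel" using m by simp
    show "AE x in lborel. f x * indicator {0..<1} x = indicator {0..1} x * f x"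
      using AE_lborel_singleton[of 1] by eventually_elim (auto simp: indicator_def)
  qed
  ultimately show ?thesis by simp
qed

text \<open>On [0, 1) the logarithmic potential is
  \<open>x * ln x + (1 - x) * ln (1 - x) - 1\<close>, whose integral is -1/4 - 1/4 - 1.\<close>

lemma log_energy_uniform: "log_energy (indicator {0..<1}) (indicator {0..<1}) = 3 / 2"
proof -
  let ?u = "indicator {0..<1} :: real \<Rightarrow> real"
  have u: "bdd_moment ?u" by (rule densD(8)[OF dens_uniform])
  have lp: "log_potential ?u x = x * ln x + (1 - x) * ln (1 - x) - 1" if x: "0 \<le> x" "x < 1" for x
  proof -
    have i1: "(ln has_integral (x * ln x - x - (0 * ln 0 - 0))) {0..x}" using has_integral_ln[of 0 x] x by simp
    have "((\<lambda>t. ln (x - t)) has_integral (x * ln x - x)) {0..x}"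
      using has_integral_affinity[of ln "x * ln x - x" 0 x "- 1" x] i1 x by simp
    then have 1: "((\<lambda>t. ln \<bar>x - t\<bar>) has_integral (x * ln x - x)) {0..x}"
      by (rule has_integral_eq[rotated]) auto
    have i2: "(ln has_integral ((1 - x) * ln (1 - x) - (1 - x) - (0 * ln 0 - 0))) {0..1 - x}" using has_integral_ln[of 0 "1 - x"] x by simp
    have "((\<lambda>t. ln (t - x)) has_integral ((1 - x) * ln (1 - x) - (1 - x))) {x..1}"
      using has_integral_affinity[of ln "(1 - x) * ln (1 - x) - (1 - x)" 0 "1 - x" 1 "- x"] i2 x by simp
    then have 2: "((\<lambda>t. ln \<bar>x - t\<bar>) has_integral ((1 - x) * ln (1 - x) - (1 - x))) {x..1}"
      by (rule has_integral_eq[rotated]) (auto simp: abs_minus_commute)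
    have hi: "((\<lambda>t. ln \<bar>x - t\<bar>) has_integral (x * ln x + (1 - x) * ln (1 - x) - 1)) {0..1}"
      using has_integral_combine[OF _ _ 1 2] x by (simp add: algebra_simps)
    have int: "integrable lborel (\<lambda>t. ln \<bar>x - t\<bar> * ?u t)"
      using integrable_log_kernel_inner[OF log_kernel_ln u, of x] by simp
    have "(LINT t|lborel. ln \<bar>x - t\<bar> * ?u t) = integral UNIV (\<lambda>t. ln \<bar>x - t\<bar> * ?u t)"
      using int by (rule integral_lborel[symmetric])
    also have "\<dots> = integral {0..<1} (\<lambda>t. ln \<bar>x - t\<bar>)"
      by (subst integral_restrict_UNIV[symmetric]) (auto intro!: arg_cong[where f = "integral UNIV"] simp: indicator_def)
    also have "\<dots> = integral {0..1} (\<lambda>t. ln \<bar>x - t\<bar>)"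
      by (rule integral_spike_set) (auto intro: negligible_subset[of "{1}"])
    also have "\<dots> = x * ln x + (1 - x) * ln (1 - x) - 1" using hi by (rule integral_unique)
    finally show ?thesis by (simp add: log_potential_def)
  qed
  have h: "((\<lambda>x::real. x * ln x) has_integral (- (1/4))) {0..1}" using has_integral_xlnx[of 0 1] by simp
  have h': "((\<lambda>x::real. (1 - x) * ln (1 - x)) has_integral (- (1/4))) {0..1}"
    using has_integral_affinity[of "\<lambda>x::real. x * ln x" "- (1/4)" 0 1 "- 1" 1] h by simp
  have "((\<lambda>x::real. x * ln x + (1 - x) * ln (1 - x) - 1) has_integral (- (1/4) + - (1/4) - 1)) {0..1}"
    using has_integral_diff[OF has_integral_add[OF h h'] has_integral_const_real[of 1 0 1]] by simp
  moreover have "continuous_on {0..1} (\<lambda>x::real. x * ln x + (1 - x) * ln (1 - x) - 1)"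
    by (intro continuous_on_diff continuous_on_add continuous_on_const continuous_on_subset[OF continuous_on_xlnx]
        continuous_on_compose2[OF continuous_on_xlnx, of _ "\<lambda>x. 1 - x"] continuous_intros) auto
  ultimately have "(LINT x|lborel. (x * ln x + (1 - x) * ln (1 - x) - 1) * ?u x) = - (3/2)"
    by (subst lborel_integral_unit) simp_all
  moreover have "(LINT x|lborel. log_potential ?u x * ?u x) = (LINT x|lborel. (x * ln x + (1 - x) * ln (1 - x) - 1) * ?u x)"
    by (intro Bochner_Integration.integral_cong) (auto simp: indicator_def lp)
  ultimately show ?thesis using log_energy_potential(1)[OF u u] by simp
qed

section \<open>The free energy for large \<open>y\<close> and as a function of
  \<open>a\<close>\<close>

context meixner
begin

lemma mpot_eq_potential:
  assumes "0 < q" "x \<ge> 0"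
  shows "potential a q (b + 1) y x = mpot x + ln (1 / q) * min x y"
proof (cases "x = 0")
  case False
  then have "x * ln (x / (x + b)) = x * ln x - x * ln (x + b)"
    using assms b by (simp add: ln_div right_diff_distrib)
  then show ?thesis by (simp add: potential_def mpot_def algebra_simps)
qed (simp add: potential_def mpot_def algebra_simps)

lemma mpot_measurable: "mpot \<in> borel_measurable borel"
  unfolding mpot_def by measurable

lemma mpot_tame: "tame mpot"
proof (rule tame_cong)
  show "tame (potential a (1 / 2) (b + 1) 0)" using a b by (intro potential_tame) auto
  show "potential a (1 / 2) (b + 1) 0 x = mpot x" if "x \<ge> 0" for x
    using mpot_eq_potential[of "1 / 2" x 0] that by simp
qed (rule mpot_measurable)

definition free_energy :: real where "free_energy = weighted_energy mpot mdens"

lemma free_energy_le: "\<phi> \<in> dens \<Longrightarrow> free_energy \<le> weighted_energy mpot \<phi>"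
  unfolding free_energy_def by (rule mdens_minimizes[OF mpot_tame, where c = 0]) auto

lemma log_potential_le_ln:
  assumes "hi 1 < x"
  shows "log_potential mdens x \<le> ln x"
proof -
  have "log_potential mdens x \<le> (LINT t|lborel. ln x * mdens t)"
    unfolding log_potential_def
  proof (rule integral_mono)
    show "integrable lborel (\<lambda>t. ln \<bar>x - t\<bar> * mdens t)"
      using integrable_log_kernel_inner[OF log_kernel_ln densD(8)[OF mdens_dens], of x] by simp
    show "ln \<bar>x - t\<bar> * mdens t \<le> ln x * mdens t" for t
    proof (cases "0 < t \<and> t \<le> hi 1")
      case True
      then have "ln \<bar>x - t\<bar> \<le> ln x" using assms by (intro ln_mono) auto
      then show ?thesis by (intro mult_right_mono mdens_nonneg)
    next
      case False
      then have "mdens t = 0" using mdens_eq_0_hi[of t] by (auto simp: mdens_def)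
      then show ?thesis by simp
    qed
  qed (use mdens_integral_1 in auto)
  then show ?thesis using mdens_integral_1 by simp
qed

end

text \<open>Left of the kink \<open>min x y = x\<close>, so there the \<open>q\<close>-term of
  \<open>potential\<close> merely replaces \<open>a\<close> by \<open>a * q\<close>.\<close>

lemma meixner_mpot_scale:
  assumes "meixner a b" "0 < q" "q < 1"
  shows "meixner (a * q) b" "meixner.mpot (a * q) b x = meixner.mpot a b x + ln (1 / q) * x"
proof -
  interpret A: meixner a b by fact
  show m: "meixner (a * q) b"
    using A.a A.b assms mult_strict_mono[of a 1 q 1] by unfold_locales auto
  interpret B: meixner "a * q" b by fact
  have "ln (1 / (a * q)) = ln (1 / a) + ln (1 / q)" using A.a assms by (simp add: ln_div ln_mult)
  then show "meixner.mpot (a * q) b x = meixner.mpot a b x + ln (1 / q) * x"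
    by (simp add: A.mpot_def B.mpot_def distrib_right)
qed

lemma equilibrium_energy_min:
  assumes "tame V" "\<psi> \<in> dens" "\<And>\<phi>. \<phi> \<in> dens \<Longrightarrow> weighted_energy V \<psi> \<le> weighted_energy V \<phi>"
  shows "equilibrium_energy V = weighted_energy V \<psi>"
  unfolding equilibrium_energy_eq[OF assms(1)]
  by (rule cInf_eq_minimum) (use assms in auto)

text \<open>For large \<open>y\<close> the kink of the potential lies outside the support of the minimiser for the
  parameter \<open>a q\<close>.\<close>
lemma F_eq_large:
  assumes m: "meixner a b" and q: "0 < q" "q < 1"
  obtains Y where "\<And>y. y \<ge> Y \<Longrightarrow> F_eq a q (b + 1) y = meixner.free_energy (a * q) b"
proof -
  interpret A: meixner a b by fact
  interpret B: meixner "a * q" b by (rule meixner_mpot_scale(1)[OF m q])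
  obtain e C where e: "e > 0" and C: "\<And>x. x \<ge> 0 \<Longrightarrow> 2 * ln (1 + x) + e * x - C \<le> A.mpot x"
    using A.mpot_tame by (auto simp: tame_def)
  \<comment> \<open>Beyond \<open>Y\<close> there is no support of the new minimiser, and the linear
    surplus in the growth of \<open>mpot\<close> outweighs \<open>ell\<close>, which keeps the
    effective potential nonnegative past the kink; the 1 keeps \<open>x\<close> positive.\<close>
  define Y where "Y = Max {B.hi 1, 1, (C - B.ell) / e}"
  have Y: "B.hi 1 \<le> Y" "1 \<le> Y" "(C - B.ell) / e \<le> Y" by (auto simp: Y_def)
  have "F_eq a q (b + 1) y = B.free_energy" if y: "y \<ge> Y" for y
  proof -
    let ?V = "potential a q (b + 1) y"
    have t: "tame ?V" using A.a A.b q by (intro potential_tame) auto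
    have le: "?V x = B.mpot x" if "0 \<le> x" "x \<le> y" for x
      using A.mpot_eq_potential[of q x y] that q meixner_mpot_scale(2)[OF m q] by simp
    have ge: "B.hi 1 < x \<and> 2 * log_potential B.mdens x - B.ell \<le> ?V x" if x: "y < x" for x
    proof
      show "B.hi 1 < x" using x y Y by simp
      then have "log_potential B.mdens x \<le> ln x" by (rule B.log_potential_le_ln)
      moreover have "ln x \<le> ln (1 + x)" using x y Y by (intro ln_mono) auto
      moreover have "C - B.ell \<le> e * x"
      proof -
        have "(C - B.ell) / e \<le> x" using x y Y by simp
        then show ?thesis using e by (simp add: divide_le_eq mult.commute)
      qed
      moreover have "A.mpot x \<le> ?V x"
        using A.mpot_eq_potential[of q x y] x y Y q by simp
      moreover have "2 * ln (1 + x) + e * x - C \<le> A.mpot x" using C[of x] x y Y by simp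
      ultimately show "2 * log_potential B.mdens x - B.ell \<le> ?V x" by linarith
    qed
    have "equilibrium_energy ?V = weighted_energy ?V B.mdens"
    proof (rule equilibrium_energy_min[OF t B.mdens_dens])
      fix \<phi> assume "\<phi> \<in> dens"
      then show "weighted_energy ?V B.mdens \<le> weighted_energy ?V \<phi>"
      proof (rule B.mdens_minimizes[OF t, where c = 0])
        show "?V x = B.mpot x + 0 \<or> B.hi 1 < x \<and> 2 * log_potential B.mdens x - B.ell + 0 \<le> ?V x" if "x > 0" for x
          using le[of x] ge[of x] that by (cases "x \<le> y") auto
      qed
    qed
    also have "\<dots> = B.free_energy"
    proof -
      have "(LINT x|lborel. ?V x * B.mdens x) = (LINT x|lborel. B.mpot x * B.mdens x)"
      proof (rule Bochner_Integration.integral_cong[OF refl])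
        fix x
        show "?V x * B.mdens x = B.mpot x * B.mdens x"
          using le[of x] ge[of x] B.mdens_eq_0_hi[of x] densD(4)[OF B.mdens_dens, of x]
          by (cases "x < 0"; cases "x \<le> y") auto
      qed
      then show ?thesis by (simp add: B.free_energy_def weighted_energy_def)
    qed
    finally show ?thesis by (simp add: F_eq_def)
  qed
  then show ?thesis using that by blast
qed

text \<open>The slope \<open>1 / 2 + a * (b + 1) / (1 - a)\<close> is the mean of the minimiser.\<close>
lemma free_energy_supergradient:
  assumes "meixner a b" "meixner a' b"
  shows "meixner.free_energy a' b \<le> meixner.free_energy a b + (ln (1 / a') - ln (1 / a)) * (1 / 2 + a * (b + 1) / (1 - a))"
proof -
  interpret A: meixner a b by fact
  interpret B: meixner a' b by fact
  note d = densD[OF A.mdens_dens]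
  have eq: "B.mpot x = A.mpot x + (ln (1 / a') - ln (1 / a)) * x" for x
    by (simp add: A.mpot_def B.mpot_def algebra_simps)
  have "B.free_energy \<le> weighted_energy B.mpot A.mdens" by (rule B.free_energy_le[OF A.mdens_dens])
  also have "\<dots> = A.free_energy + (ln (1 / a') - ln (1 / a)) * (LINT x|lborel. x * A.mdens x)"
  proof -
    have "(LINT x|lborel. B.mpot x * A.mdens x)
      = (LINT x|lborel. A.mpot x * A.mdens x + (ln (1 / a') - ln (1 / a)) * (x * A.mdens x))"
      by (simp add: eq algebra_simps)
    also have "\<dots> = (LINT x|lborel. A.mpot x * A.mdens x) + (ln (1 / a') - ln (1 / a)) * (LINT x|lborel. x * A.mdens x)"
      using integrable_tame[OF A.mpot_tame d(8) d(4)] d(7) by simp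
    finally show ?thesis by (simp add: A.free_energy_def weighted_energy_def)
  qed
  finally show ?thesis by (simp add: A.mdens_mean)
qed

text \<open>With \<open>x\<close> and \<open>y\<close> exchanged, the inequality bounds the
  difference quotient from the other side by \<open>m y\<close>; continuity of \<open>m\<close>
  closes the gap.\<close>

lemma supergradient_imp_DERIV:
  fixes H m :: "real \<Rightarrow> real"
  assumes S: "open S" "x \<in> S" and sg: "\<And>x y. x \<in> S \<Longrightarrow> y \<in> S \<Longrightarrow> H y \<le> H x + (y - x) * m x"
    and m: "isCont m x"
  shows "(H has_real_derivative m x) (at x)"
proof -
  have "((\<lambda>y. (H y - H x) / (y - x) - m x) \<longlongrightarrow> 0) (at x)"
  proof (rule Lim_null_comparison)
    have "\<forall>\<^sub>F y in at x. y \<in> S" using S by (rule eventually_at_in_open')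
    then show "\<forall>\<^sub>F y in at x. norm ((H y - H x) / (y - x) - m x) \<le> \<bar>m y - m x\<bar>"
      using eventually_neq_at_within[of x x UNIV]
    proof eventually_elim
      case (elim y)
      have 1: "H y - H x \<le> (y - x) * m x" and 2: "(y - x) * m y \<le> H y - H x"
        using sg[of x y] sg[of y x] elim S by (auto simp: algebra_simps)
      show ?case
      proof (cases "x < y")
        case True
        then have "(H y - H x) / (y - x) \<le> m x" "m y \<le> (H y - H x) / (y - x)"
          using 1 2 by (simp_all add: divide_le_eq le_divide_eq mult.commute)
        then show ?thesis by auto
      next
        case False
        then have "y < x" using elim by simp
        then have "m x \<le> (H y - H x) / (y - x)" "(H y - H x) / (y - x) \<le> m y"
          using 1 2 by (simp_all add: divide_le_eq le_divide_eq mult.commute)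
        then show ?thesis by auto
      qed
    qed
    show "((\<lambda>y. \<bar>m y - m x\<bar>) \<longlongrightarrow> 0) (at x)"
      using m unfolding isCont_def by (intro tendsto_rabs_zero) (simp add: LIM_zero)
  qed
  then show ?thesis by (simp add: has_field_derivative_iff LIM_zero_iff)
qed

lemma free_energy_const:
  assumes b: "b \<ge> 0"
  obtains K where "\<And>a. 0 < a \<Longrightarrow> a < 1 \<Longrightarrow> meixner.free_energy a b = (b + 1) * ln (1 - a) - ln a / 2 + K"
proof -
  define H where "H l = meixner.free_energy (exp (- l)) b" for l
  define m where "m l = 1 / 2 + exp (- l) * (b + 1) / (1 - exp (- l))" for l :: real
  \<comment> \<open>An antiderivative of the mean \<open>m\<close> in the variable
    \<open>l = ln (1 / a)\<close>, to be matched with \<open>H\<close>.\<close>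
  define E where "E l = (b + 1) * ln (1 - exp (- l)) + l / 2" for l
  have M: "meixner (exp (- l)) b" if "l > 0" for l using that b by unfold_locales auto
  have dH: "(H has_real_derivative m l) (at l)" if l: "l > 0" for l
  proof (rule supergradient_imp_DERIV)
    show "open {0::real<..}" "l \<in> {0<..}" using l by auto
    show "H y \<le> H x + (y - x) * m x" if "x \<in> {0<..}" "y \<in> {0<..}" for x y
      using free_energy_supergradient[OF M M, of x y] that by (simp add: H_def m_def ln_div)
    show "isCont m l" unfolding m_def using l by (intro continuous_intros) auto
  qed
  have dE: "(E has_real_derivative m l) (at l)" if l: "l > 0" for l
  proof -
    have "(E has_real_derivative ((b + 1) * (exp (- l) / (1 - exp (- l))) + 1 / 2)) (at l)"
      unfolding E_def using l by (auto intro!: derivative_eq_intros)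
    then show ?thesis by (simp add: m_def mult.commute add.commute)
  qed
  have const: "H x - E x = H 1 - E 1" if "x > 0" for x
  proof -
    have "((\<lambda>l. H l - E l) has_real_derivative 0) (at l)" if "l > 0" for l
      using DERIV_diff[OF dH[OF that] dE[OF that]] by simp
    then have "\<And>l. l \<in> {0<..} \<Longrightarrow> ((\<lambda>l. H l - E l) has_real_derivative 0) (at l within {0<..})"
      by (auto intro: has_field_derivative_at_within)
    then show ?thesis
      using has_field_derivative_zero_constant[of "{0<..}" "\<lambda>l. H l - E l"] that by force
  qed
  have "meixner.free_energy a b = (b + 1) * ln (1 - a) - ln a / 2 + (H 1 - E 1)" if "0 < a" "a < 1" for a
    using const[of "- ln a"] that by (simp add: H_def E_def)
  then show ?thesis using that by blast
qed

text \<open>The bound is the same for all densities with values in [0, 1] on [0, 2]: 2 for the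
  singular part and 2 for the distance of two points.\<close>

lemma log_potential_bounded:
  assumes f: "bdd_moment f" "\<And>x. 0 \<le> f x" "\<And>x. f x \<le> 1" "\<And>x. x < 0 \<Longrightarrow> f x = 0" "\<And>x. x > 2 \<Longrightarrow> f x = 0"
    and one: "integral\<^sup>L lborel f = 1" and x: "0 \<le> x" "x \<le> 2"
  shows "\<bar>log_potential f x\<bar> \<le> 4"
proof -
  note i = bdd_momentD(2)[OF f(1)]
  have "\<bar>log_potential f x\<bar> \<le> (LINT t|lborel. lnear (x - t) + 2 * f t)"
    unfolding log_potential_def
  proof (rule order_trans[OF integral_abs_bound integral_mono])
    show "integrable lborel (\<lambda>t. \<bar>ln \<bar>x - t\<bar> * f t\<bar>)"
      using integrable_abs[OF integrable_log_kernel_inner[OF log_kernel_ln f(1), of x]] by simp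
    show "integrable lborel (\<lambda>t. lnear (x - t) + 2 * f t)" using i integrable_lnear(1)[of x] by simp
    fix t
    show "\<bar>ln \<bar>x - t\<bar> * f t\<bar> \<le> lnear (x - t) + 2 * f t"
    proof (cases "t < 0 \<or> t > 2")
      case False
      have "\<bar>ln \<bar>x - t\<bar> * f t\<bar> \<le> (lnear (x - t) + \<bar>x - t\<bar>) * f t"
        using abs_ln_abs_le[of "x - t"] f(2)[of t] by (simp add: abs_mult mult_right_mono)
      also have "\<dots> \<le> lnear (x - t) * 1 + 2 * f t"
        unfolding distrib_right using False x f(2,3)[of t] lnear_nonneg[of "x - t"]
        by (intro add_mono mult_mono) auto
      finally show ?thesis by simp
    qed (use f(4,5) lnear_nonneg[of "x - t"] in auto)
  qed
  also have "\<dots> = (LINT t|lborel. lnear (x - t)) + 2" using i one integrable_lnear(1)[of x] by simp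
  also have "\<dots> \<le> 4" using integrable_lnear(2)[of x] by simp
  finally show ?thesis .
qed

text \<open>The mean times \<open>ln (1 / a)\<close> is the linear part of the energy and contains
  all that diverges. What remains is the energy of \<open>mdens\<close> in a potential independent
  of \<open>a\<close>; it converges to that of the uniform density, from which \<open>mdens\<close>
  differs on a short interval only.\<close>

lemma free_energy_limit:
  assumes b: "b \<ge> 0"
  shows "((\<lambda>a. meixner.free_energy a b - ln (1 / a) * (1 / 2 + a * (b + 1) / (1 - a))) \<longlongrightarrow> - C_const (b + 1)) (at_right 0)"
proof -
  let ?u = "indicator {0..<1} :: real \<Rightarrow> real"
  define V0 where "V0 x = x * ln x - (x + b) * ln (x + b) + b" for x
  have V0c: "continuous_on {0..} V0"
  proof -
    have "continuous_on {0..} (\<lambda>x. (x + b) * ln (x + b))"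
      by (rule continuous_on_compose2[OF continuous_on_xlnx]) (use b in \<open>auto intro!: continuous_intros\<close>)
    then show ?thesis unfolding V0_def
      by (intro continuous_on_add[OF continuous_on_diff[OF continuous_on_xlnx] continuous_on_const])
  qed
  have V0m [measurable]: "V0 \<in> borel_measurable borel" unfolding V0_def by measurable
  note u = densD[OF dens_uniform]
  \<comment> \<open>The limiting value; its explicit computation is what produces
    \<open>C_const\<close>.\<close>
  define K where "K = log_energy ?u ?u + (LINT x|lborel. V0 x * ?u x)"
  have "compact (V0 ` {0..2})" by (rule compact_continuous_image[OF continuous_on_subset[OF V0c]]) auto
  then obtain M where M: "\<And>x. 0 \<le> x \<Longrightarrow> x \<le> 2 \<Longrightarrow> \<bar>V0 x\<bar> \<le> M"
    using compact_imp_bounded bounded_iff[of "V0 ` {0..2}"] by force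
  define rd where "rd a = 4 * sqrt (a * (1 + b)) / (1 - a)" for a
  \<comment> \<open>The factor collects 4 for each of the two logarithmic potentials and
    \<open>M\<close> for \<open>V0\<close>; \<open>rd a\<close> is the length of the interval where
    the densities differ. The last premise says \<open>hi 1 \<le> 2\<close>.\<close>
  have bound: "\<bar>meixner.free_energy a b - ln (1 / a) * (1 / 2 + a * (b + 1) / (1 - a)) - K\<bar> \<le> (8 + M) * rd a"
    if a: "0 < a" "a * (b + 1) < 1" and hi2: "(1 + sqrt (a * (1 + b)))\<^sup>2 / (1 - a) \<le> 2" for a
  proof -
    have "a * 1 \<le> a * (b + 1)" using a b by (intro mult_left_mono) auto
    then have a1: "a < 1" using a by linarith
    interpret A: meixner a b using a a1 b by unfold_locales
    note d = densD[OF A.mdens_dens]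
    have hi2: "A.hi 1 \<le> 2" using hi2 by (simp add: A.hi_eq)
    define r where "r x = A.mdens x - ?u x" for x
    have rm: "bdd_moment r" unfolding r_def by (intro bdd_moment_diff d(8) u(8))
    have [measurable]: "r \<in> borel_measurable borel" using rm by (simp add: bdd_moment_def)
    have ae: "AE x in lborel. \<bar>r x\<bar> \<le> indicator {A.lo 1..A.hi 1} x"
      using AE_lborel_singleton[of 0] by eventually_elim (use A.mdens_diff_uniform[OF a(2)] in \<open>auto simp: r_def\<close>)
    have hl: "A.hi 1 - A.lo 1 = rd a" by (simp add: A.hi_def A.lo_def A.rad_def rd_def)
    have "A.lo 1 \<le> A.hi 1" using A.lo_less_hi[of 1] by simp
    have lo0: "A.lo 1 \<ge> 0" by (rule A.lo_nonneg) simp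
    have gen: "\<bar>LINT x|lborel. g x * r x\<bar> \<le> c * rd a"
      if g: "integrable lborel (\<lambda>x. g x * r x)" and gc: "\<And>x. 0 \<le> x \<Longrightarrow> x \<le> 2 \<Longrightarrow> \<bar>g x\<bar> \<le> c" for g c
    proof -
      have c0: "c \<ge> 0" using gc[of 0] by simp
      have ind: "integrable lborel (\<lambda>x. c * indicator {A.lo 1..A.hi 1} x)"
        using \<open>A.lo 1 \<le> A.hi 1\<close> by (intro integrable_mult_right integrable_real_indicator) simp_all
      have "\<bar>LINT x|lborel. g x * r x\<bar> \<le> (LINT x|lborel. c * indicator {A.lo 1..A.hi 1} x)"
      proof (rule order_trans[OF integral_abs_bound integral_mono_AE])
        show "integrable lborel (\<lambda>x. \<bar>g x * r x\<bar>)" using g by simp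
        show "AE x in lborel. \<bar>g x * r x\<bar> \<le> c * indicator {A.lo 1..A.hi 1} x" using ae
        proof eventually_elim
          case (elim x)
          show ?case
          proof (cases "x \<in> {A.lo 1..A.hi 1}")
            case True
            then have "\<bar>g x\<bar> \<le> c" using gc[of x] lo0 hi2 by simp
            moreover have "\<bar>r x\<bar> \<le> 1" using elim True by simp
            ultimately have "\<bar>g x\<bar> * \<bar>r x\<bar> \<le> c * 1" by (intro mult_mono) auto
            then show ?thesis using True by (simp add: abs_mult)
          next
            case False
            then have "r x = 0" using elim by simp
            then show ?thesis using c0 by simp
          qed
        qed
      qed (rule ind)
      also have "\<dots> = c * rd a" using \<open>A.lo 1 \<le> A.hi 1\<close> hl by simp
      finally show ?thesis .
    qed
    have e1: "\<bar>log_energy r A.mdens\<bar> \<le> 4 * rd a"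
      unfolding log_energy_potential(1)[OF rm d(8)] abs_minus_cancel
    proof (rule gen[OF log_energy_potential(2)[OF rm d(8)]])
      show "\<bar>log_potential A.mdens x\<bar> \<le> 4" if "0 \<le> x" "x \<le> 2" for x
        by (rule log_potential_bounded[OF d(8) d(2) d(3) d(4) _ d(6)]) (use that hi2 A.mdens_eq_0_hi in auto)
    qed
    have e2: "\<bar>log_energy r ?u\<bar> \<le> 4 * rd a"
      unfolding log_energy_potential(1)[OF rm u(8)] abs_minus_cancel
    proof (rule gen[OF log_energy_potential(2)[OF rm u(8)]])
      show "\<bar>log_potential ?u x\<bar> \<le> 4" if "0 \<le> x" "x \<le> 2" for x
        by (rule log_potential_bounded[OF u(8) u(2) u(3) u(4) _ u(6)]) (use that in auto)
    qed
    have iu: "integrable lborel (\<lambda>x. A.mpot x * ?u x)" and im: "integrable lborel (\<lambda>x. A.mpot x * A.mdens x)"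
      by (rule integrable_tame[OF A.mpot_tame u(8) u(4)], assumption) (rule integrable_tame[OF A.mpot_tame d(8) d(4)])
    have V0: "V0 x = A.mpot x - ln (1 / a) * x" for x by (simp add: V0_def A.mpot_def)
    have iu0: "integrable lborel (\<lambda>x. V0 x * ?u x)"
      using Bochner_Integration.integrable_diff[OF iu integrable_mult_right[OF u(7), of "ln (1 / a)"]]
      by (simp add: V0 left_diff_distrib mult.assoc)
    have im0: "integrable lborel (\<lambda>x. V0 x * A.mdens x)"
      and im1: "(LINT x|lborel. V0 x * A.mdens x) = (LINT x|lborel. A.mpot x * A.mdens x) - ln (1 / a) * (LINT x|lborel. x * A.mdens x)"
      using Bochner_Integration.integrable_diff[OF im integrable_mult_right[OF d(7), of "ln (1 / a)"]]
        Bochner_Integration.integral_diff[OF im integrable_mult_right[OF d(7), of "ln (1 / a)"]]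
      by (simp_all add: V0 left_diff_distrib mult.assoc)
    have e3: "\<bar>LINT x|lborel. V0 x * r x\<bar> \<le> M * rd a"
    proof (rule gen)
      show "integrable lborel (\<lambda>x. V0 x * r x)"
        using Bochner_Integration.integrable_diff[OF im0 iu0] by (simp add: r_def right_diff_distrib)
    qed (use M in auto)
    have e4: "(LINT x|lborel. V0 x * r x) = (LINT x|lborel. V0 x * A.mdens x) - (LINT x|lborel. V0 x * ?u x)"
      using Bochner_Integration.integral_diff[OF im0 iu0] by (simp add: r_def right_diff_distrib)
    \<comment> \<open>The difference of two squares of a symmetric form, rewritten so that both
      terms on the left are linear in the small \<open>r\<close>.\<close>
    have e5: "log_energy r A.mdens + log_energy r ?u = log_energy A.mdens A.mdens - log_energy ?u ?u"
      unfolding r_def using log_energy_commute[OF d(8) u(8)] by (simp add: log_energy_diff_left d(8) u(8))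
    have "A.free_energy - ln (1 / a) * (1 / 2 + a * (b + 1) / (1 - a)) - K
      = log_energy r A.mdens + log_energy r ?u + (LINT x|lborel. V0 x * r x)"
      unfolding A.free_energy_def weighted_energy_def K_def e4 e5 im1 A.mdens_mean by simp
    then show ?thesis using e1 e2 e3 by (simp add: distrib_right)
  qed
  have ev1: "\<forall>\<^sub>F a in at_right 0. a * (b + 1) < (1::real)" using b by real_asymp
  have ev2: "\<forall>\<^sub>F a in at_right 0. (1 + sqrt (a * (1 + b)))\<^sup>2 / (1 - a) < (2::real)"
  proof -
    have "((\<lambda>a. (1 + sqrt (a * (1 + b)))\<^sup>2 / (1 - a)) \<longlongrightarrow> (1 + sqrt (0 * (1 + b)))\<^sup>2 / (1 - 0)) (at_right 0)"
      by (intro tendsto_intros) auto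
    then show ?thesis by (rule order_tendstoD(2)) simp
  qed
  have "((\<lambda>a. meixner.free_energy a b - ln (1 / a) * (1 / 2 + a * (b + 1) / (1 - a)) - K) \<longlongrightarrow> 0) (at_right 0)"
  proof (rule Lim_null_comparison)
    have "\<forall>\<^sub>F a in at_right 0. a > (0::real)" by (rule eventually_at_right_less)
    with ev1 ev2 show "\<forall>\<^sub>F a in at_right 0. norm (meixner.free_energy a b - ln (1 / a) * (1 / 2 + a * (b + 1) / (1 - a)) - K) \<le> (8 + M) * rd a"
      by eventually_elim (use bound in auto)
    have "((\<lambda>a. (8 + M) * rd a) \<longlongrightarrow> (8 + M) * (4 * sqrt (0 * (1 + b)) / (1 - 0))) (at_right 0)"
      unfolding rd_def by (intro tendsto_intros) auto
    then show "((\<lambda>a. (8 + M) * rd a) \<longlongrightarrow> 0) (at_right 0)" by simp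
  qed
  moreover have "K = - C_const (b + 1)"
  proof -
    have h1: "((\<lambda>x. x * ln x) has_integral (- (1/4))) {0..1::real}" using has_integral_xlnx[of 0 1] by simp
    have h2: "((\<lambda>x. x * ln x) has_integral (((b + 1)\<^sup>2 * ln (b + 1) / 2 - (b + 1)\<^sup>2 / 4) - (b\<^sup>2 * ln b / 2 - b\<^sup>2 / 4))) {b..b + 1}"
      by (rule has_integral_xlnx) (use b in auto)
    have h2': "((\<lambda>x. (x + b) * ln (x + b)) has_integral (((b + 1)\<^sup>2 * ln (b + 1) / 2 - (b + 1)\<^sup>2 / 4) - (b\<^sup>2 * ln b / 2 - b\<^sup>2 / 4))) {0..1}"
      using has_integral_affinity[of "\<lambda>x::real. x * ln x" _ b "b + 1" 1 b] h2 by simp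
    have "(V0 has_integral (- (1/4) - (((b + 1)\<^sup>2 * ln (b + 1) / 2 - (b + 1)\<^sup>2 / 4) - (b\<^sup>2 * ln b / 2 - b\<^sup>2 / 4)) + b)) {0..1}"
      unfolding V0_def using has_integral_add[OF has_integral_diff[OF h1 h2'] has_integral_const_real[of b 0 1]] by simp
    from lborel_integral_unit[OF this continuous_on_subset[OF V0c]]
    have "(LINT x|lborel. V0 x * ?u x) = - (1/4) - (((b + 1)\<^sup>2 * ln (b + 1) / 2 - (b + 1)\<^sup>2 / 4) - (b\<^sup>2 * ln b / 2 - b\<^sup>2 / 4)) + b"
      by auto
    then show ?thesis unfolding K_def log_energy_uniform C_const_def
      by (simp add: power2_eq_square field_simps)
  qed
  ultimately show ?thesis by (simp only: LIM_zero_cancel)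
qed

lemma free_energy_value:
  assumes "meixner a b"
  shows "meixner.free_energy a b = (b + 1) * ln (1 - a) - ln a / 2 - C_const (b + 1)"
proof -
  interpret A: meixner a b by fact
  obtain K where K: "\<And>a. 0 < a \<Longrightarrow> a < 1 \<Longrightarrow> meixner.free_energy a b = (b + 1) * ln (1 - a) - ln a / 2 + K"
    using free_energy_const[OF A.b] by blast
  have "\<forall>\<^sub>F a in at_right 0. meixner.free_energy a b - ln (1 / a) * (1 / 2 + a * (b + 1) / (1 - a))
      = (b + 1) * ln (1 - a) - ln (1 / a) * (a * (b + 1) / (1 - a)) + K"
    using eventually_at_right_real[of 0 1, simplified]
  proof eventually_elim
    case (elim a)
    then show ?case using K[of a] by (simp add: ln_div algebra_simps)
  qed
  from tendsto_cong[OF this] free_energy_limit[OF A.b]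
  have "((\<lambda>a. (b + 1) * ln (1 - a) - ln (1 / a) * (a * (b + 1) / (1 - a)) + K) \<longlongrightarrow> - C_const (b + 1)) (at_right 0)"
    by simp
  moreover have "((\<lambda>a. (b + 1) * ln (1 - a) - ln (1 / a) * (a * (b + 1) / (1 - a)) + K) \<longlongrightarrow> K) (at_right 0)"
    by real_asymp
  ultimately have "K = - C_const (b + 1)" by (rule tendsto_unique[OF trivial_limit_at_right_real, symmetric])
  then show ?thesis using K[of a] A.a by simp
qed

section \<open>Lattice operations on distribution functions\<close>

definition cdf :: "(real \<Rightarrow> real) \<Rightarrow> real \<Rightarrow> real" where
  "cdf f x = (LINT t|lborel. indicator {..x} t * f t)"

lemma integrable_indicator_mult:
  fixes f :: "real \<Rightarrow> real"
  assumes "integrable lborel f" "A \<in> sets borel"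
  shows "integrable lborel (\<lambda>t. indicator A t * f t)"
  using integrable_mult_indicator[of A lborel f] assms by simp

lemma cdf_diff:
  assumes f: "integrable lborel f" and uv: "u \<le> v"
  shows "cdf f v - cdf f u = (LINT t|lborel. indicator {u<..v} t * f t)"
proof -
  have "(\<lambda>t. indicator {u<..v} t * f t) = (\<lambda>t. indicator {..v} t * f t - indicator {..u} t * f t)"
    using uv by (auto simp: indicator_def fun_eq_iff)
  then show ?thesis unfolding cdf_def
    using Bochner_Integration.integral_diff[OF integrable_indicator_mult[OF f] integrable_indicator_mult[OF f], of "{..v}" "{..u}"]
    by simp
qed

lemma imass_cdf: "integrable lborel f \<Longrightarrow> 0 \<le> r \<Longrightarrow> imass f u r = cdf f (u + r) - cdf f u"
  using cdf_diff[of f u "u + r"] by (simp add: imass_def set_lebesgue_integral_def)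

lemma cdf_mono:
  assumes "integrable lborel f" "\<And>t. 0 \<le> f t" "u \<le> v"
  shows "cdf f u \<le> cdf f v"
proof -
  have "0 \<le> (LINT t|lborel. indicator {u<..v} t * f t)" using assms by (intro integral_nonneg_AE) simp
  then show ?thesis using cdf_diff[OF assms(1,3)] by simp
qed

lemma cdf_Lipschitz:
  assumes "integrable lborel f" "\<And>t. f t \<le> 1" "u \<le> v"
  shows "cdf f v - cdf f u \<le> v - u"
proof -
  have "(LINT t|lborel. indicator {u<..v} t * f t) \<le> (LINT t|lborel. indicator {u<..v} t)"
  proof (intro integral_mono integrable_indicator_mult assms)
    show "integrable lborel (indicator {u<..v} :: real \<Rightarrow> real)"
      using assms(3) by (intro integrable_real_indicator) simp_all
  qed (use assms in \<open>auto simp: indicator_def\<close>)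
  then show ?thesis using cdf_diff[OF assms(1,3)] assms(3) by simp
qed

lemma cdf_at_top:
  assumes "integrable lborel f"
  shows "(cdf f \<longlongrightarrow> integral\<^sup>L lborel f) at_top"
proof -
  have [measurable]: "f \<in> borel_measurable borel" using borel_measurable_integrable[OF assms] by simp
  show ?thesis unfolding cdf_def[abs_def]
  proof (rule integral_dominated_convergence_at_top[where w = "\<lambda>t. \<bar>f t\<bar>"])
    show "AE t in lborel. ((\<lambda>x. indicator {..x} t * f t) \<longlongrightarrow> f t) at_top"
    proof (rule AE_I2)
      fix t :: real
      have "\<forall>\<^sub>F x in at_top. f t = indicator {..x} t * f t"
        using eventually_ge_at_top[of t] by eventually_elim simp
      then show "((\<lambda>x. indicator {..x} t * f t) \<longlongrightarrow> f t) at_top"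
        by (rule Lim_transform_eventually[OF tendsto_const])
    qed
    show "\<forall>\<^sub>F x in at_top. AE t in lborel. norm (indicator {..x} t * f t) \<le> \<bar>f t\<bar>"
      by (intro always_eventually allI AE_I2) (auto simp: indicator_def)
  qed (use assms in auto)
qed

lemma AE_eq_if_cdf_eq:
  assumes f: "integrable lborel f" "\<And>x. 0 \<le> f x" and g: "integrable lborel g" "\<And>x. 0 \<le> g x"
    and eq: "\<And>x. cdf f x = cdf g x"
  shows "AE x in lborel. f x = g x"
proof -
  have [measurable]: "f \<in> borel_measurable borel" "g \<in> borel_measurable borel"
    using borel_measurable_integrable[OF f(1)] borel_measurable_integrable[OF g(1)] by simp_all
  have tot: "integral\<^sup>L lborel f = integral\<^sup>L lborel g"
    using cdf_at_top[OF f(1)] cdf_at_top[OF g(1)] unfolding eq[abs_def] by (rule tendsto_unique[OF trivial_limit_at_top_linorder])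
  have em: "emeasure (density lborel (\<lambda>x. ennreal (h x))) {x<..} = ennreal (integral\<^sup>L lborel h - cdf h x)"
    if h: "integrable lborel h" "\<And>x. 0 \<le> h x" for h x
  proof -
    have [measurable]: "h \<in> borel_measurable borel" using borel_measurable_integrable[OF h(1)] by simp
    have "emeasure (density lborel (\<lambda>x. ennreal (h x))) {x<..} = (\<integral>\<^sup>+t. ennreal (indicator {x<..} t * h t) \<partial>lborel)"
      by (subst emeasure_density) (auto intro!: nn_integral_cong simp: indicator_def)
    also have "\<dots> = ennreal (LINT t|lborel. indicator {x<..} t * h t)"
      by (intro nn_integral_eq_integral integrable_indicator_mult h) (auto simp: h)
    also have "(\<lambda>t. indicator {x<..} t * h t) = (\<lambda>t. h t - indicator {..x} t * h t)"
      by (auto simp: indicator_def fun_eq_iff)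
    finally show ?thesis
      using Bochner_Integration.integral_diff[OF h(1) integrable_indicator_mult[OF h(1)], of "{..x}"] by (simp add: cdf_def)
  qed
  have "density lborel (\<lambda>x. ennreal (f x)) = density lborel (\<lambda>x. ennreal (g x))"
    by (rule measure_eqI_lessThan) (simp_all add: em f g tot eq)
  then have "AE x in lborel. ennreal (f x) = ennreal (g x)"
    by (intro sigma_finite_measure.density_unique[OF lborel.sigma_finite_measure_axioms]) simp_all
  then show ?thesis by eventually_elim (simp add: f g)
qed

lemma ex_sum_measure:
  assumes M: "sets M = sets (borel :: real measure)" and N: "sets N = sets (borel :: real measure)"
  obtains S where "sets S = sets borel" "\<And>A. A \<in> sets borel \<Longrightarrow> emeasure S A = emeasure M A + emeasure N A"
proof -
  define S where "S = measure_of UNIV (sets (borel :: real measure)) (\<lambda>A. emeasure M A + emeasure N A)"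
  have sub: "sets (borel :: real measure) \<subseteq> Pow UNIV" by simp
  have sa: "sigma_algebra UNIV (sets (borel :: real measure))"
    using sets.sigma_algebra_axioms[of "borel :: real measure"] by simp
  have 1: "sets S = sets borel"
    unfolding S_def using sigma_algebra.sigma_sets_eq[OF sa] by (simp add: sets_measure_of[OF sub])
  have "emeasure S A = emeasure M A + emeasure N A" if A: "A \<in> sets borel" for A
    unfolding S_def
  proof (rule emeasure_measure_of_sigma[OF sa _ _ A])
    show "positive (sets borel) (\<lambda>A. emeasure M A + emeasure N A)" by (simp add: positive_def)
    show "countably_additive (sets borel) (\<lambda>A. emeasure M A + emeasure N A)"
      unfolding countably_additive_def
    proof (intro allI impI)
      fix A :: "nat \<Rightarrow> real set"
      assume A: "range A \<subseteq> sets borel" and dis: "disjoint_family A"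
      show "(\<Sum>i. emeasure M (A i) + emeasure N (A i)) = emeasure M (\<Union>i. A i) + emeasure N (\<Union>i. A i)"
        using suminf_emeasure[of A M] suminf_emeasure[of A N] A dis M N
        by (subst suminf_add[symmetric]) auto
    qed
  qed
  with 1 show ?thesis by (rule that)
qed

text \<open>Radon-Nikodym for the Stieltjes measures of \<open>F\<close> and \<open>x - F x\<close>, whose sum is Lebesgue measure.\<close>
lemma Lipschitz_cdf_density:
  fixes F :: "real \<Rightarrow> real"
  assumes mono: "\<And>x y. x \<le> y \<Longrightarrow> F x \<le> F y" and lip: "\<And>x y. x \<le> y \<Longrightarrow> F y - F x \<le> y - x"
  shows "\<exists>\<phi>\<in>borel_measurable borel. (\<forall>x. 0 \<le> \<phi> x \<and> \<phi> x \<le> 1) \<and>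
    (\<forall>u v. u \<le> v \<longrightarrow> (\<integral>\<^sup>+x. ennreal (indicator {u<..v} x * \<phi> x) \<partial>lborel) = ennreal (F v - F u))"
proof -
  define G where "G x = x - F x" for x
  have monoG: "x \<le> y \<Longrightarrow> G x \<le> G y" for x y using lip[of x y] by (simp add: G_def)
  have "1-lipschitz_on UNIV F"
  proof (rule lipschitz_onI)
    show "dist (F x) (F y) \<le> 1 * dist x y" for x y
      using mono[of x y] mono[of y x] lip[of x y] lip[of y x] by (cases "x \<le> y") (auto simp: dist_real_def)
  qed simp
  then have contF: "continuous_on UNIV F" by (rule lipschitz_on_continuous_on)
  then have contG: "continuous_on UNIV G" unfolding G_def by (intro continuous_intros)
  define M N where "M = interval_measure F" and "N = interval_measure G"
  have sets: "sets M = sets borel" "sets N = sets borel" by (simp_all add: M_def N_def)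
  have Icc: "emeasure M {u..v} = ennreal (F v - F u)" "emeasure N {u..v} = ennreal (G v - G u)" if "u \<le> v" for u v
    unfolding M_def N_def using that mono monoG contF contG by (auto intro!: emeasure_interval_measure_Icc)
  obtain S where S: "sets S = sets borel" "\<And>A. A \<in> sets borel \<Longrightarrow> emeasure S A = emeasure M A + emeasure N A"
    using ex_sum_measure[OF sets] by blast
  have "lborel = S"
  proof (rule lborel_eqI[OF _ S(1)])
    fix l u :: real assume "\<And>b. b \<in> Basis \<Longrightarrow> l \<bullet> b \<le> u \<bullet> b"
    then have lu: "l \<le> u" by simp
    have "emeasure S {x} = 0" for x using S(2)[of "{x}"] Icc[of x x] by simp
    then have null: "{l} \<union> {u} \<in> null_sets S" using S(1) by (intro null_sets.Un null_setsI) auto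
    have "box l u = {l..u} - ({l} \<union> {u})" by (auto simp: box_real)
    then have "emeasure S (box l u) = emeasure S {l..u}"
      using emeasure_Diff_null_set[OF null, of "{l..u}"] S(1) by simp
    also have "\<dots> = ennreal (F u - F l) + ennreal (G u - G l)" using S(2)[of "{l..u}"] Icc[OF lu] by simp
    also have "\<dots> = ennreal (u - l)"
      using mono[OF lu] monoG[OF lu] by (subst ennreal_plus[symmetric]) (auto simp: G_def)
    finally show "emeasure S (box l u) = ennreal (\<Prod>b\<in>Basis. (u - l) \<bullet> b)" by simp
  qed
  then have L: "emeasure lborel A = emeasure M A + emeasure N A" if "A \<in> sets borel" for A
    using S(2)[OF that] by simp
  have "absolutely_continuous lborel M" "absolutely_continuous lborel N"
    unfolding absolutely_continuous_def null_sets_def using L sets by auto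
  then obtain f g where f: "f \<in> borel_measurable lborel" "density lborel f = M"
    and g: "g \<in> borel_measurable lborel" "density lborel g = N"
    using sigma_finite_measure.Radon_Nikodym[OF lborel.sigma_finite_measure_axioms, of M] sigma_finite_measure.Radon_Nikodym[OF lborel.sigma_finite_measure_axioms, of N] sets by auto
  have [measurable]: "f \<in> borel_measurable borel" "g \<in> borel_measurable borel" using f g by simp_all
  \<comment> \<open>The two Stieltjes measures add up to Lebesgue measure, so their densities add up
    to 1; this is the source of the bound \<open>\<phi> x \<le> 1\<close>.\<close>
  have "density lborel (\<lambda>x. f x + g x) = density lborel (\<lambda>x. 1)"
  proof (rule measure_eqI)
    fix A assume "A \<in> sets (density lborel (\<lambda>x. f x + g x))"
    then have [measurable]: "A \<in> sets borel" by simp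
    have "emeasure (density lborel (\<lambda>x. f x + g x)) A = (\<integral>\<^sup>+x. f x * indicator A x + g x * indicator A x \<partial>lborel)"
      by (subst emeasure_density) (simp_all add: distrib_right)
    also have "\<dots> = emeasure (density lborel f) A + emeasure (density lborel g) A"
      by (subst nn_integral_add) (simp_all add: emeasure_density)
    also have "\<dots> = emeasure (density lborel (\<lambda>x. 1)) A" using L[of A] f g by (simp add: density_1)
    finally show "emeasure (density lborel (\<lambda>x. f x + g x)) A = emeasure (density lborel (\<lambda>x. 1)) A" .
  qed simp
  then have "AE x in lborel. f x + g x = 1" by (intro sigma_finite_measure.density_unique[OF lborel.sigma_finite_measure_axioms]) simp_all
  then have f1: "AE x in lborel. f x \<le> 1" by eventually_elim (metis le_iff_add)
  define \<phi> where "\<phi> x = enn2real (min 1 (f x))" for x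
  have [measurable]: "\<phi> \<in> borel_measurable borel" unfolding \<phi>_def by measurable
  have e\<phi>: "ennreal (\<phi> x) = min 1 (f x)" for x
    unfolding \<phi>_def by (rule ennreal_enn2real) (simp add: min_less_iff_disj)
  show ?thesis
  proof (intro bexI[of _ \<phi>] conjI allI impI)
    show "\<phi> x \<le> 1" for x
    proof -
      have "ennreal (\<phi> x) \<le> ennreal 1" unfolding e\<phi> by simp
      then show ?thesis by (subst (asm) ennreal_le_iff) auto
    qed
    show "(\<integral>\<^sup>+x. ennreal (indicator {u<..v} x * \<phi> x) \<partial>lborel) = ennreal (F v - F u)" if uv: "u \<le> v" for u v
    proof -
      have "(\<integral>\<^sup>+x. ennreal (indicator {u<..v} x * \<phi> x) \<partial>lborel) = (\<integral>\<^sup>+x. f x * indicator {u<..v} x \<partial>lborel)"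
      proof (rule nn_integral_cong_AE)
        show "AE x in lborel. ennreal (indicator {u<..v} x * \<phi> x) = f x * indicator {u<..v} x"
          using f1 by eventually_elim (auto simp: indicator_def e\<phi> min_def)
      qed
      also have "\<dots> = emeasure (density lborel f) {u<..v}" by (subst emeasure_density) simp_all
      also have "\<dots> = emeasure M {u<..v}" by (simp add: f(2))
      also have "\<dots> = ennreal (F v - F u)"
        unfolding M_def using contF uv mono
        by (intro emeasure_interval_measure_Ioc) (auto simp: continuous_on_eq_continuous_within continuous_at_imp_continuous_at_within)
      finally show ?thesis .
    qed
  qed (simp_all add: \<phi>_def)
qed

section \<open>Translating holes, and minima and maxima of distribution functions\<close>

lemma cdf_dens:
  assumes "\<phi> \<in> dens"
  shows "x \<le> y \<Longrightarrow> cdf \<phi> x \<le> cdf \<phi> y" "x \<le> y \<Longrightarrow> cdf \<phi> y - cdf \<phi> x \<le> y - x"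
    "x \<le> 0 \<Longrightarrow> cdf \<phi> x = 0" "cdf \<phi> x \<le> 1" "0 \<le> cdf \<phi> x" "0 \<le> x \<Longrightarrow> cdf \<phi> x \<le> x" "(cdf \<phi> \<longlongrightarrow> 1) at_top"
proof -
  note d = densD[OF assms]
  show m: "cdf \<phi> x \<le> cdf \<phi> y" if "x \<le> y" for x y using cdf_mono[OF d(5) d(2) that] .
  show l: "cdf \<phi> y - cdf \<phi> x \<le> y - x" if "x \<le> y" for x y using cdf_Lipschitz[OF d(5) d(3) that] .
  have neg: "cdf \<phi> x = 0" if "x < 0" for x
  proof -
    have "(\<lambda>t. indicator {..x} t * \<phi> t) = (\<lambda>t. 0)" using d(4) that by (auto simp: indicator_def fun_eq_iff)
    then show ?thesis by (simp add: cdf_def)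
  qed
  have "cdf \<phi> 0 \<le> e" if "e > 0" for e using l[of "- e" 0] neg[of "- e"] that by simp
  then have "cdf \<phi> 0 \<le> 0" by (rule field_le_epsilon) simp
  moreover have "0 \<le> cdf \<phi> 0" using m[of "- 1" 0] neg[of "- 1"] by simp
  ultimately have z: "cdf \<phi> 0 = 0" by simp
  show "cdf \<phi> x = 0" if "x \<le> 0" for x using that neg[of x] z by (cases "x = 0") auto
  show t: "(cdf \<phi> \<longlongrightarrow> 1) at_top" using cdf_at_top[OF d(5)] d(6) by simp
  show "cdf \<phi> x \<le> 1" for x
    by (rule tendsto_lowerbound[OF t]) (auto intro: eventually_mono[OF eventually_ge_at_top[of x]] m)
  show "0 \<le> cdf \<phi> x" for x using m[of 0 x] z neg[of x] by (cases "x < 0") auto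
  show "0 \<le> x \<Longrightarrow> cdf \<phi> x \<le> x" for x using l[of 0 x] z by simp
qed

text \<open>The density obtained by moving all particles by \<open>\<delta>\<close> to the right and filling the gap: the
  picture seen by the holes is just translated.\<close>
definition shifted :: "real \<Rightarrow> (real \<Rightarrow> real) \<Rightarrow> real \<Rightarrow> real" where
  "shifted \<delta> \<phi> x = indicator {0..<\<delta>} x + \<phi> (x - \<delta>)"

lemma bdd_moment_translate:
  assumes f: "bdd_moment f"
  shows "bdd_moment (\<lambda>x. f (x - d))" "(LINT x|lborel. f (x - d)) = integral\<^sup>L lborel f"
proof -
  have i: "integrable lborel (\<lambda>x. f (x - d))" "integrable lborel (\<lambda>x. (x - d) * f (x - d))"
    using lborel_integrable_real_affine[OF bdd_momentD(2)[OF f], of 1 "- d"]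
      lborel_integrable_real_affine[OF bdd_momentD(3)[OF f], of 1 "- d"] by simp_all
  have "integrable lborel (\<lambda>x. x * f (x - d))"
    using Bochner_Integration.integrable_add[OF i(2) integrable_mult_right[OF i(1), of d]] by (simp add: algebra_simps)
  moreover have "\<exists>B. \<forall>x. \<bar>f (x - d)\<bar> \<le> B" using f by (auto simp: bdd_moment_def)
  moreover have "(\<lambda>x. f (x - d)) \<in> borel_measurable borel" using bdd_momentD(1)[OF f] by measurable
  ultimately show "bdd_moment (\<lambda>x. f (x - d))" using i by (simp add: bdd_moment_def)
  show "(LINT x|lborel. f (x - d)) = integral\<^sup>L lborel f"
    using lborel_integral_real_affine[of 1 f "- d"] by simp
qed

lemma bdd_moment_indicator: "bdd_moment (indicator {0..<d})"
proof -
  have "integrable lborel (\<lambda>x::real. x * indicator {0..<d} x)"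
  proof (rule Bochner_Integration.integrable_bound)
    show "integrable lborel (\<lambda>x. \<bar>d\<bar> * indicator {0..<d} x :: real)"
      by (cases "d \<ge> 0") (auto intro!: integrable_mult_right integrable_real_indicator simp: not_le)
  qed (auto simp: indicator_def)
  moreover have "integrable lborel (indicator {0..<d} :: real \<Rightarrow> real)"
    by (cases "d \<ge> 0") (auto intro!: integrable_real_indicator simp: not_le)
  ultimately show ?thesis by (auto simp: bdd_moment_def indicator_def intro!: exI[of _ 1])
qed

lemma cdf_shifted:
  assumes \<phi>: "integrable lborel \<phi>"
  shows "cdf (shifted \<delta> \<phi>) x = max 0 (min x \<delta>) + cdf \<phi> (x - \<delta>)"
proof -
  note i = bdd_momentD(2)[OF bdd_moment_indicator[of \<delta>]]
  have tr: "integrable lborel (\<lambda>x. \<phi> (x - \<delta>))" using lborel_integrable_real_affine[OF \<phi>, of 1 "- \<delta>"] by simp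
  have "(\<lambda>t. indicator {..x} t * shifted \<delta> \<phi> t) = (\<lambda>t. indicator {..x} t * indicator {0..<\<delta>} t + indicator {..x} t * \<phi> (t - \<delta>))"
    by (simp add: shifted_def distrib_left)
  then have "cdf (shifted \<delta> \<phi>) x = (LINT t|lborel. indicator {..x} t * indicator {0..<\<delta>} t) + (LINT t|lborel. indicator {..x} t * \<phi> (t - \<delta>))"
    unfolding cdf_def
    using Bochner_Integration.integral_add[OF integrable_indicator_mult[OF i] integrable_indicator_mult[OF tr], of "{..x}" "{..x}"]
    by simp
  also have "(LINT t|lborel. indicator {..x} t * \<phi> (t - \<delta>)) = cdf \<phi> (x - \<delta>)"
    using lborel_integral_real_affine[of 1 "\<lambda>t. indicator {..x} t * \<phi> (t - \<delta>)" \<delta>]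
    unfolding cdf_def by (simp add: indicator_def le_diff_eq add.commute)
  also have "(LINT t|lborel. indicator {..x} t * indicator {0..<\<delta>} t) = max 0 (min x \<delta>)"
  proof -
    have "(LINT t|lborel. indicator {..x} t * indicator {0..<\<delta>} t) = (LINT t|lborel. indicator {0..min x \<delta>} t :: real)"
    proof (rule integral_cong_AE)
      show "AE t in lborel. indicator {..x} t * indicator {0..<\<delta>} t = (indicator {0..min x \<delta>} t :: real)"
        using AE_lborel_singleton[of \<delta>] by eventually_elim (auto simp: indicator_def)
    qed measurable
    also have "\<dots> = max 0 (min x \<delta>)" by (cases "0 \<le> min x \<delta>") (auto simp: max_def)
    finally show ?thesis .
  qed
  finally show ?thesis .
qed

lemma shifted_props:
  assumes \<phi>: "\<phi> \<in> dens" and \<delta>: "0 \<le> \<delta>"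
  shows "bdd_moment (shifted \<delta> \<phi>)" "0 \<le> shifted \<delta> \<phi> x" "shifted \<delta> \<phi> x \<le> 1"
    "integral\<^sup>L lborel (shifted \<delta> \<phi>) = 1 + \<delta>" "cdf (shifted \<delta> \<phi>) x = max 0 (min x \<delta>) + cdf \<phi> (x - \<delta>)"
proof -
  note d = densD[OF \<phi>] and t = bdd_moment_translate[OF densD(8)[OF \<phi>], of \<delta>] and i = bdd_moment_indicator[of \<delta>]
  show "bdd_moment (shifted \<delta> \<phi>)" unfolding shifted_def[abs_def] by (rule bdd_moment_add[OF i t(1)])
  show "0 \<le> shifted \<delta> \<phi> x" using d(2) by (simp add: shifted_def)
  show "shifted \<delta> \<phi> x \<le> 1" using d(3)[of "x - \<delta>"] d(4)[of "x - \<delta>"] by (auto simp: shifted_def indicator_def)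
  show "integral\<^sup>L lborel (shifted \<delta> \<phi>) = 1 + \<delta>"
    unfolding shifted_def[abs_def] using \<delta> t(2) d(6) bdd_momentD(2)[OF i] bdd_momentD(2)[OF t(1)] by simp
  show "cdf (shifted \<delta> \<phi>) x = max 0 (min x \<delta>) + cdf \<phi> (x - \<delta>)" by (rule cdf_shifted[OF d(5)])
qed

text \<open>Window masses of the minimum and the maximum are differences of this kind. Both sides
  contain the same squares, so the claim is the rearrangement inequality
  \<open>p * r + q * s \<le> min p q * min r s + max p q * max r s\<close>.\<close>

lemma min_max_increments:
  fixes p q r s :: real
  shows "(min p q - min r s)\<^sup>2 + (max p q - max r s)\<^sup>2 \<le> (p - r)\<^sup>2 + (q - s)\<^sup>2"
proof -
  have "min p q * min r s + max p q * max r s \<ge> p * r + q * s"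
  proof (cases "p \<le> q"; cases "r \<le> s")
    assume "p \<le> q" "\<not> r \<le> s"
    then have "0 \<le> (q - p) * (r - s)" by simp
    then show ?thesis using \<open>p \<le> q\<close> \<open>\<not> r \<le> s\<close> by (simp add: min_def max_def algebra_simps)
  next
    assume "\<not> p \<le> q" "r \<le> s"
    then have "0 \<le> (p - q) * (s - r)" by simp
    then show ?thesis using \<open>\<not> p \<le> q\<close> \<open>r \<le> s\<close> by (simp add: min_def max_def algebra_simps)
  qed (simp_all add: min_def max_def)
  moreover have "(min p q)\<^sup>2 + (max p q)\<^sup>2 = p\<^sup>2 + q\<^sup>2" "(min r s)\<^sup>2 + (max r s)\<^sup>2 = r\<^sup>2 + s\<^sup>2"
    by (simp_all add: min_def max_def)
  ultimately show ?thesis by (simp add: power2_diff)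
qed

text \<open>\<open>\<phi>2\<close> is the minimum of \<open>shifted \<delta> \<phi>0\<close> and
  \<open>\<phi>1\<close>. The maximum begins with a filled gap, hence is of the form
  \<open>shifted \<delta> \<phi>3\<close>, and \<open>\<phi>3\<close> again has mass 1. The last
  property, that minimum and maximum add up to the original sum, also dominates both new densities
  and so gives their first moments.\<close>

lemma dens_lattice:
  assumes p0: "\<phi>0 \<in> dens" and p1: "\<phi>1 \<in> dens" and \<delta>: "0 \<le> \<delta>"
  obtains \<phi>2 \<phi>3 where "\<phi>2 \<in> dens" "\<phi>3 \<in> dens"
    "\<And>x. cdf \<phi>2 x = min (cdf (shifted \<delta> \<phi>0) x) (cdf \<phi>1 x)"
    "\<And>x. cdf \<phi>3 x = max (cdf \<phi>0 x) (cdf \<phi>1 (x + \<delta>) - \<delta>)"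
    "AE x in lborel. \<phi>2 x + shifted \<delta> \<phi>3 x = shifted \<delta> \<phi>0 x + \<phi>1 x"
proof -
  note d0 = densD[OF p0] and d1 = densD[OF p1] and c0 = cdf_dens[OF p0] and c1 = cdf_dens[OF p1]
  note s0 = shifted_props[OF p0 \<delta>]
  define F0 where "F0 = cdf (shifted \<delta> \<phi>0)"
  define F2 where "F2 x = min (F0 x) (cdf \<phi>1 x)" for x
  define F3 where "F3 x = max (cdf \<phi>0 x) (cdf \<phi>1 (x + \<delta>) - \<delta>)" for x
  have F0m: "F0 x \<le> F0 y" "F0 y - F0 x \<le> y - x" if "x \<le> y" for x y
    unfolding F0_def using cdf_mono[OF bdd_momentD(2)[OF s0(1)] s0(2) that] cdf_Lipschitz[OF bdd_momentD(2)[OF s0(1)] s0(3) that] .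
  have F2m: "F2 x \<le> F2 y" "F2 y - F2 x \<le> y - x" if "x \<le> y" for x y
    unfolding F2_def using F0m[OF that] c1(1,2)[OF that] by auto
  have F3m: "F3 x \<le> F3 y" "F3 y - F3 x \<le> y - x" if "x \<le> y" for x y
    unfolding F3_def using c0(1,2)[OF that] c1(1)[of "x + \<delta>" "y + \<delta>"] c1(2)[of "x + \<delta>" "y + \<delta>"] that by auto
  have F0v: "F0 x = max 0 (min x \<delta>) + cdf \<phi>0 (x - \<delta>)" for x unfolding F0_def by (rule s0(5))
  have F2z: "F2 x = 0" if "x \<le> 0" for x
    using c0(3)[of "x - \<delta>"] c1(3)[of x] that \<delta> by (simp add: F2_def F0v)
  have F3z: "F3 x = 0" if "x \<le> 0" for x
    using c0(3)[of x] c1(3)[of "x + \<delta>"] c1(6)[of "x + \<delta>"] that \<delta> by (cases "x + \<delta> \<le> 0") (auto simp: F3_def)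
  have F2t: "(F2 \<longlongrightarrow> 1) at_top"
  proof -
    have "(F0 \<longlongrightarrow> 1 + \<delta>) at_top" unfolding F0_def using cdf_at_top[OF bdd_momentD(2)[OF s0(1)]] s0(4) by simp
    from tendsto_min[OF this c1(7)] show ?thesis using \<delta> by (simp add: F2_def[abs_def])
  qed
  have F3t: "(F3 \<longlongrightarrow> 1) at_top"
  proof -
    have "((\<lambda>x. cdf \<phi>1 (x + \<delta>) - \<delta>) \<longlongrightarrow> 1 - \<delta>) at_top"
    proof (intro tendsto_diff tendsto_const filterlim_compose[OF c1(7)])
      show "filterlim (\<lambda>x. x + \<delta>) at_top at_top" by real_asymp
    qed
    from tendsto_max[OF c0(7) this] show ?thesis using \<delta> by (simp add: F3_def[abs_def])
  qed
  have mk: "\<exists>\<phi>. \<phi> \<in> borel_measurable borel \<and> (\<forall>x. 0 \<le> \<phi> x \<and> \<phi> x \<le> 1) \<and> (\<forall>x<0. \<phi> x = 0) \<and>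
      integrable lborel \<phi> \<and> integral\<^sup>L lborel \<phi> = 1 \<and> (\<forall>x. cdf \<phi> x = F x)"
    if m: "\<And>x y. x \<le> y \<Longrightarrow> F x \<le> F y" "\<And>x y. x \<le> y \<Longrightarrow> F y - F x \<le> y - x" and z: "\<And>x. x \<le> 0 \<Longrightarrow> F x = 0"
      and t: "(F \<longlongrightarrow> 1) at_top" for F
  proof -
    obtain \<psi> where \<psi>: "\<psi> \<in> borel_measurable borel" "\<And>x. 0 \<le> \<psi> x" "\<And>x. \<psi> x \<le> 1"
      "\<And>u v. u \<le> v \<Longrightarrow> (\<integral>\<^sup>+x. ennreal (indicator {u<..v} x * \<psi> x) \<partial>lborel) = ennreal (F v - F u)"
    proof -
      have "\<exists>\<phi>\<in>borel_measurable borel. (\<forall>x. 0 \<le> \<phi> x \<and> \<phi> x \<le> 1) \<and>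
        (\<forall>u v. u \<le> v \<longrightarrow> (\<integral>\<^sup>+x. ennreal (indicator {u<..v} x * \<phi> x) \<partial>lborel) = ennreal (F v - F u))"
        by (rule Lipschitz_cdf_density) (fact m)+
      then show ?thesis using that by blast
    qed
    have [measurable]: "\<psi> \<in> borel_measurable borel" by (rule \<psi>(1))
    define \<phi> where "\<phi> x = indicator {0<..} x * \<psi> x" for x
    have [measurable]: "\<phi> \<in> borel_measurable borel" unfolding \<phi>_def by measurable
    have F1: "F x \<le> 1" for x
      by (rule tendsto_lowerbound[OF t]) (auto intro: eventually_mono[OF eventually_ge_at_top[of x]] m)
    have pos: "(\<integral>\<^sup>+t. ennreal (indicator {..x} t * \<phi> t) \<partial>lborel) = ennreal (F x)" for x
    proof (cases "x \<le> 0")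
      case True
      then have "(\<lambda>t. ennreal (indicator {..x} t * \<phi> t)) = (\<lambda>t. 0)" by (auto simp: \<phi>_def indicator_def fun_eq_iff)
      then show ?thesis using z[OF True] by simp
    next
      case False
      then have "(\<integral>\<^sup>+t. ennreal (indicator {..x} t * \<phi> t) \<partial>lborel) = (\<integral>\<^sup>+t. ennreal (indicator {0<..x} t * \<psi> t) \<partial>lborel)"
        by (intro nn_integral_cong) (auto simp: \<phi>_def indicator_def)
      then show ?thesis using \<psi>(4)[of 0 x] False z[of 0] by simp
    qed
    have "(\<integral>\<^sup>+t. ennreal (\<phi> t) \<partial>lborel) = (SUP n. \<integral>\<^sup>+t. ennreal (indicator {..real n} t * \<phi> t) \<partial>lborel)"
    proof (subst nn_integral_monotone_convergence_SUP[symmetric])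
      show "incseq (\<lambda>n t. ennreal (indicator {..real n} t * \<phi> t))"
        by (auto simp: incseq_def le_fun_def indicator_def \<phi>_def \<psi> intro!: ennreal_leI)
      have "ennreal (\<phi> t) = (SUP n. ennreal (indicator {..real n} t * \<phi> t))" for t
      proof (rule antisym)
        obtain n where "t \<le> real n" using real_arch_simple by blast
        then have "ennreal (\<phi> t) \<le> ennreal (indicator {..real n} t * \<phi> t)" by simp
        also have "\<dots> \<le> (SUP n. ennreal (indicator {..real n} t * \<phi> t))" by (rule SUP_upper) simp
        finally show "ennreal (\<phi> t) \<le> (SUP n. ennreal (indicator {..real n} t * \<phi> t))" .
        show "(SUP n. ennreal (indicator {..real n} t * \<phi> t)) \<le> ennreal (\<phi> t)"
          by (rule SUP_least) (auto simp: indicator_def)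
      qed
      then show "(\<integral>\<^sup>+t. ennreal (\<phi> t) \<partial>lborel) = (\<integral>\<^sup>+t. (SUP n. ennreal (indicator {..real n} t * \<phi> t)) \<partial>lborel)" by simp
    qed measurable
    also have "\<dots> \<le> 1" unfolding pos using F1 by (intro SUP_least) (simp add: ennreal_le_1)
    finally have "(\<integral>\<^sup>+t. ennreal (\<phi> t) \<partial>lborel) < \<infinity>" by (rule le_less_trans) simp
    then have i: "integrable lborel \<phi>" by (intro integrableI_nonneg) (auto simp: \<phi>_def \<psi>)
    have cdF: "cdf \<phi> x = F x" for x
    proof -
      have "ennreal (cdf \<phi> x) = ennreal (F x)" unfolding pos[symmetric] cdf_def
        using integrable_indicator_mult[OF i, of "{..x}"] by (intro nn_integral_eq_integral[symmetric]) (auto simp: \<phi>_def \<psi>)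
      moreover have "0 \<le> F x" using z[of 0] z[of x] m(1)[of 0 x] by (cases "x \<le> 0") auto
      moreover have "0 \<le> cdf \<phi> x" unfolding cdf_def by (intro integral_nonneg_AE) (simp add: \<phi>_def \<psi>)
      ultimately show ?thesis by simp
    qed
    have "integral\<^sup>L lborel \<phi> = 1"
      using cdf_at_top[OF i] t unfolding cdF[abs_def] by (rule tendsto_unique[OF trivial_limit_at_top_linorder])
    then show ?thesis using i cdF by (intro exI[of _ \<phi>]) (auto simp: \<phi>_def \<psi> mult_le_one indicator_def)
  qed
  obtain \<phi>2 where p2: "\<phi>2 \<in> borel_measurable borel" "\<forall>x. 0 \<le> \<phi>2 x \<and> \<phi>2 x \<le> 1" "\<forall>x<0. \<phi>2 x = 0"
      "integrable lborel \<phi>2" "integral\<^sup>L lborel \<phi>2 = 1" "\<forall>x. cdf \<phi>2 x = F2 x"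
    using mk[of F2, OF F2m F2z F2t] by blast
  obtain \<phi>3 where p3: "\<phi>3 \<in> borel_measurable borel" "\<forall>x. 0 \<le> \<phi>3 x \<and> \<phi>3 x \<le> 1" "\<forall>x<0. \<phi>3 x = 0"
      "integrable lborel \<phi>3" "integral\<^sup>L lborel \<phi>3 = 1" "\<forall>x. cdf \<phi>3 x = F3 x"
    using mk[of F3, OF F3m F3z F3t] by blast
  have [measurable]: "\<phi>2 \<in> borel_measurable borel" "\<phi>3 \<in> borel_measurable borel" by (rule p2 p3)+
  have t3: "integrable lborel (\<lambda>x. \<phi>3 (x - \<delta>))" using lborel_integrable_real_affine[OF p3(4), of 1 "- \<delta>"] by simp
  note ind = bdd_momentD(2)[OF bdd_moment_indicator[of \<delta>]]
  have s3: "integrable lborel (shifted \<delta> \<phi>3)" unfolding shifted_def[abs_def] using t3 ind by simp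
  have cs3: "cdf (shifted \<delta> \<phi>3) x = max 0 (min x \<delta>) + F3 (x - \<delta>)" for x
    using cdf_shifted[OF p3(4), of \<delta> x] p3(6) by simp
  have sum: "F2 x + cdf (shifted \<delta> \<phi>3) x = F0 x + cdf \<phi>1 x" for x
  proof (cases "x < \<delta>")
    case True
    have "F0 x = max 0 x" using True c0(3)[of "x - \<delta>"] by (simp add: F0v)
    moreover have "cdf \<phi>1 x \<le> max 0 x" using c1(3)[of x] c1(6)[of x] by (cases "x \<le> 0") auto
    ultimately show ?thesis using True F3z[of "x - \<delta>"] by (simp add: cs3 F2_def)
  next
    case False
    then show ?thesis using \<delta> by (simp add: cs3 F2_def F3_def F0v)
  qed
  have nn3: "0 \<le> shifted \<delta> \<phi>3 x" for x using p3(2) by (simp add: shifted_def)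
  have cdf_add: "cdf (\<lambda>x. f x + g x) x = cdf f x + cdf g x" if "integrable lborel f" "integrable lborel g" for f g x
    unfolding cdf_def distrib_left using that by (intro Bochner_Integration.integral_add integrable_indicator_mult) auto
  have ae: "AE x in lborel. \<phi>2 x + shifted \<delta> \<phi>3 x = shifted \<delta> \<phi>0 x + \<phi>1 x"
  proof (rule AE_eq_if_cdf_eq)
    show "cdf (\<lambda>x. \<phi>2 x + shifted \<delta> \<phi>3 x) x = cdf (\<lambda>x. shifted \<delta> \<phi>0 x + \<phi>1 x) x" for x
      using sum[of x] p2(6) s3 p2(4) d1(5) bdd_momentD(2)[OF s0(1)] by (simp add: cdf_add F0_def)
  qed (use p2 s3 nn3 s0 d1 bdd_momentD(2)[OF s0(1)] in auto)
  have mom: "bdd_moment (\<lambda>x. shifted \<delta> \<phi>0 x + \<phi>1 x)" by (rule bdd_moment_add[OF s0(1) d1(8)])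
  have "integrable lborel (\<lambda>x. x * \<phi>2 x)"
  proof (rule Bochner_Integration.integrable_bound[OF bdd_momentD(3)[OF mom]])
    show "AE x in lborel. norm (x * \<phi>2 x) \<le> norm (x * (shifted \<delta> \<phi>0 x + \<phi>1 x))"
      using ae
    proof eventually_elim
      case (elim x)
      have "0 \<le> \<phi>2 x" "\<phi>2 x \<le> shifted \<delta> \<phi>0 x + \<phi>1 x"
        using p2(2)[rule_format, of x] nn3[of x] elim by auto
      then show ?case by (auto simp: abs_mult intro!: mult_left_mono)
    qed
  qed simp
  then have "\<phi>2 \<in> dens" using p2 by (simp add: dens_def)
  have "integrable lborel (\<lambda>x. x * \<phi>3 (x - \<delta>))"
  proof (rule Bochner_Integration.integrable_bound[OF bdd_momentD(3)[OF mom]])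
    show "AE x in lborel. norm (x * \<phi>3 (x - \<delta>)) \<le> norm (x * (shifted \<delta> \<phi>0 x + \<phi>1 x))"
      using ae
    proof eventually_elim
      case (elim x)
      have ind: "(0::real) \<le> indicator {0..<\<delta>} x" by simp
      have "\<phi>3 (x - \<delta>) \<le> shifted \<delta> \<phi>0 x + \<phi>1 x"
        using p2(2)[rule_format, of x] elim ind unfolding shifted_def by linarith
      moreover have "0 \<le> \<phi>3 (x - \<delta>)" using p3(2) by simp
      ultimately have "0 \<le> \<phi>3 (x - \<delta>)" "\<phi>3 (x - \<delta>) \<le> shifted \<delta> \<phi>0 x + \<phi>1 x" by simp_all
      then show ?case by (auto simp: abs_mult intro!: mult_left_mono)
    qed
  qed simp
  then have "integrable lborel (\<lambda>x. (x + \<delta>) * \<phi>3 x)"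
    using lborel_integrable_real_affine[of "\<lambda>x. x * \<phi>3 (x - \<delta>)" 1 \<delta>] by (simp add: add.commute)
  then have "integrable lborel (\<lambda>x. (x + \<delta>) * \<phi>3 x - \<delta> * \<phi>3 x)" using p3(4) by simp
  then have "integrable lborel (\<lambda>x. x * \<phi>3 x)" by (simp add: algebra_simps)
  then have "\<phi>3 \<in> dens" using p3 by (simp add: dens_def)
  show ?thesis
    using that[OF \<open>\<phi>2 \<in> dens\<close> \<open>\<phi>3 \<in> dens\<close> _ _ ae] p2(6) p3(6) by (simp add: F2_def F3_def F0_def)
qed

lemma dens_tail:
  assumes "\<phi> \<in> dens"
  shows "(\<integral>\<^sup>+t. ennreal (indicator {c<..} t * \<phi> t) \<partial>lborel) = ennreal (1 - cdf \<phi> c)"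
proof -
  note d = densD[OF assms]
  have "(\<integral>\<^sup>+t. ennreal (indicator {c<..} t * \<phi> t) \<partial>lborel) = ennreal (LINT t|lborel. indicator {c<..} t * \<phi> t)"
    by (intro nn_integral_eq_integral integrable_indicator_mult d(5)) (auto simp: d(2))
  also have "(LINT t|lborel. indicator {c<..} t * \<phi> t) = (LINT t|lborel. \<phi> t - indicator {..c} t * \<phi> t)"
    by (intro Bochner_Integration.integral_cong) (auto simp: indicator_def)
  finally show ?thesis
    using Bochner_Integration.integral_diff[OF d(5) integrable_indicator_mult[OF d(5)], of "{..c}"] d(6) by (simp add: cdf_def)
qed

text \<open>Layer-cake formula for \<open>h - h 0\<close>: superlevel sets of a nondecreasing
  function on the half-line are half-lines up to an endpoint, and their masses are
  \<open>1 - cdf\<close>.\<close>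

lemma stochastic_order:
  assumes p: "\<phi> \<in> dens" "\<psi> \<in> dens" and le: "\<And>x. cdf \<phi> x \<le> cdf \<psi> x"
    and [measurable]: "h \<in> borel_measurable borel"
    and mono: "\<And>x y. 0 \<le> x \<Longrightarrow> x \<le> y \<Longrightarrow> h x \<le> h y"
    and i: "integrable lborel (\<lambda>x. h x * \<phi> x)" "integrable lborel (\<lambda>x. h x * \<psi> x)"
  shows "(LINT x|lborel. h x * \<psi> x) \<le> (LINT x|lborel. h x * \<phi> x)"
proof -
  note d = densD[OF p(1)] and d' = densD[OF p(2)]
  define k where "k x = h x - h 0" for x
  have k0: "0 \<le> k x" if "0 \<le> x" for x using mono[of 0 x] that by (simp add: k_def)
  have [measurable]: "k \<in> borel_measurable borel" unfolding k_def by measurable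
  define A where "A s = {x. 0 \<le> x \<and> s < k x}" for s
  have layer: "(\<integral>\<^sup>+x. ennreal (k x * f x) \<partial>lborel)
      = (\<integral>\<^sup>+s. indicator {0..} s * (\<integral>\<^sup>+x. ennreal (indicator (A s) x * f x) \<partial>lborel) \<partial>lborel)" if f: "f \<in> dens" for f
  proof -
    note df = densD[OF f]
    have [measurable]: "f \<in> borel_measurable borel" by (rule df(1))
    have "(\<integral>\<^sup>+x. ennreal (k x * f x) \<partial>lborel) = (\<integral>\<^sup>+x. (\<integral>\<^sup>+s. (if 0 \<le> s \<and> 0 \<le> x \<and> s < k x then ennreal (f x) else 0) \<partial>lborel) \<partial>lborel)"
    proof (rule nn_integral_cong)
      fix x
      show "ennreal (k x * f x) = (\<integral>\<^sup>+s. (if 0 \<le> s \<and> 0 \<le> x \<and> s < k x then ennreal (f x) else 0) \<partial>lborel)"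
      proof (cases "x < 0")
        case False
        have "(\<integral>\<^sup>+s. (if 0 \<le> s \<and> 0 \<le> x \<and> s < k x then ennreal (f x) else 0) \<partial>lborel) = (\<integral>\<^sup>+s. ennreal (f x) * indicator {0..<k x} s \<partial>lborel)"
          using False by (intro nn_integral_cong) (auto simp: indicator_def)
        also have "\<dots> = ennreal (f x) * ennreal (k x)"
          using k0[of x] False by (subst nn_integral_cmult_indicator) auto
        finally show ?thesis using df(2) k0[of x] False by (simp add: ennreal_mult'' mult.commute)
      qed (simp add: df(4))
    qed
    also have "\<dots> = (\<integral>\<^sup>+s. (\<integral>\<^sup>+x. (if 0 \<le> s \<and> 0 \<le> x \<and> s < k x then ennreal (f x) else 0) \<partial>lborel) \<partial>lborel)"
      by (rule lborel_pair.Fubini'[symmetric]) measurable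
    also have "\<dots> = (\<integral>\<^sup>+s. indicator {0..} s * (\<integral>\<^sup>+x. ennreal (indicator (A s) x * f x) \<partial>lborel) \<partial>lborel)"
      by (intro nn_integral_cong, simp add: indicator_def, intro impI nn_integral_cong) (auto simp: A_def)
    finally show ?thesis .
  qed
  have cmp: "(\<integral>\<^sup>+x. ennreal (indicator (A s) x * \<psi> x) \<partial>lborel) \<le> (\<integral>\<^sup>+x. ennreal (indicator (A s) x * \<phi> x) \<partial>lborel)" for s
  proof (cases "A s = {}")
    case False
    define c where "c = Inf (A s)"
    have bb: "bdd_below (A s)" by (rule bdd_belowI[of _ 0]) (auto simp: A_def)
    have A1: "c \<le> x" if "x \<in> A s" for x unfolding c_def by (rule cInf_lower[OF that bb])
    have c0: "0 \<le> c" unfolding c_def by (rule cInf_greatest[OF False]) (auto simp: A_def)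
    have A2: "x \<in> A s" if x: "c < x" for x
    proof -
      obtain z where z: "z \<in> A s" "z < x" using cInf_less_iff[OF False bb, of x] x by (auto simp: c_def)
      then have "k z \<le> k x" using mono[of z x] by (simp add: A_def k_def)
      then show ?thesis using z by (auto simp: A_def)
    qed
    have ind: "(\<integral>\<^sup>+x. ennreal (indicator (A s) x * f x) \<partial>lborel) = ennreal (1 - cdf f c)" if "f \<in> dens" for f
    proof -
      have "(\<integral>\<^sup>+x. ennreal (indicator (A s) x * f x) \<partial>lborel) = (\<integral>\<^sup>+x. ennreal (indicator {c<..} x * f x) \<partial>lborel)"
      proof (rule nn_integral_cong_AE)
        show "AE x in lborel. ennreal (indicator (A s) x * f x) = ennreal (indicator {c<..} x * f x)"
          using AE_lborel_singleton[of c]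
        proof eventually_elim
          case (elim x)
          then have "x \<in> A s \<longleftrightarrow> x \<in> {c<..}" using A1[of x] A2[of x] by auto
          then show ?case by (simp add: indicator_def)
        qed
      qed
      then show ?thesis using dens_tail[OF that] by simp
    qed
    show ?thesis unfolding ind[OF p(1)] ind[OF p(2)] using le[of c] by (intro ennreal_leI) simp
  qed simp
  have ik: "integrable lborel (\<lambda>x. k x * f x)" "(LINT x|lborel. k x * f x) = (LINT x|lborel. h x * f x) - h 0"
    if f: "f \<in> dens" "integrable lborel (\<lambda>x. h x * f x)" for f
    using f(2) densD(5,6)[OF f(1)] by (simp_all add: k_def left_diff_distrib)
  have "(\<integral>\<^sup>+x. ennreal (k x * \<psi> x) \<partial>lborel) \<le> (\<integral>\<^sup>+x. ennreal (k x * \<phi> x) \<partial>lborel)"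
    unfolding layer[OF p(1)] layer[OF p(2)] by (rule nn_integral_mono, rule mult_left_mono[OF cmp]) simp
  moreover have nn: "0 \<le> k x * f x" if "f \<in> dens" for f x
    using k0[of x] densD(2,4)[OF that, of x] by (cases "x < 0") auto
  ultimately have "ennreal (LINT x|lborel. k x * \<psi> x) \<le> ennreal (LINT x|lborel. k x * \<phi> x)"
    using nn_integral_eq_integral[OF ik(1)[OF p(1) i(1)]] nn_integral_eq_integral[OF ik(1)[OF p(2) i(2)]] p by simp
  moreover have "0 \<le> (LINT x|lborel. k x * \<phi> x)" using nn[OF p(1)] by (intro integral_nonneg_AE) simp
  ultimately have "(LINT x|lborel. k x * \<psi> x) \<le> (LINT x|lborel. k x * \<phi> x)" by (simp add: ennreal_le_iff)
  then show ?thesis using ik(2)[OF p(1) i(1)] ik(2)[OF p(2) i(2)] by simp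
qed

section \<open>Energy of shifted densities\<close>

lemma log_energy_translate:
  assumes f: "bdd_moment f"
  shows "log_energy (\<lambda>x. f (x - d)) (\<lambda>x. f (x - d)) = log_energy f f"
proof -
  note t = bdd_moment_translate(1)[OF f, of d]
  have inner: "(LINT y|lborel. - ln \<bar>x - y\<bar> * f (y - d)) = (LINT y|lborel. - ln \<bar>(x - d) - y\<bar> * f y)" for x
    using lborel_integral_real_affine[of 1 "\<lambda>y. - ln \<bar>x - y\<bar> * f (y - d)" d] by (simp add: algebra_simps)
  have "log_energy (\<lambda>x. f (x - d)) (\<lambda>x. f (x - d)) = (LINT x|lborel. (LINT y|lborel. - ln \<bar>(x - d) - y\<bar> * f y) * f (x - d))"
    unfolding log_energy_def kform_Fubini(1)[OF log_kernel_ln t t] inner ..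
  also have "\<dots> = (LINT x|lborel. (LINT y|lborel. - ln \<bar>x - y\<bar> * f y) * f x)"
    using lborel_integral_real_affine[of 1 "\<lambda>x. (LINT y|lborel. - ln \<bar>(x - d) - y\<bar> * f y) * f (x - d)" d] by simp
  also have "\<dots> = log_energy f f" unfolding log_energy_def kform_Fubini(1)[OF log_kernel_ln f f] ..
  finally show ?thesis .
qed

lemma log_potential_gap:
  assumes x: "0 \<le> x" and d: "0 \<le> \<delta>"
  shows "log_potential (indicator {0..<\<delta>}) (x + \<delta>) = (x + \<delta>) * ln (x + \<delta>) - x * ln x - \<delta>"
proof -
  have i: "(ln has_integral ((x + \<delta>) * ln (x + \<delta>) - (x + \<delta>) - (x * ln x - x))) {x..x + \<delta>}"
    using has_integral_ln[of x "x + \<delta>"] x d by simp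
  have "((\<lambda>t. ln (x + \<delta> - t)) has_integral ((x + \<delta>) * ln (x + \<delta>) - (x + \<delta>) - (x * ln x - x))) {0..\<delta>}"
    using has_integral_affinity[of ln "(x + \<delta>) * ln (x + \<delta>) - (x + \<delta>) - (x * ln x - x)" x "x + \<delta>" "- 1" "x + \<delta>"] i d by simp
  then have hi: "((\<lambda>t. ln \<bar>x + \<delta> - t\<bar>) has_integral ((x + \<delta>) * ln (x + \<delta>) - (x + \<delta>) - (x * ln x - x))) {0..\<delta>}"
    by (rule has_integral_eq[rotated]) (use x in auto)
  have "(LINT t|lborel. ln \<bar>x + \<delta> - t\<bar> * indicator {0..<\<delta>} t) = integral UNIV (\<lambda>t. ln \<bar>x + \<delta> - t\<bar> * indicator {0..<\<delta>} t)"
    using integrable_log_kernel_inner[OF log_kernel_ln bdd_moment_indicator, of "x + \<delta>" \<delta>] by (intro integral_lborel[symmetric]) simp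
  also have "\<dots> = integral {0..<\<delta>} (\<lambda>t. ln \<bar>x + \<delta> - t\<bar>)"
    by (subst integral_restrict_UNIV[symmetric]) (auto intro!: arg_cong[where f = "integral UNIV"] simp: indicator_def)
  also have "\<dots> = integral {0..\<delta>} (\<lambda>t. ln \<bar>x + \<delta> - t\<bar>)"
    by (rule integral_spike_set) (auto intro: negligible_subset[of "{\<delta>}"])
  also have "\<dots> = (x + \<delta>) * ln (x + \<delta>) - (x + \<delta>) - (x * ln x - x)" using hi by (rule integral_unique)
  finally show ?thesis by (simp add: log_potential_def)
qed

text \<open>For \<open>x \<ge> 0\<close> and \<open>\<delta> \<ge> 0\<close>, the logarithmic
  potential of the filled gap [0, \<delta>) at \<open>x + \<delta>\<close>, the place of a particle
  after its shift from \<open>x\<close>.\<close>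

definition gap_pot :: "real \<Rightarrow> real \<Rightarrow> real" where
  "gap_pot \<delta> x = (x + \<delta>) * ln (x + \<delta>) - x * ln x - \<delta>"

lemma log_energy_shifted:
  assumes p: "\<phi> \<in> dens" and \<delta>: "0 \<le> \<delta>"
  shows "integrable lborel (\<lambda>x. gap_pot \<delta> x * \<phi> x)"
    and "log_energy (shifted \<delta> \<phi>) (shifted \<delta> \<phi>)
      = log_energy \<phi> \<phi> - 2 * (LINT x|lborel. gap_pot \<delta> x * \<phi> x) + log_energy (indicator {0..<\<delta>}) (indicator {0..<\<delta>})"
proof -
  note d = densD[OF p]
  let ?i = "indicator {0..<\<delta>} :: real \<Rightarrow> real"
  let ?t = "\<lambda>x. \<phi> (x - \<delta>)"
  note i = bdd_moment_indicator[of \<delta>] and t = bdd_moment_translate(1)[OF d(8), of \<delta>]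
  have eq: "(\<lambda>x. log_potential ?i (\<delta> + x) * \<phi> x) = (\<lambda>x. gap_pot \<delta> x * \<phi> x)"
  proof
    fix x
    show "log_potential ?i (\<delta> + x) * \<phi> x = gap_pot \<delta> x * \<phi> x"
      using log_potential_gap[of x \<delta>] \<delta> d(4)[of x] by (cases "x < 0") (auto simp: gap_pot_def add.commute)
  qed
  have int: "integrable lborel (\<lambda>x. log_potential ?i x * \<phi> (x - \<delta>))" by (rule log_energy_potential(2)[OF t i])
  show "integrable lborel (\<lambda>x. gap_pot \<delta> x * \<phi> x)"
    using lborel_integrable_real_affine[OF int, of 1 \<delta>] eq by simp
  have "(LINT x|lborel. log_potential ?i x * \<phi> (x - \<delta>)) = (LINT x|lborel. gap_pot \<delta> x * \<phi> x)"
    using lborel_integral_real_affine[of 1 "\<lambda>x. log_potential ?i x * \<phi> (x - \<delta>)" \<delta>] eq by simp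
  then have ti: "log_energy ?t ?i = - (LINT x|lborel. gap_pot \<delta> x * \<phi> x)"
    using log_energy_potential(1)[OF t i] by simp
  have "log_energy (shifted \<delta> \<phi>) (shifted \<delta> \<phi>) = log_energy ?i ?i + log_energy ?i ?t + (log_energy ?t ?i + log_energy ?t ?t)"
    unfolding shifted_def[abs_def] using i t by (simp add: log_energy_add_left log_energy_add_right bdd_moment_add)
  then show "log_energy (shifted \<delta> \<phi>) (shifted \<delta> \<phi>)
      = log_energy \<phi> \<phi> - 2 * (LINT x|lborel. gap_pot \<delta> x * \<phi> x) + log_energy ?i ?i"
    using ti log_energy_commute[OF i t] log_energy_translate[OF d(8), of \<delta>] by simp
qed

lemma xlnx_increment_mono:
  assumes "0 \<le> x" "x \<le> y" "0 \<le> (\<delta>::real)"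
  shows "(x + \<delta>) * ln (x + \<delta>) - x * ln x \<le> (y + \<delta>) * ln (y + \<delta>) - y * ln y"
proof (rule DERIV_nonneg_imp_increasing_open[OF assms(2)])
  have "continuous_on {0..} (\<lambda>x. (x + \<delta>) * ln (x + \<delta>))"
    by (rule continuous_on_compose2[OF continuous_on_xlnx]) (use assms in \<open>auto intro!: continuous_intros\<close>)
  from continuous_on_diff[OF this continuous_on_xlnx]
  show "continuous_on {x..y} (\<lambda>x. (x + \<delta>) * ln (x + \<delta>) - x * ln x)"
    by (rule continuous_on_subset) (use assms in auto)
  fix t assume t: "x < t" "t < y"
  then have "t > 0" using assms by simp
  then have "((\<lambda>x. (x + \<delta>) * ln (x + \<delta>) - x * ln x) has_real_derivative ln (t + \<delta>) - ln t) (at t)"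
    using assms(3) by (auto intro!: derivative_eq_intros)
  moreover have "0 \<le> ln (t + \<delta>) - ln t" using \<open>t > 0\<close> assms(3) by simp
  ultimately show "\<exists>D. ((\<lambda>x. (x + \<delta>) * ln (x + \<delta>) - x * ln x) has_real_derivative D) (at t) \<and> 0 \<le> D" by blast
qed

text \<open>Slicing gives the inequality for the logarithmic energies of \<open>\<phi>2\<close>,
  \<open>shifted \<delta> \<phi>3\<close> against \<open>shifted \<delta> \<phi>0\<close>,
  \<open>\<phi>1\<close>. Undoing the shifts leaves the integral of \<open>h\<close> against
  \<open>\<phi>3\<close> minus that against \<open>\<phi>0\<close>, where \<open>h x\<close> is the
  change of energy per particle when the one from \<open>x\<close> is moved back; the self-energy of
  the gap cancels.\<close>

lemma (in meixner) weighted_energy_lattice: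
  assumes p: "\<phi>0 \<in> dens" "\<phi>1 \<in> dens" "\<phi>2 \<in> dens" "\<phi>3 \<in> dens" and \<delta>: "0 \<le> \<delta>"
    and c2: "\<And>x. cdf \<phi>2 x = min (cdf (shifted \<delta> \<phi>0) x) (cdf \<phi>1 x)"
    and c3: "\<And>x. cdf \<phi>3 x = max (cdf \<phi>0 x) (cdf \<phi>1 (x + \<delta>) - \<delta>)"
    and ae: "AE x in lborel. \<phi>2 x + shifted \<delta> \<phi>3 x = shifted \<delta> \<phi>0 x + \<phi>1 x"
  shows "weighted_energy mpot \<phi>2 + weighted_energy mpot \<phi>3 \<le> weighted_energy mpot \<phi>0 + weighted_energy mpot \<phi>1"
proof -
  note d0 = densD[OF p(1)] and d1 = densD[OF p(2)] and d2 = densD[OF p(3)] and d3 = densD[OF p(4)]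
  note s0 = shifted_props[OF p(1) \<delta>] and s3 = shifted_props[OF p(4) \<delta>]
  note e0 = log_energy_shifted[OF p(1) \<delta>] and e3 = log_energy_shifted[OF p(4) \<delta>]
  have cs3: "cdf (shifted \<delta> \<phi>3) x = max (cdf (shifted \<delta> \<phi>0) x) (cdf \<phi>1 x)" for x
    using c3[of "x - \<delta>"] cdf_dens(3)[OF p(1), of "x - \<delta>"] cdf_dens(3,6)[OF p(2), of x] cdf_dens(3)[OF p(2), of x] \<delta>
    unfolding s3(5) s0(5) by (cases "x \<le> 0"; cases "x \<le> \<delta>") (auto simp: cdf_dens(3)[OF p(4)])
  have E: "log_energy \<phi>2 \<phi>2 + log_energy (shifted \<delta> \<phi>3) (shifted \<delta> \<phi>3) \<le> log_energy (shifted \<delta> \<phi>0) (shifted \<delta> \<phi>0) + log_energy \<phi>1 \<phi>1"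
    unfolding log_energy_def
  proof (rule kform_ln_compare)
    fix u r :: real assume r: "0 < r"
    show "imass \<phi>2 u r * imass \<phi>2 u r + imass (shifted \<delta> \<phi>3) u r * imass (shifted \<delta> \<phi>3) u r
      \<le> imass (shifted \<delta> \<phi>0) u r * imass (shifted \<delta> \<phi>0) u r + imass \<phi>1 u r * imass \<phi>1 u r"
      using min_max_increments[of "cdf (shifted \<delta> \<phi>0) (u + r)" "cdf \<phi>1 (u + r)" "cdf (shifted \<delta> \<phi>0) u" "cdf \<phi>1 u"] r
      by (simp add: imass_cdf d2(5) d1(5) bdd_momentD(2)[OF s0(1)] bdd_momentD(2)[OF s3(1)] c2 cs3 power2_eq_square)
  qed (use d1 d2 s0 s3 in auto)
  have iV: "integrable lborel (\<lambda>x. mpot x * f x)" if "f \<in> dens" for f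
    using integrable_tame[OF mpot_tame densD(8)[OF that] densD(4)[OF that]] .
  have [measurable]: "mpot \<in> borel_measurable borel" by (rule mpot_measurable)
  define h where "h x = mpot x - mpot (\<delta> + x) + 2 * gap_pot \<delta> x" for x
  have iVs: "integrable lborel (\<lambda>x. mpot (\<delta> + x) * f x)"
    "(LINT x|lborel. mpot x * f (x - \<delta>)) = (LINT x|lborel. mpot (\<delta> + x) * f x)"
    "integrable lborel (\<lambda>x. mpot x * f (x - \<delta>))" if f: "f \<in> dens" for f
  proof -
    note df = densD[OF f]
    show i: "integrable lborel (\<lambda>x. mpot x * f (x - \<delta>))"
      by (rule integrable_tame[OF mpot_tame bdd_moment_translate(1)[OF df(8)]]) (use df(4) \<delta> in auto)
    show "integrable lborel (\<lambda>x. mpot (\<delta> + x) * f x)" using lborel_integrable_real_affine[OF i, of 1 \<delta>] by simp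
    show "(LINT x|lborel. mpot x * f (x - \<delta>)) = (LINT x|lborel. mpot (\<delta> + x) * f x)"
      using lborel_integral_real_affine[of 1 "\<lambda>x. mpot x * f (x - \<delta>)" \<delta>] by simp
  qed
  have ih: "integrable lborel (\<lambda>x. h x * f x)"
    and hv: "(LINT x|lborel. h x * f x) = (LINT x|lborel. mpot x * f x) - (LINT x|lborel. mpot x * f (x - \<delta>)) + 2 * (LINT x|lborel. gap_pot \<delta> x * f x)"
    if f: "f \<in> dens" for f
    using iV[OF f] iVs(1,2)[OF f] log_energy_shifted(1)[OF f \<delta>]
    by (simp_all add: h_def distrib_right left_diff_distrib mult.assoc)
  have "(LINT x|lborel. mpot x * \<phi>2 x) - (LINT x|lborel. mpot x * \<phi>1 x) = (LINT x|lborel. mpot x * \<phi>0 (x - \<delta>)) - (LINT x|lborel. mpot x * \<phi>3 (x - \<delta>))"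
  proof -
    have "(LINT x|lborel. mpot x * \<phi>2 x + mpot x * \<phi>3 (x - \<delta>)) = (LINT x|lborel. mpot x * \<phi>0 (x - \<delta>) + mpot x * \<phi>1 x)"
    proof (rule integral_cong_AE)
      show "AE x in lborel. mpot x * \<phi>2 x + mpot x * \<phi>3 (x - \<delta>) = mpot x * \<phi>0 (x - \<delta>) + mpot x * \<phi>1 x"
        using ae
      proof eventually_elim
        case (elim x)
        then have "\<phi>2 x + \<phi>3 (x - \<delta>) = \<phi>0 (x - \<delta>) + \<phi>1 x" by (simp add: shifted_def)
        then show ?case by (simp only: distrib_left[symmetric])
      qed
    qed (use iV[OF p(3)] iV[OF p(2)] iVs(3)[OF p(1)] iVs(3)[OF p(4)] in auto)
    then show ?thesis using iV[OF p(3)] iV[OF p(2)] iVs(3)[OF p(1)] iVs(3)[OF p(4)] by simp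
  qed
  moreover have "(LINT x|lborel. h x * \<phi>3 x) \<le> (LINT x|lborel. h x * \<phi>0 x)"
  proof (rule stochastic_order[OF p(1,4) _ _ _ ih[OF p(1)] ih[OF p(4)]])
    show "cdf \<phi>0 x \<le> cdf \<phi>3 x" for x by (simp add: c3)
    show "h \<in> borel_measurable borel" unfolding h_def gap_pot_def by measurable
    show "h x \<le> h y" if xy: "0 \<le> x" "x \<le> y" for x y
    proof -
      \<comment> \<open>The function \<open>t * ln t\<close> enters with coefficient -1 from the
        potential and +2 from the gap, so +1 is left; both increments are nondecreasing by
        convexity.\<close>
      have "h t = - ln (1 / a) * \<delta> - 2 * \<delta> + ((t + \<delta>) * ln (t + \<delta>) - t * ln t)
        + ((t + b + \<delta>) * ln (t + b + \<delta>) - (t + b) * ln (t + b))" for t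
        by (simp add: h_def mpot_def gap_pot_def algebra_simps)
      then show ?thesis using xlnx_increment_mono[OF xy \<delta>] xlnx_increment_mono[of "x + b" "y + b" \<delta>] xy b \<delta> by simp
    qed
  qed
  ultimately show ?thesis using E e0(2) e3(2) hv[OF p(1)] hv[OF p(4)] unfolding weighted_energy_def by linarith
qed

section \<open>The hole energy\<close>

definition hole_energy :: "(real \<Rightarrow> real) \<Rightarrow> real \<Rightarrow> real" where
  "hole_energy \<phi> y = integral {0..max y 0} (\<lambda>x. x - cdf \<phi> x)"

lemma cdf_continuous:
  assumes "\<phi> \<in> dens"
  shows "continuous_on A (cdf \<phi>)"
proof -
  have "1-lipschitz_on A (cdf \<phi>)"
  proof (rule lipschitz_onI)
    show "dist (cdf \<phi> x) (cdf \<phi> y) \<le> 1 * dist x y" for x y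
      using cdf_dens(1,2)[OF assms, of x y] cdf_dens(1,2)[OF assms, of y x] by (cases "x \<le> y") (auto simp: dist_real_def)
  qed simp
  then show ?thesis by (rule lipschitz_on_continuous_on)
qed

lemma integrable_min_dens:
  assumes "\<phi> \<in> dens"
  shows "integrable lborel (\<lambda>x. min x y * \<phi> x)"
proof -
  note d = densD[OF assms]
  show ?thesis
  proof (rule Bochner_Integration.integrable_bound)
    show "integrable lborel (\<lambda>x. \<bar>x * \<phi> x\<bar> + \<bar>y\<bar> * \<phi> x)" using d by simp
    show "AE x in lborel. norm (min x y * \<phi> x) \<le> norm (\<bar>x * \<phi> x\<bar> + \<bar>y\<bar> * \<phi> x)"
    proof (rule AE_I2)
      fix x
      have "\<bar>min x y\<bar> * \<phi> x \<le> (\<bar>x\<bar> + \<bar>y\<bar>) * \<phi> x" using d(2)[of x] by (intro mult_right_mono) auto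
      then show "norm (min x y * \<phi> x) \<le> norm (\<bar>x * \<phi> x\<bar> + \<bar>y\<bar> * \<phi> x)"
        using d(2)[of x] by (simp add: abs_mult distrib_right)
    qed
  qed (use d(1) in measurable)
qed

text \<open>For \<open>y > 0\<close> and \<open>x \<ge> 0\<close>, \<open>min x y\<close> is the
  length of [0, min x y], so by Tonelli its mean is the integral of \<open>1 - cdf \<phi>\<close>
  over [0, y]. This is how the explicit quadratic and linear terms of the rate function combine with
  the kink of the potential into one quantity monotone in \<open>y\<close>.\<close>

lemma hole_energy_eq:
  assumes p: "\<phi> \<in> dens"
  shows "hole_energy \<phi> y = (LINT x|lborel. min x y * \<phi> x) + (max y 0)\<^sup>2 / 2 - y"
proof (cases "y \<le> 0")
  case True
  note d = densD[OF p]
  have "min x y * \<phi> x = y * \<phi> x" for x using True d(4)[of x] by (cases "x < 0") auto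
  then have "(LINT x|lborel. min x y * \<phi> x) = (LINT x|lborel. y * \<phi> x)"
    by (intro Bochner_Integration.integral_cong refl)
  then show ?thesis using True d by (simp add: hole_energy_def)
next
  case False
  note d = densD[OF p]
  have [measurable]: "\<phi> \<in> borel_measurable borel" by (rule d(1))
  have ic: "cdf \<phi> integrable_on {0..y}" by (intro integrable_continuous_interval cdf_continuous p)
  have hi: "((\<lambda>t. 1 - cdf \<phi> t) has_integral (y - integral {0..y} (cdf \<phi>))) {0..y}"
    using has_integral_diff[OF has_integral_const_real[of 1 0 y] integrable_integral[OF ic]] False by simp
  have c1: "0 \<le> 1 - cdf \<phi> t" for t using cdf_dens(4)[OF p, of t] by simp
  have "ennreal (LINT x|lborel. min x y * \<phi> x) = (\<integral>\<^sup>+x. ennreal (min x y * \<phi> x) \<partial>lborel)"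
  proof (rule nn_integral_eq_integral[symmetric, OF integrable_min_dens[OF p]])
    show "AE x in lborel. 0 \<le> min x y * \<phi> x"
    proof (rule AE_I2)
      show "0 \<le> min x y * \<phi> x" for x using False d(2,4)[of x] by (cases "x < 0") auto
    qed
  qed
  also have "\<dots> = (\<integral>\<^sup>+x. (\<integral>\<^sup>+t. (if 0 \<le> t \<and> t < x \<and> t \<le> y then ennreal (\<phi> x) else 0) \<partial>lborel) \<partial>lborel)"
  proof (rule nn_integral_cong)
    fix x
    show "ennreal (min x y * \<phi> x) = (\<integral>\<^sup>+t. (if 0 \<le> t \<and> t < x \<and> t \<le> y then ennreal (\<phi> x) else 0) \<partial>lborel)"
    proof (cases "x < 0")
      case x: False
      have "(\<integral>\<^sup>+t. (if 0 \<le> t \<and> t < x \<and> t \<le> y then ennreal (\<phi> x) else 0) \<partial>lborel) = (\<integral>\<^sup>+t. ennreal (\<phi> x) * indicator {0..min x y} t \<partial>lborel)"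
      proof (rule nn_integral_cong_AE)
        show "AE t in lborel. (if 0 \<le> t \<and> t < x \<and> t \<le> y then ennreal (\<phi> x) else 0) = ennreal (\<phi> x) * indicator {0..min x y} t"
          using AE_lborel_singleton[of x] by eventually_elim (auto simp: indicator_def)
      qed
      also have "\<dots> = ennreal (\<phi> x) * ennreal (min x y)" using x False by (subst nn_integral_cmult_indicator) auto
      finally show ?thesis using d(2) x False by (simp add: ennreal_mult'' mult.commute)
    qed (simp add: d(4) cong: if_cong)
  qed
  also have "\<dots> = (\<integral>\<^sup>+t. (\<integral>\<^sup>+x. (if 0 \<le> t \<and> t < x \<and> t \<le> y then ennreal (\<phi> x) else 0) \<partial>lborel) \<partial>lborel)"
    by (rule lborel_pair.Fubini'[symmetric]) measurable
  also have "\<dots> = (\<integral>\<^sup>+t. ennreal (indicator {0..y} t * (1 - cdf \<phi> t)) \<partial>lborel)"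
  proof (rule nn_integral_cong)
    fix t
    show "(\<integral>\<^sup>+x. (if 0 \<le> t \<and> t < x \<and> t \<le> y then ennreal (\<phi> x) else 0) \<partial>lborel) = ennreal (indicator {0..y} t * (1 - cdf \<phi> t))"
    proof (cases "t \<in> {0..y}")
      case True
      then have "(\<integral>\<^sup>+x. (if 0 \<le> t \<and> t < x \<and> t \<le> y then ennreal (\<phi> x) else 0) \<partial>lborel) = (\<integral>\<^sup>+x. ennreal (indicator {t<..} x * \<phi> x) \<partial>lborel)"
        by (intro nn_integral_cong) (auto simp: indicator_def)
      then show ?thesis using True dens_tail[OF p, of t] by simp
    next
      case False
      then have "(\<lambda>x. if 0 \<le> t \<and> t < x \<and> t \<le> y then ennreal (\<phi> x) else 0) = (\<lambda>x. 0)" by auto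
      then show ?thesis using False by simp
    qed
  qed
  also have "\<dots> = ennreal (y - integral {0..y} (cdf \<phi>))"
    by (rule nn_integral_has_integral_lebesgue[OF c1 hi])
  finally have *: "ennreal (LINT x|lborel. min x y * \<phi> x) = ennreal (y - integral {0..y} (cdf \<phi>))" .
  have "0 \<le> (LINT x|lborel. min x y * \<phi> x)"
  proof (rule integral_nonneg_AE, rule AE_I2)
    show "0 \<le> min x y * \<phi> x" for x using False d(2,4)[of x] by (cases "x < 0") auto
  qed
  moreover have "0 \<le> y - integral {0..y} (cdf \<phi>)" by (rule has_integral_nonneg[OF hi c1])
  ultimately have L: "(LINT x|lborel. min x y * \<phi> x) = y - integral {0..y} (cdf \<phi>)" using * by simp
  have "((\<lambda>x::real. x) has_integral (y\<^sup>2 / 2 - 0\<^sup>2 / 2)) {0..y}"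
    by (rule fundamental_theorem_of_calculus)
      (use False in \<open>auto intro!: derivative_eq_intros simp: has_real_derivative_iff_has_vector_derivative[symmetric]\<close>)
  from has_integral_diff[OF this integrable_integral[OF ic]]
  have "integral {0..y} (\<lambda>x. x - cdf \<phi> x) = y\<^sup>2 / 2 - integral {0..y} (cdf \<phi>)" by (simp add: integral_unique)
  then show ?thesis using L False by (simp add: hole_energy_def max_def)
qed

lemma hole_integrable: "\<phi> \<in> dens \<Longrightarrow> (\<lambda>x. x - cdf \<phi> x) integrable_on {u..v}"
  by (intro integrable_continuous_interval continuous_intros cdf_continuous)

lemma hole_energy_mono:
  assumes p: "\<phi> \<in> dens" and "y \<le> y'"
  shows "hole_energy \<phi> y \<le> hole_energy \<phi> y'"
  unfolding hole_energy_def
  by (rule integral_subset_le) (use assms cdf_dens(6)[OF p] in \<open>auto intro: hole_integrable\<close>)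

text \<open>In terms of hole counts, \<open>\<phi>2\<close> has the maximum of the translated count
  of \<open>\<phi>0\<close> and the count of \<open>\<phi>1\<close> from \<delta> on, and
  \<open>\<phi>3\<close>, translated, has the minimum. Where both integrals run, maximum plus
  minimum is the sum; on the remaining stretch up to \<open>y1\<close> the minimum is at most the
  count of \<open>\<phi>1\<close>.\<close>

lemma hole_energy_lattice:
  assumes p: "\<phi>0 \<in> dens" "\<phi>1 \<in> dens" "\<phi>2 \<in> dens" "\<phi>3 \<in> dens" and \<delta>: "0 \<le> \<delta>"
    and c2: "\<And>x. cdf \<phi>2 x = min (cdf (shifted \<delta> \<phi>0) x) (cdf \<phi>1 x)"
    and c3: "\<And>x. cdf \<phi>3 x = max (cdf \<phi>0 x) (cdf \<phi>1 (x + \<delta>) - \<delta>)"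
    and y: "0 \<le> y0" "y0 + \<delta> \<le> y1"
  shows "hole_energy \<phi>2 (y0 + \<delta>) + hole_energy \<phi>3 (y1 - \<delta>) \<le> hole_energy \<phi>0 y0 + hole_energy \<phi>1 y1"
proof -
  define H0 H1 where "H0 x = x - cdf \<phi>0 x" and "H1 x = x - cdf \<phi>1 x" for x
  define G2 G3 where "G2 x = x - cdf \<phi>2 x" and "G3 x = x - cdf \<phi>3 x" for x
  note c0 = cdf_continuous[OF p(1)] and c1 = cdf_continuous[OF p(2)]
  have cH0: "continuous_on A H0" and cH1: "continuous_on A H1" and cG2: "continuous_on A G2" and cG3: "continuous_on A G3" for A
    unfolding H0_def H1_def G2_def G3_def by (intro continuous_intros cdf_continuous p)+
  have cH0s: "continuous_on A (\<lambda>x. H0 (x - \<delta>))" and cG3s: "continuous_on A (\<lambda>x. G3 (x - \<delta>))" for A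
    by (rule continuous_on_compose2[OF cH0[of UNIV]] continuous_on_compose2[OF cG3[of UNIV]]; auto intro!: continuous_intros)+
  have shift: "integral {u..v} f = integral {u + \<delta>..v + \<delta>} (\<lambda>x. f (x - \<delta>))" if "continuous_on UNIV f" for u v and f :: "real \<Rightarrow> real"
    using integral_shift[of "u" \<delta> v "\<lambda>x. f (x - \<delta>)"] that
      continuous_on_compose2[OF that, of "{u + \<delta>..v + \<delta>}" "\<lambda>x. x - \<delta>"]
    by (simp add: o_def continuous_intros)
  have G2a: "G2 x = H1 x" if "0 \<le> x" "x \<le> \<delta>" for x
    using that cdf_dens(3)[OF p(1), of "x - \<delta>"] cdf_dens(6)[OF p(2), of x]
    by (simp add: G2_def H1_def c2 shifted_props(5)[OF p(1) \<delta>])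
  have G2b: "G2 x = max (H0 (x - \<delta>)) (H1 x)" if "\<delta> \<le> x" for x
    using that \<delta> by (simp add: G2_def H0_def H1_def c2 shifted_props(5)[OF p(1) \<delta>])
  have G3: "G3 (x - \<delta>) = min (H0 (x - \<delta>)) (H1 x)" for x
    by (simp add: G3_def H0_def H1_def c3)
  note io = integrable_continuous_interval
  have "integral {0..y0 + \<delta>} G2 = integral {0..\<delta>} G2 + integral {\<delta>..y0 + \<delta>} G2"
    using Henstock_Kurzweil_Integration.integral_combine[of 0 \<delta> "y0 + \<delta>" G2] \<delta> y io[OF cG2] by simp
  also have "integral {0..\<delta>} G2 = integral {0..\<delta>} H1" using G2a by (intro integral_cong) auto
  finally have 1: "integral {0..y0 + \<delta>} G2 = integral {0..\<delta>} H1 + integral {\<delta>..y0 + \<delta>} G2" .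
  have "integral {0..y1 - \<delta>} G3 = integral {\<delta>..y1} (\<lambda>x. G3 (x - \<delta>))"
    using shift[OF cG3, of 0 "y1 - \<delta>"] by simp
  also have "\<dots> = integral {\<delta>..y0 + \<delta>} (\<lambda>x. G3 (x - \<delta>)) + integral {y0 + \<delta>..y1} (\<lambda>x. G3 (x - \<delta>))"
    using Henstock_Kurzweil_Integration.integral_combine[of \<delta> "y0 + \<delta>" y1 "\<lambda>x. G3 (x - \<delta>)"] y io[OF cG3s] by simp
  also have "integral {y0 + \<delta>..y1} (\<lambda>x. G3 (x - \<delta>)) \<le> integral {y0 + \<delta>..y1} H1"
    by (rule integral_le[OF io[OF cG3s] io[OF cH1]]) (simp add: G3)
  finally have 2: "integral {0..y1 - \<delta>} G3 \<le> integral {\<delta>..y0 + \<delta>} (\<lambda>x. G3 (x - \<delta>)) + integral {y0 + \<delta>..y1} H1" by simp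
  have "integral {\<delta>..y0 + \<delta>} G2 + integral {\<delta>..y0 + \<delta>} (\<lambda>x. G3 (x - \<delta>)) = integral {\<delta>..y0 + \<delta>} (\<lambda>x. G2 x + G3 (x - \<delta>))"
    by (rule integral_add[symmetric]; rule io; rule cG2 cG3s)
  also have "\<dots> = integral {\<delta>..y0 + \<delta>} (\<lambda>x. H0 (x - \<delta>) + H1 x)"
    using G2b G3 by (intro integral_cong) auto
  also have "\<dots> = integral {\<delta>..y0 + \<delta>} (\<lambda>x. H0 (x - \<delta>)) + integral {\<delta>..y0 + \<delta>} H1"
    by (rule integral_add; rule io; rule cH1 cH0s)
  also have "integral {\<delta>..y0 + \<delta>} (\<lambda>x. H0 (x - \<delta>)) = integral {0..y0} H0" using shift[OF cH0, of 0 y0] by simp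
  finally have 3: "integral {\<delta>..y0 + \<delta>} G2 + integral {\<delta>..y0 + \<delta>} (\<lambda>x. G3 (x - \<delta>)) = integral {0..y0} H0 + integral {\<delta>..y0 + \<delta>} H1" .
  have 4: "integral {0..y1} H1 = integral {0..\<delta>} H1 + integral {\<delta>..y0 + \<delta>} H1 + integral {y0 + \<delta>..y1} H1"
    using Henstock_Kurzweil_Integration.integral_combine[of 0 \<delta> y1 H1] Henstock_Kurzweil_Integration.integral_combine[of \<delta> "y0 + \<delta>" y1 H1]
      \<delta> y io[OF cH1] by simp
  have "max (y0 + \<delta>) 0 = y0 + \<delta>" "max (y1 - \<delta>) 0 = y1 - \<delta>" "max y0 0 = y0" "max y1 0 = y1" using y \<delta> by auto
  then show ?thesis using 1 2 3 4
    unfolding hole_energy_def G2_def[abs_def] G3_def[abs_def] H0_def[abs_def] H1_def[abs_def] by simp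
qed

section \<open>The rate function\<close>

locale meixner_q = meixner +
  fixes q :: real
  assumes q: "0 < q" "q < 1"
begin

abbreviation "L \<equiv> ln (1 / q)"

lemma L_pos: "0 < L" using q by simp

definition objective :: "(real \<Rightarrow> real) \<Rightarrow> real \<Rightarrow> real" where
  "objective \<phi> y = weighted_energy mpot \<phi> + L * hole_energy \<phi> y"

text \<open>The rate function up to an additive constant; \<open>optimum_le\<close> and
  \<open>le_optimumI\<close> identify it as the infimum of \<open>objective\<close> over
  \<open>dens\<close>.\<close>

definition optimum :: "real \<Rightarrow> real" where
  "optimum y = L * ((max y 0)\<^sup>2 / 2 - y) + F_eq a q (b + 1) y"

lemma weighted_energy_potential:
  assumes p: "\<phi> \<in> dens"
  shows "weighted_energy (potential a q (b + 1) y) \<phi> = objective \<phi> y - L * ((max y 0)\<^sup>2 / 2 - y)"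
proof -
  note d = densD[OF p]
  have "(LINT x|lborel. potential a q (b + 1) y x * \<phi> x) = (LINT x|lborel. mpot x * \<phi> x + L * (min x y * \<phi> x))"
  proof (intro Bochner_Integration.integral_cong refl)
    show "potential a q (b + 1) y x * \<phi> x = mpot x * \<phi> x + L * (min x y * \<phi> x)" for x
      using mpot_eq_potential[of q x y] q d(4)[of x] by (cases "x < 0") (auto simp: distrib_right)
  qed
  also have "\<dots> = (LINT x|lborel. mpot x * \<phi> x) + L * (LINT x|lborel. min x y * \<phi> x)"
    using integrable_tame[OF mpot_tame d(8) d(4)] integrable_min_dens[OF p, of y] by simp
  finally show ?thesis
    by (simp add: weighted_energy_def objective_def hole_energy_eq[OF p] algebra_simps)
qed

lemma F_eq_INF: "F_eq a q (b + 1) y = (INF \<phi>\<in>dens. weighted_energy (potential a q (b + 1) y) \<phi>)"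
  and bdd: "bdd_below (weighted_energy (potential a q (b + 1) y) ` dens)"
proof -
  have t: "tame (potential a q (b + 1) y)" using a b q by (intro potential_tame) auto
  show "F_eq a q (b + 1) y = (INF \<phi>\<in>dens. weighted_energy (potential a q (b + 1) y) \<phi>)"
    unfolding F_eq_def by (rule equilibrium_energy_eq[OF t])
  show "bdd_below (weighted_energy (potential a q (b + 1) y) ` dens)" by (rule weighted_energy_bdd_below[OF t])
qed

lemma optimum_le: "\<phi> \<in> dens \<Longrightarrow> optimum y \<le> objective \<phi> y"
  using cINF_lower[OF bdd, of \<phi> y] by (simp add: optimum_def F_eq_INF weighted_energy_potential)

lemma optimum_approx:
  assumes "e > 0"
  obtains \<phi> where "\<phi> \<in> dens" "objective \<phi> y < optimum y + e"
proof -
  have "\<exists>\<phi>\<in>dens. weighted_energy (potential a q (b + 1) y) \<phi> < F_eq a q (b + 1) y + e"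
    using cINF_less_iff[OF _ bdd, of y "F_eq a q (b + 1) y + e"] dens_uniform assms F_eq_INF by auto
  then show ?thesis using that by (force simp: weighted_energy_potential optimum_def)
qed

lemma le_optimumI:
  assumes "\<And>\<phi>. \<phi> \<in> dens \<Longrightarrow> c \<le> objective \<phi> y"
  shows "c \<le> optimum y"
proof (rule field_le_epsilon)
  fix e :: real assume "e > 0"
  then obtain \<phi> where "\<phi> \<in> dens" "objective \<phi> y < optimum y + e" by (rule optimum_approx)
  then show "c \<le> optimum y + e" using assms[of \<phi>] by simp
qed

lemma optimum_mono: "mono optimum"
proof (rule monoI)
  fix x y :: real assume "x \<le> y"
  show "optimum x \<le> optimum y"
  proof (rule le_optimumI)
    fix \<phi> assume p: "\<phi> \<in> dens"
    have "optimum x \<le> objective \<phi> x" by (rule optimum_le[OF p])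
    also have "\<dots> \<le> objective \<phi> y" using hole_energy_mono[OF p \<open>x \<le> y\<close>] L_pos by (simp add: objective_def)
    finally show "optimum x \<le> objective \<phi> y" .
  qed
qed

lemma optimum_nonpos: assumes "y \<le> 0" shows "optimum y = free_energy"
proof (rule antisym)
  have z: "hole_energy \<phi> y = 0" for \<phi> using assms by (simp add: hole_energy_def)
  show "optimum y \<le> free_energy" using optimum_le[OF mdens_dens, of y] by (simp add: objective_def z free_energy_def)
  show "free_energy \<le> optimum y" by (rule le_optimumI) (simp add: objective_def z free_energy_le)
qed

lemma optimum_ge: "free_energy \<le> optimum y"
  using optimum_nonpos[of "min y 0"] monoD[OF optimum_mono, of "min y 0" y] by simp

lemma optimum_midpoint_nonneg:
  assumes "0 \<le> y0" "y0 \<le> y1"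
  shows "optimum ((y0 + y1) / 2) \<le> (optimum y0 + optimum y1) / 2"
proof -
  define d where "d = (y1 - y0) / 2"
  have d: "0 \<le> d" "y0 + d = (y0 + y1) / 2" "y1 - d = (y0 + y1) / 2" "y0 + d \<le> y1"
    using assms by (simp_all add: d_def field_simps)
  have le: "2 * optimum ((y0 + y1) / 2) \<le> objective \<phi>0 y0 + objective \<phi>1 y1" if p: "\<phi>0 \<in> dens" "\<phi>1 \<in> dens" for \<phi>0 \<phi>1
  proof -
    obtain \<phi>2 \<phi>3 where l: "\<phi>2 \<in> dens" "\<phi>3 \<in> dens"
      "\<And>x. cdf \<phi>2 x = min (cdf (shifted d \<phi>0) x) (cdf \<phi>1 x)"
      "\<And>x. cdf \<phi>3 x = max (cdf \<phi>0 x) (cdf \<phi>1 (x + d) - d)"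
      "AE x in lborel. \<phi>2 x + shifted d \<phi>3 x = shifted d \<phi>0 x + \<phi>1 x"
      using dens_lattice[OF p d(1)] by blast
    have "2 * optimum ((y0 + y1) / 2) \<le> objective \<phi>2 (y0 + d) + objective \<phi>3 (y1 - d)"
      using optimum_le[OF l(1), of "(y0 + y1) / 2"] optimum_le[OF l(2), of "(y0 + y1) / 2"] unfolding d(2,3) by linarith
    also have "\<dots> = (weighted_energy mpot \<phi>2 + weighted_energy mpot \<phi>3) + L * (hole_energy \<phi>2 (y0 + d) + hole_energy \<phi>3 (y1 - d))"
      by (simp add: objective_def algebra_simps)
    also have "\<dots> \<le> (weighted_energy mpot \<phi>0 + weighted_energy mpot \<phi>1) + L * (hole_energy \<phi>0 y0 + hole_energy \<phi>1 y1)"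
      by (rule add_mono[OF weighted_energy_lattice[OF p l(1,2) d(1) l(3,4,5)]
            mult_left_mono[OF hole_energy_lattice[OF p l(1,2) d(1) l(3,4) assms(1) d(4)] less_imp_le[OF L_pos]]])
    also have "\<dots> = objective \<phi>0 y0 + objective \<phi>1 y1" by (simp add: objective_def algebra_simps)
    finally show ?thesis .
  qed
  have "2 * optimum ((y0 + y1) / 2) - objective \<phi>1 y1 \<le> optimum y0" if "\<phi>1 \<in> dens" for \<phi>1
    by (rule le_optimumI) (use le that in fastforce)
  then have "2 * optimum ((y0 + y1) / 2) - optimum y0 \<le> optimum y1" by (intro le_optimumI) fastforce
  then show ?thesis by simp
qed

lemma optimum_midpoint: "optimum ((x + y) / 2) \<le> (optimum x + optimum y) / 2"
proof -
  have *: "optimum ((x + y) / 2) \<le> (optimum x + optimum y) / 2" if xy: "x \<le> y" for x y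
  proof (cases "0 \<le> x")
    case False
    have "optimum x = optimum 0" using optimum_nonpos[of x] optimum_nonpos[of 0] False by simp
    show ?thesis
    proof (cases "0 \<le> y")
      case True
      have "optimum ((x + y) / 2) \<le> optimum ((0 + y) / 2)" using False by (intro monoD[OF optimum_mono]) simp
      also have "\<dots> \<le> (optimum 0 + optimum y) / 2" by (rule optimum_midpoint_nonneg) (use True in auto)
      finally show ?thesis using \<open>optimum x = optimum 0\<close> by simp
    next
      case y: False
      then show ?thesis using False optimum_nonpos[of x] optimum_nonpos[of y] optimum_nonpos[of "(x + y) / 2"] by simp
    qed
  qed (use optimum_midpoint_nonneg that in auto)
  show ?thesis using *[of x y] *[of y x] by (cases "x \<le> y") (auto simp: add.commute)
qed

text \<open>For fixed \<phi>, the objective minus \<open>L * y\<^sup>2 / 2\<close> is a constant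
  plus \<open>L\<close> times the following: the mean of \<open>min x y\<close>, which is concave in
  \<open>y\<close>, minus \<open>y\<close> and minus the convex function
  \<open>(min y 0)\<^sup>2 / 2\<close>. Concavity then passes to the infimum over \<phi>.\<close>

lemma objective_semiconcave:
  assumes p: "\<phi> \<in> dens" and t: "0 \<le> t" "t \<le> 1"
  shows "(1 - t) * (objective \<phi> u - L * u\<^sup>2 / 2) + t * (objective \<phi> v - L * v\<^sup>2 / 2)
    \<le> objective \<phi> ((1 - t) * u + t * v) - L * ((1 - t) * u + t * v)\<^sup>2 / 2"
proof -
  define w where "w = (1 - t) * u + t * v"
  define m where "m y = (LINT x|lborel. min x y * \<phi> x)" for y
  have Jv: "objective \<phi> y - L * y\<^sup>2 / 2 = weighted_energy mpot \<phi> + L * (m y - y - (min y 0)\<^sup>2 / 2)" for y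
  proof -
    have "(max y 0)\<^sup>2 - y\<^sup>2 = - (min y 0)\<^sup>2" by (simp add: max_def min_def)
    then have "L * ((max y 0)\<^sup>2 - y\<^sup>2) = L * (- (min y 0)\<^sup>2)" by simp
    then show ?thesis unfolding objective_def hole_energy_eq[OF p] m_def by (simp add: field_simps)
  qed
  have mc: "(1 - t) * m u + t * m v \<le> m w"
  proof -
    have "(1 - t) * m u + t * m v = (LINT x|lborel. (1 - t) * (min x u * \<phi> x) + t * (min x v * \<phi> x))"
      unfolding m_def using integrable_min_dens[OF p] by simp
    also have "\<dots> \<le> m w" unfolding m_def
    proof (rule integral_mono)
      fix x
      have "(1 - t) * min x u \<le> (1 - t) * x" "(1 - t) * min x u \<le> (1 - t) * u" "t * min x v \<le> t * x" "t * min x v \<le> t * v"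
        using t by (auto intro!: mult_left_mono)
      then have "(1 - t) * min x u + t * min x v \<le> min x w"
        unfolding w_def by (simp add: algebra_simps min_def) 
      then have "((1 - t) * min x u + t * min x v) * \<phi> x \<le> min x w * \<phi> x"
        using densD(2)[OF p, of x] by (rule mult_right_mono)
      then show "(1 - t) * (min x u * \<phi> x) + t * (min x v * \<phi> x) \<le> min x w * \<phi> x" by (simp add: algebra_simps)
    qed (use integrable_min_dens[OF p] in auto)
    finally show ?thesis .
  qed
  have sq: "(min w 0)\<^sup>2 \<le> (1 - t) * (min u 0)\<^sup>2 + t * (min v 0)\<^sup>2"
  proof -
    define U V where "U = min u 0" and "V = min v 0"
    have "(1 - t) * U \<le> (1 - t) * u" "t * V \<le> t * v" "(1 - t) * U \<le> 0" "t * V \<le> 0"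
      using t by (auto simp: U_def V_def mult_nonneg_nonpos intro!: mult_left_mono)
    then have "(1 - t) * U + t * V \<le> min w 0" by (simp add: w_def)
    then have "(min w 0)\<^sup>2 \<le> ((1 - t) * U + t * V)\<^sup>2"
      by (simp add: power2_le_iff_abs_le abs_le_iff flip: abs_le_square_iff) linarith?
    also have "\<dots> = (1 - t) * U\<^sup>2 + t * V\<^sup>2 - t * (1 - t) * (U - V)\<^sup>2" by (simp add: power2_eq_square algebra_simps)
    also have "\<dots> \<le> (1 - t) * U\<^sup>2 + t * V\<^sup>2" using t by simp
    finally show ?thesis by (simp add: U_def V_def)
  qed
  have "(1 - t) * (objective \<phi> u - L * u\<^sup>2 / 2) + t * (objective \<phi> v - L * v\<^sup>2 / 2)
    = weighted_energy mpot \<phi> + L * (((1 - t) * m u + t * m v) - w - ((1 - t) * (min u 0)\<^sup>2 + t * (min v 0)\<^sup>2) / 2)"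
    unfolding Jv w_def by (simp add: algebra_simps add_divide_distrib diff_divide_distrib)
  also have "\<dots> \<le> weighted_energy mpot \<phi> + L * (m w - w - (min w 0)\<^sup>2 / 2)"
  proof (intro add_left_mono mult_left_mono)
    show "(1 - t) * m u + t * m v - w - ((1 - t) * (min u 0)\<^sup>2 + t * (min v 0)\<^sup>2) / 2 \<le> m w - w - (min w 0)\<^sup>2 / 2"
      by (intro diff_mono mc divide_right_mono sq order_refl) simp
  qed (use L_pos in simp)
  also have "\<dots> = objective \<phi> w - L * w\<^sup>2 / 2" by (rule Jv[symmetric])
  finally show ?thesis unfolding w_def .
qed

lemma optimum_semiconcave: "convex_on UNIV (\<lambda>y. L * y\<^sup>2 / 2 - optimum y)"
proof (rule convex_onI)
  fix t u v :: real assume t: "0 < t" "t < 1"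
  define w where "w = (1 - t) * u + t * v"
  have "(1 - t) * (optimum u - L * u\<^sup>2 / 2) + t * (optimum v - L * v\<^sup>2 / 2) + L * w\<^sup>2 / 2 \<le> optimum w"
  proof (rule le_optimumI)
    fix \<phi> assume p: "\<phi> \<in> dens"
    have "(1 - t) * (optimum u - L * u\<^sup>2 / 2) + t * (optimum v - L * v\<^sup>2 / 2) \<le> (1 - t) * (objective \<phi> u - L * u\<^sup>2 / 2) + t * (objective \<phi> v - L * v\<^sup>2 / 2)"
      using t optimum_le[OF p] by (intro add_mono mult_left_mono) auto
    also have "\<dots> \<le> objective \<phi> w - L * w\<^sup>2 / 2" using objective_semiconcave[OF p, of t u v] t by (simp add: w_def)
    finally show "(1 - t) * (optimum u - L * u\<^sup>2 / 2) + t * (optimum v - L * v\<^sup>2 / 2) + L * w\<^sup>2 / 2 \<le> objective \<phi> w" by simp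
  qed
  moreover have e: "(1 - t) *\<^sub>R u + t *\<^sub>R v = w" by (simp add: w_def)
  ultimately show "L * ((1 - t) *\<^sub>R u + t *\<^sub>R v)\<^sup>2 / 2 - optimum ((1 - t) *\<^sub>R u + t *\<^sub>R v)
    \<le> (1 - t) * (L * u\<^sup>2 / 2 - optimum u) + t * (L * v\<^sup>2 / 2 - optimum v)"
    unfolding e by (simp add: algebra_simps)
qed simp

lemma optimum_convex: "convex_on UNIV optimum"
proof (rule midpoint_convex_continuous_imp_convex)
  \<comment> \<open>A finite convex function on the line is continuous; semiconcavity thus supplies
    the continuity that midpoint convexity alone does not give.\<close>
  have c: "continuous_on UNIV (\<lambda>y. L * y\<^sup>2 / 2 - optimum y)" by (rule convex_on_continuous[OF open_UNIV optimum_semiconcave])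
  have "continuous_on UNIV (\<lambda>y. L * y\<^sup>2 / 2 - (L * y\<^sup>2 / 2 - optimum y))"
    by (intro continuous_on_diff[OF _ c] continuous_intros) auto
  then show "continuous_on UNIV optimum" by simp
qed (rule optimum_midpoint)

text \<open>Left of \<open>lo 1\<close> the minimiser \<open>mdens\<close> of the Meixner energy is
  saturated, so there are no holes and the additional term vanishes at \<open>y = lo 1\<close>.
  Under the hypothesis this edge is \<gamma> for \<open>\<kappa> = b + 1\<close>.\<close>

lemma optimum_saturated:
  assumes "a * (b + 1) \<le> 1"
  shows "optimum (lo 1) = free_energy"
proof -
  have l0: "0 \<le> lo 1" by (rule lo_nonneg) simp
  have "hole_energy mdens (lo 1) = 0"
  proof (cases "lo 1 = 0")
    case False
    have "a * (b + 1) \<noteq> 1"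
    proof
      assume "a * (b + 1) = 1"
      then have "sqrt (a * (1 + b)) = 1" by (simp add: add.commute)
      then show False using False by (simp add: lo_eq)
    qed
    then have lt: "a * (b + 1) < 1" using assms by simp
    have "cdf mdens x = x" if x: "0 \<le> x" "x \<le> lo 1" for x
    proof -
      have "cdf mdens x - cdf mdens 0 = (LINT t|lborel. indicator {0<..x} t * mdens t)"
        by (rule cdf_diff[OF mdens_integral_1(1) x(1)])
      also have "\<dots> = (LINT t|lborel. indicator {0<..x} t)"
      proof (rule integral_cong_AE)
        show "AE t in lborel. indicator {0<..x} t * mdens t = indicator {0<..x} t"
          using AE_lborel_singleton[of "lo 1"]
          by eventually_elim (use mdens_saturated[OF _ _ lt] x in \<open>auto simp: indicator_def\<close>)
      qed measurable
      also have "\<dots> = x" using x by simp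
      finally show ?thesis using cdf_dens(3)[OF mdens_dens, of 0] by simp
    qed
    then have "integral {0..lo 1} (\<lambda>x. x - cdf mdens x) = integral {0..lo 1} (\<lambda>x. 0)"
      by (intro integral_cong) auto
    then show ?thesis using l0 by (simp add: hole_energy_def max_def)
  qed (simp add: hole_energy_def)
  then have "optimum (lo 1) \<le> free_energy" using optimum_le[OF mdens_dens, of "lo 1"] by (simp add: objective_def free_energy_def)
  then show ?thesis using optimum_ge by (intro antisym)
qed

lemma rate_fun_eq: "rate_fun a q (b + 1) y = optimum y - free_energy"
proof -
  have "free_energy = (b + 1) * ln (1 - a) - ln a / 2 - C_const (b + 1)"
    by (rule free_energy_value) unfold_locales
  then show ?thesis using b by (simp add: rate_fun_def optimum_def field_simps)
qed

lemma rate_fun_large: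
  obtains Y where "\<And>y. y \<ge> Y \<Longrightarrow> rate_fun a q (b + 1) y = L * ((y - 1)\<^sup>2 / 2) + (b + 1) * ln ((1 - a * q) / (1 - a))"
proof -
  have m: "meixner a b" by unfold_locales
  have m': "meixner (a * q) b" by (rule meixner_mpot_scale(1)[OF m q])
  obtain Y where Y: "\<And>y. y \<ge> Y \<Longrightarrow> F_eq a q (b + 1) y = meixner.free_energy (a * q) b"
    using F_eq_large[OF m q] by blast
  have "rate_fun a q (b + 1) y = L * ((y - 1)\<^sup>2 / 2) + (b + 1) * ln ((1 - a * q) / (1 - a))" if y: "y \<ge> max Y 0" for y
  proof -
    have aq: "a * q < 1" using meixner.a(2)[OF m'] .
    have "rate_fun a q (b + 1) y = L * (y\<^sup>2 / 2 - y) + meixner.free_energy (a * q) b - meixner.free_energy a b"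
      using y Y[of y] by (simp add: rate_fun_eq optimum_def)
    also have "\<dots> = L * (y\<^sup>2 / 2 - y) + (b + 1) * (ln (1 - a * q) - ln (1 - a)) - (ln (a * q) - ln a) / 2"
      unfolding free_energy_value[OF m] free_energy_value[OF m'] by (simp add: algebra_simps add_divide_distrib diff_divide_distrib)
    also have "ln (a * q) - ln a = - L" using a q by (simp add: ln_mult ln_div)
    also have "ln (1 - a * q) - ln (1 - a) = ln ((1 - a * q) / (1 - a))" using a aq by (simp add: ln_div)
    finally show ?thesis by (simp add: power2_eq_square algebra_simps add_divide_distrib diff_divide_distrib)
  qed
  then show ?thesis using that by blast
qed

lemma gam_zero: "rate_fun a q (b + 1) (gam a (b + 1)) = 0"
proof (cases "a * (b + 1) \<le> 1")
  case True
  have "gam a (b + 1) = lo 1"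
    using True a b by (simp add: gam_def lo_eq le_divide_eq mult.commute add.commute)
  then show ?thesis using optimum_saturated[OF True] by (simp add: rate_fun_eq)
next
  case False
  then have "gam a (b + 1) = 0" using a b by (simp add: gam_def le_divide_eq mult.commute)
  then show ?thesis using optimum_nonpos[of 0] by (simp add: rate_fun_eq)
qed

end

text \<open>Conditions free of derivatives that are stable, with the same \<open>L\<close>, under
  the change of variable relating \<kappa> and \<open>1 / \<kappa>\<close>; regularity is extracted
  from them once, by \<open>convex_semiconcave_C11\<close>.\<close>

definition rate_shape :: "real \<Rightarrow> (real \<Rightarrow> real) \<Rightarrow> bool" where
  "rate_shape L f \<longleftrightarrow> mono f \<and> (\<forall>y. 0 \<le> f y) \<and> convex_on UNIV f \<and> convex_on UNIV (\<lambda>y. L * y\<^sup>2 / 2 - f y)"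

lemma rate_fun_shape_ge_1:
  assumes "0 < a" "a < 1" "0 < q" "q < 1" "1 \<le> \<kappa>"
  shows "rate_shape (ln (1 / q)) (rate_fun a q \<kappa>)"
    and "rate_fun a q \<kappa> (gam a \<kappa>) = 0"
    and "\<exists>Y. \<forall>y\<ge>Y. rate_fun a q \<kappa> y = ln (1 / q) * ((y - 1)\<^sup>2 / 2) + \<kappa> * ln ((1 - a * q) / (1 - a))"
proof -
  interpret meixner_q a "\<kappa> - 1" q using assms by unfold_locales auto
  have eq: "rate_fun a q \<kappa> = (\<lambda>y. optimum y - free_energy)" using rate_fun_eq by (auto simp: fun_eq_iff)
  have "convex_on UNIV (\<lambda>y. optimum y + - free_energy)" by (rule convex_on_add[OF optimum_convex]) (simp add: convex_on_const)
  moreover have "convex_on UNIV (\<lambda>y. (L * y\<^sup>2 / 2 - optimum y) + free_energy)"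
    by (rule convex_on_add[OF optimum_semiconcave]) (simp add: convex_on_const)
  ultimately show "rate_shape (ln (1 / q)) (rate_fun a q \<kappa>)"
    unfolding rate_shape_def eq using optimum_mono optimum_ge by (auto simp: mono_def algebra_simps)
  show "rate_fun a q \<kappa> (gam a \<kappa>) = 0" using gam_zero by simp
  show "\<exists>Y. \<forall>y\<ge>Y. rate_fun a q \<kappa> y = ln (1 / q) * ((y - 1)\<^sup>2 / 2) + \<kappa> * ln ((1 - a * q) / (1 - a))"
    using rate_fun_large by (metis diff_add_cancel)
qed

section \<open>Duality between \<kappa> and 1 / \<kappa>, and conclusion\<close>

lemma integral_pos_part:
  fixes u v :: real
  assumes "u \<le> v"
  shows "integral {u..v} (\<lambda>t. max t 0) = ((max v 0)\<^sup>2 - (max u 0)\<^sup>2) / 2"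
proof -
  have "((\<lambda>t. max t 0) has_integral ((max v 0)\<^sup>2 / 2 - (max u 0)\<^sup>2 / 2)) {u..v}"
  proof (rule fundamental_theorem_of_calculus_interior_strong[where S = "{0}"])
    show "continuous_on {u..v} (\<lambda>t. (max t 0)\<^sup>2 / 2)" by (intro continuous_intros) auto
    fix x assume x: "x \<in> {u<..<v} - {0}"
    show "((\<lambda>t. (max t 0)\<^sup>2 / 2) has_vector_derivative max x 0) (at x)"
    proof (cases "x > 0")
      case True
      have "((\<lambda>t. t\<^sup>2 / 2) has_real_derivative x) (at x)" by (auto intro!: derivative_eq_intros)
      then have "((\<lambda>t. (max t 0)\<^sup>2 / 2) has_real_derivative x) (at x)"
        by (rule has_field_derivative_transform_within_open[where S = "{0<..}"]) (use True in auto)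
      then show ?thesis using True by (simp add: has_real_derivative_iff_has_vector_derivative max_def)
    next
      case False
      have "((\<lambda>t. 0) has_real_derivative 0) (at x)" by simp
      then have "((\<lambda>t. (max t 0)\<^sup>2 / 2) has_real_derivative 0) (at x)"
        by (rule has_field_derivative_transform_within_open[where S = "{..<0}"]) (use False x in auto)
      then show ?thesis using False by (simp add: has_real_derivative_iff_has_vector_derivative max_def)
    qed
  qed (use assms in auto)
  then show ?thesis by (simp add: integral_unique diff_divide_distrib)
qed

text \<open>The integral in the definition is half the difference of the squares of
  \<open>max y 0\<close> and \<open>max (y - 1 + \<kappa>) 0\<close>. The first cancels against the
  explicit square. For \<open>z = (y - 1) / \<kappa> + 1\<close> the second is
  \<open>\<kappa>\<^sup>2 * (max z 0)\<^sup>2\<close>, and the linear terms are \<open>- 2 *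
  \<kappa> * (y - 1 + \<kappa>) = - 2 * \<kappa>\<^sup>2 * z\<close>.\<close>

lemma rate_fun_dual:
  assumes k: "0 < \<kappa>" "\<kappa> < 1"
  shows "rate_fun a q \<kappa> y = \<kappa>\<^sup>2 * rate_fun a q (1 / \<kappa>) ((y - 1) / \<kappa> + 1)"
proof -
  define z where "z = (y - 1) / \<kappa> + 1"
  have kz: "\<kappa> * z = y - 1 + \<kappa>" using k by (simp add: z_def field_simps)
  have kmax: "max (y - 1 + \<kappa>) 0 = \<kappa> * max z 0"
    unfolding kz[symmetric] using k by (auto simp: max_def zero_le_mult_iff mult_le_0_iff)
  have "integral {\<kappa>..1} (\<lambda>x. max (y + x - 1) 0) = integral {\<kappa> + (y - 1)..1 + (y - 1)} (\<lambda>t. max t 0)"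
    using integral_shift[of \<kappa> "y - 1" 1 "\<lambda>t. max t 0"] by (simp add: o_def algebra_simps continuous_intros)
  also have "\<dots> = ((max y 0)\<^sup>2 - (max (y - 1 + \<kappa>) 0)\<^sup>2) / 2"
    using integral_pos_part[of "\<kappa> + (y - 1)" "1 + (y - 1)"] k by (simp add: algebra_simps)
  finally have int: "integral {\<kappa>..1} (\<lambda>x. max (y + x - 1) 0) = ((max y 0)\<^sup>2 - \<kappa>\<^sup>2 * (max z 0)\<^sup>2) / 2"
    unfolding kmax by (simp add: power_mult_distrib)
  have zeq: "y / \<kappa> - 1 / \<kappa> + 1 = z" by (simp add: z_def diff_divide_distrib)
  have y: "y = \<kappa> * z + 1 - \<kappa>" using kz by simp
  define l where "l = ln (1 / q)"
  have "rate_fun a q \<kappa> y = l * (((max y 0)\<^sup>2 - 2 * y * \<kappa> + 2 * \<kappa> - 2 * \<kappa>\<^sup>2) / 2) - l * (((max y 0)\<^sup>2 - \<kappa>\<^sup>2 * (max z 0)\<^sup>2) / 2)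
     - \<kappa> * ln (1 - a) + \<kappa>\<^sup>2 * (ln a / 2) + \<kappa>\<^sup>2 * C_const (1 / \<kappa>) + \<kappa>\<^sup>2 * F_eq a q (1 / \<kappa>) z"
    using k by (simp add: rate_fun_def int zeq l_def)
  also have "l * (((max y 0)\<^sup>2 - 2 * y * \<kappa> + 2 * \<kappa> - 2 * \<kappa>\<^sup>2) / 2) - l * (((max y 0)\<^sup>2 - \<kappa>\<^sup>2 * (max z 0)\<^sup>2) / 2)
     = l * ((\<kappa>\<^sup>2 * (max z 0)\<^sup>2 - 2 * y * \<kappa> + 2 * \<kappa> - 2 * \<kappa>\<^sup>2) / 2)"
    by (simp add: field_simps)
  also have "\<kappa>\<^sup>2 * (max z 0)\<^sup>2 - 2 * y * \<kappa> + 2 * \<kappa> - 2 * \<kappa>\<^sup>2 = \<kappa>\<^sup>2 * ((max z 0)\<^sup>2 - 2 * z)"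
    unfolding y by (simp add: power2_eq_square algebra_simps)
  also have "\<kappa> * ln (1 - a) = \<kappa>\<^sup>2 * ((1 / \<kappa>) * ln (1 - a))" using k by (simp add: power2_eq_square)
  finally have "rate_fun a q \<kappa> y = \<kappa>\<^sup>2 * (l * (((max z 0)\<^sup>2 - 2 * z) / 2) - (1 / \<kappa>) * ln (1 - a) + ln a / 2 + C_const (1 / \<kappa>) + F_eq a q (1 / \<kappa>) z)"
    by (simp add: algebra_simps)
  also have "\<dots> = \<kappa>\<^sup>2 * rate_fun a q (1 / \<kappa>) z" using k by (simp add: rate_fun_def l_def)
  finally show ?thesis unfolding z_def .
qed

lemma convex_on_affine:
  fixes f :: "real \<Rightarrow> real"
  assumes "convex_on UNIV f"
  shows "convex_on UNIV (\<lambda>y. f (c * y + d))"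
proof (rule convex_onI)
  fix t x y :: real assume t: "0 < t" "t < 1"
  have "c * ((1 - t) *\<^sub>R x + t *\<^sub>R y) + d = (1 - t) *\<^sub>R (c * x + d) + t *\<^sub>R (c * y + d)" by (simp add: algebra_simps)
  then show "f (c * ((1 - t) *\<^sub>R x + t *\<^sub>R y) + d) \<le> (1 - t) * f (c * x + d) + t * f (c * y + d)"
    using convex_onD[OF assms, of t "c * x + d" "c * y + d"] t by simp
qed simp

lemma convex_on_add_affine:
  fixes f :: "real \<Rightarrow> real"
  assumes "convex_on UNIV f"
  shows "convex_on UNIV (\<lambda>y. f y + (c * y + d))"
proof (rule convex_onI)
  fix t x y :: real assume t: "0 < t" "t < 1"
  then show "f ((1 - t) *\<^sub>R x + t *\<^sub>R y) + (c * ((1 - t) *\<^sub>R x + t *\<^sub>R y) + d) \<le> (1 - t) * (f x + (c * x + d)) + t * (f y + (c * y + d))"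
    using convex_onD[OF assms, of t x y] by (simp add: algebra_simps)
qed simp

lemma rate_fun_shape:
  assumes aq: "0 < a" "a < 1" "0 < q" "q < 1" and k: "0 < \<kappa>"
  shows "rate_shape (ln (1 / q)) (rate_fun a q \<kappa>)"
    and "rate_fun a q \<kappa> (gam a \<kappa>) = 0"
    and "\<exists>Y. \<forall>y\<ge>Y. rate_fun a q \<kappa> y = ln (1 / q) * ((y - 1)\<^sup>2 / 2) + \<kappa> * ln ((1 - a * q) / (1 - a))"
proof -
  have "rate_shape (ln (1 / q)) (rate_fun a q \<kappa>) \<and> rate_fun a q \<kappa> (gam a \<kappa>) = 0 \<and>
    (\<exists>Y. \<forall>y\<ge>Y. rate_fun a q \<kappa> y = ln (1 / q) * ((y - 1)\<^sup>2 / 2) + \<kappa> * ln ((1 - a * q) / (1 - a)))"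
  proof (cases "1 \<le> \<kappa>")
    case True
    then show ?thesis using rate_fun_shape_ge_1[OF aq True] by blast
  next
    case False
    then have k1: "\<kappa> < 1" by simp
    define f where "f = rate_fun a q (1 / \<kappa>)"
    define L where "L = ln (1 / q)"
    define z where "z y = (1 / \<kappa>) * y + (1 - 1 / \<kappa>)" for y
    have kk: "1 \<le> 1 / \<kappa>" using k k1 by simp
    note S = rate_fun_shape_ge_1[OF aq kk]
    have eq: "rate_fun a q \<kappa> y = \<kappa>\<^sup>2 * f (z y)" for y
      using rate_fun_dual[OF k k1, of a q y] by (simp add: f_def z_def diff_divide_distrib algebra_simps)
    have kz: "\<kappa> * z y = y - 1 + \<kappa>" for y using k by (simp add: z_def field_simps)
    have f: "mono f" "\<And>y. 0 \<le> f y" "convex_on UNIV f" "convex_on UNIV (\<lambda>y. L * y\<^sup>2 / 2 - f y)"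
      using S(1) by (auto simp: rate_shape_def f_def L_def)
    have 1: "mono (\<lambda>y. \<kappa>\<^sup>2 * f (z y))"
    proof (rule monoI)
      fix x y :: real assume "x \<le> y"
      then have "z x \<le> z y" using k by (simp add: z_def divide_right_mono)
      then show "\<kappa>\<^sup>2 * f (z x) \<le> \<kappa>\<^sup>2 * f (z y)" using monoD[OF f(1)] by (intro mult_left_mono) auto
    qed
    have 2: "convex_on UNIV (\<lambda>y. \<kappa>\<^sup>2 * f (z y))"
      unfolding z_def by (rule convex_on_cmul[OF _ convex_on_affine[OF f(3)]]) simp
    have "convex_on UNIV (\<lambda>y. \<kappa>\<^sup>2 * (L * (z y)\<^sup>2 / 2 - f (z y)))"
      unfolding z_def by (rule convex_on_cmul[OF _ convex_on_affine[OF f(4)]]) simp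
    \<comment> \<open>As \<open>\<kappa> * z y = y - (1 - \<kappa>)\<close>, its square differs from
      \<open>y\<^sup>2\<close> by an affine function of \<open>y\<close>, which does not affect
      convexity.\<close>
    from convex_on_add_affine[OF this, of "L * (1 - \<kappa>)" "- (L * (1 - \<kappa>)\<^sup>2 / 2)"]
    have 3: "convex_on UNIV (\<lambda>y. L * y\<^sup>2 / 2 - \<kappa>\<^sup>2 * f (z y))"
    proof (rule back_subst[of "convex_on UNIV"], intro ext)
      fix y
      have "\<kappa>\<^sup>2 * (L * (z y)\<^sup>2 / 2) = L * (\<kappa> * z y)\<^sup>2 / 2" by (simp add: power_mult_distrib)
      also have "\<dots> = L * (y - 1 + \<kappa>)\<^sup>2 / 2" by (simp only: kz)
      finally have e: "\<kappa>\<^sup>2 * (L * (z y)\<^sup>2 / 2) = L * (y - 1 + \<kappa>)\<^sup>2 / 2" .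
      show "\<kappa>\<^sup>2 * (L * (z y)\<^sup>2 / 2 - f (z y)) + (L * (1 - \<kappa>) * y + - (L * (1 - \<kappa>)\<^sup>2 / 2)) = L * y\<^sup>2 / 2 - \<kappa>\<^sup>2 * f (z y)"
        unfolding right_diff_distrib e by (simp add: power2_eq_square field_simps)
    qed
    have 4: "rate_fun a q \<kappa> (gam a \<kappa>) = 0"
    proof (cases "\<kappa> \<le> a")
      case True
      \<comment> \<open>The value \<open>gam a \<kappa> = 1 - \<kappa>\<close> is sent to 0, and
        \<open>gam a (1 / \<kappa>)\<close> is 0 as well; at \<open>\<kappa> = a\<close> this comes
        from the middle formula, where \<open>sqrt (a * (1 / \<kappa>)) = 1\<close>.\<close>
      have "z (gam a \<kappa>) = 0" using True k by (simp add: gam_def z_def field_simps)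
      moreover have "gam a (1 / \<kappa>) = 0 \<or> a = \<kappa>" using True k aq k1
        mult_strict_mono[of \<kappa> 1 a 1] by (cases "a = \<kappa>") (auto simp: gam_def field_simps)
      moreover have "gam a (1 / \<kappa>) = 0" if "a = \<kappa>"
      proof -
        have "1 < 1 / \<kappa>" using k k1 by simp
        then have "\<not> 1 / \<kappa> \<le> \<kappa>" using k1 by linarith
        then show ?thesis using that k by (simp add: gam_def)
      qed
      ultimately show ?thesis using S(2) by (auto simp: eq f_def)
    next
      case F: False
      have "a * \<kappa> \<le> 1" using aq k k1 by (simp add: mult_le_one)
      then have g1: "gam a \<kappa> = (1 - sqrt (a * \<kappa>))\<^sup>2 / (1 - a)" using F aq by (simp add: gam_def field_simps)
      have "a / \<kappa> \<le> 1" using F k by simp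
      then have g2: "gam a (1 / \<kappa>) = (1 - sqrt (a / \<kappa>))\<^sup>2 / (1 - a)"
        using aq kk k k1 mult_strict_mono[of \<kappa> 1 a 1] by (auto simp: gam_def field_simps)
      have s: "sqrt (a * \<kappa>) = \<kappa> * sqrt (a / \<kappa>)"
      proof -
        have "a * \<kappa> = \<kappa>\<^sup>2 * (a / \<kappa>)" using k by (simp add: power2_eq_square)
        then have "sqrt (a * \<kappa>) = sqrt (\<kappa>\<^sup>2) * sqrt (a / \<kappa>)" by (simp only: real_sqrt_mult)
        then show ?thesis using k by simp
      qed
      define r where "r = sqrt (a / \<kappa>)"
      have r2: "r\<^sup>2 = a / \<kappa>" using aq k by (simp add: r_def)
      \<comment> \<open>Both sides equal \<open>\<kappa> * (1 - r)\<^sup>2\<close>, by the relation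
        \<open>\<kappa> * r\<^sup>2 = a\<close>.\<close>
      have "\<kappa> * z (gam a \<kappa>) * (1 - a) = \<kappa> * gam a (1 / \<kappa>) * (1 - a)"
      proof -
        have "\<kappa> * z (gam a \<kappa>) * (1 - a) = (1 - \<kappa> * r)\<^sup>2 - (1 - \<kappa>) * (1 - a)"
          unfolding kz g1 s r_def[symmetric] using aq by (simp add: field_simps)
        also have "\<dots> = 1 - 2 * \<kappa> * r + \<kappa> * (\<kappa> * r\<^sup>2) - (1 - \<kappa>) * (1 - a)"
          by (simp add: power2_eq_square algebra_simps)
        also have "\<kappa> * r\<^sup>2 = a" using k by (simp add: r2)
        also have "1 - 2 * \<kappa> * r + \<kappa> * a - (1 - \<kappa>) * (1 - a) = \<kappa> - 2 * \<kappa> * r + a" by (simp add: algebra_simps)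
        also have "\<dots> = \<kappa> * (1 - r)\<^sup>2"
        proof -
          have "\<kappa> * (1 - r)\<^sup>2 = \<kappa> - 2 * \<kappa> * r + \<kappa> * r\<^sup>2" by (simp add: power2_eq_square algebra_simps)
          then show ?thesis using k by (simp add: r2)
        qed
        also have "\<dots> = \<kappa> * gam a (1 / \<kappa>) * (1 - a)" unfolding g2 r_def[symmetric] using aq by simp
        finally show ?thesis .
      qed
      then have "z (gam a \<kappa>) = gam a (1 / \<kappa>)" using k aq by simp
      then show ?thesis using S(2) by (simp add: eq f_def)
    qed
    obtain Y where Y: "\<And>y. y \<ge> Y \<Longrightarrow> f y = L * ((y - 1)\<^sup>2 / 2) + (1 / \<kappa>) * ln ((1 - a * q) / (1 - a))"
      using S(3) unfolding f_def L_def by blast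
    have 5: "rate_fun a q \<kappa> y = L * ((y - 1)\<^sup>2 / 2) + \<kappa> * ln ((1 - a * q) / (1 - a))" if y: "y \<ge> \<kappa> * Y + 1 - \<kappa>" for y
    proof -
      have "\<kappa> * Y \<le> \<kappa> * z y" using y kz[of y] by simp
      then have "Y \<le> z y" using k by simp
      then have "rate_fun a q \<kappa> y = \<kappa>\<^sup>2 * (L * ((z y - 1)\<^sup>2 / 2)) + \<kappa>\<^sup>2 * ((1 / \<kappa>) * ln ((1 - a * q) / (1 - a)))"
        unfolding eq Y[OF \<open>Y \<le> z y\<close>] by (simp add: distrib_left)
      also have "\<kappa>\<^sup>2 * (L * ((z y - 1)\<^sup>2 / 2)) = L * ((\<kappa> * z y - \<kappa>)\<^sup>2 / 2)" by (simp add: power2_eq_square field_simps)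
      also have "\<kappa> * z y - \<kappa> = y - 1" using kz[of y] by simp
      also have "\<kappa>\<^sup>2 * ((1 / \<kappa>) * ln ((1 - a * q) / (1 - a))) = \<kappa> * ln ((1 - a * q) / (1 - a))" using k by (simp add: power2_eq_square)
      finally show ?thesis .
    qed
    have "rate_fun a q \<kappa> = (\<lambda>y. \<kappa>\<^sup>2 * f (z y))" using eq by auto
    then have "rate_shape L (rate_fun a q \<kappa>)" using 1 2 3 f(2) by (simp add: rate_shape_def)
    then show ?thesis using 4 5 unfolding L_def by blast
  qed
  then show "rate_shape (ln (1 / q)) (rate_fun a q \<kappa>)"
    and "rate_fun a q \<kappa> (gam a \<kappa>) = 0"
    and "\<exists>Y. \<forall>y\<ge>Y. rate_fun a q \<kappa> y = ln (1 / q) * ((y - 1)\<^sup>2 / 2) + \<kappa> * ln ((1 - a * q) / (1 - a))"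
    by blast+
qed

theorem theorem1p3:
  fixes a q \<kappa> :: real
  assumes "0 < a" "a < 1" "0 < q" "q < 1" "0 < \<kappa>"
  shows "mono (rate_fun a q \<kappa>)
    \<and> (\<forall>y. 0 \<le> rate_fun a q \<kappa> y)
    \<and> convex_on UNIV (rate_fun a q \<kappa>)
    \<and> (\<forall>y. rate_fun a q \<kappa> differentiable (at y))
    \<and> continuous_on UNIV (deriv (rate_fun a q \<kappa>))
    \<and> (ln (1 / q))-lipschitz_on UNIV (deriv (rate_fun a q \<kappa>))
    \<and> rate_fun a q \<kappa> (gam a \<kappa>) = 0
    \<and> (\<exists>x0>0. \<forall>x\<ge>x0. rate_fun a q \<kappa> x =
          ln (1 / q) * ((x - 1)\<^sup>2 / 2) + \<kappa> * ln ((1 - a * q) / (1 - a)))"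
proof -
  let ?f = "rate_fun a q \<kappa>"
  note S = rate_fun_shape[OF assms]
  have s: "mono ?f" "\<And>y. 0 \<le> ?f y" "convex_on UNIV ?f" "convex_on UNIV (\<lambda>y. ln (1 / q) * y\<^sup>2 / 2 - ?f y)"
    using S(1) by (auto simp: rate_shape_def)
  obtain d where d: "\<And>y. (?f has_real_derivative d y) (at y)" "(ln (1 / q))-lipschitz_on UNIV d"
    using convex_semiconcave_C11[OF s(3,4)] by blast
  have dd: "deriv ?f = d" using d(1) by (auto simp: fun_eq_iff intro: DERIV_imp_deriv)
  have "?f differentiable (at y)" for y using d(1)[of y] by (auto simp: real_differentiable_def)
  moreover have "continuous_on UNIV (deriv ?f)" unfolding dd by (rule lipschitz_on_continuous_on[OF d(2)])
  moreover obtain Y where Y: "\<forall>y\<ge>Y. ?f y = ln (1 / q) * ((y - 1)\<^sup>2 / 2) + \<kappa> * ln ((1 - a * q) / (1 - a))"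
    using S(3) by blast
  then have "\<exists>x0>0. \<forall>x\<ge>x0. ?f x = ln (1 / q) * ((x - 1)\<^sup>2 / 2) + \<kappa> * ln ((1 - a * q) / (1 - a))"
    by (intro exI[of _ "max Y 1"]) auto
  ultimately show ?thesis using s(1,2,3) S(2) d(2) dd by simp
qed

end
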